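(* Let $\mathcal{D}_F$ and $\mathcal{D}_U$ be approximable triangulated categories and let $\mathcal{D}$ be a compactly generated triangulated category with coproducts. Assume there is a recollement of $\mathcal{D}$ relative to $\mathcal{D}_F$ and $\mathcal{D}_U$, with functors $i^*, i_*, i^!$ between $\mathcal{D}$ and $\mathcal{D}_F$ and $j_!, j^*, j_*$ between $\mathcal{D}$ and $\mathcal{D}_U$. Then $\mathcal{D}$ has a (single) compact generator $G$. If moreover $\operatorname{Hom}_{\mathcal{D}}(\Sigma^{-n}G, G)=0$ for $n\gg 0$, then $\mathcal{D}$ is approximable.
   Context: All triangulated categories have (small) coproducts; $\Sigma=[1]$ is the suspension. $\mathcal{D}$ is compactly generated if there is a set $S$ of compact objects such that any $X$ with $\operatorname{Hom}(\Sigma^n s,X)=0$ for all $s\in S$, $n\in\mathbb{Z}$ is zero; a compact object $G$ is a compact generator if one may take $S=\{G\}$. For a t-structure $(\mathcal{D}^{\le 0},\mathcal{D}^{\ge 0})$ put $\mathcal{D}^{\le n}=\Sigma^{-n}\mathcal{D}^{\le 0}$, $\mathcal{D}^{\ge n}=\Sigma^{-n}\mathcal{D}^{\ge 0}$. Notation. For full subcategories $\mathcal{A},\mathcal{B}\subset\mathcal{D}$, $\mathcal{A}\ast\mathcal{B}$ is the full subcategory of those $x$ admitting an exact triangle $a\to x\to b$ with $a\in\mathcal{A}$, $b\in\mathcal{B}$; $\operatorname{Add}(\mathcal{A})$ consists of all coproducts of objects of $\mathcal{A}$; $\operatorname{smd}(\mathcal{A})$ consists of all direct summands of objects of $\mathcal{A}$.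 For an object $G$ and integers $A\le B$, $G[A,B]=\{\Sigma^{-i}G\mid A\le i\le B\}$. Set $\operatorname{Coprod}_1(G[A,B])=\operatorname{Add}(G[A,B])$, $\operatorname{Coprod}_{n+1}(G[A,B])=\operatorname{Coprod}_1(G[A,B])\ast\operatorname{Coprod}_n(G[A,B])$, and $\overline{\langle G\rangle}_n^{[A,B]}=\operatorname{smd}(\operatorname{Coprod}_n(G[A,B]))$. A triangulated category $\mathcal{D}$ with coproducts is approximable if there exist a compact generator $G$, a t-structure $(\mathcal{D}^{\le 0},\mathcal{D}^{\ge 0})$ and an integer $A>0$ such that: (1) $\Sigma^A G\in\mathcal{D}^{\le 0}$ and $\operatorname{Hom}_{\mathcal{D}}(\Sigma^{-A}G,X)=0$ for all $X\in\mathcal{D}^{\le 0}$; (2) every $X\in\mathcal{D}^{\le 0}$ admits an exact triangle $E\to X\to D$ with $E\in\overline{\langle G\rangle}_A^{[-A,A]}$ and $D\in\mathcal{D}^{\le -1}$. A recollement of $\mathcal{D}$ relative to $\mathcal{D}_F,\mathcal{D}_U$ consists of exact functors $i_*:\mathcal{D}_F\to\mathcal{D}$, $i^*,i^!:\mathcal{D}\to\mathcal{D}_F$, $j^*:\mathcal{D}\to\mathcal{D}_U$, $j_!,j_*:\mathcal{D}_U\to\mathcal{D}$ such that: $i^*\dashv i_*\dashv i^!$ and $j_!\dashv j^*\dashv j_*$; $j^*i_*=0$; $i_*,j_!,j_*$ are fully faithful; and for every $X\in\mathcal{D}$ there are exact triangles, natural in $X$, $j_!j^*X\to X\to i_*i^*X\to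 j_!j^*X[1]$ and $i_*i^!X\to X\to j_*j^*X\to i_*i^!X[1]$ whose first two maps are the (co)units of the adjunctions. *)

theory Defs
  imports "HOL-Algebra.Free_Abelian_Groups"
begin

unbundle cardinal_syntax


section \<open>Small sets\<close>

text \<open>
  Smallness is measured by a cardinal \<open>r\<close>: a set \<open>A\<close>, of whatever type, is small iff
  \<open>|A| <o r\<close>. For \<open>r\<close> the cardinality of a Grothendieck universe (or, in a theory of classes,
  of the class of all sets) this is the usual notion. Only regularity and uncountability of \<open>r\<close>
  are imposed. Every small set is equipotent to a subset of the field of \<open>r :: 'u rel\<close>, so
  it is enough to let families be indexed by small sets of type \<open>'u set\<close>.
\<close>

definition size_cardinal :: "'u rel \<Rightarrow> bool" where
  "size_cardinal r \<longleftrightarrow> Card_order r \<and> regularCard r \<and> natLeq <o r"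

definition small :: "'u rel \<Rightarrow> 'a set \<Rightarrow> bool" where
  "small r A \<longleftrightarrow> |A| <o r"


section \<open>Categories, functors, adjunctions\<close>

record ('o, 'm) cat =
  Obj :: "'o set"
  Arr :: "'m set"
  Dom :: "'m \<Rightarrow> 'o"
  Cod :: "'m \<Rightarrow> 'o"
  Idn :: "'o \<Rightarrow> 'm"
  Cmp :: "'m \<Rightarrow> 'm \<Rightarrow> 'm" (infixl "\<cdot>\<index>" 75)

definition Hom :: "('o, 'm, 'z) cat_scheme \<Rightarrow> 'o \<Rightarrow> 'o \<Rightarrow> 'm set" where
  "Hom C X Y = {f \<in> Arr C. Dom C f = X \<and> Cod C f = Y}"

locale category =
  fixes C :: "('o, 'm, 'z) cat_scheme" (structure)
  assumes Dom_Obj: "f \<in> Arr C \<Longrightarrow> Dom C f \<in> Obj C"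
    and Cod_Obj: "f \<in> Arr C \<Longrightarrow> Cod C f \<in> Obj C"
    and Idn_Hom: "X \<in> Obj C \<Longrightarrow> Idn C X \<in> Hom C X X"
    and Cmp_Hom: "f \<in> Hom C X Y \<Longrightarrow> g \<in> Hom C Y Z \<Longrightarrow> g \<cdot> f \<in> Hom C X Z"
    and Idn_left: "f \<in> Hom C X Y \<Longrightarrow> Idn C Y \<cdot> f = f"
    and Idn_right: "f \<in> Hom C X Y \<Longrightarrow> f \<cdot> Idn C X = f"
    and Cmp_assoc: "f \<in> Hom C W X \<Longrightarrow> g \<in> Hom C X Y \<Longrightarrow> h \<in> Hom C Y Z
          \<Longrightarrow> (h \<cdot> g) \<cdot> f = h \<cdot> (g \<cdot> f)"

definition iso_arr :: "('o, 'm, 'z) cat_scheme \<Rightarrow> 'o \<Rightarrow> 'o \<Rightarrow> 'm \<Rightarrow> bool" where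
  "iso_arr C X Y f \<longleftrightarrow> f \<in> Hom C X Y \<and>
     (\<exists>g \<in> Hom C Y X. g \<cdot>\<^bsub>C\<^esub> f = Idn C X \<and> f \<cdot>\<^bsub>C\<^esub> g = Idn C Y)"

definition zero_object :: "('o, 'm, 'z) cat_scheme \<Rightarrow> 'o \<Rightarrow> bool" where
  "zero_object C Z \<longleftrightarrow> Z \<in> Obj C \<and>
     (\<forall>X \<in> Obj C. (\<exists>!f. f \<in> Hom C X Z) \<and> (\<exists>!f. f \<in> Hom C Z X))"

definition is_coproduct ::
  "('o, 'm, 'z) cat_scheme \<Rightarrow> 'i set \<Rightarrow> ('i \<Rightarrow> 'o) \<Rightarrow> 'o \<Rightarrow> ('i \<Rightarrow> 'm) \<Rightarrow> bool" where
  "is_coproduct C I X S \<iota> \<longleftrightarrow> S \<in> Obj C \<and>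
     (\<forall>i \<in> I. X i \<in> Obj C \<and> \<iota> i \<in> Hom C (X i) S) \<and>
     (\<forall>Y \<in> Obj C. \<forall>f. (\<forall>i \<in> I. f i \<in> Hom C (X i) Y) \<longrightarrow>
        (\<exists>!h. h \<in> Hom C S Y \<and> (\<forall>i \<in> I. h \<cdot>\<^bsub>C\<^esub> \<iota> i = f i)))"

definition has_small_coproducts :: "'u rel \<Rightarrow> ('o, 'm, 'z) cat_scheme \<Rightarrow> bool" where
  "has_small_coproducts r C \<longleftrightarrow>
     (\<forall>(I :: 'u set) X. small r I \<and> (\<forall>i \<in> I. X i \<in> Obj C) \<longrightarrow> (\<exists>S \<iota>. is_coproduct C I X S \<iota>))"

definition locally_small :: "'u rel \<Rightarrow> ('o, 'm, 'z) cat_scheme \<Rightarrow> bool" where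
  "locally_small r C \<longleftrightarrow> (\<forall>X \<in> Obj C. \<forall>Y \<in> Obj C. small r (Hom C X Y))"

record ('o, 'm, 'p, 'n) functr =
  on_obj :: "'o \<Rightarrow> 'p"
  on_arr :: "'m \<Rightarrow> 'n"

definition is_functor ::
  "('o, 'm, 'y) cat_scheme \<Rightarrow> ('p, 'n, 'z) cat_scheme \<Rightarrow> ('o, 'm, 'p, 'n) functr \<Rightarrow> bool" where
  "is_functor C D F \<longleftrightarrow>
     (\<forall>X \<in> Obj C. on_obj F X \<in> Obj D \<and> on_arr F (Idn C X) = Idn D (on_obj F X)) \<and>
     (\<forall>X Y. \<forall>f \<in> Hom C X Y. on_arr F f \<in> Hom D (on_obj F X) (on_obj F Y)) \<and>
     (\<forall>X Y Z. \<forall>f \<in> Hom C X Y. \<forall>g \<in> Hom C Y Z.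
        on_arr F (g \<cdot>\<^bsub>C\<^esub> f) = on_arr F g \<cdot>\<^bsub>D\<^esub> on_arr F f)"

definition fully_faithful ::
  "('o, 'm, 'y) cat_scheme \<Rightarrow> ('p, 'n, 'z) cat_scheme \<Rightarrow> ('o, 'm, 'p, 'n) functr \<Rightarrow> bool" where
  "fully_faithful C D F \<longleftrightarrow>
     (\<forall>X \<in> Obj C. \<forall>Y \<in> Obj C.
        bij_betw (on_arr F) (Hom C X Y) (Hom D (on_obj F X) (on_obj F Y)))"

definition idF :: "('o, 'm, 'o, 'm) functr" where
  "idF = \<lparr>on_obj = id, on_arr = id\<rparr>"

definition compF :: "('p, 'n, 'q, 'k) functr \<Rightarrow> ('o, 'm, 'p, 'n) functr \<Rightarrow> ('o, 'm, 'q, 'k) functr"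
    (infixl "\<circ>F" 60) where
  "G \<circ>F F = \<lparr>on_obj = on_obj G \<circ> on_obj F, on_arr = on_arr G \<circ> on_arr F\<rparr>"

definition natural_transformation ::
  "('o, 'm, 'y) cat_scheme \<Rightarrow> ('p, 'n, 'z) cat_scheme \<Rightarrow> ('o, 'm, 'p, 'n) functr \<Rightarrow>
   ('o, 'm, 'p, 'n) functr \<Rightarrow> ('o \<Rightarrow> 'n) \<Rightarrow> bool" where
  "natural_transformation C D F G \<alpha> \<longleftrightarrow>
     (\<forall>X \<in> Obj C. \<alpha> X \<in> Hom D (on_obj F X) (on_obj G X)) \<and>
     (\<forall>X Y. \<forall>f \<in> Hom C X Y. \<alpha> Y \<cdot>\<^bsub>D\<^esub> on_arr F f = on_arr G f \<cdot>\<^bsub>D\<^esub> \<alpha> X)"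

definition adjunction ::
  "('o, 'm, 'y) cat_scheme \<Rightarrow> ('p, 'n, 'z) cat_scheme \<Rightarrow> ('o, 'm, 'p, 'n) functr \<Rightarrow>
   ('p, 'n, 'o, 'm) functr \<Rightarrow> ('o \<Rightarrow> 'm) \<Rightarrow> ('p \<Rightarrow> 'n) \<Rightarrow> bool" where
  "adjunction C D L R \<eta> \<epsilon> \<longleftrightarrow>
     is_functor C D L \<and> is_functor D C R \<and>
     natural_transformation C C idF (R \<circ>F L) \<eta> \<and>
     natural_transformation D D (L \<circ>F R) idF \<epsilon> \<and>
     (\<forall>X \<in> Obj C. \<epsilon> (on_obj L X) \<cdot>\<^bsub>D\<^esub> on_arr L (\<eta> X) = Idn D (on_obj L X)) \<and>
     (\<forall>Y \<in> Obj D. on_arr R (\<epsilon> Y) \<cdot>\<^bsub>C\<^esub> \<eta> (on_obj R Y) = Idn C (on_obj R Y))"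


section \<open>Additive categories\<close>

record ('o, 'm) add_cat = "('o, 'm) cat" +
  Plus :: "'m \<Rightarrow> 'm \<Rightarrow> 'm"
  Zero :: "'o \<Rightarrow> 'o \<Rightarrow> 'm"

text \<open>The abelian group of morphisms, in the multiplicative notation of HOL-Algebra.\<close>

definition hom_group :: "('o, 'm, 'z) add_cat_scheme \<Rightarrow> 'o \<Rightarrow> 'o \<Rightarrow> 'm monoid" where
  "hom_group C X Y = \<lparr>carrier = Hom C X Y, mult = Plus C, one = Zero C X Y\<rparr>"

definition hom_zero :: "('o, 'm, 'z) add_cat_scheme \<Rightarrow> 'o \<Rightarrow> 'o \<Rightarrow> bool" where
  "hom_zero C X Y \<longleftrightarrow> Hom C X Y = {Zero C X Y}"

definition is_biproduct :: "('o, 'm, 'z) add_cat_scheme \<Rightarrow> 'o \<Rightarrow> 'o \<Rightarrow> 'o \<Rightarrow> bool" where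
  "is_biproduct C X Y P \<longleftrightarrow> X \<in> Obj C \<and> Y \<in> Obj C \<and> P \<in> Obj C \<and>
     (\<exists>i1 \<in> Hom C X P. \<exists>i2 \<in> Hom C Y P. \<exists>p1 \<in> Hom C P X. \<exists>p2 \<in> Hom C P Y.
        p1 \<cdot>\<^bsub>C\<^esub> i1 = Idn C X \<and> p2 \<cdot>\<^bsub>C\<^esub> i2 = Idn C Y \<and>
        p2 \<cdot>\<^bsub>C\<^esub> i1 = Zero C X Y \<and> p1 \<cdot>\<^bsub>C\<^esub> i2 = Zero C Y X \<and>
        Plus C (i1 \<cdot>\<^bsub>C\<^esub> p1) (i2 \<cdot>\<^bsub>C\<^esub> p2) = Idn C P)"

locale additive_category = category C
  for C :: "('o, 'm, 'z) add_cat_scheme" (structure) +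
  assumes hom_group_comm: "X \<in> Obj C \<Longrightarrow> Y \<in> Obj C \<Longrightarrow> comm_group (hom_group C X Y)"
    and Cmp_Plus_left: "f \<in> Hom C X Y \<Longrightarrow> g \<in> Hom C Y Z \<Longrightarrow> g' \<in> Hom C Y Z
          \<Longrightarrow> Plus C g g' \<cdot> f = Plus C (g \<cdot> f) (g' \<cdot> f)"
    and Cmp_Plus_right: "f \<in> Hom C X Y \<Longrightarrow> f' \<in> Hom C X Y \<Longrightarrow> g \<in> Hom C Y Z
          \<Longrightarrow> g \<cdot> Plus C f f' = Plus C (g \<cdot> f) (g \<cdot> f')"
    and ex_zero_object: "\<exists>Z. zero_object C Z"
    and ex_biproduct: "X \<in> Obj C \<Longrightarrow> Y \<in> Obj C \<Longrightarrow> \<exists>P. is_biproduct C X Y P"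

definition additive_functor ::
  "('o, 'm, 'y) add_cat_scheme \<Rightarrow> ('p, 'n, 'z) add_cat_scheme \<Rightarrow> ('o, 'm, 'p, 'n) functr \<Rightarrow> bool"
  where
  "additive_functor C D F \<longleftrightarrow> is_functor C D F \<and>
     (\<forall>X Y. \<forall>f \<in> Hom C X Y. \<forall>g \<in> Hom C X Y.
        on_arr F (Plus C f g) = Plus D (on_arr F f) (on_arr F g))"


section \<open>Triangulated categories\<close>

text \<open>
  As in Verdier and Neeman, the suspension is an automorphism of the category (not just an
  autoequivalence). A triangle is represented by its three morphisms.
\<close>

record ('o, 'm) tri_cat = "('o, 'm) add_cat" +
  Susp :: "('o, 'm, 'o, 'm) functr"
  Tri :: "('m \<times> 'm \<times> 'm) set"

locale triangulated_category = additive_category C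
  for C :: "('o, 'm, 'z) tri_cat_scheme" (structure) +
  assumes Susp_additive: "additive_functor C C (Susp C)"
    and Susp_bij_Obj: "bij_betw (on_obj (Susp C)) (Obj C) (Obj C)"
    and Susp_bij_Arr: "bij_betw (on_arr (Susp C)) (Arr C) (Arr C)"
    and Tri_candidate: "(f, g, h) \<in> Tri C \<Longrightarrow>
          \<exists>X Y Z. f \<in> Hom C X Y \<and> g \<in> Hom C Y Z \<and> h \<in> Hom C Z (on_obj (Susp C) X)"
    and TR1_iso: "(f, g, h) \<in> Tri C \<Longrightarrow>
          f \<in> Hom C X Y \<Longrightarrow> g \<in> Hom C Y Z \<Longrightarrow> h \<in> Hom C Z (on_obj (Susp C) X) \<Longrightarrow>
          f' \<in> Hom C X' Y' \<Longrightarrow> g' \<in> Hom C Y' Z' \<Longrightarrow> h' \<in> Hom C Z' (on_obj (Susp C) X') \<Longrightarrow>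
          iso_arr C X X' u \<Longrightarrow> iso_arr C Y Y' v \<Longrightarrow> iso_arr C Z Z' w \<Longrightarrow>
          v \<cdot> f = f' \<cdot> u \<Longrightarrow> w \<cdot> g = g' \<cdot> v \<Longrightarrow> on_arr (Susp C) u \<cdot> h = h' \<cdot> w \<Longrightarrow>
          (f', g', h') \<in> Tri C"
    and TR1_Idn: "X \<in> Obj C \<Longrightarrow> zero_object C Z \<Longrightarrow>
          (Idn C X, Zero C X Z, Zero C Z (on_obj (Susp C) X)) \<in> Tri C"
    and TR1_cone: "f \<in> Arr C \<Longrightarrow> \<exists>g h. (f, g, h) \<in> Tri C"
    and TR2: "f \<in> Hom C X Y \<Longrightarrow> g \<in> Hom C Y Z \<Longrightarrow> h \<in> Hom C Z (on_obj (Susp C) X) \<Longrightarrow>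
          (f, g, h) \<in> Tri C \<longleftrightarrow>
          (g, h, inv\<^bsub>hom_group C (on_obj (Susp C) X) (on_obj (Susp C) Y)\<^esub> (on_arr (Susp C) f)) \<in> Tri C"
    and TR3: "(f, g, h) \<in> Tri C \<Longrightarrow> (f', g', h') \<in> Tri C \<Longrightarrow>
          f \<in> Hom C X Y \<Longrightarrow> g \<in> Hom C Y Z \<Longrightarrow> f' \<in> Hom C X' Y' \<Longrightarrow> g' \<in> Hom C Y' Z' \<Longrightarrow>
          u \<in> Hom C X X' \<Longrightarrow> v \<in> Hom C Y Y' \<Longrightarrow> v \<cdot> f = f' \<cdot> u \<Longrightarrow>
          \<exists>w \<in> Hom C Z Z'. w \<cdot> g = g' \<cdot> v \<and> on_arr (Susp C) u \<cdot> h = h' \<cdot> w"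
    and TR4: "f \<in> Hom C X Y \<Longrightarrow> g \<in> Hom C Y Z \<Longrightarrow>
          (f, f1, f2) \<in> Tri C \<Longrightarrow> (g, g1, g2) \<in> Tri C \<Longrightarrow> (g \<cdot> f, h1, h2) \<in> Tri C \<Longrightarrow>
          \<exists>a b. (a, b, on_arr (Susp C) f1 \<cdot> g2) \<in> Tri C \<and>
            Dom C a = Cod C f1 \<and> Cod C a = Cod C h1 \<and> Cod C b = Cod C g1 \<and>
            a \<cdot> f1 = h1 \<cdot> g \<and> h2 \<cdot> a = f2 \<and>
            b \<cdot> h1 = g1 \<and> g2 \<cdot> b = on_arr (Susp C) f \<cdot> h2"

definition shift :: "('o, 'm, 'z) tri_cat_scheme \<Rightarrow> int \<Rightarrow> 'o \<Rightarrow> 'o" where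
  "shift C n X =
     (if 0 \<le> n then (on_obj (Susp C) ^^ nat n) X
      else (inv_into (Obj C) (on_obj (Susp C)) ^^ nat (- n)) X)"

definition has_triangle :: "('o, 'm, 'z) tri_cat_scheme \<Rightarrow> 'o \<Rightarrow> 'o \<Rightarrow> 'o \<Rightarrow> bool" where
  "has_triangle C X Y Z \<longleftrightarrow>
     (\<exists>f g h. (f, g, h) \<in> Tri C \<and>
        f \<in> Hom C X Y \<and> g \<in> Hom C Y Z \<and> h \<in> Hom C Z (on_obj (Susp C) X))"

text \<open>
  Being exact is a property here: a compatibility isomorphism with the suspensions exists.
\<close>

definition exact_functor ::
  "('o, 'm, 'y) tri_cat_scheme \<Rightarrow> ('p, 'n, 'z) tri_cat_scheme \<Rightarrow> ('o, 'm, 'p, 'n) functr \<Rightarrow> bool"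
  where
  "exact_functor C D F \<longleftrightarrow> additive_functor C D F \<and>
     (\<exists>\<phi>. natural_transformation C D (F \<circ>F Susp C) (Susp D \<circ>F F) \<phi> \<and>
        (\<forall>X \<in> Obj C. iso_arr D (on_obj F (on_obj (Susp C) X)) (on_obj (Susp D) (on_obj F X)) (\<phi> X)) \<and>
        (\<forall>f g h. (f, g, h) \<in> Tri C \<longrightarrow>
           (on_arr F f, on_arr F g, \<phi> (Dom C f) \<cdot>\<^bsub>D\<^esub> on_arr F h) \<in> Tri D))"

text \<open>Local smallness is part of the usual convention on categories.\<close>

definition triangulated_with_coproducts :: "'u rel \<Rightarrow> ('o, 'm, 'z) tri_cat_scheme \<Rightarrow> bool" where
  "triangulated_with_coproducts r C \<longleftrightarrow>
     triangulated_category C \<and> locally_small r C \<and> has_small_coproducts r C"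


section \<open>Compact generation\<close>

text \<open>
  \<open>K\<close> is compact if for each small coproduct \<open>S\<close> of objects \<open>X i\<close> the canonical map from the direct
  sum of the groups \<open>Hom(K, X i)\<close> to \<open>Hom(K, S)\<close> is an isomorphism. Here \<open>gfinprod\<close> is a finite
  sum of morphisms, taken over the support.
\<close>

definition compact_object :: "'u rel \<Rightarrow> ('o, 'm, 'z) tri_cat_scheme \<Rightarrow> 'o \<Rightarrow> bool" where
  "compact_object r C K \<longleftrightarrow> K \<in> Obj C \<and>
     (\<forall>(I :: 'u set) X S \<iota>. small r I \<and> is_coproduct C I X S \<iota> \<longrightarrow>
        (\<lambda>f. gfinprod (hom_group C K S) (\<lambda>i. \<iota> i \<cdot>\<^bsub>C\<^esub> f i) I)
          \<in> iso (sum_group I (\<lambda>i. hom_group C K (X i))) (hom_group C K S))"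

definition generates :: "('o, 'm, 'z) tri_cat_scheme \<Rightarrow> 'o set \<Rightarrow> bool" where
  "generates C S \<longleftrightarrow>
     (\<forall>X \<in> Obj C. (\<forall>s \<in> S. \<forall>n. hom_zero C (shift C n s) X) \<longrightarrow> zero_object C X)"

definition compactly_generated :: "'u rel \<Rightarrow> ('o, 'm, 'z) tri_cat_scheme \<Rightarrow> bool" where
  "compactly_generated r C \<longleftrightarrow>
     (\<exists>S. small r S \<and> (\<forall>s \<in> S. compact_object r C s) \<and> generates C S)"

definition compact_generator :: "'u rel \<Rightarrow> ('o, 'm, 'z) tri_cat_scheme \<Rightarrow> 'o \<Rightarrow> bool" where
  "compact_generator r C G \<longleftrightarrow> compact_object r C G \<and> generates C {G}"


section \<open>Approximability\<close>

text \<open>Full subcategories are given by their sets of objects.\<close>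

definition shift_le :: "('o, 'm, 'z) tri_cat_scheme \<Rightarrow> 'o set \<Rightarrow> int \<Rightarrow> 'o set" where
  "shift_le C A n = shift C (- n) ` A"

text \<open>
  \<open>(L, R)\<close> stands for \<open>(D\<^sup>\<le>\<^sup>0, D\<^sup>\<ge>\<^sup>0)\<close>; then \<open>shift_le C L n\<close> and \<open>shift_le C R n\<close> are
  \<open>D\<^sup>\<le>\<^sup>n\<close> and \<open>D\<^sup>\<ge>\<^sup>n\<close>.
\<close>

definition t_structure :: "('o, 'm, 'z) tri_cat_scheme \<Rightarrow> 'o set \<Rightarrow> 'o set \<Rightarrow> bool" where
  "t_structure C L R \<longleftrightarrow>
     L \<subseteq> Obj C \<and> R \<subseteq> Obj C \<and>
     (\<forall>X Y f. iso_arr C X Y f \<longrightarrow> (X \<in> L \<longrightarrow> Y \<in> L) \<and> (X \<in> R \<longrightarrow> Y \<in> R)) \<and>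
     L \<subseteq> shift_le C L 1 \<and> shift_le C R 1 \<subseteq> R \<and>
     (\<forall>X \<in> L. \<forall>Y \<in> shift_le C R 1. hom_zero C X Y) \<and>
     (\<forall>X \<in> Obj C. \<exists>A \<in> L. \<exists>B \<in> shift_le C R 1. has_triangle C A X B)"

definition star :: "('o, 'm, 'z) tri_cat_scheme \<Rightarrow> 'o set \<Rightarrow> 'o set \<Rightarrow> 'o set" where
  "star C A B = {x \<in> Obj C. \<exists>a \<in> A. \<exists>b \<in> B. has_triangle C a x b}"

definition Add :: "'u rel \<Rightarrow> ('o, 'm, 'z) tri_cat_scheme \<Rightarrow> 'o set \<Rightarrow> 'o set" where
  "Add r C A =
     {S. \<exists>(I :: 'u set) X \<iota>. small r I \<and> (\<forall>i \<in> I. X i \<in> A) \<and> is_coproduct C I X S \<iota>}"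

definition smd :: "('o, 'm, 'z) tri_cat_scheme \<Rightarrow> 'o set \<Rightarrow> 'o set" where
  "smd C A = {X. \<exists>Y. \<exists>P \<in> A. is_biproduct C X Y P}"

definition shifts :: "('o, 'm, 'z) tri_cat_scheme \<Rightarrow> 'o \<Rightarrow> int \<Rightarrow> int \<Rightarrow> 'o set" where
  "shifts C G A B = {shift C (- i) G | i. A \<le> i \<and> i \<le> B}"

text \<open>The index \<open>0\<close> is outside the mathematical definition and gets a dummy value.\<close>

fun Coprod :: "'u rel \<Rightarrow> ('o, 'm, 'z) tri_cat_scheme \<Rightarrow> nat \<Rightarrow> 'o \<Rightarrow> int \<Rightarrow> int \<Rightarrow> 'o set" where
  "Coprod r C 0 G A B = {}"
| "Coprod r C (Suc 0) G A B = Add r C (shifts C G A B)"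
| "Coprod r C (Suc (Suc n)) G A B =
     star C (Coprod r C (Suc 0) G A B) (Coprod r C (Suc n) G A B)"

definition gen_bar :: "'u rel \<Rightarrow> ('o, 'm, 'z) tri_cat_scheme \<Rightarrow> nat \<Rightarrow> 'o \<Rightarrow> int \<Rightarrow> int \<Rightarrow> 'o set" where
  "gen_bar r C n G A B = smd C (Coprod r C n G A B)"

definition approximable :: "'u rel \<Rightarrow> ('o, 'm, 'z) tri_cat_scheme \<Rightarrow> bool" where
  "approximable r C \<longleftrightarrow> triangulated_with_coproducts r C \<and>
     (\<exists>G L R (A :: nat). compact_generator r C G \<and> t_structure C L R \<and> A > 0 \<and>
        shift C (int A) G \<in> L \<and>
        (\<forall>X \<in> L. hom_zero C (shift C (- int A) G) X) \<and>
        (\<forall>X \<in> L. \<exists>E \<in> gen_bar r C A G (- int A) (int A). \<exists>D \<in> shift_le C L (- 1).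
           has_triangle C E X D))"


section \<open>Recollements\<close>

text \<open>
  The functors are, in this order, \<open>i\<^sup>*, i\<^sub>*, i\<^sup>!, j\<^sub>!, j\<^sup>*, j\<^sub>*\<close>; units \<open>\<eta>\<close> and counits \<open>\<epsilon>\<close> are numbered by
  the adjunctions \<open>i\<^sup>* \<stileturn> i\<^sub>*\<close>, \<open>i\<^sub>* \<stileturn> i\<^sup>!\<close>, \<open>j\<^sub>! \<stileturn> j\<^sup>*\<close>, \<open>j\<^sup>* \<stileturn> j\<^sub>*\<close>.
\<close>

definition recollement ::
  "('o, 'm, 'x) tri_cat_scheme \<Rightarrow> ('p, 'n, 'y) tri_cat_scheme \<Rightarrow> ('q, 'k, 'z) tri_cat_scheme \<Rightarrow>
   ('o, 'm, 'p, 'n) functr \<Rightarrow> ('p, 'n, 'o, 'm) functr \<Rightarrow> ('o, 'm, 'p, 'n) functr \<Rightarrow>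
   ('q, 'k, 'o, 'm) functr \<Rightarrow> ('o, 'm, 'q, 'k) functr \<Rightarrow> ('q, 'k, 'o, 'm) functr \<Rightarrow> bool" where
  "recollement D DF DU i_ust i_lst i_ush j_lsh j_ust j_lst \<longleftrightarrow>
     exact_functor D DF i_ust \<and> exact_functor DF D i_lst \<and> exact_functor D DF i_ush \<and>
     exact_functor DU D j_lsh \<and> exact_functor D DU j_ust \<and> exact_functor DU D j_lst \<and>
     (\<forall>X \<in> Obj DF. zero_object DU (on_obj j_ust (on_obj i_lst X))) \<and>
     fully_faithful DF D i_lst \<and> fully_faithful DU D j_lsh \<and> fully_faithful DU D j_lst \<and>
     (\<exists>\<eta>1 \<epsilon>1 \<eta>2 \<epsilon>2 \<eta>3 \<epsilon>3 \<eta>4 \<epsilon>4.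
        adjunction D DF i_ust i_lst \<eta>1 \<epsilon>1 \<and> adjunction DF D i_lst i_ush \<eta>2 \<epsilon>2 \<and>
        adjunction DU D j_lsh j_ust \<eta>3 \<epsilon>3 \<and> adjunction D DU j_ust j_lst \<eta>4 \<epsilon>4 \<and>
        (\<exists>\<delta>. natural_transformation D D (i_lst \<circ>F i_ust) (Susp D \<circ>F (j_lsh \<circ>F j_ust)) \<delta> \<and>
           (\<forall>X \<in> Obj D. (\<epsilon>3 X, \<eta>1 X, \<delta> X) \<in> Tri D)) \<and>
        (\<exists>\<delta>. natural_transformation D D (j_lst \<circ>F j_ust) (Susp D \<circ>F (i_lst \<circ>F i_ush)) \<delta> \<and>
           (\<forall>X \<in> Obj D. (\<epsilon>2 X, \<eta>4 X, \<delta> X) \<in> Tri D)))"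

end

theory Submission
  imports Defs
begin

text \<open>
  Everything rests on one observation about sequences: if morphisms from a generating set of compact
  objects to the terms of a sequence die along the sequence, then the homotopy colimit vanishes, so
  that morphisms from any compact object die as well, even after applying an exact functor that
  preserves coproducts. Consequently a compact object is a retract of an object built in finitely
  many steps from the given compact generators. In \<open>D\<^sub>F\<close>, this shows that the images under \<open>i\<^sup>*\<close> of
  finitely many compact generators of \<open>D\<close> generate; together with \<open>j\<^sub>!G\<^sub>U\<close> they give a compact
  generator of \<open>D\<close>.

  For approximability, \<open>D\<^sup>\<le>\<^sup>0\<close> consists of the \<open>X\<close> with \<open>j\<^sup>*X\<close> and \<open>i\<^sup>*X\<close> in the given aisles. The
  hypothesis on \<open>G\<close> enters through the fact that in an approximable category an object receiving no
  morphisms from \<open>\<Sigma>\<^sup>-\<^sup>n\<close> of the generator for large \<open>n\<close> is bounded above; hence \<open>j\<^sup>*G\<close> is bounded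
  above although it need not be compact. To approximate \<open>X\<close>, one first makes \<open>j\<^sup>*X\<close> very negative by
  killing objects built from \<open>j\<^sub>!G\<^sub>U\<close>. Then there are no morphisms from shifts of \<open>G\<close> to
  \<open>\<Sigma>j\<^sub>!j\<^sup>*X\<close>, so an approximation of \<open>i\<^sup>*X\<close> by sums of shifts of \<open>i\<^sup>*G\<close> lifts to \<open>X\<close> step by step.
\<close>


section \<open>Categories\<close>

text \<open>The obvious candidate, the sum of \<open>i\<^sub>*G\<^sub>F\<close> and
  \<open>j\<^sub>!G\<^sub>U\<close>, need not be compact, because \<open>i\<^sup>!\<close> need not
  preserve coproducts. Compactness does pass along \<open>i\<^sup>*\<close> and
  \<open>j\<^sub>!\<close>, whose right adjoints are left adjoints in turn; hence the detour through
  the compact generators of \<open>D\<close>. Approximability asks for one constant that serves all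
  objects. Constructions are therefore made for whole classes of objects, built from the generator
  with a common number of layers and a common interval of shifts (\<open>bd\<close>), and constants
  are shown to exist rather than computed. Direct summands are absorbed by a swindle: a retract X of
  P lies in a triangle Q \<rightarrow> X \<rightarrow> \<Sigma>Q with Q a countable sum of copies of
  P. The vanishing of morphisms from \<open>G\<close> into \<open>j\<^sub>!Y\<close> is not reached
  by any of the adjunctions. It is known for the approximating objects, which are built from
  \<open>G\<close>, and is spread over the aisle along sequences; this is why the observation on
  sequences allows a functor.\<close>

definition isom :: "('o, 'm, 'z) cat_scheme \<Rightarrow> 'o \<Rightarrow> 'o \<Rightarrow> bool" where
  "isom C X Y \<longleftrightarrow> (\<exists>f. iso_arr C X Y f)"

lemma Hom_iff: "f \<in> Hom C X Y \<longleftrightarrow> f \<in> Arr C \<and> Dom C f = X \<and> Cod C f = Y"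
  by (simp add: Hom_def)

context category
begin

lemma Obj_Hom: "f \<in> Hom C X Y \<Longrightarrow> X \<in> Obj C \<and> Y \<in> Obj C"
  using Dom_Obj Cod_Obj by (auto simp: Hom_iff)

lemma Cmp_arr [simp]:
  assumes "f \<in> Arr C" "g \<in> Arr C" "Cod C f = Dom C g"
  shows "g \<cdot> f \<in> Arr C" "Dom C (g \<cdot> f) = Dom C f" "Cod C (g \<cdot> f) = Cod C g"
  using Cmp_Hom[of f "Dom C f" "Dom C g" g "Cod C g"] assms by (simp_all add: Hom_iff)

lemma Idn_arr [simp]:
  assumes "X \<in> Obj C"
  shows "Idn C X \<in> Arr C" "Dom C (Idn C X) = X" "Cod C (Idn C X) = X"
  using Idn_Hom[OF assms] by (simp_all add: Hom_iff)

lemma Idn_Cmp [simp]: "f \<in> Arr C \<Longrightarrow> Cod C f = Y \<Longrightarrow> Idn C Y \<cdot> f = f"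
  using Idn_left[of f "Dom C f" Y] by (simp_all add: Hom_iff)

lemma Cmp_Idn [simp]: "f \<in> Arr C \<Longrightarrow> Dom C f = X \<Longrightarrow> f \<cdot> Idn C X = f"
  using Idn_right[of f X "Cod C f"] by (simp_all add: Hom_iff)

lemma assoc [simp]:
  assumes "f \<in> Arr C" "g \<in> Arr C" "h \<in> Arr C" "Cod C f = Dom C g" "Cod C g = Dom C h"
  shows "(h \<cdot> g) \<cdot> f = h \<cdot> (g \<cdot> f)"
  using Cmp_assoc[of f "Dom C f" "Dom C g" g "Dom C h" h "Cod C h"] assms by (simp_all add: Hom_iff)

text \<open>Composites are simplified towards the right, so that an equation for
  \<open>a \<cdot> b\<close> no longer matches inside \<open>a \<cdot> (b \<cdot> x)\<close>; this
  restores its use there.\<close>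

lemma reassoc:
  assumes "a \<cdot> b = c" "a \<in> Hom C Y Z" "b \<in> Hom C X Y" "x \<in> Hom C W X"
  shows "a \<cdot> (b \<cdot> x) = c \<cdot> x"
  using assms(1) Cmp_assoc[OF assms(4,3,2)] by simp

lemma iso_arrI:
  assumes "f \<in> Hom C X Y" "g \<in> Hom C Y X" "g \<cdot> f = Idn C X" "f \<cdot> g = Idn C Y"
  shows "iso_arr C X Y f"
  using assms by (auto simp: iso_arr_def)

lemma iso_arr_Idn: "X \<in> Obj C \<Longrightarrow> iso_arr C X X (Idn C X)"
  by (rule iso_arrI[of _ _ _ "Idn C X"]) (auto simp: Hom_iff)

lemma isom_refl: "X \<in> Obj C \<Longrightarrow> isom C X X"
  using iso_arr_Idn by (auto simp: isom_def)

lemma isom_sym: "isom C X Y \<Longrightarrow> isom C Y X"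
  unfolding isom_def iso_arr_def by blast

lemma isom_Obj: "isom C X Y \<Longrightarrow> X \<in> Obj C \<and> Y \<in> Obj C"
  unfolding isom_def iso_arr_def using Obj_Hom by blast

lemma iso_arr_comp:
  assumes "iso_arr C X Y f" "iso_arr C Y Z g"
  shows "iso_arr C X Z (g \<cdot> f)"
proof -
  obtain f' g' where f: "f \<in> Hom C X Y" "f' \<in> Hom C Y X" "f' \<cdot> f = Idn C X" "f \<cdot> f' = Idn C Y"
    and g: "g \<in> Hom C Y Z" "g' \<in> Hom C Z Y" "g' \<cdot> g = Idn C Y" "g \<cdot> g' = Idn C Z"
    using assms unfolding iso_arr_def by blast
  have O: "X \<in> Obj C" "Y \<in> Obj C" "Z \<in> Obj C" using f g Obj_Hom by blast+
  have 1: "g' \<cdot> (g \<cdot> f) = f" "f \<cdot> (f' \<cdot> g') = g'"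
    using reassoc[OF g(3) g(2) g(1) f(1)] reassoc[OF f(4) f(1) f(2) g(2)] f g O
    by (simp_all add: Hom_iff)
  show ?thesis
    by (rule iso_arrI[of _ _ _ "f' \<cdot> g'"]) (use f g O 1 in \<open>simp_all add: Hom_iff\<close>)
qed

lemma isom_trans: "isom C X Y \<Longrightarrow> isom C Y Z \<Longrightarrow> isom C X Z"
  unfolding isom_def using iso_arr_comp by blast

end


section \<open>Additive categories\<close>

text \<open>Source and target are read off from the arrow, so that no hom group has to be named and
  the sign rules can be simplification rules.\<close>

definition Neg :: "('o, 'm, 'z) add_cat_scheme \<Rightarrow> 'm \<Rightarrow> 'm" where
  "Neg C f = inv\<^bsub>hom_group C (Dom C f) (Cod C f)\<^esub> f"

context additive_category
begin

lemma Zero_arr [simp]: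
  assumes "X \<in> Obj C" "Y \<in> Obj C"
  shows "Zero C X Y \<in> Arr C" "Dom C (Zero C X Y) = X" "Cod C (Zero C X Y) = Y"
proof -
  interpret G: comm_group "hom_group C X Y" using hom_group_comm assms by blast
  have "Zero C X Y \<in> Hom C X Y" using G.one_closed by (simp add: hom_group_def)
  then show "Zero C X Y \<in> Arr C" "Dom C (Zero C X Y) = X" "Cod C (Zero C X Y) = Y"
    by (simp_all add: Hom_iff)
qed

lemma Plus_arr [simp]:
  assumes "f \<in> Arr C" "g \<in> Arr C" "Dom C f = Dom C g" "Cod C f = Cod C g"
  shows "Plus C f g \<in> Arr C" "Dom C (Plus C f g) = Dom C g" "Cod C (Plus C f g) = Cod C g"
proof -
  interpret G: comm_group "hom_group C (Dom C g) (Cod C g)"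
    using hom_group_comm Dom_Obj Cod_Obj assms by blast
  have "Plus C f g \<in> Hom C (Dom C g) (Cod C g)"
    using G.m_closed[of f g] assms by (simp add: hom_group_def Hom_iff)
  then show "Plus C f g \<in> Arr C" "Dom C (Plus C f g) = Dom C g" "Cod C (Plus C f g) = Cod C g"
    by (simp_all add: Hom_iff)
qed

lemma Neg_arr [simp]:
  assumes "f \<in> Arr C"
  shows "Neg C f \<in> Arr C" "Dom C (Neg C f) = Dom C f" "Cod C (Neg C f) = Cod C f"
proof -
  interpret G: comm_group "hom_group C (Dom C f) (Cod C f)"
    using hom_group_comm Dom_Obj Cod_Obj assms by blast
  have "Neg C f \<in> Hom C (Dom C f) (Cod C f)"
    using G.inv_closed[of f] assms by (simp add: hom_group_def Hom_iff Neg_def)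
  then show "Neg C f \<in> Arr C" "Dom C (Neg C f) = Dom C f" "Cod C (Neg C f) = Cod C f"
    by (simp_all add: Hom_iff)
qed

lemma Plus_Zero [simp]:
  assumes "f \<in> Arr C" "Dom C f = X" "Cod C f = Y"
  shows "Plus C (Zero C X Y) f = f" "Plus C f (Zero C X Y) = f"
proof -
  interpret G: comm_group "hom_group C X Y"
    using hom_group_comm Dom_Obj Cod_Obj assms by blast
  show "Plus C (Zero C X Y) f = f" "Plus C f (Zero C X Y) = f"
    using G.l_one[of f] G.r_one[of f] assms by (auto simp: hom_group_def Hom_iff)
qed

lemma Plus_Neg [simp]:
  assumes "f \<in> Arr C"
  shows "Plus C (Neg C f) f = Zero C (Dom C f) (Cod C f)"
    "Plus C f (Neg C f) = Zero C (Dom C f) (Cod C f)"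
proof -
  interpret G: comm_group "hom_group C (Dom C f) (Cod C f)"
    using hom_group_comm Dom_Obj Cod_Obj assms by blast
  show "Plus C (Neg C f) f = Zero C (Dom C f) (Cod C f)"
    "Plus C f (Neg C f) = Zero C (Dom C f) (Cod C f)"
    using G.l_inv[of f] G.r_inv[of f] assms by (auto simp: hom_group_def Hom_iff Neg_def)
qed

lemma Plus_comm:
  assumes "f \<in> Arr C" "g \<in> Arr C" "Dom C f = Dom C g" "Cod C f = Cod C g"
  shows "Plus C f g = Plus C g f"
proof -
  interpret G: comm_group "hom_group C (Dom C g) (Cod C g)"
    using hom_group_comm Dom_Obj Cod_Obj assms by blast
  show ?thesis using G.m_comm[of f g] assms by (simp add: hom_group_def Hom_iff)
qed

lemma Plus_assoc:
  assumes "f \<in> Arr C" "g \<in> Arr C" "h \<in> Arr C" "Dom C f = Dom C g" "Cod C f = Cod C g"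
    "Dom C g = Dom C h" "Cod C g = Cod C h"
  shows "Plus C (Plus C f g) h = Plus C f (Plus C g h)"
proof -
  interpret G: comm_group "hom_group C (Dom C h) (Cod C h)"
    using hom_group_comm Dom_Obj Cod_Obj assms by blast
  show ?thesis using G.m_assoc[of f g h] assms by (simp add: hom_group_def Hom_iff)
qed

lemma Plus_left_comm:
  assumes "f \<in> Arr C" "g \<in> Arr C" "h \<in> Arr C" "Dom C f = Dom C g" "Cod C f = Cod C g"
    "Dom C g = Dom C h" "Cod C g = Cod C h"
  shows "Plus C f (Plus C g h) = Plus C g (Plus C f h)"
  using assms Plus_assoc[of f g h] Plus_assoc[of g f h] Plus_comm[of f g] by simp

lemma Plus_Neg_cancel [simp]:
  assumes "f \<in> Arr C" "g \<in> Arr C" "Dom C f = Dom C g" "Cod C f = Cod C g"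
  shows "Plus C f (Plus C (Neg C f) g) = g" "Plus C (Neg C f) (Plus C f g) = g"
  using assms Plus_assoc[of f "Neg C f" g] Plus_assoc[of "Neg C f" f g] by simp_all

lemma Plus_left_cancel:
  assumes "f \<in> Arr C" "g \<in> Arr C" "h \<in> Arr C" "Dom C f = Dom C g" "Cod C f = Cod C g"
    "Dom C h = Dom C g" "Cod C h = Cod C g" "Plus C f g = Plus C f h"
  shows "g = h"
proof -
  have "g = Plus C (Neg C f) (Plus C f g)" using assms(1-5) by simp
  also have "\<dots> = Plus C (Neg C f) (Plus C f h)" by (simp only: assms(8))
  also have "\<dots> = h" using assms(1-7) by simp
  finally show ?thesis .
qed

lemma Neg_unique:
  assumes "f \<in> Arr C" "g \<in> Arr C" "Dom C f = Dom C g" "Cod C f = Cod C g"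
    "Plus C f g = Zero C (Dom C g) (Cod C g)"
  shows "g = Neg C f"
  using assms by (intro Plus_left_cancel[of f g "Neg C f"]) auto

lemma Neg_Neg [simp]: "f \<in> Arr C \<Longrightarrow> Neg C (Neg C f) = f"
  using Neg_unique[of "Neg C f" f] by simp

lemma Neg_Zero [simp]: "X \<in> Obj C \<Longrightarrow> Y \<in> Obj C \<Longrightarrow> Neg C (Zero C X Y) = Zero C X Y"
  using Neg_unique[of "Zero C X Y" "Zero C X Y"] by simp

lemma Plus_distrib [simp]:
  assumes "g \<in> Arr C" "g' \<in> Arr C" "Dom C g = Dom C g'" "Cod C g = Cod C g'"
  shows "f \<in> Arr C \<Longrightarrow> Cod C f = Dom C g' \<Longrightarrow> Plus C g g' \<cdot> f = Plus C (g \<cdot> f) (g' \<cdot> f)"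
    "h \<in> Arr C \<Longrightarrow> Dom C h = Cod C g' \<Longrightarrow> h \<cdot> Plus C g g' = Plus C (h \<cdot> g) (h \<cdot> g')"
  using Cmp_Plus_left[of f "Dom C f" "Cod C f" g "Cod C g" g']
    Cmp_Plus_right[of g "Dom C g" "Cod C g" g' h "Cod C h"] assms by (simp_all add: Hom_iff)

lemma Zero_Cmp [simp]:
  assumes "f \<in> Arr C" "Cod C f = X" "Y \<in> Obj C"
  shows "Zero C X Y \<cdot> f = Zero C (Dom C f) Y"
proof -
  have X: "X \<in> Obj C" "Dom C f \<in> Obj C" using assms Cod_Obj Dom_Obj by auto
  let ?z = "Zero C X Y \<cdot> f"
  have "Plus C ?z ?z = Plus C (Zero C X Y) (Zero C X Y) \<cdot> f" using assms X by (subst Plus_distrib) auto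
  also have "\<dots> = Plus C ?z (Zero C (Dom C f) Y)" using assms X by simp
  finally show ?thesis using assms X by (intro Plus_left_cancel[of ?z ?z]) auto
qed

lemma Cmp_Zero [simp]:
  assumes "f \<in> Arr C" "Dom C f = X" "W \<in> Obj C"
  shows "f \<cdot> Zero C W X = Zero C W (Cod C f)"
proof -
  have X: "X \<in> Obj C" "Cod C f \<in> Obj C" using assms Cod_Obj Dom_Obj by auto
  let ?z = "f \<cdot> Zero C W X"
  have "Plus C ?z ?z = f \<cdot> Plus C (Zero C W X) (Zero C W X)" using assms X by (subst Plus_distrib) auto
  also have "\<dots> = Plus C ?z (Zero C W (Cod C f))" using assms X by simp
  finally show ?thesis using assms X by (intro Plus_left_cancel[of ?z ?z]) auto
qed

lemma Neg_Cmp [simp]: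
  assumes "f \<in> Arr C" "g \<in> Arr C" "Cod C f = Dom C g"
  shows "Neg C g \<cdot> f = Neg C (g \<cdot> f)" "g \<cdot> Neg C f = Neg C (g \<cdot> f)"
proof -
  have O: "Dom C f \<in> Obj C" "Cod C g \<in> Obj C" using assms Dom_Obj Cod_Obj by auto
  have "Plus C (g \<cdot> f) (Neg C g \<cdot> f) = Plus C g (Neg C g) \<cdot> f" using assms by (subst Plus_distrib) auto
  also have "\<dots> = Zero C (Dom C f) (Cod C g)" using assms O by simp
  finally show "Neg C g \<cdot> f = Neg C (g \<cdot> f)" using assms by (intro Neg_unique) auto
  have "Plus C (g \<cdot> f) (g \<cdot> Neg C f) = g \<cdot> Plus C f (Neg C f)" using assms by (subst Plus_distrib) auto
  also have "\<dots> = Zero C (Dom C f) (Cod C g)" using assms O by simp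
  finally show "g \<cdot> Neg C f = Neg C (g \<cdot> f)" using assms by (intro Neg_unique) auto
qed

lemma Neg_Plus [simp]:
  assumes "f \<in> Arr C" "g \<in> Arr C" "Dom C f = Dom C g" "Cod C f = Cod C g"
  shows "Neg C (Plus C f g) = Plus C (Neg C f) (Neg C g)"
  by (rule Neg_unique[symmetric]) (use assms in \<open>auto simp: Plus_assoc Plus_left_comm[of g "Neg C f" "Neg C g"]\<close>)

lemma diff_zero_iff:
  assumes "f \<in> Hom C X Y" "g \<in> Hom C X Y"
  shows "Plus C f (Neg C g) = Zero C X Y \<longleftrightarrow> f = g"
proof
  assume "Plus C f (Neg C g) = Zero C X Y"
  then have "Neg C g = Neg C f" using assms by (intro Neg_unique) (auto simp: Hom_iff)
  then show "f = g" using Neg_Neg assms by (metis Hom_iff)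
qed (use assms in \<open>simp_all add: Hom_iff\<close>)

lemma Neg_inject:
  assumes "Neg C f = Neg C g" "f \<in> Arr C" "g \<in> Arr C" shows "f = g"
proof -
  have "f = Neg C (Neg C f)" using assms(2) by simp
  also have "\<dots> = Neg C (Neg C g)" by (simp only: assms(1))
  also have "\<dots> = g" using assms(3) by simp
  finally show ?thesis .
qed

lemma Neg_zero_iff:
  assumes "f \<in> Hom C X Y" shows "Neg C f = Zero C X Y \<longleftrightarrow> f = Zero C X Y"
  using assms Obj_Hom[OF assms] Neg_Neg Neg_Zero by (metis Hom_iff)

lemma hom_zeroI:
  "X \<in> Obj C \<Longrightarrow> Y \<in> Obj C \<Longrightarrow> (\<And>f. f \<in> Hom C X Y \<Longrightarrow> f = Zero C X Y) \<Longrightarrow> hom_zero C X Y"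
  unfolding hom_zero_def using Zero_arr by (auto simp: Hom_def)

lemma hom_zeroD: "hom_zero C X Y \<Longrightarrow> f \<in> Hom C X Y \<Longrightarrow> f = Zero C X Y"
  unfolding hom_zero_def by blast

lemma hom_zero_Obj: "hom_zero C X Y \<Longrightarrow> X \<in> Obj C \<and> Y \<in> Obj C"
  unfolding hom_zero_def using Obj_Hom by blast

lemma Idn_zero_hom:
  assumes "Z \<in> Obj C" "Idn C Z = Zero C Z Z"
  shows "f \<in> Hom C X Z \<Longrightarrow> f = Zero C X Z" "f \<in> Hom C Z X \<Longrightarrow> f = Zero C Z X"
proof -
  show "f = Zero C X Z" if "f \<in> Hom C X Z"
  proof -
    have "Idn C Z \<cdot> f = f" using that assms(1) by (simp add: Hom_iff)
    moreover have "Zero C Z Z \<cdot> f = Zero C X Z" using that assms(1) by (simp add: Hom_iff)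
    ultimately show ?thesis using assms by simp
  qed
  show "f = Zero C Z X" if "f \<in> Hom C Z X"
  proof -
    have "f \<cdot> Idn C Z = f" using that assms(1) by (simp add: Hom_iff)
    moreover have "f \<cdot> Zero C Z Z = Zero C Z X" using that assms(1) by (simp add: Hom_iff)
    ultimately show ?thesis using assms by simp
  qed
qed

text \<open>Turns the universal property into an equation, which every additive functor
  preserves.\<close>

lemma zero_object_iff: "zero_object C Z \<longleftrightarrow> Z \<in> Obj C \<and> Idn C Z = Zero C Z Z"
proof
  assume "zero_object C Z"
  then have Z: "Z \<in> Obj C" and "\<exists>!f. f \<in> Hom C Z Z" unfolding zero_object_def by simp_all
  then obtain e where e: "\<And>f. f \<in> Hom C Z Z \<Longrightarrow> f = e" by (elim ex1E) blast
  have "Idn C Z = e" "Zero C Z Z = e" using Z by (intro e; simp add: Hom_iff)+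
  then show "Z \<in> Obj C \<and> Idn C Z = Zero C Z Z" using Z by simp
next
  assume Z: "Z \<in> Obj C \<and> Idn C Z = Zero C Z Z"
  have "(\<exists>!f. f \<in> Hom C X Z) \<and> (\<exists>!f. f \<in> Hom C Z X)" if X: "X \<in> Obj C" for X
  proof
    show "\<exists>!f. f \<in> Hom C X Z"
      by (rule ex1I[of _ "Zero C X Z"], use Z X in \<open>simp add: Hom_iff\<close>) (use Z Idn_zero_hom in blast)
    show "\<exists>!f. f \<in> Hom C Z X"
      by (rule ex1I[of _ "Zero C Z X"], use Z X in \<open>simp add: Hom_iff\<close>) (use Z Idn_zero_hom in blast)
  qed
  then show "zero_object C Z" using Z unfolding zero_object_def by simp
qed

lemma zero_object_hom:
  assumes "zero_object C Z"
  shows "f \<in> Hom C X Z \<Longrightarrow> f = Zero C X Z" "f \<in> Hom C Z X \<Longrightarrow> f = Zero C Z X"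
  using assms unfolding zero_object_iff by (blast intro: Idn_zero_hom)+

lemma zero_object_isom:
  assumes "zero_object C Z" "isom C Z Z'" shows "zero_object C Z'"
proof -
  obtain f g where f: "f \<in> Hom C Z Z'" "g \<in> Hom C Z' Z" "g \<cdot> f = Idn C Z" "f \<cdot> g = Idn C Z'"
    using assms unfolding isom_def iso_arr_def by blast
  have O: "Z' \<in> Obj C" using f Obj_Hom by blast
  have "f = Zero C Z Z'" using zero_object_hom(2)[OF assms(1) f(1)] .
  then show ?thesis using f O by (simp add: zero_object_iff Hom_iff)
qed

lemma hom_zero_self: "hom_zero C X X \<Longrightarrow> zero_object C X"
  unfolding zero_object_iff using hom_zero_Obj hom_zeroD Idn_Hom by blast

lemma zero_object_hom_zero:
  assumes "zero_object C Z" "X \<in> Obj C"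
  shows "hom_zero C X Z" "hom_zero C Z X"
  using assms zero_object_hom[OF assms(1)] unfolding zero_object_iff by (blast intro!: hom_zeroI)+

lemma hom_zero_retract:
  assumes "a \<in> Hom C X' X" "b \<in> Hom C X X'" "b \<cdot> a = Idn C X'" "hom_zero C X Y"
  shows "hom_zero C X' Y"
proof (rule hom_zeroI)
  fix f assume f: "f \<in> Hom C X' Y"
  have "f \<cdot> b \<in> Hom C X Y" using f assms by (simp_all add: Hom_iff)
  then have "f \<cdot> b = Zero C X Y" using assms hom_zeroD by blast
  then have "(f \<cdot> b) \<cdot> a = Zero C X Y \<cdot> a" by simp
  then show "f = Zero C X' Y" using f assms Obj_Hom[OF f] by (simp_all add: Hom_iff)
qed (use assms Obj_Hom hom_zero_Obj in blast)+

lemma hom_zero_retract_right: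
  assumes "a \<in> Hom C Y' Y" "b \<in> Hom C Y Y'" "b \<cdot> a = Idn C Y'" "hom_zero C X Y"
  shows "hom_zero C X Y'"
proof (rule hom_zeroI)
  fix f assume f: "f \<in> Hom C X Y'"
  have "a \<cdot> f \<in> Hom C X Y" using f assms by (simp_all add: Hom_iff)
  then have "a \<cdot> f = Zero C X Y" using assms hom_zeroD by blast
  then have "b \<cdot> (a \<cdot> f) = b \<cdot> Zero C X Y" by simp
  moreover have "b \<cdot> (a \<cdot> f) = f" using reassoc[OF assms(3,2,1) f] f Obj_Hom[OF f] by (simp_all add: Hom_iff)
  ultimately show "f = Zero C X Y'" using f assms Obj_Hom[OF f] by (simp_all add: Hom_iff)
qed (use assms Obj_Hom hom_zero_Obj in blast)+

lemma hom_zero_isom: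
  assumes "isom C X X'" "isom C Y Y'" "hom_zero C X Y" shows "hom_zero C X' Y'"
proof -
  obtain f g where "f \<in> Hom C X X'" "g \<in> Hom C X' X" "f \<cdot> g = Idn C X'"
    using assms unfolding isom_def iso_arr_def by blast
  then have "hom_zero C X' Y" using hom_zero_retract assms by blast
  moreover obtain f g where "f \<in> Hom C Y Y'" "g \<in> Hom C Y' Y" "f \<cdot> g = Idn C Y'"
    using assms unfolding isom_def iso_arr_def by blast
  ultimately show ?thesis using hom_zero_retract_right by blast
qed

text \<open>The last hypothesis is applied to \<open>g \<cdot> f\<close> minus the identity, which
  \<open>f\<close> annihilates.\<close>

lemma iso_if_mono_split:
  assumes "f \<in> Hom C X Y" "g \<in> Hom C Y X" "f \<cdot> g = Idn C Y"
    and "\<And>W u. u \<in> Hom C W X \<Longrightarrow> f \<cdot> u = Zero C W Y \<Longrightarrow> u = Zero C W X"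
  shows "iso_arr C X Y f"
proof (rule iso_arrI)
  have O: "X \<in> Obj C" "Y \<in> Obj C" using assms Obj_Hom by blast+
  let ?u = "Plus C (g \<cdot> f) (Neg C (Idn C X))"
  have "f \<cdot> (g \<cdot> f) = f" using reassoc[OF assms(3,1,2,1)] assms O by (simp_all add: Hom_iff)
  then have "f \<cdot> ?u = Zero C X Y" using assms O by (simp_all add: Hom_iff)
  moreover have "?u \<in> Hom C X X" using assms O by (simp_all add: Hom_iff)
  ultimately have "?u = Zero C X X" using assms(4) by blast
  then show "g \<cdot> f = Idn C X" using diff_zero_iff[of "g \<cdot> f" X X "Idn C X"] assms O by (simp_all add: Hom_iff)
qed (use assms in auto)

end


section \<open>Additive functors\<close>

locale add_functor = A: additive_category C + B: additive_category D
  for C :: "('o, 'm, 'y) add_cat_scheme" and D :: "('p, 'n, 'z) add_cat_scheme" +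
  fixes F :: "('o, 'm, 'p, 'n) functr"
  assumes F_additive: "additive_functor C D F"
begin

lemma F_functor: "is_functor C D F"
  using F_additive by (simp add: additive_functor_def)

lemma F_Hom: "f \<in> Hom C X Y \<Longrightarrow> on_arr F f \<in> Hom D (on_obj F X) (on_obj F Y)"
  using F_functor by (simp add: is_functor_def)

lemma F_Obj [simp]: "X \<in> Obj C \<Longrightarrow> on_obj F X \<in> Obj D"
  using F_functor by (simp add: is_functor_def)

lemma F_Idn [simp]: "X \<in> Obj C \<Longrightarrow> on_arr F (Idn C X) = Idn D (on_obj F X)"
  using F_functor by (simp add: is_functor_def)

lemma F_arr [simp]:
  assumes "f \<in> Arr C"
  shows "on_arr F f \<in> Arr D" "Dom D (on_arr F f) = on_obj F (Dom C f)"
    "Cod D (on_arr F f) = on_obj F (Cod C f)"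
  using F_Hom[of f "Dom C f" "Cod C f"] assms by (simp_all add: Hom_iff)

lemma F_Cmp [simp]:
  assumes "f \<in> Arr C" "g \<in> Arr C" "Cod C f = Dom C g"
  shows "on_arr F (g \<cdot>\<^bsub>C\<^esub> f) = on_arr F g \<cdot>\<^bsub>D\<^esub> on_arr F f"
proof -
  have "f \<in> Hom C (Dom C f) (Cod C f)" "g \<in> Hom C (Cod C f) (Cod C g)"
    using assms by (simp_all add: Hom_iff)
  then show ?thesis using F_functor unfolding is_functor_def by blast
qed

lemma F_Plus [simp]:
  assumes "f \<in> Arr C" "g \<in> Arr C" "Dom C f = Dom C g" "Cod C f = Cod C g"
  shows "on_arr F (Plus C f g) = Plus D (on_arr F f) (on_arr F g)"
proof -
  have "f \<in> Hom C (Dom C f) (Cod C f)" "g \<in> Hom C (Dom C f) (Cod C f)"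
    using assms by (simp_all add: Hom_iff)
  then show ?thesis using F_additive unfolding additive_functor_def by blast
qed

lemma F_Zero [simp]:
  assumes "X \<in> Obj C" "Y \<in> Obj C"
  shows "on_arr F (Zero C X Y) = Zero D (on_obj F X) (on_obj F Y)"
proof -
  let ?z = "on_arr F (Zero C X Y)"
  have z: "?z \<in> Arr D" "Dom D ?z = on_obj F X" "Cod D ?z = on_obj F Y" using assms by simp_all
  have "Plus D ?z ?z = on_arr F (Plus C (Zero C X Y) (Zero C X Y))"
    using assms by (intro F_Plus[symmetric]) simp_all
  also have "\<dots> = Plus D ?z (Zero D (on_obj F X) (on_obj F Y))" using assms by simp
  finally show ?thesis using z assms by (intro B.Plus_left_cancel[of ?z ?z]) simp_all
qed

lemma F_Neg [simp]:
  assumes "f \<in> Arr C" shows "on_arr F (Neg C f) = Neg D (on_arr F f)"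
proof (rule B.Neg_unique)
  have O: "Dom C f \<in> Obj C" "Cod C f \<in> Obj C" using assms A.Dom_Obj A.Cod_Obj by simp_all
  have "Plus D (on_arr F f) (on_arr F (Neg C f)) = on_arr F (Plus C f (Neg C f))"
    using assms by (intro F_Plus[symmetric]) simp_all
  also have "\<dots> = Zero D (on_obj F (Dom C f)) (on_obj F (Cod C f))" using assms O by simp
  finally show "Plus D (on_arr F f) (on_arr F (Neg C f)) =
    Zero D (Dom D (on_arr F (Neg C f))) (Cod D (on_arr F (Neg C f)))" using assms by simp
qed (use assms in simp_all)

lemma F_zero_object: "zero_object C Z \<Longrightarrow> zero_object D (on_obj F Z)"
  unfolding A.zero_object_iff B.zero_object_iff using F_Idn[of Z] F_Zero[of Z Z] F_Obj[of Z] by simp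

lemma F_iso_arr:
  assumes "iso_arr C X Y f" shows "iso_arr D (on_obj F X) (on_obj F Y) (on_arr F f)"
proof -
  obtain g where g: "f \<in> Hom C X Y" "g \<in> Hom C Y X" "g \<cdot>\<^bsub>C\<^esub> f = Idn C X" "f \<cdot>\<^bsub>C\<^esub> g = Idn C Y"
    using assms unfolding iso_arr_def by blast
  have O: "X \<in> Obj C" "Y \<in> Obj C" using g A.Obj_Hom by blast+
  have "on_arr F g \<cdot>\<^bsub>D\<^esub> on_arr F f = on_arr F (g \<cdot>\<^bsub>C\<^esub> f)" "on_arr F f \<cdot>\<^bsub>D\<^esub> on_arr F g = on_arr F (f \<cdot>\<^bsub>C\<^esub> g)"
    using g(1,2) by (simp_all add: Hom_iff)
  then show ?thesis
    using g O F_Hom by (intro B.iso_arrI[of _ _ _ "on_arr F g"]) simp_all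
qed

lemma F_isom: "isom C X Y \<Longrightarrow> isom D (on_obj F X) (on_obj F Y)"
  unfolding isom_def using F_iso_arr by blast

end


section \<open>Triangulated categories\<close>

text \<open>\<open>Tri\<close> records only morphisms. Carrying the three objects along keeps
  sources and targets at hand without returning to \<open>Tri_candidate\<close>.\<close>

definition tri :: "('o, 'm, 'z) tri_cat_scheme \<Rightarrow> 'o \<Rightarrow> 'o \<Rightarrow> 'o \<Rightarrow> 'm \<Rightarrow> 'm \<Rightarrow> 'm \<Rightarrow> bool" where
  "tri C X Y Z f g h \<longleftrightarrow> (f, g, h) \<in> Tri C \<and>
     f \<in> Hom C X Y \<and> g \<in> Hom C Y Z \<and> h \<in> Hom C Z (on_obj (Susp C) X)"

lemma has_triangle_tri: "has_triangle C X Y Z \<longleftrightarrow> (\<exists>f g h. tri C X Y Z f g h)"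
  by (simp add: has_triangle_def tri_def)

lemma triD:
  assumes "tri C X Y Z f g h"
  shows "(f, g, h) \<in> Tri C" "f \<in> Hom C X Y" "g \<in> Hom C Y Z" "h \<in> Hom C Z (on_obj (Susp C) X)"
  using assms by (simp_all add: tri_def)

sublocale triangulated_category \<subseteq> Susp: add_functor C C "Susp C"
  by unfold_locales (rule Susp_additive)

context triangulated_category
begin

abbreviation S where "S X \<equiv> on_obj (Susp C) X"
abbreviation Sa where "Sa f \<equiv> on_arr (Susp C) f"

lemma S_inj: "X \<in> Obj C \<Longrightarrow> Y \<in> Obj C \<Longrightarrow> S X = S Y \<Longrightarrow> X = Y"
  using Susp_bij_Obj by (auto simp: bij_betw_def inj_on_def)

lemma S_surj: assumes "Y \<in> Obj C" obtains X where "X \<in> Obj C" "S X = Y"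
  using Susp_bij_Obj assms unfolding bij_betw_def by (metis imageE)

lemma Sa_inj: "f \<in> Arr C \<Longrightarrow> g \<in> Arr C \<Longrightarrow> Sa f = Sa g \<Longrightarrow> f = g"
  using Susp_bij_Arr by (auto simp: bij_betw_def inj_on_def)

lemma Sa_surj:
  assumes "g \<in> Hom C (S X) (S Y)" "X \<in> Obj C" "Y \<in> Obj C"
  obtains f where "f \<in> Hom C X Y" "Sa f = g"
proof -
  have "g \<in> Arr C" using assms by (simp add: Hom_iff)
  then obtain f where f: "f \<in> Arr C" "Sa f = g"
    using Susp_bij_Arr unfolding bij_betw_def by (metis imageE)
  have "S (Dom C f) = S X" "S (Cod C f) = S Y" using f assms(1) by (auto simp: Hom_iff)
  then have "Dom C f = X" "Cod C f = Y" using S_inj f assms Dom_Obj Cod_Obj by blast+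
  then show ?thesis using that[of f] f by (simp add: Hom_iff)
qed

lemma Sa_zero:
  assumes "f \<in> Hom C X Y" "Sa f = Zero C (S X) (S Y)" shows "f = Zero C X Y"
  using assms Obj_Hom[OF assms(1)] by - (rule Sa_inj, simp_all add: Hom_iff)

lemma tri_Obj: "tri C X Y Z f g h \<Longrightarrow> X \<in> Obj C \<and> Y \<in> Obj C \<and> Z \<in> Obj C"
  using triD Obj_Hom by metis

lemma has_triangle_Obj: "has_triangle C X Y Z \<Longrightarrow> X \<in> Obj C \<and> Y \<in> Obj C \<and> Z \<in> Obj C"
  unfolding has_triangle_tri using tri_Obj by blast

lemma tri_ex:
  assumes "f \<in> Hom C X Y"
  obtains Z g h where "tri C X Y Z f g h"
proof -
  obtain g h where t: "(f, g, h) \<in> Tri C" using TR1_cone[of f] assms unfolding Hom_iff by blast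
  obtain X' Y' Z where "f \<in> Hom C X' Y'" "g \<in> Hom C Y' Z" "h \<in> Hom C Z (S X')"
    using Tri_candidate[OF t] by blast
  moreover have "X' = X" "Y' = Y" using assms \<open>f \<in> Hom C X' Y'\<close> by (auto simp: Hom_iff)
  ultimately show ?thesis using that t assms by (auto simp: tri_def)
qed

lemma tri_map:
  assumes "tri C X Y Z f g h" "tri C X' Y' Z' f' g' h'" "u \<in> Hom C X X'" "v \<in> Hom C Y Y'"
    "v \<cdot> f = f' \<cdot> u"
  obtains w where "w \<in> Hom C Z Z'" "w \<cdot> g = g' \<cdot> v" "Sa u \<cdot> h = h' \<cdot> w"
  using TR3[of f g h f' g' h' X Y Z X' Y' Z' u v] assms that unfolding tri_def by blast

lemma Neg_inv: "f \<in> Hom C X Y \<Longrightarrow> inv\<^bsub>hom_group C X Y\<^esub> f = Neg C f"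
  by (auto simp: Neg_def Hom_iff)

lemma tri_rot: 
  assumes "tri C X Y Z f g h" shows "tri C Y Z (S X) g h (Neg C (Sa f))"
proof -
  have "(g, h, inv\<^bsub>hom_group C (S X) (S Y)\<^esub> (Sa f)) \<in> Tri C"
    using TR2[of f X Y g Z h] assms by (simp add: tri_def)
  moreover have "Sa f \<in> Hom C (S X) (S Y)" using assms by (simp add: tri_def Hom_iff)
  ultimately show ?thesis using assms by (simp add: tri_def Neg_inv Hom_iff)
qed

text \<open>The suspension is bijective on arrows, so every candidate \<open>k\<close> for a third
  morphism is the negative of a suspended morphism.\<close>

lemma tri_rotinv: 
  assumes "tri C Y Z (S X) g h k" "X \<in> Obj C"
  obtains f where "tri C X Y Z f g h" "k = Neg C (Sa f)"
proof -
  have Y: "Y \<in> Obj C" using assms tri_Obj by blast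
  have k: "k \<in> Hom C (S X) (S Y)" using assms(1) by (simp add: tri_def)
  then have "Neg C k \<in> Hom C (S X) (S Y)" by (simp add: Hom_iff)
  then obtain f where f: "f \<in> Hom C X Y" "Sa f = Neg C k" using Sa_surj assms Y by metis
  have k': "k = Neg C (Sa f)" using f k by (simp add: Hom_iff)
  moreover have "Sa f \<in> Hom C (S X) (S Y)" using Susp.F_Hom[OF f(1)] .
  ultimately have "(f, g, h) \<in> Tri C"
    using TR2[of f X Y g Z h] assms(1) f(1) k' by (simp add: tri_def Neg_inv)
  then have "tri C X Y Z f g h" using f(1) assms(1) by (simp add: tri_def)
  then show ?thesis using that k' by blast
qed

lemma has_triangle_rot: "has_triangle C X Y Z \<Longrightarrow> has_triangle C Y Z (S X)"
  unfolding has_triangle_tri using tri_rot by blast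

lemma has_triangle_rotinv: "has_triangle C Y Z (S X) \<Longrightarrow> X \<in> Obj C \<Longrightarrow> has_triangle C X Y Z"
  unfolding has_triangle_tri using tri_rotinv by metis

text \<open>Three rotations; the signs that they introduce are hidden because
  \<open>has_triangle\<close> forgets the morphisms.\<close>

lemma has_triangle_S: "has_triangle C X Y Z \<Longrightarrow> has_triangle C (S X) (S Y) (S Z)"
  by (rule has_triangle_rot, rule has_triangle_rot, rule has_triangle_rot)

lemma has_triangle_S_D:
  "has_triangle C (S X) (S Y) (S Z) \<Longrightarrow> X \<in> Obj C \<Longrightarrow> Y \<in> Obj C \<Longrightarrow> Z \<in> Obj C \<Longrightarrow> has_triangle C X Y Z"
  by (rule has_triangle_rotinv, rule has_triangle_rotinv, rule has_triangle_rotinv) simp_all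

lemma tri_Idn:
  assumes "X \<in> Obj C" "zero_object C Z"
  shows "tri C X X Z (Idn C X) (Zero C X Z) (Zero C Z (S X))"
proof -
  have "Z \<in> Obj C" using assms zero_object_iff by blast
  then show ?thesis using assms TR1_Idn by (simp add: tri_def Hom_iff)
qed

lemma has_triangle_right_zero: "X \<in> Obj C \<Longrightarrow> zero_object C Z \<Longrightarrow> has_triangle C X X Z"
  unfolding has_triangle_tri using tri_Idn by blast

lemma has_triangle_left_zero: "X \<in> Obj C \<Longrightarrow> zero_object C Z \<Longrightarrow> has_triangle C Z X X"
  using has_triangle_rotinv has_triangle_right_zero Susp.F_zero_object zero_object_iff by blast

section \<open>Exactness of Hom in each variable\<close>

lemma tri_comp_zero:
  assumes "tri C X Y Z f g h" shows "g \<cdot> f = Zero C X Z"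
proof -
  obtain N where N: "zero_object C N" using ex_zero_object by blast
  have O: "X \<in> Obj C" "Y \<in> Obj C" "Z \<in> Obj C" "N \<in> Obj C" 
    using tri_Obj[OF assms] N zero_object_iff by blast+
  have f: "f \<in> Hom C X Y" using assms by (simp add: tri_def)
  \<comment> \<open>The square that maps the triangle X = X \<rightarrow> 0 into the given one by
    the identity and \<open>f\<close>; the third component then factors \<open>g \<cdot> f\<close>
    through a zero object.\<close>
  have "f \<cdot> Idn C X = f \<cdot> Idn C X" by simp
  then obtain w where w: "w \<in> Hom C N Z" "w \<cdot> Zero C X N = g \<cdot> f"
    using tri_map[OF tri_Idn[OF O(1) N] assms Idn_Hom[OF O(1)] f] by blast
  have "w \<cdot> Zero C X N = Zero C X Z" using w(1) O by (simp add: Hom_iff)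
  then show ?thesis using w(2) by simp
qed

text \<open>TR3 is applied to the rotated triangle W \<rightarrow> 0 \<rightarrow> \<Sigma>W, with
  \<open>u\<close> and zero as the first two components; the third component, desuspended, is the
  lift.\<close>

lemma tri_cov1:
  assumes t: "tri C X Y Z f g h" and u: "u \<in> Hom C W Y" "g \<cdot> u = Zero C W Z"
  obtains v where "v \<in> Hom C W X" "f \<cdot> v = u"
proof -
  obtain N where N: "zero_object C N" using ex_zero_object by blast
  have O: "X \<in> Obj C" "Y \<in> Obj C" "Z \<in> Obj C" "N \<in> Obj C" "W \<in> Obj C"
    using tri_Obj[OF t] N zero_object_iff Obj_Hom[OF u(1)] by blast+
  have f: "f \<in> Hom C X Y" "g \<in> Hom C Y Z" "h \<in> Hom C Z (S X)" using t by (simp_all add: tri_def)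
  have "Zero C N Z \<in> Hom C N Z" "Zero C N Z \<cdot> Zero C W N = g \<cdot> u"
    using O u by (simp_all add: Hom_iff)
  then obtain w where w: "w \<in> Hom C (S W) (S X)" "Sa u \<cdot> Neg C (Sa (Idn C W)) = Neg C (Sa f) \<cdot> w"
    using tri_map[OF tri_rot[OF tri_Idn[OF O(5) N]] tri_rot[OF t] u(1)] by blast
  obtain v where v: "v \<in> Hom C W X" "Sa v = w" using Sa_surj w O by blast
  have "Neg C (Sa u) = Neg C (Sa (f \<cdot> v))" using w(2) v(1) f u(1) O v(2)[symmetric] by (simp add: Hom_iff)
  then have "Sa u = Sa (f \<cdot> v)" by (rule Neg_inject) (use v(1) f u(1) in \<open>simp_all add: Hom_iff\<close>)
  then have "f \<cdot> v = u" using v f u by - (rule Sa_inj, simp_all add: Hom_iff)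
  then show ?thesis using that v by blast
qed

lemma tri_cov2:
  assumes t: "tri C X Y Z f g h" and u: "u \<in> Hom C W Z" "h \<cdot> u = Zero C W (S X)"
  obtains v where "v \<in> Hom C W Y" "g \<cdot> v = u"
  using tri_cov1[OF tri_rot[OF t] u] by blast

lemma tri_cov3:
  assumes t: "tri C X Y Z f g h" and u: "u \<in> Hom C W (S X)" "Sa f \<cdot> u = Zero C W (S Y)"
  obtains v where "v \<in> Hom C W Z" "h \<cdot> v = u"
proof -
  have f: "f \<in> Hom C X Y" using t by (simp add: tri_def)
  have O: "X \<in> Obj C" "Y \<in> Obj C" "W \<in> Obj C"
    using tri_Obj[OF t] Obj_Hom[OF u(1)] by blast+
  have "Neg C (Sa f) \<cdot> u = Zero C W (S Y)" using f u O by (simp add: Hom_iff)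
  then show ?thesis using tri_cov2[OF tri_rot[OF t] u(1)] that by blast
qed

text \<open>Dually, the triangle is mapped to 0 \<rightarrow> W = W, which arises from W = W
  \<rightarrow> \<Sigma>0 by rotating backwards.\<close>

lemma tri_con1:
  assumes t: "tri C X Y Z f g h" and u: "u \<in> Hom C Y W" "u \<cdot> f = Zero C X W"
  obtains v where "v \<in> Hom C Z W" "v \<cdot> g = u"
proof -
  obtain N where N: "zero_object C N" using ex_zero_object by blast
  have SN: "zero_object C (S N)" using N Susp.F_zero_object by blast
  have O: "X \<in> Obj C" "Y \<in> Obj C" "Z \<in> Obj C" "N \<in> Obj C" "W \<in> Obj C"
    using tri_Obj[OF t] N zero_object_iff Obj_Hom[OF u(1)] by blast+
  obtain e where e: "tri C N W W e (Idn C W) (Zero C W (S N))"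
    using tri_rotinv[OF tri_Idn[OF O(5) SN] O(4)] by blast
  have e': "e = Zero C N W" using zero_object_hom(2)[OF N triD(2)[OF e]] .
  have f: "f \<in> Hom C X Y" "g \<in> Hom C Y Z" "h \<in> Hom C Z (S X)" using t by (simp_all add: tri_def)
  have "Zero C X N \<in> Hom C X N" "u \<cdot> f = e \<cdot> Zero C X N"
    using O u e' by (simp_all add: Hom_iff)
  then obtain w where w: "w \<in> Hom C Z W" "w \<cdot> g = Idn C W \<cdot> u"
    using tri_map[OF t e _ u(1)] by blast
  then show ?thesis using that u(1) by (simp add: Hom_iff)
qed

lemma tri_con2:
  assumes t: "tri C X Y Z f g h" and u: "u \<in> Hom C Z W" "u \<cdot> g = Zero C Y W"
  obtains v where "v \<in> Hom C (S X) W" "v \<cdot> h = u"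
  using tri_con1[OF tri_rot[OF t] u] by blast

lemma tri_con3:
  assumes t: "tri C X Y Z f g h" and u: "u \<in> Hom C (S X) W" "u \<cdot> h = Zero C Z W"
  obtains v where "v \<in> Hom C (S Y) W" "v \<cdot> Sa f = u"
proof -
  obtain v where v: "v \<in> Hom C (S Y) W" "v \<cdot> Neg C (Sa f) = u"
    using tri_con2[OF tri_rot[OF t] u] by blast
  have f: "f \<in> Hom C X Y" using t by (simp add: tri_def)
  have "Neg C v \<in> Hom C (S Y) W" using v by (simp add: Hom_iff)
  moreover have "Neg C v \<cdot> Sa f = u" using v f by (simp add: Hom_iff)
  ultimately show ?thesis using that by blast
qed

lemma tri_comp_zero2: "tri C X Y Z f g h \<Longrightarrow> h \<cdot> g = Zero C Y (S X)"
  using tri_comp_zero tri_rot by blast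

lemma tri_comp_zero3:
  assumes t: "tri C X Y Z f g h" shows "Sa f \<cdot> h = Zero C Z (S Y)"
proof -
  have f: "f \<in> Hom C X Y" "h \<in> Hom C Z (S X)" using t by (simp_all add: tri_def)
  have O: "Y \<in> Obj C" "Z \<in> Obj C" using tri_Obj[OF t] by blast+
  have "Neg C (Sa f) \<cdot> h = Zero C Z (S Y)" using tri_comp_zero2[OF tri_rot[OF t]] .
  then have "Neg C (Sa f \<cdot> h) = Zero C Z (S Y)" using f by (simp add: Hom_iff)
  then show ?thesis using Neg_zero_iff[of "Sa f \<cdot> h" Z "S Y"] f by (simp add: Hom_iff)
qed

text \<open>Both \<open>g\<close> and \<open>h\<close> vanish: the first fact yields a section of
  \<open>f\<close>, the second makes \<open>f\<close> cancellable on the left.\<close>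

lemma zero_cone_iso:
  assumes t: "tri C X Y Z f g h" and Z: "zero_object C Z"
  shows "iso_arr C X Y f"
proof -
  have f: "f \<in> Hom C X Y" "g \<in> Hom C Y Z" "h \<in> Hom C Z (S X)" using t by (simp_all add: tri_def)
  have O: "X \<in> Obj C" "Y \<in> Obj C" "Z \<in> Obj C" using tri_Obj[OF t] by blast+
  have g: "g = Zero C Y Z" "h = Zero C Z (S X)" using zero_object_hom[OF Z] f by blast+
  have "g \<cdot> Idn C Y = Zero C Y Z" using g O by simp
  then obtain s where s: "s \<in> Hom C Y X" "f \<cdot> s = Idn C Y"
    using tri_cov1[OF t Idn_Hom[OF O(2)]] by blast
  have "u = Zero C W X" if u: "u \<in> Hom C W X" "f \<cdot> u = Zero C W Y" for u W
  proof -
    have W: "W \<in> Obj C" using u Obj_Hom by blast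
    have "Sa f \<cdot> Sa u = Sa (f \<cdot> u)" using u(1) f by (simp add: Hom_iff)
    also have "\<dots> = Zero C (S W) (S Y)" using u(2) W O by simp
    finally obtain v where v: "v \<in> Hom C (S W) Z" "h \<cdot> v = Sa u"
      using tri_cov3[OF t Susp.F_Hom[OF u(1)]] by blast
    have "Sa u = Zero C (S W) (S X)" using v g(2) W O by (simp add: Hom_iff)
    then show ?thesis using Sa_zero u by blast
  qed
  then show ?thesis using iso_if_mono_split f(1) s by blast
qed

lemma tri_isos:
  assumes t: "tri C X Y Z f g h" and u: "iso_arr C X X' u" and v: "iso_arr C Y Y' v"
    and w: "iso_arr C Z Z' w"
    and f': "f' \<in> Hom C X' Y'" "g' \<in> Hom C Y' Z'" "h' \<in> Hom C Z' (S X')"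
    and "v \<cdot> f = f' \<cdot> u" "w \<cdot> g = g' \<cdot> v" "Sa u \<cdot> h = h' \<cdot> w"
  shows "tri C X' Y' Z' f' g' h'"
  using TR1_iso[of f g h X Y Z f' X' Y' g' Z' h' u v w] assms by (simp add: tri_def)

lemma has_triangle_isom:
  assumes "has_triangle C X Y Z" "isom C X X'" "isom C Y Y'" "isom C Z Z'"
  shows "has_triangle C X' Y' Z'"
proof -
  obtain f g h where t: "tri C X Y Z f g h" using assms unfolding has_triangle_tri by blast
  note f = triD[OF t]
  obtain u where u: "iso_arr C X X' u" using assms unfolding isom_def by blast
  then obtain u' where u': "u \<in> Hom C X X'" "u' \<in> Hom C X' X" "u' \<cdot> u = Idn C X"
    unfolding iso_arr_def by blast
  obtain v where v: "iso_arr C Y Y' v" using assms unfolding isom_def by blast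
  then obtain v' where v': "v \<in> Hom C Y Y'" "v' \<in> Hom C Y' Y" "v' \<cdot> v = Idn C Y"
    unfolding iso_arr_def by blast
  obtain w where w: "iso_arr C Z Z' w" using assms unfolding isom_def by blast
  then obtain w' where w': "w \<in> Hom C Z Z'" "w' \<in> Hom C Z' Z" "w' \<cdot> w = Idn C Z"
    unfolding iso_arr_def by blast
  have O: "X \<in> Obj C" "Y \<in> Obj C" "Z \<in> Obj C" using tri_Obj[OF t] by blast+
  have "tri C X' Y' Z' (v \<cdot> f \<cdot> u') (w \<cdot> g \<cdot> v') (Sa u \<cdot> h \<cdot> w')"
    by (rule tri_isos[OF t u v w]) (use O f(2-4) u' v' w' in \<open>simp_all add: Hom_iff\<close>)
  then show ?thesis unfolding has_triangle_tri by blast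
qed

text \<open>TR4 with most morphisms forgotten. Together with the converse rebracketing below, this
  is the associativity of \<open>star\<close>.\<close>

lemma octahedral1:
  assumes "has_triangle C v x c" "has_triangle C a v b"
  obtains u where "has_triangle C a x u" "has_triangle C b u c"
proof -
  obtain g g1 g2 where g: "tri C v x c g g1 g2" using assms(1) unfolding has_triangle_tri by blast
  obtain f f1 f2 where f: "tri C a v b f f1 f2" using assms(2) unfolding has_triangle_tri by blast
  note gD = triD[OF g] and fD = triD[OF f]
  have "g \<cdot> f \<in> Hom C a x" using Cmp_Hom[OF fD(2) gD(2)] .
  then obtain u h1 h2 where h: "tri C a x u (g \<cdot> f) h1 h2" using tri_ex by blast
  note hD = triD[OF h]
  obtain p q where pq: "(p, q, Sa f1 \<cdot> g2) \<in> Tri C" "Dom C p = Cod C f1" "Cod C p = Cod C h1"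
    "Cod C q = Cod C g1"
    using TR4[OF fD(2) gD(2) fD(1) gD(1) hD(1)] by blast
  obtain X Y Z where XYZ: "p \<in> Hom C X Y" "q \<in> Hom C Y Z" "Sa f1 \<cdot> g2 \<in> Hom C Z (S X)"
    using Tri_candidate[OF pq(1)] by blast
  have "X = b" "Y = u" "Z = c" using XYZ pq gD fD hD by (auto simp: Hom_iff)
  then have "tri C b u c p q (Sa f1 \<cdot> g2)" using XYZ pq by (simp add: tri_def)
  then show ?thesis using that h unfolding has_triangle_tri by blast
qed

text \<open>The first rebracketing is applied to the rotated triangles x \<rightarrow> u
  \<rightarrow> \<Sigma>a and u \<rightarrow> c \<rightarrow> \<Sigma>b, and the object that it
  yields is desuspended.\<close>

lemma octahedral2:
  assumes "has_triangle C a x u" "has_triangle C b u c"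
  obtains v where "has_triangle C v x c" "has_triangle C a v b"
proof -
  have O: "a \<in> Obj C" "b \<in> Obj C" "c \<in> Obj C" "x \<in> Obj C" "u \<in> Obj C"
    using has_triangle_Obj[OF assms(1)] has_triangle_Obj[OF assms(2)] by simp_all
  have "has_triangle C x u (S a)" "has_triangle C u c (S b)" using assms has_triangle_rot by blast+
  then obtain w where w: "has_triangle C x c w" "has_triangle C (S a) w (S b)"
    using octahedral1 by blast
  have "w \<in> Obj C" using has_triangle_Obj[OF w(1)] by blast
  then obtain v where v: "v \<in> Obj C" "S v = w" using S_surj by blast
  then have "has_triangle C v x c" using w(1) has_triangle_rotinv by blast
  moreover have "has_triangle C a v b" using has_triangle_S_D[of a v b] w(2) v O by blast
  ultimately show ?thesis using that by blast
qed

lemma is_biproductI: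
  assumes "i1 \<in> Hom C X P" "i2 \<in> Hom C Y P" "p1 \<in> Hom C P X" "p2 \<in> Hom C P Y"
    "p1 \<cdot> i1 = Idn C X" "p2 \<cdot> i2 = Idn C Y" "p2 \<cdot> i1 = Zero C X Y" "p1 \<cdot> i2 = Zero C Y X"
    "Plus C (i1 \<cdot> p1) (i2 \<cdot> p2) = Idn C P"
  shows "is_biproduct C X Y P"
  unfolding is_biproduct_def using assms Obj_Hom by blast

lemma is_biproductE:
  assumes "is_biproduct C X Y P"
  obtains i1 i2 p1 p2 where "X \<in> Obj C" "Y \<in> Obj C" "P \<in> Obj C"
    "i1 \<in> Hom C X P" "i2 \<in> Hom C Y P" "p1 \<in> Hom C P X" "p2 \<in> Hom C P Y"
    "p1 \<cdot> i1 = Idn C X" "p2 \<cdot> i2 = Idn C Y" "p2 \<cdot> i1 = Zero C X Y" "p1 \<cdot> i2 = Zero C Y X"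
    "Plus C (i1 \<cdot> p1) (i2 \<cdot> p2) = Idn C P"
  using assms unfolding is_biproduct_def by blast

text \<open>The suspended retraction recovers \<open>h\<close> from \<open>Sa f \<cdot> h\<close>,
  which is zero; and once the third morphism vanishes, \<open>g\<close> can be cancelled on the
  right.\<close>

lemma split_mono_tri:
  assumes t: "tri C X Y Z f g h" and r: "r \<in> Hom C Y X" "r \<cdot> f = Idn C X"
  shows "h = Zero C Z (S X)" "\<And>W u. u \<in> Hom C Z W \<Longrightarrow> u \<cdot> g = Zero C Y W \<Longrightarrow> u = Zero C Z W"
proof -
  note f = triD[OF t]
  have O: "X \<in> Obj C" "Y \<in> Obj C" "Z \<in> Obj C" using tri_Obj[OF t] by blast+
  have "Sa r \<cdot> Sa f = Sa (r \<cdot> f)" using r(1) f by (simp add: Hom_iff)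
  then have 1: "Sa r \<cdot> Sa f = Idn C (S X)" using r(2) O by simp
  have "h = Idn C (S X) \<cdot> h" using f O by (simp add: Hom_iff)
  also have "\<dots> = Sa r \<cdot> (Sa f \<cdot> h)"
    using reassoc[OF 1 Susp.F_Hom[OF r(1)] Susp.F_Hom[OF f(2)] f(4)] by simp
  also have "\<dots> = Zero C Z (S X)" using tri_comp_zero3[OF t] r(1) O by (simp add: Hom_iff)
  finally show h: "h = Zero C Z (S X)" .
  show "u = Zero C Z W" if u: "u \<in> Hom C Z W" "u \<cdot> g = Zero C Y W" for u W
  proof -
    obtain v where v: "v \<in> Hom C (S X) W" "v \<cdot> h = u" using tri_con2[OF t u] by blast
    then show ?thesis using h O Obj_Hom[OF v(1)] by (simp add: Hom_iff)
  qed
qed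

lemma has_triangle_biproduct:
  assumes "is_biproduct C X Y P" shows "has_triangle C X P Y"
proof -
  obtain i1 i2 p1 p2 where i: "X \<in> Obj C" "Y \<in> Obj C" "P \<in> Obj C"
    "i1 \<in> Hom C X P" "i2 \<in> Hom C Y P" "p1 \<in> Hom C P X" "p2 \<in> Hom C P Y"
    "p1 \<cdot> i1 = Idn C X" "p2 \<cdot> i2 = Idn C Y" "p2 \<cdot> i1 = Zero C X Y" "p1 \<cdot> i2 = Zero C Y X"
    and sum: "Plus C (i1 \<cdot> p1) (i2 \<cdot> p2) = Idn C P"
    using assms by (rule is_biproductE)
  obtain Z g h where t: "tri C X P Z i1 g h" using tri_ex i(4) by blast
  note gD = triD[OF t]
  have Z: "Z \<in> Obj C" using tri_Obj[OF t] by blast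
  note epi = split_mono_tri(2)[OF t i(6,8)]
  obtain q where q: "q \<in> Hom C Z Y" "q \<cdot> g = p2" using tri_con1[OF t i(7,10)] by blast
  have ga: "g \<cdot> i1 = Zero C X Z" using tri_comp_zero[OF t] .
  have "g = g \<cdot> Plus C (i1 \<cdot> p1) (i2 \<cdot> p2)" using sum gD i by (simp add: Hom_iff)
  also have "\<dots> = Plus C (g \<cdot> (i1 \<cdot> p1)) (g \<cdot> (i2 \<cdot> p2))" using gD i(1-7) by (simp add: Hom_iff)
  also have "g \<cdot> (i1 \<cdot> p1) = Zero C P Z" using reassoc[OF ga gD(3,2) i(6)] i(1-7) Z by (simp add: Hom_iff)
  finally have g: "g \<cdot> (i2 \<cdot> p2) = g" using gD i(1-7) Z by (simp add: Hom_iff)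
  \<comment> \<open>The inverse is \<open>g \<cdot> i2\<close>: one composite is
    \<open>p2 \<cdot> i2\<close>, the other becomes the identity after cancelling the epimorphism
    \<open>g\<close>.\<close>
  have "iso_arr C Z Y q"
  proof (rule iso_arrI)
    show "q \<in> Hom C Z Y" "g \<cdot> i2 \<in> Hom C Y Z" using q gD i(1-7) by (simp_all add: Hom_iff)
    show "q \<cdot> (g \<cdot> i2) = Idn C Y" using reassoc[OF q(2,1) gD(3) i(5)] i by simp
    let ?d = "Plus C (g \<cdot> i2 \<cdot> q) (Neg C (Idn C Z))"
    have "?d \<cdot> g = Zero C P Z" using q g gD(2-4) i(1-7) Z by (simp add: Hom_iff)
    moreover have "?d \<in> Hom C Z Z" using q gD(2-4) i(1-7) Z by (simp add: Hom_iff)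
    ultimately have "?d = Zero C Z Z" using epi by blast
    then show "g \<cdot> i2 \<cdot> q = Idn C Z"
      using diff_zero_iff[of "g \<cdot> i2 \<cdot> q" Z Z "Idn C Z"] q gD(2-4) i(1-7) Z by (simp add: Hom_iff)
  qed
  then have "isom C Z Y" unfolding isom_def by blast
  moreover have "has_triangle C X P Z" using t unfolding has_triangle_tri by blast
  ultimately show ?thesis using has_triangle_isom isom_refl i(1,3) by blast
qed

lemma is_biproduct_zero:
  assumes "X \<in> Obj C" "zero_object C N" shows "is_biproduct C X N X"
proof -
  have N: "N \<in> Obj C" "Idn C N = Zero C N N" using assms zero_object_iff by blast+
  show ?thesis
    by (rule is_biproductI[of "Idn C X" _ _ "Zero C N X" _ "Idn C X" "Zero C X N"])
      (use assms(1) N in \<open>simp_all add: Hom_iff\<close>)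
qed


subsection \<open>Shifts\<close>

lemma shift_0 [simp]: "shift C 0 X = X"
  by (simp add: shift_def)

lemma Sinv:
  assumes "X \<in> Obj C"
  shows "inv_into (Obj C) (on_obj (Susp C)) X \<in> Obj C" "S (inv_into (Obj C) (on_obj (Susp C)) X) = X"
proof -
  have "X \<in> on_obj (Susp C) ` Obj C" using assms Susp_bij_Obj by (simp add: bij_betw_def)
  then show "inv_into (Obj C) (on_obj (Susp C)) X \<in> Obj C" "S (inv_into (Obj C) (on_obj (Susp C)) X) = X"
    by (auto intro: inv_into_into f_inv_into_f)
qed

lemma shift_Obj [simp]: assumes "X \<in> Obj C" shows "shift C n X \<in> Obj C"
proof -
  have "(on_obj (Susp C) ^^ k) X \<in> Obj C" for k by (induction k) (use assms in simp_all)
  moreover have "(inv_into (Obj C) (on_obj (Susp C)) ^^ k) X \<in> Obj C" for k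
    by (induction k) (use assms Sinv in simp_all)
  ultimately show ?thesis by (simp add: shift_def)
qed

lemma shift_Suc: assumes "X \<in> Obj C" shows "shift C (n + 1) X = S (shift C n X)"
proof (cases "0 \<le> n")
  case True
  then have "nat (n + 1) = Suc (nat n)" by simp
  then show ?thesis using True by (simp add: shift_def)
next
  case False
  then have n: "nat (- n) = Suc (nat (- (n + 1)))" by simp
  let ?Y = "(inv_into (Obj C) (on_obj (Susp C)) ^^ nat (- (n + 1))) X"
  have Y: "?Y = shift C (n + 1) X" using False by (auto simp: shift_def)
  have "shift C n X = inv_into (Obj C) (on_obj (Susp C)) ?Y" using False n by (simp add: shift_def)
  then show ?thesis using Sinv(2)[of ?Y] Y shift_Obj[OF assms, of "n + 1"] by simp
qed

lemma shift_1: "X \<in> Obj C \<Longrightarrow> shift C 1 X = S X"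
  using shift_Suc[of X 0] by simp

lemma shift_add: assumes "X \<in> Obj C" shows "shift C m (shift C n X) = shift C (m + n) X"
proof (induction m rule: int_induct[where k = 0])
  case (step1 i)
  have "shift C (i + 1) (shift C n X) = S (shift C (i + n) X)" using step1 assms shift_Suc by simp
  also have "\<dots> = shift C (i + n + 1) X" using shift_Suc[OF assms] by simp
  finally show ?case by (simp add: algebra_simps)
next
  case (step2 i)
  have "S (shift C (i - 1) (shift C n X)) = shift C (i + n) X"
    using step2 assms shift_Suc[of "shift C n X" "i - 1"] by simp
  also have "\<dots> = S (shift C (i - 1 + n) X)" using shift_Suc[OF assms, of "i - 1 + n"] by (simp add: algebra_simps)
  finally show ?case using assms by - (rule S_inj[rotated 2], simp_all)
qed simp

lemma shift_induct:
  assumes P0: "P X" and X: "X \<in> Obj C" and up: "\<And>Y. Y \<in> Obj C \<Longrightarrow> P Y \<longleftrightarrow> P (S Y)"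
  shows "P (shift C n X)"
proof (induction n rule: int_induct[where k = 0])
  case (step1 i)
  then show ?case using up[of "shift C i X"] X shift_Suc by simp
next
  case (step2 i)
  then show ?case using up[of "shift C (i - 1) X"] X shift_Suc[OF X, of "i - 1"] by simp
qed (simp add: P0)

lemma hom_zero_S: 
  assumes "X \<in> Obj C" "Y \<in> Obj C" shows "hom_zero C (S X) (S Y) \<longleftrightarrow> hom_zero C X Y"
proof
  assume h: "hom_zero C (S X) (S Y)"
  show "hom_zero C X Y"
    using assms by (intro hom_zeroI) (use h hom_zeroD Susp.F_Hom Sa_zero in blast)+
next
  assume h: "hom_zero C X Y"
  show "hom_zero C (S X) (S Y)"
  proof (rule hom_zeroI)
    fix f assume "f \<in> Hom C (S X) (S Y)"
    then obtain g where g: "g \<in> Hom C X Y" "Sa g = f" using Sa_surj assms by metis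
    then have "g = Zero C X Y" using h hom_zeroD by blast
    then show "f = Zero C (S X) (S Y)" using g assms by auto
  qed (use assms in simp_all)
qed

lemma hom_zero_shift_both:
  assumes "X \<in> Obj C" "Y \<in> Obj C"
  shows "hom_zero C (shift C n X) (shift C n Y) \<longleftrightarrow> hom_zero C X Y"
proof (induction n rule: int_induct[where k = 0])
  case (step1 i)
  then show ?case using assms shift_Suc hom_zero_S by simp
next
  case (step2 i)
  have "shift C i X = S (shift C (i - 1) X)" "shift C i Y = S (shift C (i - 1) Y)"
    using shift_Suc[OF assms(1), of "i - 1"] shift_Suc[OF assms(2), of "i - 1"] by simp_all
  then show ?case using step2 assms hom_zero_S by simp
qed simp

lemma hom_zero_shift:
  assumes "X \<in> Obj C" "Y \<in> Obj C"
  shows "hom_zero C (shift C m X) (shift C n Y) \<longleftrightarrow> hom_zero C (shift C (m - n) X) Y"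
  using hom_zero_shift_both[of "shift C (m - n) X" Y n] shift_add[of X n "m - n"] assms by simp

lemma isom_S: assumes "X \<in> Obj C" "Y \<in> Obj C" shows "isom C (S X) (S Y) \<longleftrightarrow> isom C X Y"
proof
  assume "isom C (S X) (S Y)"
  then obtain f g where f: "f \<in> Hom C (S X) (S Y)" "g \<in> Hom C (S Y) (S X)"
    "g \<cdot> f = Idn C (S X)" "f \<cdot> g = Idn C (S Y)" unfolding isom_def iso_arr_def by blast
  obtain f' where f': "f' \<in> Hom C X Y" "Sa f' = f" using Sa_surj f assms by metis
  obtain g' where g': "g' \<in> Hom C Y X" "Sa g' = g" using Sa_surj f assms by metis
  have "Sa (g' \<cdot> f') = Sa (Idn C X)" "Sa (f' \<cdot> g') = Sa (Idn C Y)"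
    using f f' g' assms by (simp_all add: Hom_iff)
  then have "g' \<cdot> f' = Idn C X" "f' \<cdot> g' = Idn C Y" 
    using f' g' assms by (simp_all add: Hom_iff Sa_inj)
  then show "isom C X Y" using f' g' iso_arrI unfolding isom_def by blast
qed (rule Susp.F_isom)

lemma isom_shift:
  assumes "isom C X Y" shows "isom C (shift C n X) (shift C n Y)"
proof -
  have O: "X \<in> Obj C" "Y \<in> Obj C" using assms isom_Obj by blast+
  show ?thesis
  proof (induction n rule: int_induct[where k = 0])
    case (step1 i)
    then show ?case using O shift_Suc isom_S by simp
  next
    case (step2 i)
    have "shift C i X = S (shift C (i - 1) X)" "shift C i Y = S (shift C (i - 1) Y)"
      using shift_Suc[OF O(1), of "i - 1"] shift_Suc[OF O(2), of "i - 1"] by simp_all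
    then show ?case using step2 O isom_S by simp
  qed (use assms in simp)
qed

lemma has_triangle_shift:
  assumes "has_triangle C X Y Z" shows "has_triangle C (shift C n X) (shift C n Y) (shift C n Z)"
proof -
  have O: "X \<in> Obj C" "Y \<in> Obj C" "Z \<in> Obj C" using assms has_triangle_Obj by blast+
  show ?thesis
  proof (induction n rule: int_induct[where k = 0])
    case (step1 i)
    then show ?case using O shift_Suc has_triangle_S by simp
  next
    case (step2 i)
    have "shift C i X = S (shift C (i - 1) X)" "shift C i Y = S (shift C (i - 1) Y)"
      "shift C i Z = S (shift C (i - 1) Z)"
      using shift_Suc[OF O(1), of "i - 1"] shift_Suc[OF O(2), of "i - 1"] shift_Suc[OF O(3), of "i - 1"]
      by simp_all
    then show ?case using step2 O has_triangle_S_D by simp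
  qed (use assms in simp)
qed

lemma zero_object_shift: "zero_object C Z \<Longrightarrow> zero_object C (shift C n Z)"
  unfolding zero_object_iff[of "shift C n Z"]
  using hom_zero_shift_both[of Z Z n] zero_object_hom_zero[of Z Z] hom_zero_self zero_object_iff by metis

lemma shift_triangle_left:
  assumes "has_triangle C X Y Z" shows "has_triangle C (shift C (- 1) Z) X Y"
proof (rule has_triangle_rotinv)
  have O: "X \<in> Obj C" "Y \<in> Obj C" "Z \<in> Obj C" using assms has_triangle_Obj by blast+
  then show "has_triangle C X Y (S (shift C (-1) Z))" 
    using assms shift_Suc[of Z "-1"] by simp
  show "shift C (-1) Z \<in> Obj C" using O by simp
qed

lemma hom_zero_extension_left:
  assumes "has_triangle C X Y Z" "hom_zero C X W" "hom_zero C Z W" shows "hom_zero C Y W"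
proof -
  obtain f g h where t: "tri C X Y Z f g h" using assms unfolding has_triangle_tri by blast
  note fD = triD[OF t]
  have O: "X \<in> Obj C" "Y \<in> Obj C" "Z \<in> Obj C" "W \<in> Obj C"
    using tri_Obj[OF t] hom_zero_Obj assms by blast+
  show ?thesis
  proof (rule hom_zeroI)
    fix u assume u: "u \<in> Hom C Y W"
    have "u \<cdot> f = Zero C X W" using hom_zeroD[OF assms(2)] Cmp_Hom[OF fD(2) u] by blast
    then obtain v where v: "v \<in> Hom C Z W" "v \<cdot> g = u" using tri_con1[OF t u] by blast
    have "v = Zero C Z W" using hom_zeroD[OF assms(3) v(1)] .
    then show "u = Zero C Y W" using v fD O by (simp add: Hom_iff)
  qed (use O in simp_all)
qed

lemma hom_zero_extension_right:
  assumes "has_triangle C X Y Z" "hom_zero C W X" "hom_zero C W Z" shows "hom_zero C W Y"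
proof -
  obtain f g h where t: "tri C X Y Z f g h" using assms unfolding has_triangle_tri by blast
  note fD = triD[OF t]
  have O: "X \<in> Obj C" "Y \<in> Obj C" "Z \<in> Obj C" "W \<in> Obj C"
    using tri_Obj[OF t] hom_zero_Obj assms by blast+
  show ?thesis
  proof (rule hom_zeroI)
    fix u assume u: "u \<in> Hom C W Y"
    have "g \<cdot> u = Zero C W Z" using hom_zeroD[OF assms(3)] Cmp_Hom[OF u fD(3)] by blast
    then obtain v where v: "v \<in> Hom C W X" "f \<cdot> v = u" using tri_cov1[OF t u] by blast
    have "v = Zero C W X" using hom_zeroD[OF assms(2) v(1)] .
    then show "u = Zero C W Y" using v(2) fD O by (simp add: Hom_iff)
  qed (use O in simp_all)
qed

end


section \<open>Small sets and coproducts\<close>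

context
  fixes r :: "'u rel" assumes size: "size_cardinal r"
begin

lemma size_Card: "Card_order r" and size_regular: "regularCard r" and size_nat: "natLeq <o r"
  using size by (simp_all add: size_cardinal_def)

lemma small_subset: "small r A \<Longrightarrow> B \<subseteq> A \<Longrightarrow> small r B"
  unfolding small_def using card_of_mono1 ordLeq_ordLess_trans by blast

lemma small_image: "small r A \<Longrightarrow> small r (f ` A)"
  unfolding small_def using card_of_image ordLeq_ordLess_trans by blast

lemma small_nat: "small r (UNIV :: nat set)"
  unfolding small_def using size_nat card_of_nat ordIso_ordLess_trans by blast

lemma small_int: "small r (UNIV :: int set)"
proof -
  have "(UNIV :: int set) = range (from_nat :: nat \<Rightarrow> int)" using surj_from_nat by simp
  then show ?thesis using small_image[OF small_nat] by metis
qed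

lemma small_finite: assumes "finite A" shows "small r A"
proof -
  obtain f n where "A = f ` {i::nat. i < n}" using finite_imp_nat_seg_image_inj_on[OF assms] by blast
  then show ?thesis using small_image[OF small_subset[OF small_nat]] by blast
qed

text \<open>Regularity of \<open>r\<close> enters here, in the form of stability under small
  unions.\<close>

lemma small_Sigma:
  fixes A :: "'a set" and B :: "'a \<Rightarrow> 'b set"
  assumes "small r A" "\<And>a. a \<in> A \<Longrightarrow> small r (B a)" shows "small r (Sigma A B)"
proof -
  have "infinite (Field r)" using size_nat size_Card natLeq_ordLeq_cinfinite
    by (meson cinfinite_def cinfinite_mono natLeq_cinfinite ordLess_imp_ordLeq)
  then have "stable r" using regularCard_stable size_Card size_regular by blast
  then show ?thesis using assms stable_elim unfolding small_def by blast
qed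

text \<open>Coproducts are given for index sets of type \<open>'u\<close>. Through this injection a
  small family with any other index type is reindexed by such a set.\<close>

lemma small_inj: 
  fixes A :: "'a set"
  assumes "small r A" obtains e :: "'a \<Rightarrow> 'u" where "inj_on e A"
proof -
  have "|Field r| =o r" using size_Card card_of_Field_ordIso by blast
  moreover have "|Field r| \<le>o |UNIV :: 'u set|" by simp
  ultimately have "|A| \<le>o |UNIV :: 'u set|" using assms unfolding small_def
    by (meson ordIso_symmetric ordLess_imp_ordLeq ordLess_ordIso_trans ordLeq_transitive)
  then show ?thesis using that unfolding card_of_ordLeq[symmetric] by blast
qed

end

context category
begin

lemma is_coproduct_arr:
  assumes "is_coproduct C I X P \<iota>"
  shows "P \<in> Obj C" "i \<in> I \<Longrightarrow> X i \<in> Obj C" "i \<in> I \<Longrightarrow> \<iota> i \<in> Hom C (X i) P"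
    "i \<in> I \<Longrightarrow> \<iota> i \<in> Arr C" "i \<in> I \<Longrightarrow> Dom C (\<iota> i) = X i" "i \<in> I \<Longrightarrow> Cod C (\<iota> i) = P"
  using assms unfolding is_coproduct_def by (simp_all add: Hom_iff)

lemma copr_map:
  assumes "is_coproduct C I X P \<iota>" "Y \<in> Obj C" "\<And>i. i \<in> I \<Longrightarrow> f i \<in> Hom C (X i) Y"
  obtains h where "h \<in> Hom C P Y" "\<And>i. i \<in> I \<Longrightarrow> h \<cdot> \<iota> i = f i"
  using assms unfolding is_coproduct_def by metis

lemma copr_eq:
  assumes "is_coproduct C I X P \<iota>" "h \<in> Hom C P Y" "h' \<in> Hom C P Y"
    "\<And>i. i \<in> I \<Longrightarrow> h \<cdot> \<iota> i = h' \<cdot> \<iota> i"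
  shows "h = h'"
proof -
  have Y: "Y \<in> Obj C" using assms(2) Obj_Hom by blast
  have "\<forall>i \<in> I. h \<cdot> \<iota> i \<in> Hom C (X i) Y"
    using is_coproduct_arr(3)[OF assms(1)] assms(2) Cmp_Hom by blast
  then have "\<exists>!k. k \<in> Hom C P Y \<and> (\<forall>i \<in> I. k \<cdot> \<iota> i = h \<cdot> \<iota> i)"
    using assms(1) Y unfolding is_coproduct_def by (elim conjE) (drule (1) bspec, drule spec, erule (1) mp)
  moreover have "h \<in> Hom C P Y \<and> (\<forall>i \<in> I. h \<cdot> \<iota> i = h \<cdot> \<iota> i)"
    "h' \<in> Hom C P Y \<and> (\<forall>i \<in> I. h' \<cdot> \<iota> i = h \<cdot> \<iota> i)" using assms by simp_all
  ultimately show ?thesis by blast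
qed

lemma is_coproductI:
  assumes "P \<in> Obj C" "\<And>i. i \<in> I \<Longrightarrow> X i \<in> Obj C" "\<And>i. i \<in> I \<Longrightarrow> \<iota> i \<in> Hom C (X i) P"
    and ex: "\<And>Y f. Y \<in> Obj C \<Longrightarrow> (\<And>i. i \<in> I \<Longrightarrow> f i \<in> Hom C (X i) Y) \<Longrightarrow>
      \<exists>h \<in> Hom C P Y. \<forall>i \<in> I. h \<cdot> \<iota> i = f i"
    and un: "\<And>Y h h'. h \<in> Hom C P Y \<Longrightarrow> h' \<in> Hom C P Y \<Longrightarrow> (\<And>i. i \<in> I \<Longrightarrow> h \<cdot> \<iota> i = h' \<cdot> \<iota> i) \<Longrightarrow> h = h'"
  shows "is_coproduct C I X P \<iota>"
  unfolding is_coproduct_def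
proof (intro conjI ballI allI impI)
  fix Y f assume Y: "Y \<in> Obj C" and f: "\<forall>i \<in> I. f i \<in> Hom C (X i) Y"
  obtain h where h: "h \<in> Hom C P Y" "\<forall>i \<in> I. h \<cdot> \<iota> i = f i" using ex[OF Y, of f] f by blast
  then show "\<exists>!h. h \<in> Hom C P Y \<and> (\<forall>i \<in> I. h \<cdot> \<iota> i = f i)"
    by (intro ex1I[of _ h]) (auto intro!: un[of _ Y h])
qed (use assms in simp_all)

lemma is_coproduct_isom:
  assumes "is_coproduct C I X P \<iota>" "is_coproduct C I X P' \<iota>'"
  shows "isom C P P'"
proof -
  note i = is_coproduct_arr[OF assms(1)] and i' = is_coproduct_arr[OF assms(2)]
  obtain h where h: "h \<in> Hom C P P'" "\<And>i. i \<in> I \<Longrightarrow> h \<cdot> \<iota> i = \<iota>' i"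
    using copr_map[OF assms(1) i'(1), of \<iota>'] i'(3) by blast
  obtain k where k: "k \<in> Hom C P' P" "\<And>i. i \<in> I \<Longrightarrow> k \<cdot> \<iota>' i = \<iota> i"
    using copr_map[OF assms(2) i(1), of \<iota>] i(3) by blast
  have "k \<cdot> h = Idn C P"
    by (rule copr_eq[OF assms(1)]) (use h k i i' in \<open>simp_all add: Hom_iff\<close>)
  moreover have "h \<cdot> k = Idn C P'"
    by (rule copr_eq[OF assms(2)]) (use h k i i' in \<open>simp_all add: Hom_iff\<close>)
  ultimately show ?thesis using h(1) k(1) iso_arrI unfolding isom_def by blast
qed

lemma is_coproduct_transfer_family:
  assumes c: "is_coproduct C I X P \<iota>" and u: "\<And>i. i \<in> I \<Longrightarrow> isom C (X' i) (X i)"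
  obtains \<iota>' where "is_coproduct C I X' P \<iota>'"
proof -
  note i = is_coproduct_arr[OF c]
  have "\<forall>i \<in> I. \<exists>u v. u \<in> Hom C (X' i) (X i) \<and> v \<in> Hom C (X i) (X' i) \<and> v \<cdot> u = Idn C (X' i) \<and> u \<cdot> v = Idn C (X i)"
    using u unfolding isom_def iso_arr_def by blast
  then obtain u v where uv: "\<And>i. i \<in> I \<Longrightarrow> u i \<in> Hom C (X' i) (X i)" "\<And>i. i \<in> I \<Longrightarrow> v i \<in> Hom C (X i) (X' i)"
    "\<And>i. i \<in> I \<Longrightarrow> v i \<cdot> u i = Idn C (X' i)" "\<And>i. i \<in> I \<Longrightarrow> u i \<cdot> v i = Idn C (X i)" by metis
  have "is_coproduct C I X' P (\<lambda>i. \<iota> i \<cdot> u i)"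
  proof (rule is_coproductI)
    show "X' j \<in> Obj C" "\<iota> j \<cdot> u j \<in> Hom C (X' j) P" if "j \<in> I" for j
      using i(3)[OF that] uv(1)[OF that] Cmp_Hom Obj_Hom by blast+
    fix Y and f assume Y: "Y \<in> Obj C" and f: "\<And>j. j \<in> I \<Longrightarrow> f j \<in> Hom C (X' j) Y"
    have "f j \<cdot> v j \<in> Hom C (X j) Y" if "j \<in> I" for j using f[OF that] uv(2)[OF that] Cmp_Hom by blast
    then obtain h where h: "h \<in> Hom C P Y" "\<And>j. j \<in> I \<Longrightarrow> h \<cdot> \<iota> j = f j \<cdot> v j"
      using copr_map[OF c Y, of "\<lambda>j. f j \<cdot> v j"] by blast
    have "h \<cdot> (\<iota> j \<cdot> u j) = f j" if j: "j \<in> I" for j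
    proof -
      have "h \<cdot> (\<iota> j \<cdot> u j) = (h \<cdot> \<iota> j) \<cdot> u j" using h(1) i(4-6)[OF j] uv(1)[OF j] by (simp add: Hom_iff)
      also have "\<dots> = f j \<cdot> (v j \<cdot> u j)" using h(2)[OF j] f[OF j] uv(1,2)[OF j] by (simp add: Hom_iff)
      also have "\<dots> = f j" using uv(3)[OF j] f[OF j] by (simp add: Hom_iff)
      finally show ?thesis .
    qed
    then show "\<exists>h \<in> Hom C P Y. \<forall>j \<in> I. h \<cdot> (\<iota> j \<cdot> u j) = f j" using h(1) by blast
  next
    fix Y h h' assume h: "h \<in> Hom C P Y" "h' \<in> Hom C P Y"
      and eq: "\<And>j. j \<in> I \<Longrightarrow> h \<cdot> (\<iota> j \<cdot> u j) = h' \<cdot> (\<iota> j \<cdot> u j)"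
    show "h = h'"
    proof (rule copr_eq[OF c h])
      fix j assume j: "j \<in> I"
      have "(h \<cdot> (\<iota> j \<cdot> u j)) \<cdot> v j = (h' \<cdot> (\<iota> j \<cdot> u j)) \<cdot> v j" using eq[OF j] by simp
      then show "h \<cdot> \<iota> j = h' \<cdot> \<iota> j" using h i(4-6)[OF j] uv[OF j] i(2)[OF j] by (simp add: Hom_iff)
    qed
  qed (rule i(1))
  then show ?thesis using that by blast
qed

lemma is_coproduct_singleton:
  assumes "iso_arr C (X i) P (\<iota> i)" shows "is_coproduct C {i} X P \<iota>"
proof -
  obtain v where uv: "\<iota> i \<in> Hom C (X i) P" "v \<in> Hom C P (X i)" "v \<cdot> \<iota> i = Idn C (X i)" "\<iota> i \<cdot> v = Idn C P"
    using assms unfolding iso_arr_def by blast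
  show ?thesis
  proof (rule is_coproductI)
    fix Y and f assume Y: "Y \<in> Obj C" and f: "\<And>j. j \<in> {i} \<Longrightarrow> f j \<in> Hom C (X j) Y"
    have "f i \<cdot> v \<in> Hom C P Y" "(f i \<cdot> v) \<cdot> \<iota> i = f i" using f[of i] uv by (simp_all add: Hom_iff)
    then show "\<exists>h \<in> Hom C P Y. \<forall>j \<in> {i}. h \<cdot> \<iota> j = f j" by blast
  next
    fix Y h h' assume h: "h \<in> Hom C P Y" "h' \<in> Hom C P Y"
      and eq: "\<And>j. j \<in> {i} \<Longrightarrow> h \<cdot> \<iota> j = h' \<cdot> \<iota> j"
    have "(h \<cdot> \<iota> i) \<cdot> v = (h' \<cdot> \<iota> i) \<cdot> v" using eq by simp
    then show "h = h'" using h uv by (simp add: Hom_iff)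
  qed (use uv Obj_Hom in blast)+
qed

lemma is_coproduct_singletonD:
  assumes c: "is_coproduct C {i} X P \<iota>" shows "iso_arr C (X i) P (\<iota> i)"
proof -
  note i = is_coproduct_arr(1)[OF c] is_coproduct_arr(2-6)[OF c, of i, simplified]
  obtain v where v: "v \<in> Hom C P (X i)" "v \<cdot> \<iota> i = Idn C (X i)"
    using copr_map[OF c i(2), of "\<lambda>_. Idn C (X i)"] i(2) by (auto simp: Hom_def)
  have "\<iota> i \<cdot> v = Idn C P"
    by (rule copr_eq[OF c]) (use v i in \<open>simp_all add: Hom_iff\<close>)
  then show ?thesis using iso_arrI v i(3) by blast
qed

lemma is_coproduct_cong:
  assumes "is_coproduct C I X P \<iota>" "\<And>i. i \<in> I \<Longrightarrow> X i = X' i" "\<And>i. i \<in> I \<Longrightarrow> \<iota> i = \<iota>' i"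
  shows "is_coproduct C I X' P \<iota>'"
  using assms unfolding is_coproduct_def by simp

lemma is_coproduct_reindex:
  assumes c: "is_coproduct C I X P \<iota>" and e: "bij_betw e J I"
  shows "is_coproduct C J (\<lambda>j. X (e j)) P (\<lambda>j. \<iota> (e j))"
proof -
  note i = is_coproduct_arr[OF c]
  have eI: "\<And>j. j \<in> J \<Longrightarrow> e j \<in> I" and inj: "inj_on e J" and im: "e ` J = I"
    using e by (auto simp: bij_betw_def)
  show ?thesis
  proof (rule is_coproductI)
    fix Y and f assume Y: "Y \<in> Obj C" and f: "\<And>j. j \<in> J \<Longrightarrow> f j \<in> Hom C (X (e j)) Y"
    let ?f = "\<lambda>k. f (the_inv_into J e k)"
    have fe: "?f (e j) = f j" if "j \<in> J" for j using the_inv_into_f_f[OF inj that] by simp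
    have "?f k \<in> Hom C (X k) Y" if "k \<in> I" for k using im that f fe by force
    then obtain h where h: "h \<in> Hom C P Y" "\<And>k. k \<in> I \<Longrightarrow> h \<cdot> \<iota> k = ?f k"
      using copr_map[OF c Y, of ?f] by blast
    then have "\<forall>j \<in> J. h \<cdot> \<iota> (e j) = f j" using fe eI by simp
    then show "\<exists>h \<in> Hom C P Y. \<forall>j \<in> J. h \<cdot> \<iota> (e j) = f j" using h(1) by blast
  next
    fix Y h h' assume h: "h \<in> Hom C P Y" "h' \<in> Hom C P Y"
      and eq: "\<And>j. j \<in> J \<Longrightarrow> h \<cdot> \<iota> (e j) = h' \<cdot> \<iota> (e j)"
    show "h = h'" by (rule copr_eq[OF c h]) (use eq im in blast)
  qed (use i eI in simp_all)
qed

end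

context additive_category
begin

lemma copr_zero:
  assumes "is_coproduct C I X P \<iota>" "h \<in> Hom C P Y" "\<And>i. i \<in> I \<Longrightarrow> h \<cdot> \<iota> i = Zero C (X i) Y"
  shows "h = Zero C P Y"
  by (rule copr_eq[OF assms(1,2)])
    (use assms(3) is_coproduct_arr[OF assms(1)] Obj_Hom[OF assms(2)] in \<open>simp_all add: Hom_iff\<close>)

lemma hom_zero_coproduct:
  assumes c: "is_coproduct C I X P \<iota>" and "\<And>i. i \<in> I \<Longrightarrow> hom_zero C (X i) Y" "Y \<in> Obj C"
  shows "hom_zero C P Y"
proof (rule hom_zeroI)
  fix h assume h: "h \<in> Hom C P Y"
  show "h = Zero C P Y" 
    by (rule copr_zero[OF c h]) (use hom_zeroD[OF assms(2)] Cmp_Hom[OF is_coproduct_arr(3)[OF c] h] in blast)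
qed (use assms is_coproduct_arr(1)[OF c] in blast)+

definition prj where
  "prj I X P \<iota> j = (SOME p. p \<in> Hom C P (X j) \<and>
     (\<forall>i \<in> I. p \<cdot> \<iota> i = (if i = j then Idn C (X j) else Zero C (X i) (X j))))"

text \<open>The idempotent of the coproduct \<open>P\<close> that keeps the summands indexed by
  \<open>J\<close> and kills the others. That \<open>f\<close> lies in these summands is the
  equation \<open>cut I X P \<iota> J \<cdot> f = f\<close>.\<close>

definition cut where
  "cut I X P \<iota> J = (SOME p. p \<in> Hom C P P \<and>
     (\<forall>i \<in> I. p \<cdot> \<iota> i = (if i \<in> J then \<iota> i else Zero C (X i) P)))"

lemma prj:
  assumes c: "is_coproduct C I X P \<iota>" and j: "j \<in> I"
  shows "prj I X P \<iota> j \<in> Hom C P (X j)"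
    "\<And>i. i \<in> I \<Longrightarrow> prj I X P \<iota> j \<cdot> \<iota> i = (if i = j then Idn C (X j) else Zero C (X i) (X j))"
proof -
  note i = is_coproduct_arr[OF c]
  have X: "X j \<in> Obj C" using i(2) j .
  have "(if i = j then Idn C (X j) else Zero C (X i) (X j)) \<in> Hom C (X i) (X j)" if "i \<in> I" for i
    using i(2)[OF that] X by (simp add: Hom_iff)
  then obtain p where "p \<in> Hom C P (X j)" 
    "\<And>i. i \<in> I \<Longrightarrow> p \<cdot> \<iota> i = (if i = j then Idn C (X j) else Zero C (X i) (X j))"
    using copr_map[OF c X, of "\<lambda>i. if i = j then Idn C (X j) else Zero C (X i) (X j)"] by blast
  then have "\<exists>p. p \<in> Hom C P (X j) \<and>
     (\<forall>i \<in> I. p \<cdot> \<iota> i = (if i = j then Idn C (X j) else Zero C (X i) (X j)))" by blast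
  from someI_ex[OF this] show "prj I X P \<iota> j \<in> Hom C P (X j)"
    "\<And>i. i \<in> I \<Longrightarrow> prj I X P \<iota> j \<cdot> \<iota> i = (if i = j then Idn C (X j) else Zero C (X i) (X j))"
    unfolding prj_def by blast+
qed

lemma cut:
  assumes c: "is_coproduct C I X P \<iota>"
  shows "cut I X P \<iota> J \<in> Hom C P P"
    "\<And>i. i \<in> I \<Longrightarrow> cut I X P \<iota> J \<cdot> \<iota> i = (if i \<in> J then \<iota> i else Zero C (X i) P)"
proof -
  note i = is_coproduct_arr[OF c]
  have "(if i \<in> J then \<iota> i else Zero C (X i) P) \<in> Hom C (X i) P" if "i \<in> I" for i
    using i(1) i(2-6)[OF that] by (simp add: Hom_iff)
  then obtain p where "p \<in> Hom C P P" 
    "\<And>i. i \<in> I \<Longrightarrow> p \<cdot> \<iota> i = (if i \<in> J then \<iota> i else Zero C (X i) P)"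
    using copr_map[OF c i(1), of "\<lambda>i. if i \<in> J then \<iota> i else Zero C (X i) P"] by blast
  then have "\<exists>p. p \<in> Hom C P P \<and>
     (\<forall>i \<in> I. p \<cdot> \<iota> i = (if i \<in> J then \<iota> i else Zero C (X i) P))" by blast
  from someI_ex[OF this] show "cut I X P \<iota> J \<in> Hom C P P"
    "\<And>i. i \<in> I \<Longrightarrow> cut I X P \<iota> J \<cdot> \<iota> i = (if i \<in> J then \<iota> i else Zero C (X i) P)"
    unfolding cut_def by blast+
qed

lemma cut_unique:
  assumes c: "is_coproduct C I X P \<iota>" and p: "p \<in> Hom C P P"
    "\<And>i. i \<in> I \<Longrightarrow> p \<cdot> \<iota> i = (if i \<in> J then \<iota> i else Zero C (X i) P)"
  shows "cut I X P \<iota> J = p"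
  by (rule copr_eq[OF c cut(1)[OF c] p(1)]) (simp add: cut(2)[OF c] p(2))

lemma cut_empty: assumes c: "is_coproduct C I X P \<iota>" shows "cut I X P \<iota> {} = Zero C P P"
  by (rule cut_unique[OF c]) (use is_coproduct_arr[OF c] in \<open>simp_all add: Hom_iff\<close>)

lemma cut_cut:
  assumes c: "is_coproduct C I X P \<iota>" and M: "M \<subseteq> J"
  shows "cut I X P \<iota> J \<cdot> cut I X P \<iota> M = cut I X P \<iota> M"
proof (rule copr_eq[OF c Cmp_Hom[OF cut(1)[OF c] cut(1)[OF c]] cut(1)[OF c]])
  note i = is_coproduct_arr[OF c]
  fix j assume j: "j \<in> I"
  have "(cut I X P \<iota> J \<cdot> cut I X P \<iota> M) \<cdot> \<iota> j = cut I X P \<iota> J \<cdot> (cut I X P \<iota> M \<cdot> \<iota> j)"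
    using cut(1)[OF c, where J = J] cut(1)[OF c, where J = M] i(4-6)[OF j] by (simp add: Hom_iff)
  also have "\<dots> = cut I X P \<iota> M \<cdot> \<iota> j"
    unfolding cut(2)[OF c j] using cut(2)[OF c j] cut(1)[OF c, where J = J] M i(1) i(2)[OF j]
    by (auto simp: Hom_def)
  finally show "(cut I X P \<iota> J \<cdot> cut I X P \<iota> M) \<cdot> \<iota> j = cut I X P \<iota> M \<cdot> \<iota> j" .
qed

lemma cut_insert:
  assumes c: "is_coproduct C I X P \<iota>" and j: "j \<in> I" "j \<notin> J"
  shows "cut I X P \<iota> (insert j J) = Plus C (\<iota> j \<cdot> prj I X P \<iota> j) (cut I X P \<iota> J)"
proof (rule cut_unique[OF c])
  note i = is_coproduct_arr[OF c] and p = prj[OF c j(1)] and q = cut[OF c, where J = J]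
  show "Plus C (\<iota> j \<cdot> prj I X P \<iota> j) (cut I X P \<iota> J) \<in> Hom C P P"
    using i(1) i(2-6)[OF j(1)] p(1) q(1) by (simp add: Hom_iff)
  fix k assume k: "k \<in> I"
  have "Plus C (\<iota> j \<cdot> prj I X P \<iota> j) (cut I X P \<iota> J) \<cdot> \<iota> k =
    Plus C (\<iota> j \<cdot> (prj I X P \<iota> j \<cdot> \<iota> k)) (cut I X P \<iota> J \<cdot> \<iota> k)"
    using i(1) i(2-6)[OF j(1)] i(2-6)[OF k] p(1) q(1) by (simp add: Hom_iff)
  also have "\<dots> = (if k \<in> insert j J then \<iota> k else Zero C (X k) P)"
    unfolding p(2)[OF k] q(2)[OF k] using i(1) i(2-6)[OF j(1)] i(2-6)[OF k] j by (auto simp: Hom_def)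
  finally show "Plus C (\<iota> j \<cdot> prj I X P \<iota> j) (cut I X P \<iota> J) \<cdot> \<iota> k =
    (if k \<in> insert j J then \<iota> k else Zero C (X k) P)" .
qed

text \<open>Takes the place of writing a morphism as the finite sum of its components: a property is
  checked on zero, on sums and on single summands.\<close>

lemma cut_induct:
  assumes c: "is_coproduct C I X P \<iota>" and f: "f \<in> Hom C K P" and J: "finite J" "J \<subseteq> I"
    and Q0: "Q (Zero C K P)" 
    and Qp: "\<And>a b. a \<in> Hom C K P \<Longrightarrow> b \<in> Hom C K P \<Longrightarrow> Q a \<Longrightarrow> Q b \<Longrightarrow> Q (Plus C a b)"
    and Qi: "\<And>j g. j \<in> I \<Longrightarrow> g \<in> Hom C K (X j) \<Longrightarrow> Q (\<iota> j \<cdot> g)"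
  shows "Q (cut I X P \<iota> J \<cdot> f)"
  using J
proof (induction J)
  case empty
  have K: "K \<in> Obj C" using f Obj_Hom by blast
  show ?case unfolding cut_empty[OF c] using f Q0 is_coproduct_arr(1)[OF c] by (simp add: Hom_iff)
next
  case (insert j J)
  have j: "j \<in> I" "j \<notin> J" and IH: "Q (cut I X P \<iota> J \<cdot> f)" using insert by simp_all
  note i = is_coproduct_arr[OF c] and p = prj[OF c j(1)] and q = cut[OF c, where J = J]
  have h: "\<iota> j \<cdot> (prj I X P \<iota> j \<cdot> f) \<in> Hom C K P" "cut I X P \<iota> J \<cdot> f \<in> Hom C K P"
    "prj I X P \<iota> j \<cdot> f \<in> Hom C K (X j)"
    using i(3)[OF j(1)] p(1) q(1) f Cmp_Hom by blast+
  have "cut I X P \<iota> (insert j J) \<cdot> f = Plus C (\<iota> j \<cdot> (prj I X P \<iota> j \<cdot> f)) (cut I X P \<iota> J \<cdot> f)"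
    unfolding cut_insert[OF c j] using i(1) i(2-6)[OF j(1)] p(1) q(1) f by (simp add: Hom_iff)
  then show ?case using Qp[OF h(1,2) Qi[OF j(1) h(3)] IH] by simp
qed

lemma cut_reindex:
  assumes c: "is_coproduct C I X P \<iota>" and e: "bij_betw e J I" and M: "M \<subseteq> J"
  shows "cut J (\<lambda>j. X (e j)) P (\<lambda>j. \<iota> (e j)) M = cut I X P \<iota> (e ` M)"
proof (rule cut_unique[OF is_coproduct_reindex[OF c e]])
  have inj: "inj_on e J" and im: "e ` J = I" using e by (auto simp: bij_betw_def)
  show "cut I X P \<iota> (e ` M) \<in> Hom C P P" using cut(1)[OF c] .
  fix j assume j: "j \<in> J"
  then have "e j \<in> e ` M \<longleftrightarrow> j \<in> M" using inj M by (meson inj_on_image_mem_iff)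
  then show "cut I X P \<iota> (e ` M) \<cdot> \<iota> (e j) = (if j \<in> M then \<iota> (e j) else Zero C (X (e j)) P)"
    using cut(2)[OF c, of "e j" "e ` M"] im j by (metis imageI)
qed


subsection \<open>Compact objects\<close>

text \<open>Equivalent to compactness (\<open>compact_iff\<close> below), but free of finite sums of morphisms.\<close>

definition cpt :: "'u rel \<Rightarrow> 'o \<Rightarrow> bool" where
  "cpt r K \<longleftrightarrow> K \<in> Obj C \<and> (\<forall>(I :: 'u set) X P \<iota>. small r I \<and> is_coproduct C I X P \<iota> \<longrightarrow>
     (\<forall>f \<in> Hom C K P. \<exists>J \<subseteq> I. finite J \<and> cut I X P \<iota> J \<cdot> f = f))"

lemma cpt_Obj: "cpt r K \<Longrightarrow> K \<in> Obj C"
  by (simp add: cpt_def)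

lemma cptI:
  assumes "K \<in> Obj C" "\<And>(I :: 'u set) X P \<iota> f. small r I \<Longrightarrow> is_coproduct C I X P \<iota> \<Longrightarrow> f \<in> Hom C K P \<Longrightarrow>
    \<exists>J \<subseteq> I. finite J \<and> cut I X P \<iota> J \<cdot> f = f"
  shows "cpt (r :: 'u rel) K"
  using assms unfolding cpt_def by simp

lemma cptD:
  assumes "cpt (r :: 'u rel) K" "small r (I :: 'u set)" "is_coproduct C I X P \<iota>" "f \<in> Hom C K P"
  obtains J where "J \<subseteq> I" "finite J" "cut I X P \<iota> J \<cdot> f = f"
proof -
  have "\<forall>f \<in> Hom C K P. \<exists>J \<subseteq> I. finite J \<and> cut I X P \<iota> J \<cdot> f = f"
    using assms(1-3) unfolding cpt_def by simp
  then show ?thesis using assms(4) that by blast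
qed

lemma cpt_cut:
  fixes r :: "'u rel" and I :: "'i set"
  assumes r: "size_cardinal r" and K: "cpt r K" and I: "small r I" 
    and c: "is_coproduct C I X P \<iota>" and f: "f \<in> Hom C K P"
  obtains J where "J \<subseteq> I" "finite J" "cut I X P \<iota> J \<cdot> f = f"
proof -
  obtain e :: "'i \<Rightarrow> 'u" where e: "inj_on e I" by (rule small_inj[OF r I])
  define d where "d = the_inv_into I e"
  have d: "bij_betw d (e ` I) I" unfolding d_def using e by (simp add: bij_betw_the_inv_into inj_on_imp_bij_betw)
  have "small r (e ` I)" using small_image[OF r I] .
  then obtain J where J: "J \<subseteq> e ` I" "finite J" 
    "cut (e ` I) (\<lambda>j. X (d j)) P (\<lambda>j. \<iota> (d j)) J \<cdot> f = f"
    using cptD[OF K _ is_coproduct_reindex[OF c d] f] by blast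
  have "d ` J \<subseteq> I" using J(1) d by (auto simp: bij_betw_def)
  then show ?thesis using that[of "d ` J"] J cut_reindex[OF c d J(1)] by simp
qed

lemma cpt_hom_zero:
  assumes r: "size_cardinal r" and K: "cpt r K" and I: "small r I" and c: "is_coproduct C I X P \<iota>"
    and z: "\<And>i. i \<in> I \<Longrightarrow> hom_zero C K (X i)"
  shows "hom_zero C K P"
proof (rule hom_zeroI)
  note i = is_coproduct_arr[OF c]
  show K': "K \<in> Obj C" "P \<in> Obj C" using K cpt_Obj i(1) by blast+
  fix f assume f: "f \<in> Hom C K P"
  obtain J where J: "J \<subseteq> I" "finite J" "cut I X P \<iota> J \<cdot> f = f" using cpt_cut[OF r K I c f] .
  have "cut I X P \<iota> J \<cdot> f = Zero C K P"
  proof (rule cut_induct[OF c f J(2,1)])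
    fix j g assume j: "j \<in> I" "g \<in> Hom C K (X j)"
    then have "g = Zero C K (X j)" using z hom_zeroD by blast
    then show "\<iota> j \<cdot> g = Zero C K P" using i(1) i(2-6)[OF j(1)] K' by simp
  qed (use K' in simp_all)
  then show "f = Zero C K P" using J by simp
qed

text \<open>Injectivity of the canonical map holds for every \<open>K\<close>, since the projections
  \<open>prj\<close> recover the components; the finiteness condition expresses its
  surjectivity.\<close>

lemma cpt_iff_compact:
  assumes K: "K \<in> Obj C" and c: "is_coproduct C I X P \<iota>"
  shows "(\<lambda>f. gfinprod (hom_group C K P) (\<lambda>i. \<iota> i \<cdot> f i) I)
          \<in> iso (sum_group I (\<lambda>i. hom_group C K (X i))) (hom_group C K P)
    \<longleftrightarrow> (\<forall>f \<in> Hom C K P. \<exists>J \<subseteq> I. finite J \<and> cut I X P \<iota> J \<cdot> f = f)"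
proof -
  note i = is_coproduct_arr[OF c]
  interpret G: comm_group "hom_group C K P" using hom_group_comm K i(1) by blast
  have grp: "comm_group (hom_group C K (X j))" if "j \<in> I" for j using hom_group_comm K i(2) that by blast
  then have grp': "group (hom_group C K (X j))" if "j \<in> I" for j using that by (simp add: comm_group_def)
  have carG: "carrier (hom_group C K Y) = Hom C K Y" "\<one>\<^bsub>hom_group C K Y\<^esub> = Zero C K Y" 
    "mult (hom_group C K Y) = Plus C" for Y
    by (simp_all add: hom_group_def)
  have sumcar: "x \<in> carrier (sum_group I (\<lambda>i. hom_group C K (X i))) \<longleftrightarrow>
     x \<in> (\<Pi>\<^sub>E i\<in>I. Hom C K (X i)) \<and> finite {i \<in> I. x i \<noteq> Zero C K (X i)}" for x
    using grp' by (simp add: carrier_sum_group carG)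
  let ?\<psi> = "\<lambda>f. gfinprod (hom_group C K P) (\<lambda>i. \<iota> i \<cdot> f i) I"
  have in_car: "\<iota> j \<cdot> x \<in> carrier (hom_group C K P)" if "j \<in> I" "x \<in> Hom C K (X j)" for j x
    unfolding carG using i(3)[OF that(1)] that(2) Cmp_Hom by blast
  have fin: "?\<psi> x = finprod (hom_group C K P) (\<lambda>i. \<iota> i \<cdot> x i) J"
    if J: "finite J" "J \<subseteq> I" and x: "\<And>j. j \<in> I \<Longrightarrow> x j \<in> Hom C K (X j)" 
      and z: "\<And>j. j \<in> I - J \<Longrightarrow> x j = Zero C K (X j)" for x J
  proof -
    have "?\<psi> x = gfinprod (hom_group C K P) (\<lambda>i. \<iota> i \<cdot> x i) J"
    proof (rule G.gfinprod_mono_neutral_cong_right)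
      show "\<iota> j \<cdot> x j = \<one>\<^bsub>hom_group C K P\<^esub>" if "j \<in> I - J" for j
        unfolding carG using z[OF that] i(1) i(2-6)[of j] that K by simp
    qed (use J x in_car in auto)
    also have "\<dots> = finprod (hom_group C K P) (\<lambda>i. \<iota> i \<cdot> x i) J"
      by (rule G.gfinprod_eq_finprod) (use J x in_car in auto)
    finally show ?thesis .
  qed
  have finhom: "finprod (hom_group C K P) (\<lambda>i. \<iota> i \<cdot> x i) J \<in> Hom C K P"
    if J: "J \<subseteq> I" and x: "\<And>j. j \<in> I \<Longrightarrow> x j \<in> Hom C K (X j)" for x J
    using G.finprod_closed[of "\<lambda>i. \<iota> i \<cdot> x i" J] in_car J x unfolding carG by blast
  have ins: "finprod (hom_group C K P) (\<lambda>i. \<iota> i \<cdot> x i) (insert j J) =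
      Plus C (\<iota> j \<cdot> x j) (finprod (hom_group C K P) (\<lambda>i. \<iota> i \<cdot> x i) J)"
    if J: "finite J" "J \<subseteq> I" and x: "\<And>j. j \<in> I \<Longrightarrow> x j \<in> Hom C K (X j)" and j: "j \<in> I" "j \<notin> J"
    for J x j
  proof -
    have "(\<lambda>i. \<iota> i \<cdot> x i) \<in> J \<rightarrow> carrier (hom_group C K P)"
      "\<iota> j \<cdot> x j \<in> carrier (hom_group C K P)" using in_car x J(2) j(1) by blast+
    then show ?thesis using G.finprod_insert[OF J(1) j(2)] by (simp add: carG)
  qed
  have comp: "g \<cdot> finprod (hom_group C K P) (\<lambda>i. \<iota> i \<cdot> x i) (insert j J) =
     Plus C (g \<cdot> (\<iota> j \<cdot> x j)) (g \<cdot> finprod (hom_group C K P) (\<lambda>i. \<iota> i \<cdot> x i) J)"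
    if J: "finite J" "J \<subseteq> I" and x: "\<And>j. j \<in> I \<Longrightarrow> x j \<in> Hom C K (X j)" and j: "j \<in> I" "j \<notin> J"
      and g: "g \<in> Hom C P Y" for J x j g Y
  proof -
    show ?thesis using ins[OF J x j] finhom[OF J(2) x] in_car[OF j(1) x[OF j(1)]] g
      by (simp add: Hom_iff carG)
  qed
  show ?thesis
  proof
    assume iso: "?\<psi> \<in> iso (sum_group I (\<lambda>i. hom_group C K (X i))) (hom_group C K P)"
    show "\<forall>f \<in> Hom C K P. \<exists>J \<subseteq> I. finite J \<and> cut I X P \<iota> J \<cdot> f = f"
    proof
      fix f assume f: "f \<in> Hom C K P"
      then have "f \<in> ?\<psi> ` carrier (sum_group I (\<lambda>i. hom_group C K (X i)))"
        using iso by (simp add: iso_def bij_betw_def carG)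
      then obtain x where x: "x \<in> carrier (sum_group I (\<lambda>i. hom_group C K (X i)))" "f = ?\<psi> x" by blast
      let ?J = "{i \<in> I. x i \<noteq> Zero C K (X i)}"
      have xh: "x j \<in> Hom C K (X j)" if "j \<in> I" for j using x(1) that unfolding sumcar by blast
      have J: "finite ?J" "?J \<subseteq> I" using x(1) unfolding sumcar by auto
      have ff: "f = finprod (hom_group C K P) (\<lambda>i. \<iota> i \<cdot> x i) ?J" 
        unfolding x(2) by (rule fin[OF J xh]) auto
      have "cut I X P \<iota> ?J \<cdot> finprod (hom_group C K P) (\<lambda>i. \<iota> i \<cdot> x i) M = 
        finprod (hom_group C K P) (\<lambda>i. \<iota> i \<cdot> x i) M" if "finite M" "M \<subseteq> ?J" for M
        using that
      proof (induction M)
        case empty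
        have "finprod (hom_group C K P) (\<lambda>i. \<iota> i \<cdot> x i) {} = Zero C K P" by (simp add: carG)
        then show ?case using cut(1)[OF c, where J = ?J] K by (simp add: Hom_iff)
      next
        case (insert j M)
        have j: "j \<in> I" "j \<in> ?J" "j \<notin> M" and M: "finite M" "M \<subseteq> I" using insert by auto
        have e: "finprod (hom_group C K P) (\<lambda>i. \<iota> i \<cdot> x i) (insert j M) =
          Plus C (\<iota> j \<cdot> x j) (finprod (hom_group C K P) (\<lambda>i. \<iota> i \<cdot> x i) M)"
          using ins[OF M xh j(1,3)] .
        have "cut I X P \<iota> ?J \<cdot> (\<iota> j \<cdot> x j) = \<iota> j \<cdot> x j"
          using reassoc[OF cut(2)[OF c j(1)] cut(1)[OF c] i(3)[OF j(1)] xh[OF j(1)], of ?J] j(2) by simp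
        moreover have "cut I X P \<iota> ?J \<cdot> finprod (hom_group C K P) (\<lambda>i. \<iota> i \<cdot> x i) M =
          finprod (hom_group C K P) (\<lambda>i. \<iota> i \<cdot> x i) M" using insert by auto
        ultimately show ?case using comp[OF M xh j(1,3) cut(1)[OF c, where J = ?J]] e by simp
      qed
      from this[OF J(1) subset_refl] have "cut I X P \<iota> ?J \<cdot> f = f" unfolding ff[symmetric] .
      then show "\<exists>J \<subseteq> I. finite J \<and> cut I X P \<iota> J \<cdot> f = f" using J by blast
    qed
  next
    assume ex: "\<forall>f \<in> Hom C K P. \<exists>J \<subseteq> I. finite J \<and> cut I X P \<iota> J \<cdot> f = f"
    have hom: "?\<psi> \<in> hom (sum_group I (\<lambda>i. hom_group C K (X i))) (hom_group C K P)"
    proof (rule G.hom_group_sum)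
      fix j assume j: "j \<in> I"
      show "group (hom_group C K (X j))" using grp' j .
      show "(\<lambda>x. \<iota> j \<cdot> x) \<in> hom (hom_group C K (X j)) (hom_group C K P)"
      proof (rule homI)
        fix x y assume "x \<in> carrier (hom_group C K (X j))" "y \<in> carrier (hom_group C K (X j))"
        then show "\<iota> j \<cdot> (x \<otimes>\<^bsub>hom_group C K (X j)\<^esub> y) = \<iota> j \<cdot> x \<otimes>\<^bsub>hom_group C K P\<^esub> \<iota> j \<cdot> y"
          unfolding carG using i(1) i(2-6)[OF j] by (simp add: Hom_iff)
      qed (use in_car[OF j] carG in simp)
    qed
    have inj: "inj_on ?\<psi> (carrier (sum_group I (\<lambda>i. hom_group C K (X i))))"
    proof (rule inj_onI)
      fix x y assume x: "x \<in> carrier (sum_group I (\<lambda>i. hom_group C K (X i)))"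
        and y: "y \<in> carrier (sum_group I (\<lambda>i. hom_group C K (X i)))" and xy: "?\<psi> x = ?\<psi> y"
      have prjfin: "prj I X P \<iota> j \<cdot> finprod (hom_group C K P) (\<lambda>i. \<iota> i \<cdot> x i) J = (if j \<in> J then x j else Zero C K (X j))"
        if "finite J" "J \<subseteq> I" and j: "j \<in> I" and xh: "\<And>j. j \<in> I \<Longrightarrow> x j \<in> Hom C K (X j)" for j J x
        using that(1,2)
      proof (induction J)
        case empty
        have "finprod (hom_group C K P) (\<lambda>i. \<iota> i \<cdot> x i) {} = Zero C K P" by (simp add: carG)
        then show ?case using prj(1)[OF c j] K by (simp add: Hom_iff)
      next
        case (insert k M)
        have k: "k \<in> I" "k \<notin> M" and M: "finite M" "M \<subseteq> I" using insert by auto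
        note p = prj(1)[OF c j]
        have e: "prj I X P \<iota> j \<cdot> (\<iota> k \<cdot> x k) = (if k = j then x j else Zero C K (X j))"
          using reassoc[OF prj(2)[OF c j k(1)] p i(3)[OF k(1)] xh[OF k(1)]] xh[OF k(1)] xh[OF j]
            i(2)[OF j] i(2)[OF k(1)] K by (auto simp: Hom_def)
        have "prj I X P \<iota> j \<cdot> finprod (hom_group C K P) (\<lambda>i. \<iota> i \<cdot> x i) (insert k M) =
          Plus C (if k = j then x j else Zero C K (X j)) (if j \<in> M then x j else Zero C K (X j))"
          using comp[OF M xh k p] e insert.IH M by simp
        also have "\<dots> = (if j \<in> insert k M then x j else Zero C K (X j))"
          using k xh[OF j] K i(2)[OF j] by (auto simp: Hom_def)
        finally show ?case .
      qed
      have prj\<psi>: "prj I X P \<iota> j \<cdot> ?\<psi> x = x j"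
        if x: "x \<in> carrier (sum_group I (\<lambda>i. hom_group C K (X i)))" and j: "j \<in> I" for x j
      proof -
        let ?J = "{i \<in> I. x i \<noteq> Zero C K (X i)}"
        have xh: "x j \<in> Hom C K (X j)" if "j \<in> I" for j using x(1) that unfolding sumcar by blast
        have J: "finite ?J" "?J \<subseteq> I" using x(1) unfolding sumcar by auto
        have ff: "?\<psi> x = finprod (hom_group C K P) (\<lambda>i. \<iota> i \<cdot> x i) ?J" 
          by (rule fin[OF J xh]) auto
        have "prj I X P \<iota> j \<cdot> ?\<psi> x = (if j \<in> ?J then x j else Zero C K (X j))"
          unfolding ff by (rule prjfin[OF J j xh])
        then show ?thesis using j by simp
      qed
      have "x j = y j" if "j \<in> I" for j using prj\<psi>[OF x that] prj\<psi>[OF y that] xy by simp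
      then show "x = y" using x y unfolding sumcar by (auto intro: PiE_ext)
    qed
    have "f \<in> ?\<psi> ` carrier (sum_group I (\<lambda>i. hom_group C K (X i)))" if f: "f \<in> Hom C K P" for f
    proof -
      obtain J where J: "J \<subseteq> I" "finite J" "cut I X P \<iota> J \<cdot> f = f" using ex f by blast
      \<comment> \<open>The components of \<open>f\<close> on \<open>J\<close>. Outside
        \<open>I\<close> the value is \<open>undefined\<close> because the direct sum consists of
        extensional functions.\<close>
      define x where "x j = (if j \<in> I then if j \<in> J then prj I X P \<iota> j \<cdot> f else Zero C K (X j) else undefined)" for j
      have xh: "x j \<in> Hom C K (X j)" if "j \<in> I" for j
        using that prj(1)[OF c that] f i(2)[OF that] K by (simp add: x_def Hom_iff)
      have "{i \<in> I. x i \<noteq> Zero C K (X i)} \<subseteq> J" by (auto simp: x_def)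
      then have "finite {i \<in> I. x i \<noteq> Zero C K (X i)}" using J(2) finite_subset by blast
      then have xs: "x \<in> carrier (sum_group I (\<lambda>i. hom_group C K (X i)))"
        unfolding sumcar using xh by (auto simp: x_def)
      have "?\<psi> x = finprod (hom_group C K P) (\<lambda>i. \<iota> i \<cdot> x i) J"
        by (rule fin[OF J(2,1) xh]) (auto simp: x_def)
      also have "finprod (hom_group C K P) (\<lambda>i. \<iota> i \<cdot> x i) M = cut I X P \<iota> M \<cdot> f" if "finite M" "M \<subseteq> J" for M
        using that
      proof (induction M)
        case empty
        have "finprod (hom_group C K P) (\<lambda>i. \<iota> i \<cdot> x i) {} = Zero C K P" by (simp add: carG)
        then show ?case unfolding cut_empty[OF c] using f i(1) by (simp add: Hom_iff)
      next
        case (insert j M)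
        have j: "j \<in> I" "j \<in> J" "j \<notin> M" and M: "finite M" "M \<subseteq> I" using insert J by auto
        have e: "finprod (hom_group C K P) (\<lambda>i. \<iota> i \<cdot> x i) (insert j M) =
          Plus C (\<iota> j \<cdot> x j) (finprod (hom_group C K P) (\<lambda>i. \<iota> i \<cdot> x i) M)"
          using ins[OF M xh j(1,3)] .
        have "x j = prj I X P \<iota> j \<cdot> f" using j by (simp add: x_def)
        then show ?case unfolding e cut_insert[OF c j(1,3)] 
          using insert i(1) i(2-6)[OF j(1)] prj(1)[OF c j(1)] cut(1)[OF c, where J = M] f by (simp add: Hom_iff)
      qed
      then have "finprod (hom_group C K P) (\<lambda>i. \<iota> i \<cdot> x i) J = f" using J by simp
      finally show ?thesis using xs by blast
    qed
    moreover have "?\<psi> ` carrier (sum_group I (\<lambda>i. hom_group C K (X i))) \<subseteq> Hom C K P"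
      using hom by (auto simp: hom_def carG)
    ultimately show "?\<psi> \<in> iso (sum_group I (\<lambda>i. hom_group C K (X i))) (hom_group C K P)"
      using hom inj by (auto simp: iso_def bij_betw_def carG)
  qed
qed

end

context triangulated_category
begin

lemma compact_iff: "compact_object r C K \<longleftrightarrow> cpt r K"
proof (cases "K \<in> Obj C")
  case True
  show ?thesis unfolding compact_object_def cpt_def
    by (simp add: True cpt_iff_compact[OF True] cong: conj_cong imp_cong)
qed (simp add: compact_object_def cpt_def)

section \<open>Coproducts, suspension and triangles\<close>

lemma is_coproduct_S:
  assumes c: "is_coproduct C I X P \<iota>"
  shows "is_coproduct C I (\<lambda>i. S (X i)) (S P) (\<lambda>i. Sa (\<iota> i))"
proof -
  note i = is_coproduct_arr[OF c]
  show ?thesis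
  proof (rule is_coproductI)
    show "S P \<in> Obj C" using i(1) by simp
    show "S (X j) \<in> Obj C" "Sa (\<iota> j) \<in> Hom C (S (X j)) (S P)" if "j \<in> I" for j
      using i(2,3)[OF that] Susp.F_Hom by simp_all
    fix Y and f assume Y: "Y \<in> Obj C" and f: "\<And>j. j \<in> I \<Longrightarrow> f j \<in> Hom C (S (X j)) Y"
    obtain Z where Z: "Z \<in> Obj C" "S Z = Y" using S_surj Y by blast
    have "\<exists>g. g \<in> Hom C (X j) Z \<and> Sa g = f j" if j: "j \<in> I" for j
    proof -
      have "f j \<in> Hom C (S (X j)) (S Z)" using f[OF j] Z by simp
      then show ?thesis using Sa_surj i(2)[OF j] Z(1) by metis
    qed
    then obtain g where g: "\<And>j. j \<in> I \<Longrightarrow> g j \<in> Hom C (X j) Z" "\<And>j. j \<in> I \<Longrightarrow> Sa (g j) = f j" by metis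
    obtain h where h: "h \<in> Hom C P Z" "\<And>j. j \<in> I \<Longrightarrow> h \<cdot> \<iota> j = g j" using copr_map[OF c Z(1) g(1)] by blast
    have "Sa h \<in> Hom C (S P) Y" using Susp.F_Hom[OF h(1)] Z(2) by simp
    moreover have "Sa h \<cdot> Sa (\<iota> j) = f j" if j: "j \<in> I" for j
    proof -
      have "Sa h \<cdot> Sa (\<iota> j) = Sa (h \<cdot> \<iota> j)" using h(1) i(3)[OF j] by (simp add: Hom_iff)
      then show ?thesis using h(2)[OF j] g(2)[OF j] by simp
    qed
    ultimately show "\<exists>h \<in> Hom C (S P) Y. \<forall>j \<in> I. h \<cdot> Sa (\<iota> j) = f j" by blast
  next
    fix Y h h' assume h: "h \<in> Hom C (S P) Y" "h' \<in> Hom C (S P) Y"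
      and eq: "\<And>j. j \<in> I \<Longrightarrow> h \<cdot> Sa (\<iota> j) = h' \<cdot> Sa (\<iota> j)"
    obtain Z where Z: "Z \<in> Obj C" "S Z = Y" using S_surj Obj_Hom[OF h(1)] by blast
    obtain k where k: "k \<in> Hom C P Z" "Sa k = h" using Sa_surj h(1) Z i(1) by metis
    obtain k' where k': "k' \<in> Hom C P Z" "Sa k' = h'" using Sa_surj h(2) Z i(1) by metis
    have "k = k'"
    proof (rule copr_eq[OF c k(1) k'(1)])
      fix j assume j: "j \<in> I"
      have "Sa (k \<cdot> \<iota> j) = Sa k \<cdot> Sa (\<iota> j)" "Sa (k' \<cdot> \<iota> j) = Sa k' \<cdot> Sa (\<iota> j)"
        using k(1) k'(1) i(3)[OF j] by (simp_all add: Hom_iff)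
      then have "Sa (k \<cdot> \<iota> j) = Sa (k' \<cdot> \<iota> j)" using eq[OF j] k(2) k'(2) by simp
      moreover have "k \<cdot> \<iota> j \<in> Arr C" "k' \<cdot> \<iota> j \<in> Arr C"
        using k(1) k'(1) i(3)[OF j] by (simp_all add: Hom_iff)
      ultimately show "k \<cdot> \<iota> j = k' \<cdot> \<iota> j" using Sa_inj by blast
    qed
    then show "h = h'" using k k' by simp
  qed
qed

lemma is_coproduct_S_D:
  assumes c: "is_coproduct C I (\<lambda>i. S (X i)) (S P) \<iota>" and "\<And>i. i \<in> I \<Longrightarrow> X i \<in> Obj C" "P \<in> Obj C"
  obtains \<kappa> where "is_coproduct C I X P \<kappa>" "\<And>i. i \<in> I \<Longrightarrow> Sa (\<kappa> i) = \<iota> i"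
proof -
  note i = is_coproduct_arr[OF c]
  have "\<exists>k. k \<in> Hom C (X j) P \<and> Sa k = \<iota> j" if "j \<in> I" for j using Sa_surj i(3) assms that by metis
  then obtain \<kappa> where k: "\<And>j. j \<in> I \<Longrightarrow> \<kappa> j \<in> Hom C (X j) P" "\<And>j. j \<in> I \<Longrightarrow> Sa (\<kappa> j) = \<iota> j" by metis
  have "is_coproduct C I X P \<kappa>"
  proof (rule is_coproductI)
    fix Y and f assume Y: "Y \<in> Obj C" and f: "\<And>j. j \<in> I \<Longrightarrow> f j \<in> Hom C (X j) Y"
    have SY: "S Y \<in> Obj C" using Y by simp
    obtain h where h: "h \<in> Hom C (S P) (S Y)" "\<And>j. j \<in> I \<Longrightarrow> h \<cdot> \<iota> j = Sa (f j)"
      using copr_map[OF c SY, of "\<lambda>j. Sa (f j)"] Susp.F_Hom[OF f] by blast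
    obtain g where g: "g \<in> Hom C P Y" "Sa g = h" using Sa_surj h(1) assms(3) Y by metis
    have "g \<cdot> \<kappa> j = f j" if j: "j \<in> I" for j
    proof (rule Sa_inj)
      have "Sa (g \<cdot> \<kappa> j) = Sa g \<cdot> Sa (\<kappa> j)" using g(1) k(1)[OF j] by (simp add: Hom_iff)
      then show "Sa (g \<cdot> \<kappa> j) = Sa (f j)" using g(2) k(2)[OF j] h(2)[OF j] by simp
    qed (use g(1) k(1)[OF j] f[OF j] in \<open>simp_all add: Hom_iff\<close>)
    then show "\<exists>h \<in> Hom C P Y. \<forall>j \<in> I. h \<cdot> \<kappa> j = f j" using g(1) by blast
  next
    fix Y h h' assume h: "h \<in> Hom C P Y" "h' \<in> Hom C P Y"
      and eq: "\<And>j. j \<in> I \<Longrightarrow> h \<cdot> \<kappa> j = h' \<cdot> \<kappa> j"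
    have "Sa h = Sa h'"
    proof (rule copr_eq[OF c Susp.F_Hom[OF h(1)] Susp.F_Hom[OF h(2)]])
      fix j assume j: "j \<in> I"
      have "Sa (h \<cdot> \<kappa> j) = Sa h \<cdot> Sa (\<kappa> j)" "Sa (h' \<cdot> \<kappa> j) = Sa h' \<cdot> Sa (\<kappa> j)"
        using h k(1)[OF j] by (simp_all add: Hom_iff)
      then show "Sa h \<cdot> \<iota> j = Sa h' \<cdot> \<iota> j" using k(2)[OF j] eq[OF j] by simp
    qed
    then show "h = h'" using h by - (rule Sa_inj, simp_all add: Hom_iff)
  qed (use assms k in simp_all)
  then show ?thesis using that k(2) by blast
qed

lemma is_coproduct_shift:
  assumes "is_coproduct C I X P \<iota>"
  shows "\<exists>\<iota>'. is_coproduct C I (\<lambda>i. shift C n (X i)) (shift C n P) \<iota>'"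
proof -
  note i = is_coproduct_arr[OF assms]
  show ?thesis
  proof (induction n rule: int_induct[where k = 0])
    case base
    then show ?case using assms by auto
  next
    case (step1 k)
    obtain \<iota>' where "is_coproduct C I (\<lambda>i. shift C k (X i)) (shift C k P) \<iota>'" using step1 by blast
    from is_coproduct_S[OF this]
    have "is_coproduct C I (\<lambda>i. S (shift C k (X i))) (S (shift C k P)) (\<lambda>i. Sa (\<iota>' i))" .
    moreover have "isom C (shift C (k + 1) (X j)) (S (shift C k (X j)))" if "j \<in> I" for j
      using shift_Suc i(2)[OF that] isom_refl by simp
    ultimately obtain \<iota>'' where "is_coproduct C I (\<lambda>i. shift C (k + 1) (X i)) (S (shift C k P)) \<iota>''"
      by (rule is_coproduct_transfer_family)
    then show ?case using shift_Suc[OF i(1), of k] by auto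
  next
    case (step2 k)
    obtain \<iota>' where c: "is_coproduct C I (\<lambda>i. shift C k (X i)) (shift C k P) \<iota>'" using step2 by blast
    have "isom C (S (shift C (k - 1) (X j))) (shift C k (X j))" if "j \<in> I" for j
      using shift_Suc[OF i(2)[OF that], of "k - 1"] i(2)[OF that] isom_refl by simp
    from is_coproduct_transfer_family[OF c this]
    obtain \<iota>'' where "is_coproduct C I (\<lambda>i. S (shift C (k - 1) (X i))) (shift C k P) \<iota>''" by blast
    then have "is_coproduct C I (\<lambda>i. S (shift C (k - 1) (X i))) (S (shift C (k - 1) P)) \<iota>''"
      using shift_Suc[OF i(1), of "k - 1"] by simp
    from is_coproduct_S_D[OF this] show ?case using i(1,2) by (metis shift_Obj)
  qed
qed

text \<open>The five lemma for the long exact sequences of Hom(-, V), where those of the given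
  triangles are multiplied over \<open>I\<close>. The chase is done for arbitrary compatible
  \<open>w\<close>, so that maps obtained from TR3 qualify.\<close>

lemma coproduct_cone:
  assumes t: "\<And>i. i \<in> I \<Longrightarrow> tri C (X i) (Y i) (Z i) (f i) (g i) (h i)"
    and cP: "is_coproduct C I X P \<iota>" and cQ: "is_coproduct C I Y Q \<kappa>"
    and T: "tri C P Q R F G H" and F: "\<And>i. i \<in> I \<Longrightarrow> F \<cdot> \<iota> i = \<kappa> i \<cdot> f i"
    and w: "\<And>i. i \<in> I \<Longrightarrow> w i \<in> Hom C (Z i) R" "\<And>i. i \<in> I \<Longrightarrow> w i \<cdot> g i = G \<cdot> \<kappa> i"
      "\<And>i. i \<in> I \<Longrightarrow> Sa (\<iota> i) \<cdot> h i = H \<cdot> w i"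
  shows "is_coproduct C I Z R w"
proof -
  note i = is_coproduct_arr[OF cP] and k = is_coproduct_arr[OF cQ]
  note cSP = is_coproduct_S[OF cP] and cSQ = is_coproduct_S[OF cQ]
  note FD = triD[OF T]
  have R: "R \<in> Obj C" using tri_Obj[OF T] by blast
  have fD: "f j \<in> Hom C (X j) (Y j)" "g j \<in> Hom C (Y j) (Z j)" "h j \<in> Hom C (Z j) (S (X j))" 
    "Z j \<in> Obj C" if "j \<in> I" for j
    using triD(2-4)[OF t[OF that]] tri_Obj[OF t[OF that]] by simp_all
  have uniq: "c = Zero C R V" if c: "c \<in> Hom C R V" and z: "\<And>j. j \<in> I \<Longrightarrow> c \<cdot> w j = Zero C (Z j) V" for c V
  proof -
    have V: "V \<in> Obj C" using c Obj_Hom by blast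
    have "c \<cdot> G = Zero C Q V"
    proof (rule copr_zero[OF cQ Cmp_Hom[OF FD(3) c]])
      fix j assume j: "j \<in> I"
      have "(c \<cdot> G) \<cdot> \<kappa> j = c \<cdot> (w j \<cdot> g j)" using c FD(3) k(3)[OF j] w(2)[OF j] by (simp add: Hom_iff)
      also have "\<dots> = Zero C (Y j) V"
        using reassoc[OF z[OF j] c w(1)[OF j] fD(2)[OF j]] fD[OF j] V by (simp add: Hom_iff)
      finally show "(c \<cdot> G) \<cdot> \<kappa> j = Zero C (Y j) V" .
    qed
    then obtain s where s: "s \<in> Hom C (S P) V" "s \<cdot> H = c" using tri_con2[OF T c] by blast
    \<comment> \<open>On each summand \<open>s\<close> vanishes after \<open>h j\<close>, hence
      extends along \<open>Sa (f j)\<close>. The extensions assemble to a \<open>p\<close> through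
      which \<open>s\<close> factors by \<open>Sa F\<close>, and \<open>Sa F \<cdot> H\<close> is
      zero.\<close>
    have "\<exists>q. q \<in> Hom C (S (Y j)) V \<and> q \<cdot> Sa (f j) = s \<cdot> Sa (\<iota> j)" if j: "j \<in> I" for j
    proof -
      have sh: "s \<cdot> Sa (\<iota> j) \<in> Hom C (S (X j)) V" using s(1) Susp.F_Hom[OF i(3)[OF j]] Cmp_Hom by blast
      have "(s \<cdot> Sa (\<iota> j)) \<cdot> h j = s \<cdot> (H \<cdot> w j)" 
        using s(1) Susp.F_Hom[OF i(3)[OF j]] fD(3)[OF j] w(3)[OF j] by (simp add: Hom_iff)
      also have "\<dots> = Zero C (Z j) V" using reassoc[OF s(2,1) FD(4) w(1)[OF j]] z[OF j] by simp
      finally show ?thesis using tri_con3[OF t[OF j] sh] by blast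
    qed
    then obtain q where q: "\<And>j. j \<in> I \<Longrightarrow> q j \<in> Hom C (S (Y j)) V" 
      "\<And>j. j \<in> I \<Longrightarrow> q j \<cdot> Sa (f j) = s \<cdot> Sa (\<iota> j)" by metis
    obtain p where p: "p \<in> Hom C (S Q) V" "\<And>j. j \<in> I \<Longrightarrow> p \<cdot> Sa (\<kappa> j) = q j"
      using copr_map[OF cSQ V q(1)] by blast
    have "s = p \<cdot> Sa F"
    proof (rule copr_eq[OF cSP s(1) Cmp_Hom[OF Susp.F_Hom[OF FD(2)] p(1)]])
      fix j assume j: "j \<in> I"
      have "(p \<cdot> Sa F) \<cdot> Sa (\<iota> j) = p \<cdot> Sa (F \<cdot> \<iota> j)"
        using p(1) FD(2) i(3)[OF j] by (simp add: Hom_iff)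
      also have "\<dots> = p \<cdot> (Sa (\<kappa> j) \<cdot> Sa (f j))" using F[OF j] k(3)[OF j] fD(1)[OF j] by (simp add: Hom_iff)
      also have "\<dots> = s \<cdot> Sa (\<iota> j)"
        using reassoc[OF p(2)[OF j] p(1) Susp.F_Hom[OF k(3)[OF j]] Susp.F_Hom[OF fD(1)[OF j]]] q(2)[OF j] by simp
      finally show "s \<cdot> Sa (\<iota> j) = (p \<cdot> Sa F) \<cdot> Sa (\<iota> j)" by simp
    qed
    then have "c = p \<cdot> (Sa F \<cdot> H)" using s(2) p(1) FD(2,4) by (simp add: Hom_iff)
    also have "\<dots> = Zero C R V" using tri_comp_zero3[OF T] p(1) R by (simp add: Hom_iff)
    finally show ?thesis .
  qed
  show ?thesis
  proof (rule is_coproductI)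
    fix V d assume V: "V \<in> Obj C" and d: "\<And>j. j \<in> I \<Longrightarrow> d j \<in> Hom C (Z j) V"
    have dg: "d j \<cdot> g j \<in> Hom C (Y j) V" if "j \<in> I" for j using d[OF that] fD(2)[OF that] Cmp_Hom by blast
    obtain y where y: "y \<in> Hom C Q V" "\<And>j. j \<in> I \<Longrightarrow> y \<cdot> \<kappa> j = d j \<cdot> g j"
      using copr_map[OF cQ V dg] by blast
    have "y \<cdot> F = Zero C P V"
    proof (rule copr_zero[OF cP Cmp_Hom[OF FD(2) y(1)]])
      fix j assume j: "j \<in> I"
      have "(y \<cdot> F) \<cdot> \<iota> j = y \<cdot> (\<kappa> j \<cdot> f j)" using y(1) FD(2) i(3)[OF j] F[OF j] by (simp add: Hom_iff)
      also have "\<dots> = (d j \<cdot> g j) \<cdot> f j" using reassoc[OF y(2)[OF j] y(1) k(3)[OF j] fD(1)[OF j]] .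
      also have "\<dots> = Zero C (X j) V" using tri_comp_zero[OF t[OF j]] d[OF j] fD[OF j] i(2)[OF j]
        by (simp add: Hom_iff)
      finally show "(y \<cdot> F) \<cdot> \<iota> j = Zero C (X j) V" .
    qed
    then obtain c where c: "c \<in> Hom C R V" "c \<cdot> G = y" using tri_con1[OF T y(1)] by blast
    \<comment> \<open>So far \<open>c\<close> is correct only on the \<open>Y j\<close>. Its defect
      on \<open>Z j\<close> factors through \<open>S (X j)\<close>; the assembled defects, composed
      with \<open>H\<close>, correct it.\<close>
    have "\<exists>q. q \<in> Hom C (S (X j)) V \<and> q \<cdot> h j = Plus C (d j) (Neg C (c \<cdot> w j))" if j: "j \<in> I" for j
    proof -
      have u: "Plus C (d j) (Neg C (c \<cdot> w j)) \<in> Hom C (Z j) V"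
        using d[OF j] c(1) w(1)[OF j] by (simp add: Hom_iff)
      have "c \<cdot> (w j \<cdot> g j) = d j \<cdot> g j"
        using w(2)[OF j] reassoc[OF c(2,1) FD(3) k(3)[OF j]] y(2)[OF j] by simp
      then have "Plus C (d j) (Neg C (c \<cdot> w j)) \<cdot> g j = Zero C (Y j) V"
        using d[OF j] c(1) w(1)[OF j] fD(2)[OF j] by (simp add: Hom_iff)
      then show ?thesis using tri_con2[OF t[OF j] u] by blast
    qed
    then obtain q where q: "\<And>j. j \<in> I \<Longrightarrow> q j \<in> Hom C (S (X j)) V" 
      "\<And>j. j \<in> I \<Longrightarrow> q j \<cdot> h j = Plus C (d j) (Neg C (c \<cdot> w j))" by metis
    obtain s where s: "s \<in> Hom C (S P) V" "\<And>j. j \<in> I \<Longrightarrow> s \<cdot> Sa (\<iota> j) = q j"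
      using copr_map[OF cSP V q(1)] by blast
    have "Plus C c (s \<cdot> H) \<in> Hom C R V" using c(1) s(1) FD(4) by (simp add: Hom_iff)
    moreover have "Plus C c (s \<cdot> H) \<cdot> w j = d j" if j: "j \<in> I" for j
    proof -
      have "s \<cdot> (H \<cdot> w j) = s \<cdot> (Sa (\<iota> j) \<cdot> h j)" using w(3)[OF j] by simp
      also have "\<dots> = q j \<cdot> h j" using reassoc[OF s(2)[OF j] s(1) Susp.F_Hom[OF i(3)[OF j]] fD(3)[OF j]] .
      finally have "Plus C c (s \<cdot> H) \<cdot> w j = Plus C (c \<cdot> w j) (Plus C (d j) (Neg C (c \<cdot> w j)))"
        using q(2)[OF j] c(1) s(1) FD(4) w(1)[OF j] by (simp add: Hom_iff)
      also have "\<dots> = d j" using c(1) w(1)[OF j] d[OF j]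
        by (simp add: Hom_iff Plus_left_comm[of "c \<cdot> w j" "d j"])
      finally show ?thesis .
    qed
    ultimately show "\<exists>h \<in> Hom C R V. \<forall>j \<in> I. h \<cdot> w j = d j" by blast
  next
    fix V c c' assume c: "c \<in> Hom C R V" "c' \<in> Hom C R V" and eq: "\<And>j. j \<in> I \<Longrightarrow> c \<cdot> w j = c' \<cdot> w j"
    have V: "V \<in> Obj C" using c Obj_Hom by blast
    have "Plus C c (Neg C c') \<in> Hom C R V" using c by (simp add: Hom_iff)
    moreover have "Plus C c (Neg C c') \<cdot> w j = Zero C (Z j) V" if j: "j \<in> I" for j
      using c eq[OF j] w(1)[OF j] by (simp add: Hom_iff)
    ultimately have "Plus C c (Neg C c') = Zero C R V" using uniq by blast
    then show "c = c'" using diff_zero_iff c by blast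
  qed (use R fD(4) w(1) in simp_all)
qed

lemma coproduct_triangle:
  assumes t: "\<And>i. i \<in> I \<Longrightarrow> has_triangle C (X i) (Y i) (Z i)"
    and cP: "is_coproduct C I X P \<iota>" and cQ: "is_coproduct C I Y Q \<kappa>" and cR: "is_coproduct C I Z R \<mu>"
  shows "has_triangle C P Q R"
proof -
  note i = is_coproduct_arr[OF cP] and k = is_coproduct_arr[OF cQ]
  obtain f g h where T: "\<And>i. i \<in> I \<Longrightarrow> tri C (X i) (Y i) (Z i) (f i) (g i) (h i)"
    using t unfolding has_triangle_tri by metis
  have "\<kappa> j \<cdot> f j \<in> Hom C (X j) Q" if "j \<in> I" for j using k(3)[OF that] triD(2)[OF T[OF that]] Cmp_Hom by blast
  then obtain F where F: "F \<in> Hom C P Q" "\<And>j. j \<in> I \<Longrightarrow> F \<cdot> \<iota> j = \<kappa> j \<cdot> f j"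
    using copr_map[OF cP k(1), of "\<lambda>j. \<kappa> j \<cdot> f j"] by blast
  obtain R' G H where T': "tri C P Q R' F G H" using tri_ex[OF F(1)] by blast
  have "\<exists>w. w \<in> Hom C (Z j) R' \<and> w \<cdot> g j = G \<cdot> \<kappa> j \<and> Sa (\<iota> j) \<cdot> h j = H \<cdot> w" if j: "j \<in> I" for j
    using tri_map[OF T[OF j] T' i(3)[OF j] k(3)[OF j] F(2)[OF j, symmetric]] by metis
  then obtain w where w: "\<And>j. j \<in> I \<Longrightarrow> w j \<in> Hom C (Z j) R'" "\<And>j. j \<in> I \<Longrightarrow> w j \<cdot> g j = G \<cdot> \<kappa> j"
    "\<And>j. j \<in> I \<Longrightarrow> Sa (\<iota> j) \<cdot> h j = H \<cdot> w j" by metis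
  have "is_coproduct C I Z R' w" by (rule coproduct_cone[OF T cP cQ T' F(2) w])
  then have "isom C R' R" using is_coproduct_isom cR by blast
  moreover have "has_triangle C P Q R'" using T' unfolding has_triangle_tri by blast
  ultimately show ?thesis using has_triangle_isom isom_refl i(1) k(1) by blast
qed

text \<open>The five lemma is the case of a coproduct with one summand.\<close>

lemma five_iso:
  assumes "tri C X Y Z f g h" "tri C X' Y' Z' f' g' h'" "iso_arr C X X' u" "iso_arr C Y Y' v"
    "w \<in> Hom C Z Z'" "v \<cdot> f = f' \<cdot> u" "w \<cdot> g = g' \<cdot> v" "Sa u \<cdot> h = h' \<cdot> w"
  shows "iso_arr C Z Z' w"
proof -
  have "is_coproduct C {()} (\<lambda>_. Z) Z' (\<lambda>_. w)"
    by (rule coproduct_cone[where f = "\<lambda>_. f" and g = "\<lambda>_. g" and h = "\<lambda>_. h" and X = "\<lambda>_. X" and Y = "\<lambda>_. Y"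
          and \<iota> = "\<lambda>_. u" and \<kappa> = "\<lambda>_. v", OF _ _ _ assms(2)])
      (use assms is_coproduct_singleton[of "\<lambda>_. X" "()" X' "\<lambda>_. u"]
        is_coproduct_singleton[of "\<lambda>_. Y" "()" Y' "\<lambda>_. v"] in simp_all)
  from is_coproduct_singletonD[OF this] show ?thesis .
qed

lemma cone_isom:
  assumes t: "tri C X Y Z f g h" "tri C X' Y' Z' f' g' h'" and uv: "iso_arr C X X' u" "iso_arr C Y Y' v"
    and e: "v \<cdot> f = f' \<cdot> u"
  shows "isom C Z Z'"
proof -
  have "u \<in> Hom C X X'" "v \<in> Hom C Y Y'" using uv by (simp_all add: iso_arr_def)
  from tri_map[OF t this e] obtain w where w: "w \<in> Hom C Z Z'" "w \<cdot> g = g' \<cdot> v" "Sa u \<cdot> h = h' \<cdot> w" .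
  have "iso_arr C Z Z' w" by (rule five_iso[OF t uv w(1) e w(2,3)])
  then show ?thesis unfolding isom_def by blast
qed

lemma fibre_isom:
  assumes t: "tri C X Y Z f g h" "tri C X' Y' Z' f' g' h'" and uv: "iso_arr C Y Y' v" "iso_arr C Z Z' w"
    and e: "w \<cdot> g = g' \<cdot> v"
  shows "isom C X X'"
proof -
  have "isom C (S X) (S X')" by (rule cone_isom[OF tri_rot[OF t(1)] tri_rot[OF t(2)] uv e])
  then show ?thesis using isom_S tri_Obj t by blast
qed

text \<open>
  The Eilenberg swindle: with \<open>Q\<close> the sum of countably many copies of \<open>P\<close>, moving the summand \<open>X\<close>
  of each copy to the next one shows that \<open>Q\<close> is the biproduct of \<open>Q\<close> and \<open>X\<close>.
\<close>

lemma swindle: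
  assumes a: "a \<in> Hom C X P" and b: "b \<in> Hom C P X" and ba: "b \<cdot> a = Idn C X"
    and c: "is_coproduct C (UNIV :: nat set) (\<lambda>_. P) Q \<iota>"
  shows "has_triangle C Q Q X"
proof -
  have O: "X \<in> Obj C" "P \<in> Obj C" "Q \<in> Obj C" using a Obj_Hom is_coproduct_arr(1)[OF c] by blast+
  have i: "\<iota> k \<in> Arr C" "Dom C (\<iota> k) = P" "Cod C (\<iota> k) = Q" for k using is_coproduct_arr(4-6)[OF c, of k] by simp_all
  have A: "a \<in> Arr C" "Dom C a = X" "Cod C a = P" "b \<in> Arr C" "Dom C b = P" "Cod C b = X"
    using a b by (simp_all add: Hom_iff)
  \<comment> \<open>The idempotent complementary to \<open>a \<cdot> b\<close>: what a copy of
    \<open>P\<close> has besides \<open>X\<close>.\<close>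
  define d where "d = Plus C (Idn C P) (Neg C (a \<cdot> b))"
  have d: "d \<in> Arr C" "Dom C d = P" "Cod C d = P" unfolding d_def using A O by simp_all
  have ba': "b \<cdot> (a \<cdot> x) = x" if "x \<in> Arr C" "Cod C x = X" for x
    using reassoc[OF ba b a, of x "Dom C x"] that by (simp add: Hom_iff)
  have da: "d \<cdot> a = Zero C X P" unfolding d_def using A O ba' by (simp add: ba)
  have bd: "b \<cdot> d = Zero C P X" unfolding d_def using A O ba' by simp
  have dd: "d \<cdot> d = d"
  proof -
    have "d \<cdot> d = Plus C d (Neg C (a \<cdot> (b \<cdot> d)))" 
      using A O d by (subst (1) d_def) simp
    then show ?thesis using bd A O d by simp
  qed
  have dax: "d \<cdot> (a \<cdot> x) = Zero C (Dom C x) P" if "x \<in> Arr C" "Cod C x = X" for x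
    using reassoc[OF da _ a, of P x "Dom C x"] that d O by (simp add: Hom_iff)
  have sum: "Plus C d (a \<cdot> b) = Idn C P" unfolding d_def using A O by (simp add: Plus_assoc)
  have isum: "Plus C (\<iota> k \<cdot> d) (\<iota> k \<cdot> (a \<cdot> b)) = \<iota> k" for k
  proof -
    have "Plus C (\<iota> k \<cdot> d) (\<iota> k \<cdot> (a \<cdot> b)) = \<iota> k \<cdot> Plus C d (a \<cdot> b)" using A d i[of k] by simp
    then show ?thesis using sum i[of k] by simp
  qed
  obtain \<sigma> where s: "\<sigma> \<in> Hom C Q Q" and s': "\<And>k. \<sigma> \<cdot> \<iota> k = Plus C (\<iota> k \<cdot> d) (\<iota> (Suc k) \<cdot> (a \<cdot> b))"
    using copr_map[OF c O(3), of "\<lambda>k. Plus C (\<iota> k \<cdot> d) (\<iota> (Suc k) \<cdot> (a \<cdot> b))"] i A d by (auto simp: Hom_def)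
  \<comment> \<open>\<open>\<rho>\<close> moves \<open>X\<close> back by one copy. In copy 0 there
    is nowhere to go and \<open>X\<close> is killed: this is the extra summand, included by
    \<open>\<iota> 0 \<cdot> a\<close>.\<close>
  define R where "R k = (case k of 0 \<Rightarrow> \<iota> 0 \<cdot> d | Suc n \<Rightarrow> Plus C (\<iota> k \<cdot> d) (\<iota> n \<cdot> (a \<cdot> b)))" for k
  have "R k \<in> Hom C P Q" for k unfolding R_def using i A d by (cases k) (simp_all add: Hom_iff)
  then obtain \<rho> where r: "\<rho> \<in> Hom C Q Q" and r': "\<And>k. \<rho> \<cdot> \<iota> k = R k"
    using copr_map[OF c O(3), of R] by auto
  obtain p where p: "p \<in> Hom C Q P" and p': "\<And>k. p \<cdot> \<iota> k = (if k = 0 then Idn C P else Zero C P P)"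
    using prj(1)[OF c UNIV_I, where j = 0] prj(2)[OF c UNIV_I UNIV_I, where j = 0] by blast
  have sA: "\<sigma> \<in> Arr C" "Dom C \<sigma> = Q" "Cod C \<sigma> = Q" using s by (simp_all add: Hom_iff)
  have rA: "\<rho> \<in> Arr C" "Dom C \<rho> = Q" "Cod C \<rho> = Q" using r by (simp_all add: Hom_iff)
  have pA: "p \<in> Arr C" "Dom C p = Q" "Cod C p = P" using p by (simp_all add: Hom_iff)
  have sx: "\<sigma> \<cdot> (\<iota> k \<cdot> x) = Plus C (\<iota> k \<cdot> (d \<cdot> x)) (\<iota> (Suc k) \<cdot> (a \<cdot> (b \<cdot> x)))"
    if "x \<in> Arr C" "Cod C x = P" for k x
    using assoc[of x "\<iota> k" \<sigma>] s'[of k] that i A d sA by simp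
  have rx0: "\<rho> \<cdot> (\<iota> 0 \<cdot> x) = \<iota> 0 \<cdot> (d \<cdot> x)" if "x \<in> Arr C" "Cod C x = P" for x
    using assoc[of x "\<iota> 0" \<rho>] r'[of 0] that i A d rA by (simp add: R_def)
  have rxS: "\<rho> \<cdot> (\<iota> (Suc k) \<cdot> x) = Plus C (\<iota> (Suc k) \<cdot> (d \<cdot> x)) (\<iota> k \<cdot> (a \<cdot> (b \<cdot> x)))"
    if "x \<in> Arr C" "Cod C x = P" for k x
    using assoc[of x "\<iota> (Suc k)" \<rho>] r'[of "Suc k"] that i A d rA by (simp add: R_def)
  have px: "p \<cdot> (\<iota> k \<cdot> x) = (if k = 0 then x else Zero C (Dom C x) P)" if "x \<in> Arr C" "Cod C x = P" for k x
    using assoc[of x "\<iota> k" p] p'[of k] that i pA O by auto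
  have "is_biproduct C Q X Q"
  proof (rule is_biproductI[of \<sigma> _ _ "\<iota> 0 \<cdot> a" _ \<rho> "b \<cdot> p"])
    show "\<rho> \<cdot> \<sigma> = Idn C Q"
    proof (rule copr_eq[OF c])
      fix k
      show "(\<rho> \<cdot> \<sigma>) \<cdot> \<iota> k = Idn C Q \<cdot> \<iota> k"
        by (cases k) (use sA rA i A d O in \<open>simp_all add: s' rx0 rxS dd dax bd ba' isum\<close>)
    qed (use sA rA O in \<open>simp_all add: Hom_iff\<close>)
    show "(b \<cdot> p) \<cdot> (\<iota> 0 \<cdot> a) = Idn C X" using A pA i O by (simp add: px ba)
    show "(b \<cdot> p) \<cdot> \<sigma> = Zero C Q X"
    proof (rule copr_zero[OF c])
      fix k
      show "((b \<cdot> p) \<cdot> \<sigma>) \<cdot> \<iota> k = Zero C P X"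
        by (cases "k = 0") (use sA pA i A d O in \<open>simp_all add: s' px bd\<close>)
    qed (use sA pA A O in \<open>simp_all add: Hom_iff\<close>)
    show "\<rho> \<cdot> (\<iota> 0 \<cdot> a) = Zero C X Q" using A i O by (simp add: rx0 da)
    show "Plus C (\<sigma> \<cdot> \<rho>) ((\<iota> 0 \<cdot> a) \<cdot> (b \<cdot> p)) = Idn C Q"
    proof (rule copr_eq[OF c])
      fix k
      show "Plus C (\<sigma> \<cdot> \<rho>) ((\<iota> 0 \<cdot> a) \<cdot> (b \<cdot> p)) \<cdot> \<iota> k = Idn C Q \<cdot> \<iota> k"
        by (cases k) (use sA rA pA i A d O in \<open>simp_all add: r' R_def sx p' dd dax bd ba' isum\<close>)
    qed (use sA rA pA i A O in \<open>simp_all add: Hom_iff\<close>)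
  qed (use sA rA pA i A O in \<open>simp_all add: Hom_iff\<close>)
  then show ?thesis using has_triangle_biproduct by blast
qed

end


section \<open>Compact objects as retracts\<close>

context add_functor
begin

lemma F_cut:
  assumes c: "is_coproduct C I X P \<iota>"
    and c': "is_coproduct D I (\<lambda>i. on_obj F (X i)) (on_obj F P) (\<lambda>i. on_arr F (\<iota> i))"
  shows "on_arr F (A.cut I X P \<iota> J) =
    B.cut I (\<lambda>i. on_obj F (X i)) (on_obj F P) (\<lambda>i. on_arr F (\<iota> i)) J"
proof (rule B.cut_unique[OF c', symmetric])
  note i = A.is_coproduct_arr[OF c] and k = A.cut[OF c, where J = J]
  show "on_arr F (A.cut I X P \<iota> J) \<in> Hom D (on_obj F P) (on_obj F P)" using F_Hom k(1) .
  fix j assume j: "j \<in> I"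
  have "on_arr F (A.cut I X P \<iota> J) \<cdot>\<^bsub>D\<^esub> on_arr F (\<iota> j) = on_arr F (A.cut I X P \<iota> J \<cdot>\<^bsub>C\<^esub> \<iota> j)"
    using k(1) i(4-6)[OF j] by (simp add: Hom_iff)
  then show "on_arr F (A.cut I X P \<iota> J) \<cdot>\<^bsub>D\<^esub> on_arr F (\<iota> j) =
    (if j \<in> J then on_arr F (\<iota> j) else Zero D (on_obj F (X j)) (on_obj F P))"
    using k(2)[OF j] i(1) i(2)[OF j] by simp
qed

end

context triangulated_category
begin

section \<open>Compact objects and triangles\<close>

lemma cpt_S:
  fixes r :: "'u rel"
  assumes K: "K \<in> Obj C" shows "cpt r (S K) \<longleftrightarrow> cpt r K"
proof
  assume SK: "cpt r (S K)"
  show "cpt r K"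
  proof (rule cptI)
    fix I :: "'u set" and X P \<iota> f assume I: "small r I" and c: "is_coproduct C I X P \<iota>" and f: "f \<in> Hom C K P"
    note cS = is_coproduct_S[OF c]
    obtain J where J: "J \<subseteq> I" "finite J"
      "cut I (\<lambda>i. S (X i)) (S P) (\<lambda>i. Sa (\<iota> i)) J \<cdot> Sa f = Sa f"
      using cptD[OF SK I cS Susp.F_Hom[OF f]] .
    have "Sa (cut I X P \<iota> J \<cdot> f) = Sa f"
      using J(3) Susp.F_cut[OF c cS, of J, symmetric] cut(1)[OF c, where J = J] f by (simp add: Hom_iff)
    moreover have "cut I X P \<iota> J \<cdot> f \<in> Arr C" "f \<in> Arr C"
      using cut(1)[OF c, where J = J] f by (simp_all add: Hom_iff)
    ultimately have "cut I X P \<iota> J \<cdot> f = f" using Sa_inj by blast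
    then show "\<exists>J\<subseteq>I. finite J \<and> cut I X P \<iota> J \<cdot> f = f" using J by blast
  qed (rule K)
next
  assume K': "cpt r K"
  show "cpt r (S K)"
  proof (rule cptI)
    show "S K \<in> Obj C" using K by simp
    fix I :: "'u set" and X P \<iota> f assume I: "small r I" and c: "is_coproduct C I X P \<iota>" and f: "f \<in> Hom C (S K) P"
    note i = is_coproduct_arr[OF c]
    obtain Q where Q: "Q \<in> Obj C" "S Q = P" using S_surj i(1) by blast
    have "\<exists>Y. Y \<in> Obj C \<and> S Y = X j" if "j \<in> I" for j using S_surj i(2)[OF that] by blast
    then obtain Y where Y: "\<And>j. j \<in> I \<Longrightarrow> Y j \<in> Obj C" "\<And>j. j \<in> I \<Longrightarrow> S (Y j) = X j" by metis
    have "is_coproduct C I (\<lambda>j. S (Y j)) (S Q) \<iota>" using is_coproduct_cong[OF c] Y(2) Q(2) by simp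
    then obtain \<kappa> where k: "is_coproduct C I Y Q \<kappa>" "\<And>j. j \<in> I \<Longrightarrow> Sa (\<kappa> j) = \<iota> j"
      using is_coproduct_S_D Y(1) Q(1) by blast
    have cS: "is_coproduct C I (\<lambda>j. S (Y j)) (S Q) (\<lambda>j. Sa (\<kappa> j))" using is_coproduct_S[OF k(1)] .
    obtain g where g: "g \<in> Hom C K Q" "Sa g = f" using Sa_surj f Q K by metis
    obtain J where J: "J \<subseteq> I" "finite J" "cut I Y Q \<kappa> J \<cdot> g = g"
      using cptD[OF K' I k(1) g(1)] .
    have "cut I X P \<iota> J = Sa (cut I Y Q \<kappa> J)"
    proof (rule cut_unique[OF c])
      show "Sa (cut I Y Q \<kappa> J) \<in> Hom C P P" using Susp.F_Hom[OF cut(1)[OF k(1)]] Q(2) by simp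
      fix j assume j: "j \<in> I"
      show "Sa (cut I Y Q \<kappa> J) \<cdot> \<iota> j = (if j \<in> J then \<iota> j else Zero C (X j) P)"
        unfolding Susp.F_cut[OF k(1) cS] using cut(2)[OF cS j] k(2)[OF j] Y(2)[OF j] Q(2) by simp
    qed
    then have "cut I X P \<iota> J \<cdot> f = Sa (cut I Y Q \<kappa> J \<cdot> g)"
      using g cut(1)[OF k(1), where J = J] by (auto simp: Hom_def)
    then show "\<exists>J\<subseteq>I. finite J \<and> cut I X P \<iota> J \<cdot> f = f" using J g(2) by auto
  qed
qed

lemma cpt_shift: "cpt r K \<Longrightarrow> cpt r (shift C n K)"
  by (rule shift_induct[where P = "cpt r"]) (simp_all add: cpt_S cpt_Obj)

text \<open>Restricted to \<open>K'\<close>, the morphism \<open>f\<close> lies in finitely many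
  summands \<open>J\<close>. Removing from \<open>f\<close> its part in \<open>J\<close> leaves a
  morphism that factors through \<open>K''\<close> and so lies in finitely many summands
  \<open>M\<close>; together they support \<open>f\<close>.\<close>

lemma cpt_extension:
  fixes r :: "'u rel"
  assumes t: "has_triangle C K' K K''" and K': "cpt r K'" "cpt r K''"
  shows "cpt r K"
proof (rule cptI)
  obtain a b h where t': "tri C K' K K'' a b h" using t unfolding has_triangle_tri by blast
  note aD = triD[OF t']
  show K: "K \<in> Obj C" using tri_Obj[OF t'] by blast
  fix I :: "'u set" and X P \<iota> f assume I: "small r I" and c: "is_coproduct C I X P \<iota>" and f: "f \<in> Hom C K P"
  note i = is_coproduct_arr[OF c]
  let ?p = "\<lambda>J. cut I X P \<iota> J"
  have p: "?p J \<in> Arr C" "Dom C (?p J) = P" "Cod C (?p J) = P" for J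
    using cut(1)[OF c, where J = J] by (simp_all add: Hom_iff)
  obtain J where J: "J \<subseteq> I" "finite J" "?p J \<cdot> (f \<cdot> a) = f \<cdot> a"
    using cptD[OF K'(1) I c Cmp_Hom[OF aD(2) f]] .
  let ?u = "Plus C f (Neg C (?p J \<cdot> f))"
  have u: "?u \<in> Hom C K P" using f p by (simp add: Hom_iff)
  have "?u \<cdot> a = Zero C K' P" using f p aD J(3) by (simp add: Hom_iff)
  then obtain g where g: "g \<in> Hom C K'' P" "g \<cdot> b = ?u" using tri_con1[OF t' u] by blast
  obtain M where M: "M \<subseteq> I" "finite M" "?p M \<cdot> g = g" using cptD[OF K'(2) I c g(1)] .
  have "f = Plus C (?p J \<cdot> f) ?u" using f p by (simp add: Hom_iff Plus_left_comm[of "?p J \<cdot> f" f])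
  also have "?u = ?p M \<cdot> (g \<cdot> b)" using reassoc[OF M(3) _ g(1) aD(3)] p[of M] g by (simp add: Hom_iff)
  finally have 1: "f = Plus C (?p J \<cdot> f) (?p M \<cdot> (g \<cdot> b))" .
  let ?L = "J \<union> M"
  have 2: "?p ?L \<cdot> (?p J \<cdot> x) = ?p J \<cdot> x" "?p ?L \<cdot> (?p M \<cdot> x) = ?p M \<cdot> x" if "x \<in> Hom C K P" for x
    using reassoc[OF cut_cut[OF c], of J ?L P P P x K] reassoc[OF cut_cut[OF c], of M ?L P P P x K] that p
    by (simp_all add: Hom_iff)
  have "?p ?L \<cdot> f = ?p ?L \<cdot> Plus C (?p J \<cdot> f) (?p M \<cdot> (g \<cdot> b))" using 1 by simp
  also have "\<dots> = Plus C (?p ?L \<cdot> (?p J \<cdot> f)) (?p ?L \<cdot> (?p M \<cdot> (g \<cdot> b)))"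
    using f p g(1) aD by (intro Plus_distrib) (simp_all add: Hom_iff)
  also have "\<dots> = f" using 1 2(1)[OF f] 2(2)[OF Cmp_Hom[OF aD(3) g(1)]] by simp
  finally show "\<exists>J\<subseteq>I. finite J \<and> cut I X P \<iota> J \<cdot> f = f" using J M by (intro exI[of _ ?L]) simp
qed

lemma cpt_cone:
  assumes "has_triangle C X Y Z" "cpt r X" "cpt r Y" shows "cpt r Z"
  using cpt_extension[OF has_triangle_rot[OF assms(1)]] assms cpt_S cpt_Obj by blast

lemma cpt_fibre:
  assumes "has_triangle C X Y Z" "cpt r Y" "cpt r Z" shows "cpt r X"
  using cpt_extension[OF shift_triangle_left[OF assms(1)]] assms cpt_shift by blast

lemma isom_zero_cone: "has_triangle C X Y Z \<Longrightarrow> zero_object C Z \<Longrightarrow> isom C X Y"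
  unfolding has_triangle_tri isom_def using zero_cone_iso by blast

lemma isom_zero_fibre: "has_triangle C X Y Z \<Longrightarrow> zero_object C X \<Longrightarrow> isom C Y Z"
  using isom_zero_cone[OF has_triangle_rot] Susp.F_zero_object by blast

lemma cpt_zero: assumes Z: "zero_object C Z" shows "cpt (r :: 'u rel) Z"
proof (rule cptI)
  show "Z \<in> Obj C" using Z zero_object_iff by blast
  fix I :: "'u set" and X P \<iota> f assume c: "is_coproduct C I X P \<iota>" and f: "f \<in> Hom C Z P"
  have "cut I X P \<iota> {} \<cdot> f = f"
    using zero_object_hom(2)[OF Z Cmp_Hom[OF f cut(1)[OF c]]] zero_object_hom(2)[OF Z f] by metis
  then show "\<exists>J\<subseteq>I. finite J \<and> cut I X P \<iota> J \<cdot> f = f" by blast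
qed

lemma hom_zero_shift_left:
  assumes "X \<in> Obj C" "Y \<in> Obj C" shows "hom_zero C (shift C n X) Y \<longleftrightarrow> hom_zero C X (shift C (- n) Y)"
  using hom_zero_shift[OF assms, of 0 "- n"] by simp

lemma hom_zero_shift_retract:
  assumes "a \<in> Hom C X' X" "b \<in> Hom C X X'" "b \<cdot> a = Idn C X'" "hom_zero C (shift C n X) Y" "Y \<in> Obj C"
  shows "hom_zero C (shift C n X') Y"
proof -
  have O: "X \<in> Obj C" "X' \<in> Obj C" using assms Obj_Hom by blast+
  have "hom_zero C X (shift C (- n) Y)" using assms(4) hom_zero_shift_left[OF O(1) assms(5)] by simp
  then show ?thesis using hom_zero_retract[OF assms(1-3)] hom_zero_shift_left[OF O(2) assms(5)] by simp
qed

text \<open>\<open>H\<close> is an iterated biproduct. Each member of \<open>S0\<close> is a retract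
  of it, and retracts inherit the vanishing of morphisms to \<open>X\<close>.\<close>

lemma finite_compact_sum:
  assumes "finite S0" "\<And>s. s \<in> S0 \<Longrightarrow> cpt r s"
  shows "\<exists>H. cpt r H \<and> (\<forall>X \<in> Obj C. (\<forall>n. hom_zero C (shift C n H) X) \<longrightarrow> (\<forall>s \<in> S0. \<forall>n. hom_zero C (shift C n s) X))"
  using assms
proof (induction S0)
  case empty
  obtain Z where "zero_object C Z" using ex_zero_object by blast
  then show ?case using cpt_zero by blast
next
  case (insert s S0)
  then obtain H where H: "cpt r H"
    "\<And>X. X \<in> Obj C \<Longrightarrow> (\<And>n. hom_zero C (shift C n H) X) \<Longrightarrow> \<forall>s \<in> S0. \<forall>n. hom_zero C (shift C n s) X" by blast
  have s: "cpt r s" using insert.prems by blast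
  obtain P where P: "is_biproduct C s H P" using ex_biproduct[OF cpt_Obj[OF s] cpt_Obj[OF H(1)]] by blast
  obtain i1 i2 p1 p2 where i: "s \<in> Obj C" "H \<in> Obj C" "P \<in> Obj C"
    "i1 \<in> Hom C s P" "i2 \<in> Hom C H P" "p1 \<in> Hom C P s" "p2 \<in> Hom C P H"
    "p1 \<cdot> i1 = Idn C s" "p2 \<cdot> i2 = Idn C H"
    using P by (rule is_biproductE)
  have "cpt r P" using cpt_extension[OF has_triangle_biproduct[OF P] s H(1)] .
  moreover have "\<forall>t \<in> insert s S0. \<forall>n. hom_zero C (shift C n t) X" if X: "X \<in> Obj C" and z: "\<forall>n. hom_zero C (shift C n P) X" for X
  proof -
    have "hom_zero C (shift C n s) X" "hom_zero C (shift C n H) X" for n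
      using hom_zero_shift_retract[OF i(4,6,8) _ X] hom_zero_shift_retract[OF i(5,7,9) _ X] z by blast+
    then show ?thesis using H(2)[OF X] by blast
  qed
  ultimately show ?case by blast
qed

end

section \<open>Sequences and their homotopy colimits\<close>

primrec path :: "('o, 'm, 'z) cat_scheme \<Rightarrow> (nat \<Rightarrow> 'o) \<Rightarrow> (nat \<Rightarrow> 'm) \<Rightarrow> nat \<Rightarrow> nat \<Rightarrow> 'm" where
  "path C Y y k 0 = Idn C (Y k)"
| "path C Y y k (Suc m) = y (k + m) \<cdot>\<^bsub>C\<^esub> path C Y y k m"

context category
begin

lemma path_Hom:
  assumes "\<And>k. y k \<in> Hom C (Y k) (Y (Suc k))" shows "path C Y y k m \<in> Hom C (Y k) (Y (k + m))"
proof (induction m)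
  case 0
  have "Y k \<in> Obj C" using assms[of k] Obj_Hom by blast
  then show ?case by (simp add: Hom_iff)
next
  case (Suc m)
  then show ?case using assms[of "k + m"] by (simp add: Hom_iff)
qed

lemma path_Suc:
  assumes y: "\<And>k. y k \<in> Hom C (Y k) (Y (Suc k))"
  shows "path C Y y k (Suc m) = path C Y y (Suc k) m \<cdot> y k"
proof (induction m)
  case 0
  have "Y k \<in> Obj C" "Y (Suc k) \<in> Obj C" using y[of k] Obj_Hom by blast+
  then show ?case using y[of k] by (simp add: Hom_iff)
next
  case (Suc m)
  have p: "path C Y y (Suc k) m \<in> Hom C (Y (Suc k)) (Y (Suc k + m))" by (rule path_Hom[where y = y and Y = Y, OF y])
  have "path C Y y k (Suc (Suc m)) = y (k + Suc m) \<cdot> (path C Y y (Suc k) m \<cdot> y k)"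
    using Suc by simp
  then show ?case using p y[of k] y[of "Suc k + m"] by (simp add: Hom_iff)
qed

end

locale tri_coproducts = triangulated_category C
  for C :: "('o, 'm, 'z) tri_cat_scheme" (structure) +
  fixes r :: "'u rel"
  assumes size: "size_cardinal r" and coprods: "has_small_coproducts r C" and loc_small: "locally_small r C"
begin

lemma ex_coproduct:
  fixes I :: "'i set"
  assumes I: "small r I" and X: "\<And>i. i \<in> I \<Longrightarrow> X i \<in> Obj C"
  obtains P \<iota> where "is_coproduct C I X P \<iota>"
proof -
  obtain e :: "'i \<Rightarrow> 'u" where e: "inj_on e I" by (rule small_inj[OF size I])
  let ?d = "the_inv_into I e"
  have de: "?d (e i) = i" if "i \<in> I" for i using the_inv_into_f_f[OF e that] .
  have "\<forall>j \<in> e ` I. X (?d j) \<in> Obj C" using X de by auto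
  then obtain P \<iota> where "is_coproduct C (e ` I) (\<lambda>j. X (?d j)) P \<iota>"
    using coprods[unfolded has_small_coproducts_def, rule_format, of "e ` I" "\<lambda>j. X (?d j)"] small_image[OF size I, of e]
    by blast
  from is_coproduct_reindex[OF this inj_on_imp_bij_betw[OF e]]
  have "is_coproduct C I (\<lambda>i. X (?d (e i))) P (\<lambda>i. \<iota> (e i))" .
  then have "is_coproduct C I X P (\<lambda>i. \<iota> (e i))" by (rule is_coproduct_cong) (simp_all add: de)
  then show ?thesis using that by blast
qed

end

text \<open>Closure under suspension and desuspension frees orthogonality from shifts and lets a
  morphism from a generator to a suspension be desuspended to one from another generator. Smallness
  permits the coproduct over all morphisms from generators to a fixed object.\<close>

locale generated = tri_coproducts C r
  for C :: "('o, 'm, 'z) tri_cat_scheme" (structure) and r :: "'u rel" +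
  fixes \<S> :: "'o set"
  assumes S_cpt: "s \<in> \<S> \<Longrightarrow> cpt r s"
    and S_up: "s \<in> \<S> \<Longrightarrow> on_obj (Susp C) s \<in> \<S>"
    and S_down: "s \<in> \<S> \<Longrightarrow> \<exists>t \<in> \<S>. on_obj (Susp C) t = s"
    and S_gen: "X \<in> Obj C \<Longrightarrow> (\<And>s. s \<in> \<S> \<Longrightarrow> hom_zero C s X) \<Longrightarrow> zero_object C X"
    and S_small: "small r \<S>"
begin

lemma S_Obj: "s \<in> \<S> \<Longrightarrow> s \<in> Obj C"
  using S_cpt cpt_Obj by blast

text \<open>The cone of \<open>1 - \<sigma>\<close> is the homotopy colimit of the sequence \<open>Y\<close>.\<close>

lemma shift_map_iso:
  assumes y: "\<And>k. y k \<in> Hom C (Y k) (Y (Suc k))"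
    and die: "\<And>s k f. s \<in> \<S> \<Longrightarrow> f \<in> Hom C s (Y k) \<Longrightarrow> \<exists>m. path C Y y k m \<cdot> f = Zero C s (Y (k + m))"
    and c: "is_coproduct C UNIV Y Q \<iota>"
    and s: "\<sigma> \<in> Hom C Q Q" "\<And>k. \<sigma> \<cdot> \<iota> k = \<iota> (Suc k) \<cdot> y k"
  shows "iso_arr C Q Q (Plus C (Idn C Q) (Neg C \<sigma>))"
proof -
  have Q: "Q \<in> Obj C" using is_coproduct_arr(1)[OF c] .
  have iA: "\<iota> k \<in> Hom C (Y k) Q" for k using is_coproduct_arr(3)[OF c] by blast
  define \<delta> where "\<delta> = Plus C (Idn C Q) (Neg C \<sigma>)"
  have d: "\<delta> \<in> Hom C Q Q" using s(1) Q by (simp add: \<delta>_def Hom_iff)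
  have dx: "\<delta> \<cdot> x = Plus C x (Neg C (\<sigma> \<cdot> x))" if "x \<in> Hom C W Q" for x W
    using that s(1) Q by (simp add: \<delta>_def Hom_iff)
  let ?pow = "\<lambda>m a. ((\<lambda>a. \<sigma> \<cdot> a) ^^ m) a"
  have pow_Hom: "?pow m a \<in> Hom C W Q" if "a \<in> Hom C W Q" for m a W
    using that s(1) Cmp_Hom by (induction m) auto
  have pow_Plus: "?pow m (Plus C a b) = Plus C (?pow m a) (?pow m b)"
    if "a \<in> Hom C W Q" "b \<in> Hom C W Q" for m a b W
  proof (induction m)
    case (Suc m)
    then show ?case using pow_Hom[OF that(1), of m] pow_Hom[OF that(2), of m] s(1)
      by (simp add: Hom_iff)
  qed simp
  have pow_Zero: "?pow m (Zero C W Q) = Zero C W Q" if "W \<in> Obj C" for m W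
    by (induction m) (use that s(1) in \<open>simp_all add: Hom_iff\<close>)
  have pow_later: "?pow (m + n) a = Zero C W Q" 
    if a: "a \<in> Hom C W Q" and z: "?pow m a = Zero C W Q" for m n a W
    using pow_Zero[of W n] z Obj_Hom[OF a] by (simp add: funpow_add add.commute[of m n])
  have pow_i: "?pow m (\<iota> k \<cdot> g) = \<iota> (k + m) \<cdot> (path C Y y k m \<cdot> g)" if g: "g \<in> Hom C W (Y k)" for m k g W
  proof (induction m)
    case 0
    then show ?case using g Obj_Hom[OF g] by (simp add: Hom_iff)
  next
    case (Suc m)
    have p: "path C Y y k m \<in> Hom C (Y k) (Y (k + m))" by (rule path_Hom[where y = y and Y = Y, OF y])
    have "?pow (Suc m) (\<iota> k \<cdot> g) = \<sigma> \<cdot> (\<iota> (k + m) \<cdot> (path C Y y k m \<cdot> g))" using Suc by simp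
    also have "\<dots> = (\<iota> (Suc (k + m)) \<cdot> y (k + m)) \<cdot> (path C Y y k m \<cdot> g)"
      using reassoc[OF s(2) s(1) iA Cmp_Hom[OF g p]] .
    also have "\<dots> = \<iota> (k + Suc m) \<cdot> (path C Y y k (Suc m) \<cdot> g)"
      using g p y[of "k + m"] iA[of "Suc (k + m)"] by (simp add: Hom_iff)
    finally show ?case .
  qed
  have dies: "\<exists>m. ?pow m (\<iota> k \<cdot> g) = Zero C s Q" if s': "s \<in> \<S>" and g: "g \<in> Hom C s (Y k)" for s k g
  proof -
    obtain m where "path C Y y k m \<cdot> g = Zero C s (Y (k + m))" using die[OF s' g] by blast
    then have "?pow m (\<iota> k \<cdot> g) = Zero C s Q"
      using pow_i[OF g] iA[of "k + m"] S_Obj[OF s'] by (simp add: Hom_iff)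
    then show ?thesis by blast
  qed
  \<comment> \<open>If \<delta> kills \<open>f\<close>, then every power of \<sigma> fixes
    \<open>f\<close>. By compactness \<open>f\<close> lies in finitely many summands, and each of
    these parts is killed by some power of \<sigma>.\<close>
  have inj: "f = Zero C s Q" if s': "s \<in> \<S>" and f: "f \<in> Hom C s Q" and z: "\<delta> \<cdot> f = Zero C s Q" for s f
  proof -
    have sO: "s \<in> Obj C" using S_Obj s' .
    have "\<sigma> \<cdot> f = f" using z dx[OF f] diff_zero_iff[of f s Q "\<sigma> \<cdot> f"] f s(1) Cmp_Hom[OF f s(1)] by simp
    then have pfix: "?pow m f = f" for m by (induction m) simp_all
    obtain J where J: "J \<subseteq> UNIV" "finite J" "cut UNIV Y Q \<iota> J \<cdot> f = f"
      using cpt_cut[OF size S_cpt[OF s'] small_nat[OF size] c f] .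
    have "\<exists>m. ?pow m (cut UNIV Y Q \<iota> J \<cdot> f) = Zero C s Q"
    proof (rule cut_induct[OF c f J(2,1)])
      show "\<exists>m. ?pow m (Zero C s Q) = Zero C s Q" using pow_Zero[OF sO] by blast
      fix a b assume ab: "a \<in> Hom C s Q" "b \<in> Hom C s Q"
        and m: "\<exists>m. ?pow m a = Zero C s Q" and n: "\<exists>m. ?pow m b = Zero C s Q"
      obtain m n where "?pow m a = Zero C s Q" "?pow n b = Zero C s Q" using m n by blast
      then have "?pow (m + n) a = Zero C s Q" "?pow (m + n) b = Zero C s Q"
        using pow_later[OF ab(1), of m n] pow_later[OF ab(2), of n m] by (simp_all add: add.commute)
      then have "?pow (m + n) (Plus C a b) = Zero C s Q" using pow_Plus[OF ab] sO Q by simp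
      then show "\<exists>m. ?pow m (Plus C a b) = Zero C s Q" by blast
    qed (use dies s' in blast)
    then show ?thesis using pfix J by simp
  qed
  \<comment> \<open>Telescoping: \<open>a\<close> minus its image under the m-th power of \<sigma>
    is \<delta> applied to the sum of the images under the lower powers. For \<open>a\<close> in a
    single summand the m-th power vanishes for some m.\<close>
  have surj: "\<exists>g. g \<in> Hom C s Q \<and> \<delta> \<cdot> g = f" if s': "s \<in> \<S>" and f: "f \<in> Hom C s Q" for s f
  proof -
    have sO: "s \<in> Obj C" using S_Obj s' .
    have im: "\<exists>g. g \<in> Hom C s Q \<and> \<delta> \<cdot> g = Plus C a (Neg C (?pow m a))" if a: "a \<in> Hom C s Q" for a m
    proof (induction m)
      case 0
      have "Zero C s Q \<in> Hom C s Q" "\<delta> \<cdot> Zero C s Q = Plus C a (Neg C (?pow 0 a))"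
        using a d sO Q by (simp_all add: Hom_iff)
      then show ?case by blast
    next
      case (Suc m)
      then obtain g where g: "g \<in> Hom C s Q" "\<delta> \<cdot> g = Plus C a (Neg C (?pow m a))" by blast
      note p = pow_Hom[OF a, of m]
      have "Plus C g (?pow m a) \<in> Hom C s Q" using g(1) p by (simp add: Hom_iff)
      moreover have "\<delta> \<cdot> Plus C g (?pow m a) = Plus C (\<delta> \<cdot> g) (\<delta> \<cdot> ?pow m a)"
        using g(1) p d by (simp add: Hom_iff)
      moreover have "\<dots> = Plus C a (Neg C (\<sigma> \<cdot> ?pow m a))"
        unfolding g(2) dx[OF p] using p a s(1) by (simp add: Hom_iff Plus_assoc)
      ultimately show ?case by auto
    qed
    obtain J where J: "J \<subseteq> UNIV" "finite J" "cut UNIV Y Q \<iota> J \<cdot> f = f"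
      using cpt_cut[OF size S_cpt[OF s'] small_nat[OF size] c f] .
    have "\<exists>g. g \<in> Hom C s Q \<and> \<delta> \<cdot> g = cut UNIV Y Q \<iota> J \<cdot> f"
    proof (rule cut_induct[OF c f J(2,1)])
      have "Zero C s Q \<in> Hom C s Q" "\<delta> \<cdot> Zero C s Q = Zero C s Q" using d sO Q by (simp_all add: Hom_iff)
      then show "\<exists>g. g \<in> Hom C s Q \<and> \<delta> \<cdot> g = Zero C s Q" by blast
      fix a b assume "\<exists>g. g \<in> Hom C s Q \<and> \<delta> \<cdot> g = a" "\<exists>g. g \<in> Hom C s Q \<and> \<delta> \<cdot> g = b"
      then obtain g h where g: "g \<in> Hom C s Q" "\<delta> \<cdot> g = a" and h: "h \<in> Hom C s Q" "\<delta> \<cdot> h = b" by blast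
      have "Plus C g h \<in> Hom C s Q" using g h by (simp add: Hom_iff)
      moreover have "\<delta> \<cdot> Plus C g h = Plus C (\<delta> \<cdot> g) (\<delta> \<cdot> h)"
        using g(1) h(1) d by (simp add: Hom_iff)
      ultimately show "\<exists>g. g \<in> Hom C s Q \<and> \<delta> \<cdot> g = Plus C a b" using g(2) h(2) by auto
    next
      fix k g assume g: "g \<in> Hom C s (Y k)"
      obtain m where m: "?pow m (\<iota> k \<cdot> g) = Zero C s Q" using dies[OF s' g] by blast
      have a: "\<iota> k \<cdot> g \<in> Hom C s Q" using Cmp_Hom[OF g iA] .
      have "Plus C (\<iota> k \<cdot> g) (Neg C (?pow m (\<iota> k \<cdot> g))) = \<iota> k \<cdot> g"
        unfolding m using a sO Q by (simp add: Hom_iff)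
      then show "\<exists>h. h \<in> Hom C s Q \<and> \<delta> \<cdot> h = \<iota> k \<cdot> g" using im[OF a, of m] by simp
    qed
    then show ?thesis using J by simp
  qed
  obtain Z g h where t: "tri C Q Q Z \<delta> g h" using tri_ex[OF d] by blast
  note gD = triD[OF t]
  have Z: "Z \<in> Obj C" using tri_Obj[OF t] by blast
  \<comment> \<open>As \<delta> acts bijectively on morphisms from generators, its cone receives
    none but zero. Injectivity is used one desuspension lower, whence \<open>S_down\<close>.\<close>
  have "zero_object C Z"
  proof (rule S_gen[OF Z])
    fix s assume s': "s \<in> \<S>"
    have sO: "s \<in> Obj C" using S_Obj s' .
    show "hom_zero C s Z"
    proof (rule hom_zeroI[OF sO Z])
      fix u assume u: "u \<in> Hom C s Z"
      obtain q where q: "q \<in> \<S>" "S q = s" using S_down[OF s'] by blast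
      have qO: "q \<in> Obj C" using S_Obj q(1) .
      have hu: "h \<cdot> u \<in> Hom C (S q) (S Q)" using Cmp_Hom[OF u gD(4)] q(2) by simp
      obtain v where v: "v \<in> Hom C q Q" "Sa v = h \<cdot> u" using Sa_surj[OF hu qO Q] by blast
      have "Sa (\<delta> \<cdot> v) = Sa \<delta> \<cdot> (h \<cdot> u)" using v d by (simp add: Hom_iff)
      also have "\<dots> = Zero C s (S Q)"
        using reassoc[OF tri_comp_zero3[OF t] Susp.F_Hom[OF d] gD(4) u] u Q by (simp add: Hom_iff)
      finally have "\<delta> \<cdot> v = Zero C q Q" using Sa_zero[OF Cmp_Hom[OF v(1) d]] q(2) by simp
      then have "v = Zero C q Q" using inj[OF q(1) v(1)] by blast
      then have "h \<cdot> u = Zero C s (S Q)" using v(2) qO Q q(2) by simp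
      then obtain w where w: "w \<in> Hom C s Q" "g \<cdot> w = u" using tri_cov2[OF t u] by blast
      obtain x where x: "x \<in> Hom C s Q" "\<delta> \<cdot> x = w" using surj[OF s' w(1)] by blast
      have "u = g \<cdot> (\<delta> \<cdot> x)" using w x by simp
      then show "u = Zero C s Z" using reassoc[OF tri_comp_zero[OF t] gD(3) d x(1)] x(1) Z
        by (simp add: Hom_iff)
    qed
  qed
  then show ?thesis using zero_cone_iso[OF t] unfolding \<delta>_def by blast
qed

end

section \<open>Functors that preserve coproducts, applied to sequences\<close>

definition extension_closed :: "('o, 'm, 'z) tri_cat_scheme \<Rightarrow> 'o set \<Rightarrow> bool" where
  "extension_closed C \<T> \<longleftrightarrow> (\<forall>X Y Z. has_triangle C X Y Z \<longrightarrow> X \<in> \<T> \<longrightarrow> Z \<in> \<T> \<longrightarrow> Y \<in> \<T>)"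

definition fibre_closed :: "('o, 'm, 'z) tri_cat_scheme \<Rightarrow> 'o set \<Rightarrow> bool" where
  "fibre_closed C \<T> \<longleftrightarrow> (\<forall>X Y Z. has_triangle C X Y Z \<longrightarrow> Y \<in> \<T> \<longrightarrow> Z \<in> \<T> \<longrightarrow> X \<in> \<T>)"

definition preserves_coproducts ::
  "'u rel \<Rightarrow> ('o, 'm, 'y) cat_scheme \<Rightarrow> ('p, 'n, 'z) cat_scheme \<Rightarrow> ('o, 'm, 'p, 'n) functr \<Rightarrow> bool" where
  "preserves_coproducts r C D F \<longleftrightarrow> (\<forall>(I :: 'u set) X P \<iota>. is_coproduct C I X P \<iota> \<longrightarrow>
     is_coproduct D I (\<lambda>i. on_obj F (X i)) (on_obj F P) (\<lambda>i. on_arr F (\<iota> i)))"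

lemma (in category) preserves_coproducts_general:
  fixes I :: "'i set" and r :: "'u rel"
  assumes r: "size_cardinal r" and p: "preserves_coproducts r C D F" and D: "category D" and I: "small r I"
    and c: "is_coproduct C I X P \<iota>"
  shows "is_coproduct D I (\<lambda>i. on_obj F (X i)) (on_obj F P) (\<lambda>i. on_arr F (\<iota> i))"
proof -
  interpret D: category D by (rule D)
  obtain e :: "'i \<Rightarrow> 'u" where e: "inj_on e I" by (rule small_inj[OF r I])
  let ?d = "the_inv_into I e"
  have de: "?d (e i) = i" if "i \<in> I" for i using the_inv_into_f_f[OF e that] .
  have d: "bij_betw ?d (e ` I) I" using e by (simp add: bij_betw_the_inv_into inj_on_imp_bij_betw)
  have "is_coproduct D (e ` I) (\<lambda>j. on_obj F (X (?d j))) (on_obj F P) (\<lambda>j. on_arr F (\<iota> (?d j)))"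
    using p[unfolded preserves_coproducts_def, rule_format, OF is_coproduct_reindex[OF c d]] .
  from D.is_coproduct_reindex[OF this inj_on_imp_bij_betw[OF e]]
  show ?thesis by (rule D.is_coproduct_cong) (simp_all add: de)
qed

locale coproduct_functor = A: tri_coproducts C r + B: tri_coproducts D r + add_functor C D F
  for C :: "('o, 'm, 'y) tri_cat_scheme" and D :: "('p, 'n, 'z) tri_cat_scheme"
    and F :: "('o, 'm, 'p, 'n) functr" and r :: "'u rel" +
  assumes pres: "preserves_coproducts r C D F"
begin

lemma F_coproduct:
  "small r I \<Longrightarrow> is_coproduct C I X P \<iota> \<Longrightarrow>
    is_coproduct D I (\<lambda>i. on_obj F (X i)) (on_obj F P) (\<lambda>i. on_arr F (\<iota> i))"
  using A.preserves_coproducts_general[OF A.size pres] B.category_axioms by blast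

text \<open>The homotopy colimit of \<open>Y\<close> vanishes, so 1 - \<sigma> is invertible on the
  coproduct, and \<open>F\<close> preserves this. Solving g - F(\<sigma>)g = f, with
  \<open>f\<close> placed in summand 0, forces the components of \<open>g\<close> to be the images
  of \<open>f\<close> along the sequence, and compactness leaves only finitely many of them
  nonzero.\<close>

lemma compact_dies:
  assumes gen: "generated C r \<S>" and y: "\<And>k. y k \<in> Hom C (Y k) (Y (Suc k))"
    and die: "\<And>s k f. s \<in> \<S> \<Longrightarrow> f \<in> Hom C s (Y k) \<Longrightarrow> \<exists>m. path C Y y k m \<cdot>\<^bsub>C\<^esub> f = Zero C s (Y (k + m))"
    and K: "B.cpt r K" and f: "f \<in> Hom D K (on_obj F (Y 0))"
  shows "\<exists>m. on_arr F (path C Y y 0 m) \<cdot>\<^bsub>D\<^esub> f = Zero D K (on_obj F (Y m))"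
proof -
  interpret G: generated C r \<S> by (rule gen)
  have YO: "Y k \<in> Obj C" for k using y A.Obj_Hom by blast
  obtain Q \<iota> where c: "is_coproduct C UNIV Y Q \<iota>" by (rule A.ex_coproduct[OF small_nat[OF A.size] YO])
  have Q: "Q \<in> Obj C" using A.is_coproduct_arr(1)[OF c] .
  have iA: "\<iota> k \<in> Hom C (Y k) Q" for k using A.is_coproduct_arr(3)[OF c] by blast
  have "\<iota> (Suc k) \<cdot>\<^bsub>C\<^esub> y k \<in> Hom C (Y k) Q" for k using A.Cmp_Hom[OF y iA] .
  then obtain \<sigma> where s: "\<sigma> \<in> Hom C Q Q"
    and s': "\<forall>k. \<sigma> \<cdot>\<^bsub>C\<^esub> \<iota> k = \<iota> (Suc k) \<cdot>\<^bsub>C\<^esub> y k"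
    using A.copr_map[OF c Q, of "\<lambda>k. \<iota> (Suc k) \<cdot>\<^bsub>C\<^esub> y k"] by auto
  note s = s s'[rule_format]
  let ?\<delta> = "Plus C (Idn C Q) (Neg C \<sigma>)"
  have "iso_arr C Q Q ?\<delta>" by (rule G.shift_map_iso[OF y die c s])
  then obtain \<tau> where t: "\<tau> \<in> Hom C Q Q" "?\<delta> \<cdot>\<^bsub>C\<^esub> \<tau> = Idn C Q" unfolding iso_arr_def by blast
  let ?FY = "\<lambda>k. on_obj F (Y k)" and ?Fi = "\<lambda>k. on_arr F (\<iota> k)"
  have Fc: "is_coproduct D UNIV ?FY (on_obj F Q) ?Fi" using F_coproduct[OF small_nat[OF A.size] c] .
  have FiH: "?Fi k \<in> Hom D (?FY k) (on_obj F Q)" for k using F_Hom[OF iA] .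
  have KO: "K \<in> Obj D" using K B.cpt_Obj by blast
  have FQ: "on_obj F Q \<in> Obj D" using Q by simp
  \<comment> \<open>The preimage of \<open>f\<close>, placed in summand 0, under 1 -
    F(\<sigma>).\<close>
  define g where "g = on_arr F \<tau> \<cdot>\<^bsub>D\<^esub> (?Fi 0 \<cdot>\<^bsub>D\<^esub> f)"
  have g: "g \<in> Hom D K (on_obj F Q)" unfolding g_def
    using B.Cmp_Hom[OF B.Cmp_Hom[OF f FiH] F_Hom[OF t(1)]] .
  have fs: "on_arr F \<sigma> \<in> Hom D (on_obj F Q) (on_obj F Q)" using F_Hom[OF s(1)] .
  have "on_arr F ?\<delta> \<cdot>\<^bsub>D\<^esub> on_arr F \<tau> = on_arr F (?\<delta> \<cdot>\<^bsub>C\<^esub> \<tau>)"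
    using s(1) t(1) Q by (intro F_Cmp[symmetric]) (simp_all add: Hom_iff)
  then have dt: "on_arr F ?\<delta> \<cdot>\<^bsub>D\<^esub> on_arr F \<tau> = Idn D (on_obj F Q)" using t(2) Q by simp
  have dH: "?\<delta> \<in> Hom C Q Q" using s(1) Q by (simp add: Hom_iff)
  have "on_arr F ?\<delta> \<cdot>\<^bsub>D\<^esub> g = ?Fi 0 \<cdot>\<^bsub>D\<^esub> f"
    unfolding g_def using B.reassoc[OF dt F_Hom[OF dH] F_Hom[OF t(1)] B.Cmp_Hom[OF f FiH]]
      B.Cmp_Hom[OF f FiH] by (simp add: Hom_iff)
  moreover have "on_arr F ?\<delta> \<cdot>\<^bsub>D\<^esub> g = Plus D g (Neg D (on_arr F \<sigma> \<cdot>\<^bsub>D\<^esub> g))"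
    using s(1) Q g by (simp add: Hom_iff)
  ultimately have e: "Plus D g (Neg D (on_arr F \<sigma> \<cdot>\<^bsub>D\<^esub> g)) = ?Fi 0 \<cdot>\<^bsub>D\<^esub> f" by simp
  have sg: "on_arr F \<sigma> \<cdot>\<^bsub>D\<^esub> g \<in> Hom D K (on_obj F Q)" using B.Cmp_Hom[OF g fs] .
  have "Plus D (?Fi 0 \<cdot>\<^bsub>D\<^esub> f) (on_arr F \<sigma> \<cdot>\<^bsub>D\<^esub> g) = g"
    unfolding e[symmetric] using g sg by (simp add: Hom_iff B.Plus_assoc)
  note ge = this[symmetric]
  let ?p = "\<lambda>k. B.prj UNIV ?FY (on_obj F Q) ?Fi k"
  have p: "?p k \<in> Hom D (on_obj F Q) (?FY k)" for k using B.prj(1)[OF Fc UNIV_I] .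
  have p': "?p k \<cdot>\<^bsub>D\<^esub> ?Fi l = (if l = k then Idn D (?FY k) else Zero D (?FY l) (?FY k))" for k l
    using B.prj(2)[OF Fc UNIV_I UNIV_I] .
  have Fs: "on_arr F \<sigma> \<cdot>\<^bsub>D\<^esub> ?Fi k = ?Fi (Suc k) \<cdot>\<^bsub>D\<^esub> on_arr F (y k)" for k
  proof -
    have "on_arr F \<sigma> \<cdot>\<^bsub>D\<^esub> ?Fi k = on_arr F (\<sigma> \<cdot>\<^bsub>C\<^esub> \<iota> k)"
      using s(1) iA[of k] by (simp add: Hom_iff)
    then show ?thesis using s(2)[of k] iA[of "Suc k"] y[of k] by (simp add: Hom_iff)
  qed
  have p0: "?p 0 \<cdot>\<^bsub>D\<^esub> on_arr F \<sigma> = Zero D (on_obj F Q) (?FY 0)"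
  proof (rule B.copr_zero[OF Fc B.Cmp_Hom[OF fs p]])
    fix k
    have "(?p 0 \<cdot>\<^bsub>D\<^esub> on_arr F \<sigma>) \<cdot>\<^bsub>D\<^esub> ?Fi k = ?p 0 \<cdot>\<^bsub>D\<^esub> (?Fi (Suc k) \<cdot>\<^bsub>D\<^esub> on_arr F (y k))"
      using B.Cmp_assoc[OF FiH fs p] Fs by simp
    also have "\<dots> = Zero D (?FY k) (?FY 0)"
      using B.reassoc[OF p'[of 0 "Suc k"] p FiH F_Hom[OF y]] y[of k] YO by (simp add: Hom_iff)
    finally show "(?p 0 \<cdot>\<^bsub>D\<^esub> on_arr F \<sigma>) \<cdot>\<^bsub>D\<^esub> ?Fi k = Zero D (?FY k) (?FY 0)" .
  qed
  have pS: "?p (Suc k) \<cdot>\<^bsub>D\<^esub> on_arr F \<sigma> = on_arr F (y k) \<cdot>\<^bsub>D\<^esub> ?p k" for k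
  proof (rule B.copr_eq[OF Fc B.Cmp_Hom[OF fs p] B.Cmp_Hom[OF p F_Hom[OF y]]])
    fix l
    have "(?p (Suc k) \<cdot>\<^bsub>D\<^esub> on_arr F \<sigma>) \<cdot>\<^bsub>D\<^esub> ?Fi l = ?p (Suc k) \<cdot>\<^bsub>D\<^esub> (?Fi (Suc l) \<cdot>\<^bsub>D\<^esub> on_arr F (y l))"
      using B.Cmp_assoc[OF FiH fs p] Fs by simp
    also have "\<dots> = (if l = k then on_arr F (y k) else Zero D (?FY l) (?FY (Suc k)))"
      using B.reassoc[OF p'[of "Suc k" "Suc l"] p FiH F_Hom[OF y]] y[of l] y[of k] YO by (simp add: Hom_iff)
    also have "\<dots> = (on_arr F (y k) \<cdot>\<^bsub>D\<^esub> ?p k) \<cdot>\<^bsub>D\<^esub> ?Fi l"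
      using B.Cmp_assoc[OF FiH[of l] p[of k] F_Hom[OF y[of k]]] p'[of k l] y[of k] YO by (simp add: Hom_iff)
    finally show "(?p (Suc k) \<cdot>\<^bsub>D\<^esub> on_arr F \<sigma>) \<cdot>\<^bsub>D\<^esub> ?Fi l = (on_arr F (y k) \<cdot>\<^bsub>D\<^esub> ?p k) \<cdot>\<^bsub>D\<^esub> ?Fi l" .
  qed
  have pge: "?p k \<cdot>\<^bsub>D\<^esub> g = Plus D (?p k \<cdot>\<^bsub>D\<^esub> (?Fi 0 \<cdot>\<^bsub>D\<^esub> f)) (?p k \<cdot>\<^bsub>D\<^esub> (on_arr F \<sigma> \<cdot>\<^bsub>D\<^esub> g))" for k
    using arg_cong[OF ge, of "\<lambda>x. ?p k \<cdot>\<^bsub>D\<^esub> x"] sg B.Cmp_Hom[OF f FiH] p[of k] by (simp add: Hom_iff)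
  \<comment> \<open>Comparing components in the equation for \<open>g\<close>: component 0 is
    \<open>f\<close>, and component k + 1 is the image of component k under
    \<open>y k\<close>.\<close>
  have gk: "?p k \<cdot>\<^bsub>D\<^esub> g = on_arr F (path C Y y 0 k) \<cdot>\<^bsub>D\<^esub> f" for k
  proof (induction k)
    case 0
    have "?p 0 \<cdot>\<^bsub>D\<^esub> (?Fi 0 \<cdot>\<^bsub>D\<^esub> f) = f" using B.reassoc[OF p'[of 0 0] p FiH f] f by (simp add: Hom_iff)
    moreover have "?p 0 \<cdot>\<^bsub>D\<^esub> (on_arr F \<sigma> \<cdot>\<^bsub>D\<^esub> g) = Zero D K (?FY 0)"
      using B.reassoc[OF p0 p fs g] g YO by (simp add: Hom_iff)
    ultimately show ?case using pge[of 0] f YO by (simp add: Hom_iff)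
  next
    case (Suc k)
    have pa: "path C Y y 0 k \<in> Hom C (Y 0) (Y k)" using A.path_Hom[where y = y and Y = Y, OF y, of 0 k] by simp
    have "?p (Suc k) \<cdot>\<^bsub>D\<^esub> (?Fi 0 \<cdot>\<^bsub>D\<^esub> f) = Zero D K (?FY (Suc k))"
      using B.reassoc[OF p'[of "Suc k" 0] p FiH f] f YO by (simp add: Hom_iff)
    moreover have "?p (Suc k) \<cdot>\<^bsub>D\<^esub> (on_arr F \<sigma> \<cdot>\<^bsub>D\<^esub> g) = on_arr F (y k) \<cdot>\<^bsub>D\<^esub> (?p k \<cdot>\<^bsub>D\<^esub> g)"
      using B.reassoc[OF pS p fs g] B.Cmp_assoc[OF g p F_Hom[OF y]] by simp
    moreover have "on_arr F (y k) \<cdot>\<^bsub>D\<^esub> (on_arr F (path C Y y 0 k) \<cdot>\<^bsub>D\<^esub> f) = on_arr F (path C Y y 0 (Suc k)) \<cdot>\<^bsub>D\<^esub> f"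
      using pa y[of k] f by (simp add: Hom_iff)
    moreover have "on_arr F (path C Y y 0 (Suc k)) \<cdot>\<^bsub>D\<^esub> f \<in> Hom D K (?FY (Suc k))"
      using pa y[of k] f by (simp add: Hom_iff)
    ultimately show ?case using pge[of "Suc k"] Suc KO YO by (simp add: Hom_iff)
  qed
  obtain J where J: "J \<subseteq> UNIV" "finite J" "B.cut UNIV ?FY (on_obj F Q) ?Fi J \<cdot>\<^bsub>D\<^esub> g = g"
    using B.cpt_cut[OF A.size K small_nat[OF A.size] Fc g] .
  \<comment> \<open>Any index outside the finite support of \<open>g\<close>.\<close>
  obtain m where m: "m \<notin> J" using J(2) by (meson ex_new_if_finite infinite_UNIV_nat)
  let ?c = "B.cut UNIV ?FY (on_obj F Q) ?Fi J"
  have cH: "?c \<in> Hom D (on_obj F Q) (on_obj F Q)" using B.cut(1)[OF Fc] .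
  have pc: "?p m \<cdot>\<^bsub>D\<^esub> ?c = Zero D (on_obj F Q) (?FY m)"
  proof (rule B.copr_zero[OF Fc B.Cmp_Hom[OF cH p]])
    fix k
    have "(?p m \<cdot>\<^bsub>D\<^esub> ?c) \<cdot>\<^bsub>D\<^esub> ?Fi k = ?p m \<cdot>\<^bsub>D\<^esub> (?c \<cdot>\<^bsub>D\<^esub> ?Fi k)" using B.Cmp_assoc[OF FiH cH p] .
    also have "\<dots> = Zero D (?FY k) (?FY m)"
      using B.cut(2)[OF Fc UNIV_I, of J k] p'[of m k] m p[of m] YO by (auto simp: Hom_def)
    finally show "(?p m \<cdot>\<^bsub>D\<^esub> ?c) \<cdot>\<^bsub>D\<^esub> ?Fi k = Zero D (?FY k) (?FY m)" .
  qed
  have "on_arr F (path C Y y 0 m) \<cdot>\<^bsub>D\<^esub> f = ?p m \<cdot>\<^bsub>D\<^esub> (?c \<cdot>\<^bsub>D\<^esub> g)" using gk J(3) by simp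
  also have "\<dots> = Zero D K (?FY m)" using B.reassoc[OF pc p cH g] g YO by (simp add: Hom_iff)
  finally show ?thesis by blast
qed

end

context generated
begin

section \<open>Factoring morphisms out of compact objects\<close>

definition factors :: "'o set \<Rightarrow> 'o \<Rightarrow> 'o \<Rightarrow> 'm \<Rightarrow> bool" where
  "factors \<T> K W f \<longleftrightarrow> (\<exists>T \<in> \<T>. \<exists>a \<in> Hom C K T. \<exists>b \<in> Hom C T W. b \<cdot> a = f)"

text \<open>The sum passes through the biproduct of the two intermediate objects, which is an
  extension and therefore again in \<T>.\<close>

lemma factors_Plus:
  assumes ext: "extension_closed C \<T>"
    and f: "factors \<T> K W f" and g: "factors \<T> K W g"
  shows "factors \<T> K W (Plus C f g)"
proof -
  obtain T a b where T: "T \<in> \<T>" "a \<in> Hom C K T" "b \<in> Hom C T W" "b \<cdot> a = f"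
    using f unfolding factors_def by blast
  obtain T' a' b' where T': "T' \<in> \<T>" "a' \<in> Hom C K T'" "b' \<in> Hom C T' W" "b' \<cdot> a' = g"
    using g unfolding factors_def by blast
  have O: "T \<in> Obj C" "T' \<in> Obj C" using T T' Obj_Hom by blast+
  obtain P where P: "is_biproduct C T T' P" using ex_biproduct O by blast
  then have PT: "P \<in> \<T>" using ext[unfolded extension_closed_def] has_triangle_biproduct T(1) T'(1) by blast
  obtain i1 i2 p1 p2 where i: "T \<in> Obj C" "T' \<in> Obj C" "P \<in> Obj C"
    "i1 \<in> Hom C T P" "i2 \<in> Hom C T' P" "p1 \<in> Hom C P T" "p2 \<in> Hom C P T'"
    "p1 \<cdot> i1 = Idn C T" "p2 \<cdot> i2 = Idn C T'" "p2 \<cdot> i1 = Zero C T T'" "p1 \<cdot> i2 = Zero C T' T"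
    using P by (rule is_biproductE)
  have W: "W \<in> Obj C" "K \<in> Obj C" using T Obj_Hom by blast+
  have 1: "p1 \<cdot> (i1 \<cdot> x) = x" "p2 \<cdot> (i1 \<cdot> x) = Zero C K T'" if "x \<in> Hom C K T" for x
    using that reassoc[OF i(8,6,4) that] reassoc[OF i(10,7,4) that] i by (simp_all add: Hom_iff)
  have 2: "p2 \<cdot> (i2 \<cdot> x) = x" "p1 \<cdot> (i2 \<cdot> x) = Zero C K T" if "x \<in> Hom C K T'" for x
    using that reassoc[OF i(9,7,5) that] reassoc[OF i(11,6,5) that] i by (simp_all add: Hom_iff)
  let ?a = "Plus C (i1 \<cdot> a) (i2 \<cdot> a')" and ?b = "Plus C (b \<cdot> p1) (b' \<cdot> p2)"
  have "?a \<in> Hom C K P" "?b \<in> Hom C P W" using T T' i(1-7) by (simp_all add: Hom_iff)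
  moreover have "?b \<cdot> ?a = Plus C (b \<cdot> a) (b' \<cdot> a')"
    using T(2,3) T'(2,3) i(1-7) W 1[OF T(2)] 2[OF T'(2)] by (simp add: Hom_iff)
  ultimately show ?thesis using PT T(4) T'(4) unfolding factors_def by metis
qed

lemma factors_left:
  assumes "factors \<T> K W f" "g \<in> Hom C W W'" shows "factors \<T> K W' (g \<cdot> f)"
proof -
  obtain T a b where T: "T \<in> \<T>" "a \<in> Hom C K T" "b \<in> Hom C T W" "b \<cdot> a = f"
    using assms unfolding factors_def by blast
  have "(g \<cdot> b) \<cdot> a = g \<cdot> f" using Cmp_assoc[OF T(2,3) assms(2)] T(4) by simp
  then show ?thesis using T Cmp_Hom[OF T(3) assms(2)] unfolding factors_def by blast
qed

lemma factors_coproduct: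
  assumes ext: "extension_closed C \<T>"
    and T0: "T0 \<in> \<T>" "T0 \<in> Obj C" and K: "cpt r K" and I: "small r I" and c: "is_coproduct C I X Q \<iota>"
    and X: "\<And>i. i \<in> I \<Longrightarrow> X i \<in> \<T>" and f: "f \<in> Hom C K Q"
  shows "factors \<T> K Q f"
proof -
  note i = is_coproduct_arr[OF c]
  have KO: "K \<in> Obj C" using K cpt_Obj by blast
  obtain J where J: "J \<subseteq> I" "finite J" "cut I X Q \<iota> J \<cdot> f = f" using cpt_cut[OF size K I c f] .
  have "factors \<T> K Q (cut I X Q \<iota> J \<cdot> f)"
  proof (rule cut_induct[OF c f J(2,1)])
    have "Zero C K T0 \<in> Hom C K T0" "Zero C T0 Q \<in> Hom C T0 Q" "Zero C T0 Q \<cdot> Zero C K T0 = Zero C K Q"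
      using KO T0 i(1) by (simp_all add: Hom_iff)
    then show "factors \<T> K Q (Zero C K Q)" using T0 unfolding factors_def by blast
  next
    fix j g assume "j \<in> I" "g \<in> Hom C K (X j)"
    then show "factors \<T> K Q (\<iota> j \<cdot> g)" using X i(3) unfolding factors_def by blast
  qed (rule factors_Plus[OF ext])
  then show ?thesis using J by simp
qed

text \<open>Goes back one step of a sequence. The factorization of \<open>p \<cdot> f\<close>
  through some T need not lift to \<open>W\<close>; the obstruction is \<open>h \<cdot> b\<close>.
  Replacing T by the fibre of a suitable T \<rightarrow> T' removes the obstruction while
  \<open>a\<close> still lifts, and what then remains of \<open>f\<close> comes from the coproduct
  \<open>Q\<close>.\<close>

lemma factors_extension:
  assumes ext: "extension_closed C \<T>"
    and fib: "fibre_closed C \<T>"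
    and Tc: "\<forall>T \<in> \<T>. cpt r T" and ST: "\<S> \<subseteq> \<T>"
    and K: "cpt r K" and I: "small r I" and c: "is_coproduct C I X Q \<iota>" and X: "\<And>i. i \<in> I \<Longrightarrow> X i \<in> \<S>"
    and t: "tri C Q W R q p h" and f: "f \<in> Hom C K W" and pf: "factors \<T> K R (p \<cdot> f)"
  shows "factors \<T> K W f"
proof -
  note qD = triD[OF t]
  have KO: "K \<in> Obj C" using K cpt_Obj by blast
  have O: "Q \<in> Obj C" "W \<in> Obj C" "R \<in> Obj C" using tri_Obj[OF t] by blast+
  obtain T a b where T: "T \<in> \<T>" "a \<in> Hom C K T" "b \<in> Hom C T R" "b \<cdot> a = p \<cdot> f"
    using pf unfolding factors_def by blast
  have TO: "T \<in> Obj C" using T Obj_Hom by blast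
  have hb: "h \<cdot> b \<in> Hom C T (S Q)" using Cmp_Hom[OF T(3) qD(4)] .
  obtain Z a1 a2 where tK: "tri C K T Z a a1 a2" using tri_ex[OF T(2)] by blast
  note aD = triD[OF tK]
  have "cpt r Z" using cpt_cone[of K T Z r] tK K Tc T(1) unfolding has_triangle_tri by blast
  note Zc = this
  \<comment> \<open>The obstruction vanishes on \<open>K\<close>, so it factors through the cone
    \<open>Z\<close> of \<open>a\<close>. This cone is compact, hence its map to the coproduct
    \<open>S Q\<close> passes through some T' in \<T>.\<close>
  have "(h \<cdot> b) \<cdot> a = h \<cdot> (p \<cdot> f)" using Cmp_assoc[OF T(2,3) qD(4)] T(4) by simp
  also have "\<dots> = Zero C K (S Q)" using reassoc[OF tri_comp_zero2[OF t] qD(4,3) f] f O by (simp add: Hom_iff)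
  finally obtain d where d: "d \<in> Hom C Z (S Q)" "d \<cdot> a1 = h \<cdot> b" using tri_con1[OF tK hb] by blast
  have "factors \<T> Z (S Q) d"
    by (rule factors_coproduct[OF ext T(1) TO Zc I is_coproduct_S[OF c] _ d(1)]) (use X S_up ST in auto)
  then obtain T' d1 d2 where T': "T' \<in> \<T>" "d1 \<in> Hom C Z T'" "d2 \<in> Hom C T' (S Q)" "d2 \<cdot> d1 = d"
    unfolding factors_def by blast
  have da: "d1 \<cdot> a1 \<in> Hom C T T'" using Cmp_Hom[OF aD(3) T'(2)] .
  obtain B x0 y0 where "tri C T T' B (d1 \<cdot> a1) x0 y0" using tri_ex[OF da] by blast
  have BO: "B \<in> Obj C" using tri_Obj \<open>tri C T T' B (d1 \<cdot> a1) x0 y0\<close> by blast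
  obtain V where V: "V \<in> Obj C" "S V = B" using S_surj BO by blast
  have "tri C T T' (S V) (d1 \<cdot> a1) x0 y0" using V \<open>tri C T T' B (d1 \<cdot> a1) x0 y0\<close> by simp
  then obtain v where tV: "tri C V T T' v (d1 \<cdot> a1) x0" using tri_rotinv V(1) by blast
  \<comment> \<open>\<open>V\<close> is the fibre of the composite T \<rightarrow> Z \<rightarrow>
    T'. The obstruction vanishes on it, and \<open>a\<close> lifts to it because T \<rightarrow> Z
    kills \<open>a\<close>.\<close>
  have VT: "V \<in> \<T>" using fib tV T(1) T'(1) unfolding fibre_closed_def has_triangle_tri by blast
  note vD = triD[OF tV]
  have T'O: "T' \<in> Obj C" using tri_Obj[OF tV] by blast
  have "(d1 \<cdot> a1) \<cdot> a = d1 \<cdot> (a1 \<cdot> a)" using Cmp_assoc[OF aD(2,3) T'(2)] .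
  also have "\<dots> = Zero C K T'" using tri_comp_zero[OF tK] T'(2) KO by (simp add: Hom_iff)
  finally obtain a' where a': "a' \<in> Hom C K V" "v \<cdot> a' = a" using tri_cov1[OF tV T(2)] by blast
  have bv: "b \<cdot> v \<in> Hom C V R" using Cmp_Hom[OF vD(2) T(3)] .
  have "h \<cdot> (b \<cdot> v) = (h \<cdot> b) \<cdot> v" using Cmp_assoc[OF vD(2) T(3) qD(4)] by simp
  also have "\<dots> = d2 \<cdot> ((d1 \<cdot> a1) \<cdot> v)" unfolding d(2)[symmetric] T'(4)[symmetric]
    using T'(2,3) aD(2-3) vD(2) by (simp add: Hom_iff)
  also have "\<dots> = Zero C V (S Q)" unfolding tri_comp_zero[OF tV] using T'(3) V O by (simp add: Hom_iff)
  finally obtain w where w: "w \<in> Hom C V W" "p \<cdot> w = b \<cdot> v" using tri_cov2[OF t bv] by blast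
  \<comment> \<open>This difference dies in \<open>R\<close>, so it factors through \<open>Q\<close>
    and, \<open>K\<close> being compact, through \<T>.\<close>
  let ?u = "Plus C f (Neg C (w \<cdot> a'))"
  have u: "?u \<in> Hom C K W" using f w(1) a'(1) by (simp add: Hom_iff)
  have "p \<cdot> (w \<cdot> a') = p \<cdot> f" using reassoc[OF w(2) qD(3) w(1) a'(1)] Cmp_assoc[OF a'(1) vD(2) T(3)] a'(2) T(4) by simp
  then have "p \<cdot> ?u = Zero C K R" using f w(1) a'(1) qD by (simp add: Hom_iff)
  then obtain z where z: "z \<in> Hom C K Q" "q \<cdot> z = ?u" using tri_cov1[OF t u] by blast
  have "factors \<T> K Q z" by (rule factors_coproduct[OF ext T(1) TO K I c _ z(1)]) (use X ST in auto)
  then have 1: "factors \<T> K W (q \<cdot> z)" using factors_left qD(2) by blast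
  have 2: "factors \<T> K W (w \<cdot> a')" using VT w(1) a'(1) unfolding factors_def by blast
  have "f = Plus C (w \<cdot> a') (q \<cdot> z)" unfolding z(2)
    using f w(1) a'(1) by (simp add: Hom_iff Plus_left_comm[of "w \<cdot> a'" f])
  then show ?thesis using factors_Plus[OF ext 2 1] by simp
qed

lemma Hom_family_small:
  assumes "X \<in> Obj C" shows "small r (SIGMA s:\<S>. Hom C s X)"
proof (rule small_Sigma[OF size S_small])
  show "small r (Hom C s X)" if "s \<in> \<S>" for s
    using loc_small assms S_Obj[OF that] unfolding locally_small_def by simp
qed

text \<open>The coproduct runs over all morphisms from generators to \<open>X\<close>. An index is a
  pair of a source and a morphism, so \<open>fst\<close> is the family of summands and
  \<open>snd\<close> defines the map to \<open>X\<close>.\<close>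

lemma kill_step:
  assumes X: "X \<in> Obj C"
  shows "\<exists>Q X' q p h (\<iota> :: 'o \<times> 'm \<Rightarrow> 'm). tri C Q X X' q p h \<and> is_coproduct C (SIGMA s:\<S>. Hom C s X) fst Q \<iota> \<and>
    (\<forall>s \<in> \<S>. \<forall>f \<in> Hom C s X. p \<cdot> f = Zero C s X')"
proof -
  let ?I = "SIGMA s:\<S>. Hom C s X"
  have I: "small r ?I" by (rule Hom_family_small[OF X])
  have fO: "fst i \<in> Obj C" if "i \<in> ?I" for i using that S_Obj by auto
  obtain Q and \<iota> :: "'o \<times> 'm \<Rightarrow> 'm" where c: "is_coproduct C ?I fst Q \<iota>"
    by (rule ex_coproduct[OF I, of fst, OF fO])
  obtain q where q: "q \<in> Hom C Q X" "\<And>i. i \<in> ?I \<Longrightarrow> q \<cdot> \<iota> i = snd i"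
    by (rule copr_map[OF c X, of snd]) auto
  obtain X' p h where t: "tri C Q X X' q p h" using tri_ex[OF q(1)] by blast
  note pD = triD[OF t]
  have "p \<cdot> f = Zero C s X'" if "s \<in> \<S>" "f \<in> Hom C s X" for s f
  proof -
    have j: "(s, f) \<in> ?I" using that by blast
    have "p \<cdot> f = p \<cdot> (q \<cdot> \<iota> (s, f))" using q(2)[OF j] by simp
    also have "\<dots> = Zero C s X'"
      using reassoc[OF tri_comp_zero[OF t] pD(3) q(1) is_coproduct_arr(3)[OF c j]]
        is_coproduct_arr(4-6)[OF c j] tri_Obj[OF t] by simp
    finally show ?thesis .
  qed
  then show ?thesis using t c by blast
qed

text \<open>Killing all morphisms from generators again and again, starting with \<open>K\<close>,
  gives a sequence along which the identity of \<open>K\<close> dies after finitely many steps. Zero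
  factors through \<T>, and \<open>factors_extension\<close> carries this back to the
  identity.\<close>

theorem compact_retract:
  assumes ext: "extension_closed C \<T>"
    and fib: "fibre_closed C \<T>"
    and Tc: "\<forall>T \<in> \<T>. cpt r T" and ST: "\<S> \<subseteq> \<T>" and T0: "T0 \<in> \<T>"
    and K: "cpt r K"
  shows "\<exists>T \<in> \<T>. \<exists>a \<in> Hom C K T. \<exists>b \<in> Hom C T K. b \<cdot> a = Idn C K"
proof -
  have KO: "K \<in> Obj C" using K cpt_Obj by blast
  have "\<forall>X. \<exists>Q X' q p h. \<exists>\<iota> :: 'o \<times> 'm \<Rightarrow> 'm. X \<in> Obj C \<longrightarrow> tri C Q X X' q p h \<and>
    is_coproduct C (SIGMA s:\<S>. Hom C s X) fst Q \<iota> \<and> (\<forall>s \<in> \<S>. \<forall>f \<in> Hom C s X. p \<cdot> f = Zero C s X')"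
    using kill_step by blast
  then obtain nQ nX nq np nh and n\<iota> :: "'o \<Rightarrow> 'o \<times> 'm \<Rightarrow> 'm" where
    n: "\<And>X. X \<in> Obj C \<Longrightarrow> tri C (nQ X) X (nX X) (nq X) (np X) (nh X)"
    "\<And>X. X \<in> Obj C \<Longrightarrow> is_coproduct C (SIGMA s:\<S>. Hom C s X) fst (nQ X) (n\<iota> X)"
    "\<And>X s f. X \<in> Obj C \<Longrightarrow> s \<in> \<S> \<Longrightarrow> f \<in> Hom C s X \<Longrightarrow> np X \<cdot> f = Zero C s (nX X)"
    by metis
  define Y where "Y k = (nX ^^ k) K" for k
  define y where "y k = np (Y k)" for k
  have YO: "Y k \<in> Obj C" for k
  proof (induction k)
    case (Suc k)
    have "Y (Suc k) = nX (Y k)" by (simp add: Y_def)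
    then show ?case using tri_Obj[OF n(1)[OF Suc]] by simp
  qed (simp add: Y_def KO)
  have tY: "tri C (nQ (Y k)) (Y k) (Y (Suc k)) (nq (Y k)) (y k) (nh (Y k))" for k
    using n(1)[OF YO[of k]] by (simp add: Y_def y_def)
  have y: "y k \<in> Hom C (Y k) (Y (Suc k))" for k using triD(3)[OF tY] .
  have die: "\<exists>m. path C Y y k m \<cdot> f = Zero C s (Y (k + m))" if "s \<in> \<S>" "f \<in> Hom C s (Y k)" for s k f
  proof -
    have "y k \<cdot> f = Zero C s (Y (Suc k))" using n(3)[OF YO that] by (simp add: Y_def y_def)
    then have "path C Y y k 1 \<cdot> f = Zero C s (Y (k + 1))"
      using y[of k] YO by (simp add: Hom_iff)
    then show ?thesis by blast
  qed
  interpret idF: add_functor C C idF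
    by unfold_locales (auto simp: additive_functor_def is_functor_def idF_def)
  interpret idF: coproduct_functor C C idF r
    by unfold_locales (simp add: preserves_coproducts_def idF_def)
  have "Idn C K \<in> Hom C K (on_obj idF (Y 0))" using KO by (simp add: Y_def idF_def Hom_iff)
  from idF.compact_dies[OF generated_axioms y die K this]
  obtain m where m: "path C Y y 0 m \<cdot> Idn C K = Zero C K (Y m)" by (auto simp: idF_def)
  \<comment> \<open>\<open>m\<close> counts the steps after which \<open>f\<close> has died; the
    induction goes from \<open>Y (Suc k)\<close> back to \<open>Y k\<close>, and \<open>T0\<close>
    serves the zero morphism.\<close>
  have fac: "factors \<T> K (Y k) f" if "f \<in> Hom C K (Y k)" "path C Y y k m \<cdot> f = Zero C K (Y (k + m))" for k m f
    using that
  proof (induction m arbitrary: k f)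
    case 0
    have T0O: "T0 \<in> Obj C" using Tc T0 cpt_Obj by blast
    have "f = Zero C K (Y k)" using 0 YO by (simp add: Hom_iff)
    moreover have "Zero C K T0 \<in> Hom C K T0" "Zero C T0 (Y k) \<in> Hom C T0 (Y k)"
      "Zero C T0 (Y k) \<cdot> Zero C K T0 = Zero C K (Y k)"
      using KO T0O YO by (simp_all add: Hom_iff)
    ultimately show ?case using T0 unfolding factors_def by blast
  next
    case (Suc m)
    have yf: "y k \<cdot> f \<in> Hom C K (Y (Suc k))" using Cmp_Hom[OF Suc.prems(1) y] .
    have "path C Y y (Suc k) m \<cdot> (y k \<cdot> f) = path C Y y k (Suc m) \<cdot> f"
      using Cmp_assoc[OF Suc.prems(1) y path_Hom[where y = y and Y = Y, OF y]] path_Suc[where y = y and Y = Y, OF y] by simp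
    then have "factors \<T> K (Y (Suc k)) (y k \<cdot> f)" using Suc.IH[OF yf] Suc.prems(2) by simp
    then show ?case
      by (rule factors_extension[OF ext fib Tc ST K Hom_family_small[OF YO] n(2)[OF YO] _ tY Suc.prems(1), rotated 1]) auto
  qed
  have "path C Y y 0 m \<cdot> Idn C K = Zero C K (Y (0 + m))" using m by simp
  moreover have "Idn C K \<in> Hom C K (Y 0)" "Y 0 = K" using KO by (simp_all add: Y_def Hom_iff)
  ultimately show ?thesis using fac[of "Idn C K" 0 m] unfolding factors_def by auto
qed

end


section \<open>Objects built from shifts of a generator\<close>

context category
begin

lemma is_coproduct_Sigma:
  assumes c: "\<And>j. j \<in> J \<Longrightarrow> is_coproduct C (I j) (X j) (Y j) (\<iota> j)" and d: "is_coproduct C J Y P \<kappa>"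
  shows "is_coproduct C (Sigma J I) (\<lambda>(j, i). X j i) P (\<lambda>(j, i). \<kappa> j \<cdot> \<iota> j i)"
proof (rule is_coproductI)
  note k = is_coproduct_arr[OF d]
  note i = is_coproduct_arr[OF c]
  show "P \<in> Obj C" by (rule k(1))
  show "(case x of (j, i) \<Rightarrow> X j i) \<in> Obj C" if "x \<in> Sigma J I" for x
    using that i(2) by auto
  show "(case x of (j, i) \<Rightarrow> \<kappa> j \<cdot> \<iota> j i) \<in> Hom C (case x of (j, i) \<Rightarrow> X j i) P" if "x \<in> Sigma J I" for x
    using that Cmp_Hom[OF i(3) k(3)] by auto
  fix V f assume V: "V \<in> Obj C" and f: "\<And>x. x \<in> Sigma J I \<Longrightarrow> f x \<in> Hom C (case x of (j, i) \<Rightarrow> X j i) V"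
  have "\<exists>h. h \<in> Hom C (Y j) V \<and> (\<forall>l \<in> I j. h \<cdot> \<iota> j l = f (j, l))" if j: "j \<in> J" for j
  proof -
    have "f (j, l) \<in> Hom C (X j l) V" if "l \<in> I j" for l using f[of "(j, l)"] j that by simp
    from copr_map[OF c[OF j] V, of "\<lambda>l. f (j, l)", OF this] show ?thesis by metis
  qed
  then obtain h where h: "\<And>j. j \<in> J \<Longrightarrow> h j \<in> Hom C (Y j) V" "\<And>j l. j \<in> J \<Longrightarrow> l \<in> I j \<Longrightarrow> h j \<cdot> \<iota> j l = f (j, l)"
    by metis
  obtain g where g: "g \<in> Hom C P V" "\<And>j. j \<in> J \<Longrightarrow> g \<cdot> \<kappa> j = h j" by (rule copr_map[OF d V h(1)]) auto
  have "g \<cdot> (\<kappa> j \<cdot> \<iota> j l) = f (j, l)" if "j \<in> J" "l \<in> I j" for j l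
    using reassoc[OF g(2) g(1) k(3) i(3), OF that(1) that(1) that] h(2)[OF that] by simp
  then show "\<exists>h \<in> Hom C P V. \<forall>x \<in> Sigma J I. h \<cdot> (case x of (j, i) \<Rightarrow> \<kappa> j \<cdot> \<iota> j i) = f x"
    using g(1) by auto
next
  note k = is_coproduct_arr[OF d]
  note i = is_coproduct_arr[OF c]
  fix V h h' assume h: "h \<in> Hom C P V" "h' \<in> Hom C P V"
    and eq: "\<And>x. x \<in> Sigma J I \<Longrightarrow> h \<cdot> (case x of (j, i) \<Rightarrow> \<kappa> j \<cdot> \<iota> j i) = h' \<cdot> (case x of (j, i) \<Rightarrow> \<kappa> j \<cdot> \<iota> j i)"
  show "h = h'"
  proof (rule copr_eq[OF d h])
    fix j assume j: "j \<in> J"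
    show "h \<cdot> \<kappa> j = h' \<cdot> \<kappa> j"
    proof (rule copr_eq[OF c[OF j] Cmp_Hom[OF k(3)[OF j] h(1)] Cmp_Hom[OF k(3)[OF j] h(2)]])
      fix l assume l: "l \<in> I j"
      have "h \<cdot> (\<kappa> j \<cdot> \<iota> j l) = h' \<cdot> (\<kappa> j \<cdot> \<iota> j l)" using eq[of "(j, l)"] j l by simp
      then show "(h \<cdot> \<kappa> j) \<cdot> \<iota> j l = (h' \<cdot> \<kappa> j) \<cdot> \<iota> j l"
        using Cmp_assoc[OF i(3)[OF j l] k(3)[OF j] h(1)] Cmp_assoc[OF i(3)[OF j l] k(3)[OF j] h(2)] by simp
    qed
  qed
qed

end

lemma (in additive_category) is_coproduct_zero:
  assumes "zero_object C Z" shows "is_coproduct C {} X Z \<iota>"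
proof (rule is_coproductI)
  show Z: "Z \<in> Obj C" using assms zero_object_iff by blast
  fix Y f assume "Y \<in> Obj C"
  then have "Zero C Z Y \<in> Hom C Z Y" using Z by (simp add: Hom_iff)
  then show "\<exists>h \<in> Hom C Z Y. \<forall>i \<in> {}. h \<cdot> \<iota> i = f i" by blast
next
  fix Y h h' assume "h \<in> Hom C Z Y" "h' \<in> Hom C Z Y"
  then show "h = h'" using zero_object_hom(2)[OF assms] by metis
qed simp_all

context tri_coproducts
begin

section \<open>Closure under coproducts and iterated extensions\<close>

lemma AddI:
  fixes I :: "'i set"
  assumes I: "small r I" and X: "\<And>i. i \<in> I \<Longrightarrow> X i \<in> A" and c: "is_coproduct C I X P \<iota>"
  shows "P \<in> Add r C A"
proof -
  obtain e :: "'i \<Rightarrow> 'u" where e: "inj_on e I" by (rule small_inj[OF size I])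
  let ?d = "the_inv_into I e"
  have de: "?d (e i) = i" if "i \<in> I" for i using the_inv_into_f_f[OF e that] .
  have d: "bij_betw ?d (e ` I) I" using e by (simp add: bij_betw_the_inv_into inj_on_imp_bij_betw)
  have "is_coproduct C (e ` I) (\<lambda>j. X (?d j)) P (\<lambda>j. \<iota> (?d j))" by (rule is_coproduct_reindex[OF c d])
  moreover have "\<forall>j \<in> e ` I. X (?d j) \<in> A" using X de by auto
  moreover have "small r (e ` I)" using small_image[OF size I] .
  ultimately show ?thesis unfolding Add_def mem_Collect_eq by (intro exI conjI)
qed

lemma AddE:
  assumes "P \<in> Add r C A"
  obtains I :: "'u set" and X \<iota> where "small r I" "\<forall>i \<in> I. X i \<in> A" "is_coproduct C I X P \<iota>"
  using assms unfolding Add_def by blast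

lemma Add_Obj: "P \<in> Add r C A \<Longrightarrow> P \<in> Obj C"
  by (elim AddE) (rule is_coproduct_arr(1))

lemma Add_mono: "A \<subseteq> B \<Longrightarrow> Add r C A \<subseteq> Add r C B"
  unfolding Add_def by blast

lemma Add_zero: "zero_object C Z \<Longrightarrow> Z \<in> Add r C A"
  by (rule AddI[OF small_finite[OF size finite.emptyI] _ is_coproduct_zero]) simp_all

lemma Add_isom: assumes "X \<in> A" "isom C X Y" shows "Y \<in> Add r C A"
proof -
  obtain f where "iso_arr C X Y f" using assms unfolding isom_def by blast
  then have "is_coproduct C {()} (\<lambda>_. X) Y (\<lambda>_. f)" by (intro is_coproduct_singleton)
  then show ?thesis by (rule AddI[rotated 2]) (use small_finite[OF size, of "{()}"] assms(1) in simp_all)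
qed

lemma Add_self: "X \<in> A \<Longrightarrow> X \<in> Obj C \<Longrightarrow> X \<in> Add r C A"
  using Add_isom isom_refl by blast

lemma Add_coproduct:
  assumes J: "small r J" and Y: "\<And>j. j \<in> J \<Longrightarrow> Y j \<in> Add r C A" and c: "is_coproduct C J Y P \<kappa>"
  shows "P \<in> Add r C A"
proof -
  have "\<exists>(I :: 'u set) X \<iota>. small r I \<and> (\<forall>i \<in> I. X i \<in> A) \<and> is_coproduct C I X (Y j) \<iota>" if "j \<in> J" for j
    using Y[OF that] unfolding Add_def by blast
  then obtain I :: "_ \<Rightarrow> 'u set" and X \<iota> where I: "\<And>j. j \<in> J \<Longrightarrow> small r (I j)" "\<And>j i. j \<in> J \<Longrightarrow> i \<in> I j \<Longrightarrow> X j i \<in> A"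
    "\<And>j. j \<in> J \<Longrightarrow> is_coproduct C (I j) (X j) (Y j) (\<iota> j)" by metis
  show ?thesis
    by (rule AddI[OF small_Sigma[OF size J I(1)] _ is_coproduct_Sigma[OF I(3) c]]) (use I(2) in auto)
qed

lemma Add_shift: assumes "P \<in> Add r C A" shows "shift C n P \<in> Add r C (shift C n ` A)"
proof -
  obtain I :: "'u set" and X \<iota> where I: "small r I" "\<forall>i \<in> I. X i \<in> A" and c: "is_coproduct C I X P \<iota>"
    using assms by (rule AddE)
  obtain \<iota>' where "is_coproduct C I (\<lambda>i. shift C n (X i)) (shift C n P) \<iota>'" using is_coproduct_shift[OF c] by blast
  then show ?thesis by (rule AddI[OF I(1), rotated]) (use I(2) in blast)
qed

text \<open>\<open>cp n\<close> is the \<open>(n + 1)\<close>-fold extension closure, for an arbitrary set of building blocks.\<close>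

primrec cp :: "nat \<Rightarrow> 'o set \<Rightarrow> 'o set" where
  "cp 0 A = Add r C A"
| "cp (Suc n) A = star C (Add r C A) (cp n A)"

lemma Coprod_cp: "Coprod r C (Suc n) G a b = cp n (shifts C G a b)"
  by (induction n) simp_all

lemma starE:
  assumes "x \<in> star C A B" obtains a b where "a \<in> A" "b \<in> B" "has_triangle C a x b"
  using assms unfolding star_def by blast

lemma starI: "has_triangle C a x b \<Longrightarrow> a \<in> A \<Longrightarrow> b \<in> B \<Longrightarrow> x \<in> star C A B"
  unfolding star_def using has_triangle_Obj by blast

lemma star_mono: "A \<subseteq> A' \<Longrightarrow> B \<subseteq> B' \<Longrightarrow> star C A B \<subseteq> star C A' B'"
  unfolding star_def by blast

lemma cp_Obj: "x \<in> cp n A \<Longrightarrow> x \<in> Obj C"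
  by (cases n) (auto simp: Add_Obj star_def)

lemma cp_mono: "A \<subseteq> B \<Longrightarrow> cp n A \<subseteq> cp n B"
  by (induction n) (simp_all add: Add_mono star_mono)

text \<open>Coproducts of triangles are triangles, so the layers can be summed one by one.\<close>

lemma cp_coproduct:
  assumes "small r I" "\<And>i. i \<in> I \<Longrightarrow> X i \<in> cp n A" "is_coproduct C I X P \<iota>"
  shows "P \<in> cp n A"
  using assms
proof (induction n arbitrary: X P \<iota>)
  case 0
  then show ?case using Add_coproduct[OF 0(1) _ 0(3)] by simp
next
  case (Suc n)
  have "\<exists>a b. a \<in> Add r C A \<and> b \<in> cp n A \<and> has_triangle C a (X i) b" if "i \<in> I" for i
    using Suc.prems(2)[OF that] by (auto simp: star_def)
  then obtain a b where ab: "\<And>i. i \<in> I \<Longrightarrow> a i \<in> Add r C A" "\<And>i. i \<in> I \<Longrightarrow> b i \<in> cp n A"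
    "\<And>i. i \<in> I \<Longrightarrow> has_triangle C (a i) (X i) (b i)" by metis
  obtain Q \<kappa> where Q: "is_coproduct C I a Q \<kappa>" by (rule ex_coproduct[OF Suc.prems(1), of a, OF Add_Obj[OF ab(1)]])
  obtain R \<mu> where R: "is_coproduct C I b R \<mu>" by (rule ex_coproduct[OF Suc.prems(1), of b, OF cp_Obj[OF ab(2)]])
  have "Q \<in> Add r C A" by (rule Add_coproduct[OF Suc.prems(1) ab(1) Q])
  moreover have "R \<in> cp n A" by (rule Suc.IH[OF Suc.prems(1) ab(2) R])
  moreover have "has_triangle C Q P R" by (rule coproduct_triangle[OF ab(3) Q Suc.prems(3) R])
  ultimately show ?case using starI by simp
qed

lemma cp_Suc: "cp n A \<subseteq> cp (Suc n) A"
proof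
  fix x assume x: "x \<in> cp n A"
  obtain N where N: "zero_object C N" using ex_zero_object by blast
  then show "x \<in> cp (Suc n) A" using starI[OF has_triangle_left_zero[OF cp_Obj[OF x] N] Add_zero x] by simp
qed

lemma cp_le: "m \<le> n \<Longrightarrow> cp m A \<subseteq> cp n A"
  by (induction n rule: dec_induct) (use cp_Suc in blast)+

text \<open>Rebracketing, one layer of the left factor at a time. As \<open>cp m\<close> has m + 1
  layers, the layers add up to m + n + 2, which is \<open>cp (Suc (m + n))\<close>.\<close>

lemma star_cp: "x \<in> star C (cp m A) (cp n A) \<Longrightarrow> x \<in> cp (Suc (m + n)) A"
proof (induction m arbitrary: x)
  case (Suc m)
  obtain u v where uv: "u \<in> cp (Suc m) A" "v \<in> cp n A" "has_triangle C u x v" using Suc.prems by (rule starE)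
  then have "u \<in> star C (Add r C A) (cp m A)" by simp
  then obtain p q where pq: "p \<in> Add r C A" "q \<in> cp m A" "has_triangle C p u q" by (rule starE)
  obtain w where w: "has_triangle C p x w" "has_triangle C q w v" by (rule octahedral1[OF uv(3) pq(3)])
  have "w \<in> cp (Suc (m + n)) A" by (rule Suc.IH[OF starI[OF w(2) pq(2) uv(2)]])
  then have "x \<in> star C (Add r C A) (cp (Suc (m + n)) A)" using starI[OF w(1) pq(1)] by blast
  then show ?case by simp
qed simp

lemma cp_shift: "x \<in> cp n A \<Longrightarrow> shift C k x \<in> cp n (shift C k ` A)"
proof (induction n arbitrary: x)
  case (Suc n)
  then obtain a b where "a \<in> Add r C A" "b \<in> cp n A" "has_triangle C a x b" by (auto elim: starE)
  then show ?case using starI[OF has_triangle_shift Add_shift Suc.IH] by simp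
qed (simp add: Add_shift)

text \<open>The swindle, rotated, gives Q \<rightarrow> X \<rightarrow> \<Sigma>Q with Q a countable
  sum of copies of \<open>P\<close>. A direct summand is thus traded for twice the number of layers
  and one further suspension.\<close>

lemma cp_retract:
  assumes P: "P \<in> cp n A" and ab: "a \<in> Hom C X P" "b \<in> Hom C P X" "b \<cdot> a = Idn C X"
  shows "X \<in> cp (Suc (n + n)) (A \<union> shift C 1 ` A)"
proof -
  have PO: "P \<in> Obj C" using cp_Obj[OF P] .
  obtain Q and \<iota> :: "nat \<Rightarrow> 'm" where c: "is_coproduct C UNIV (\<lambda>_. P) Q \<iota>"
    by (rule ex_coproduct[OF small_nat[OF size], of "\<lambda>_. P", OF PO])
  have Q: "Q \<in> cp n A" by (rule cp_coproduct[OF small_nat[OF size] P c])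
  have QO: "Q \<in> Obj C" using cp_Obj[OF Q] .
  have "has_triangle C Q X (S Q)" by (rule has_triangle_rot[OF swindle[OF ab c]])
  moreover have "S Q \<in> cp n (shift C 1 ` A)" using cp_shift[OF Q, of 1] shift_1[OF QO] by simp
  ultimately have "X \<in> star C (cp n A) (cp n (shift C 1 ` A))" using Q starI by blast
  then have "X \<in> star C (cp n (A \<union> shift C 1 ` A)) (cp n (A \<union> shift C 1 ` A))"
    using star_mono[OF cp_mono cp_mono, of A "A \<union> shift C 1 ` A" "shift C 1 ` A" "A \<union> shift C 1 ` A"] by blast
  then show ?thesis by (rule star_cp)
qed

lemma cp_closed:
  assumes A: "\<And>X. X \<in> A \<Longrightarrow> Q X"
    and c: "\<And>(I :: 'u set) X P \<iota>. small r I \<Longrightarrow> is_coproduct C I X P \<iota> \<Longrightarrow> \<forall>i \<in> I. Q (X i) \<Longrightarrow> Q P"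
    and e: "\<And>X Y Z. has_triangle C X Y Z \<Longrightarrow> Q X \<Longrightarrow> Q Z \<Longrightarrow> Q Y"
    and X: "X \<in> cp n A"
  shows "Q X"
proof -
  have Add: "Q P" if P: "P \<in> Add r C A" for P
  proof -
    obtain I :: "'u set" and X \<iota> where I: "small r I" "\<forall>i \<in> I. X i \<in> A" "is_coproduct C I X P \<iota>"
      using P by (rule AddE)
    show ?thesis by (rule c[OF I(1,3)]) (use A I(2) in blast)
  qed
  show ?thesis using X
  proof (induction n arbitrary: X)
    case (Suc n)
    then obtain a b where "a \<in> Add r C A" "b \<in> cp n A" "has_triangle C a X b" by (auto elim: starE)
    then show ?case using e Add Suc.IH by blast
  qed (simp add: Add)
qed

section \<open>Classes of objects uniformly built from a generator\<close>

lemma shifts_mono: "a' \<le> a \<Longrightarrow> b \<le> b' \<Longrightarrow> shifts C G a b \<subseteq> shifts C G a' b'"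
  unfolding shifts_def by fastforce

lemma shifts_Obj: "G \<in> Obj C \<Longrightarrow> shifts C G a b \<subseteq> Obj C"
  unfolding shifts_def by auto

lemma shift_shifts: "G \<in> Obj C \<Longrightarrow> shift C k ` shifts C G a b \<subseteq> shifts C G (a - k) (b - k)"
proof
  fix x assume G: "G \<in> Obj C" and "x \<in> shift C k ` shifts C G a b"
  then obtain i where i: "a \<le> i" "i \<le> b" "x = shift C k (shift C (- i) G)" unfolding shifts_def by blast
  then have "x = shift C (- (i - k)) G" using shift_add[OF G] by simp
  then show "x \<in> shifts C G (a - k) (b - k)" unfolding shifts_def using i(1,2) by (intro CollectI exI[of _ "i - k"]) simp
qed

text \<open>One length and one interval serve the whole class, as the single constant of
  approximability demands. With the numbers hidden, closure properties of \<open>bd\<close> take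
  over their bookkeeping.\<close>

definition bd :: "'o \<Rightarrow> 'o set \<Rightarrow> bool" where
  "bd G E \<longleftrightarrow> G \<in> Obj C \<and> (\<exists>n a b. E \<subseteq> cp n (shifts C G a b))"

lemma bd_subset: "bd G E \<Longrightarrow> E' \<subseteq> E \<Longrightarrow> bd G E'"
  unfolding bd_def by blast

lemma cp_shifts_le:
  assumes "m \<le> n" "a' \<le> a" "b \<le> b'" shows "cp m (shifts C G a b) \<subseteq> cp n (shifts C G a' b')"
  using cp_mono[OF shifts_mono[OF assms(2,3)], of m G] cp_le[OF assms(1), of "shifts C G a' b'"] by blast

lemma bd_common:
  assumes "bd G E" "bd G E'"
  obtains n a b where "E \<subseteq> cp n (shifts C G a b)" "E' \<subseteq> cp n (shifts C G a b)"
proof -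
  obtain n a b where 1: "E \<subseteq> cp n (shifts C G a b)" using assms unfolding bd_def by blast
  obtain n' a' b' where 2: "E' \<subseteq> cp n' (shifts C G a' b')" using assms unfolding bd_def by blast
  show ?thesis
    by (rule that[of "max n n'" "min a a'" "max b b'"])
      (use 1 2 cp_shifts_le[of n "max n n'" "min a a'" a b "max b b'" G]
        cp_shifts_le[of n' "max n n'" "min a a'" a' b' "max b b'" G] in auto)
qed

lemma bd_star: assumes "bd G E" "bd G E'" shows "bd G (star C E E')"
proof -
  obtain n a b where "E \<subseteq> cp n (shifts C G a b)" "E' \<subseteq> cp n (shifts C G a b)" by (rule bd_common[OF assms])
  from star_mono[OF this] have "star C E E' \<subseteq> cp (Suc (n + n)) (shifts C G a b)"
    using star_cp[where m = n and n = n] by blast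
  then show ?thesis using assms(1) unfolding bd_def by blast
qed

lemma bd_shift: assumes "bd G E" shows "bd G (shift C k ` E)"
proof -
  obtain n a b where G: "G \<in> Obj C" and 1: "E \<subseteq> cp n (shifts C G a b)" using assms unfolding bd_def by blast
  have "shift C k ` E \<subseteq> cp n (shifts C G (a - k) (b - k))"
    using 1 cp_shift cp_mono[OF shift_shifts[OF G]] by blast
  then show ?thesis using G unfolding bd_def by blast
qed

lemma bd_Add: assumes "bd G E" shows "bd G (Add r C E)"
proof -
  obtain n a b where G: "G \<in> Obj C" and 1: "E \<subseteq> cp n (shifts C G a b)" using assms unfolding bd_def by blast
  have "Add r C E \<subseteq> cp n (shifts C G a b)"
  proof
    fix P assume "P \<in> Add r C E"
    then obtain I :: "'u set" and X \<iota> where I: "small r I" "\<forall>i \<in> I. X i \<in> E" "is_coproduct C I X P \<iota>"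
      by (rule AddE)
    show "P \<in> cp n (shifts C G a b)" by (rule cp_coproduct[OF I(1) _ I(3)]) (use 1 I(2) in blast)
  qed
  then show ?thesis using G unfolding bd_def by blast
qed

lemma bd_cp: "bd G E \<Longrightarrow> bd G (cp n E)"
  by (induction n) (simp_all add: bd_Add bd_star)

lemma bd_retracts: 
  assumes "bd G E" 
  shows "bd G {X. \<exists>P \<in> E. \<exists>a \<in> Hom C X P. \<exists>b \<in> Hom C P X. b \<cdot> a = Idn C X}"
proof -
  obtain n a b where G: "G \<in> Obj C" and 1: "E \<subseteq> cp n (shifts C G a b)" using assms unfolding bd_def by blast
  have "shifts C G a b \<union> shift C 1 ` shifts C G a b \<subseteq> shifts C G (a - 1) b"
    using shift_shifts[OF G, of 1 a b] shifts_mono[of "a - 1" a b b G] shifts_mono[of "a - 1" "a - 1" "b - 1" b G] by auto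
  note 2 = cp_mono[OF this]
  have "X \<in> cp (Suc (n + n)) (shifts C G (a - 1) b)" 
    if "P \<in> E" "p \<in> Hom C X P" "q \<in> Hom C P X" "q \<cdot> p = Idn C X" for X P p q
    using cp_retract[OF subsetD[OF 1 that(1)] that(2-4)] 2 by blast
  then have "{X. \<exists>P \<in> E. \<exists>a \<in> Hom C X P. \<exists>b \<in> Hom C P X. b \<cdot> a = Idn C X} \<subseteq> cp (Suc (n + n)) (shifts C G (a - 1) b)"
    by blast
  then show ?thesis using G unfolding bd_def by blast
qed

lemma bd_smd: assumes "bd G E" shows "bd G (smd C E)"
  by (rule bd_subset[OF bd_retracts[OF assms]]) (unfold smd_def is_biproduct_def, blast)

lemma bd_isom: assumes "bd G E" shows "bd G {X. \<exists>Y \<in> E. isom C Y X}"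
  by (rule bd_subset[OF bd_Add[OF assms]]) (use Add_isom in blast)

lemma bd_shifts: assumes "G \<in> Obj C" shows "bd G (shifts C G a b)"
proof -
  have "shifts C G a b \<subseteq> cp 0 (shifts C G a b)" using Add_self shifts_Obj[OF assms, of a b] by (simp add: subset_iff)
  then show ?thesis using assms unfolding bd_def by blast
qed

lemma bd_self: assumes "G \<in> Obj C" shows "bd G {G}"
  by (rule bd_subset[OF bd_shifts[OF assms, of 0 0]]) (simp add: shifts_def exI[of _ 0])

text \<open>Only shifts of \<open>H\<close> from a bounded interval occur, and these are built from
  \<open>G\<close> with one length; the intervals of shifts add.\<close>

lemma bd_trans: assumes H: "bd G {H}" and E: "bd H E" shows "bd G E"
proof -
  obtain n a b where 1: "E \<subseteq> cp n (shifts C H a b)" using E unfolding bd_def by blast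
  obtain m c d where G: "G \<in> Obj C" and 2: "H \<in> cp m (shifts C G c d)" using H unfolding bd_def by blast
  have "shift C (- i) H \<in> cp m (shifts C G (c + a) (d + b))" if "a \<le> i" "i \<le> b" for i
  proof -
    have "shift C (- i) H \<in> cp m (shifts C G (c + i) (d + i))"
      using cp_shift[OF 2, of "- i"] cp_mono[OF shift_shifts[OF G, of "- i" c d], of m] by auto
    then show ?thesis using cp_shifts_le[of m m "c + a" "c + i" "d + i" "d + b" G] that by auto
  qed
  then have "shifts C H a b \<subseteq> cp m (shifts C G (c + a) (d + b))" unfolding shifts_def by blast
  then have "bd G (shifts C H a b)" using G unfolding bd_def by blast
  from bd_cp[OF this] show ?thesis using bd_subset 1 by blast
qed

lemma bd_gen_bar: assumes "G \<in> Obj C" shows "bd G (gen_bar r C n G a b)"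
proof (cases n)
  case 0
  then show ?thesis using assms unfolding bd_def gen_bar_def smd_def by simp
next
  case (Suc m)
  have "bd G (cp m (shifts C G a b))" using assms unfolding bd_def by blast
  from bd_smd[OF this] show ?thesis unfolding gen_bar_def Suc Coprod_cp .
qed

lemma gen_bar_bd:
  assumes "bd G E" obtains N where "N > 0" "\<And>n. n \<ge> N \<Longrightarrow> E \<subseteq> gen_bar r C n G (- int n) (int n)"
proof -
  obtain m a b where G: "G \<in> Obj C" and 1: "E \<subseteq> cp m (shifts C G a b)" using assms unfolding bd_def by blast
  obtain Z where Z: "zero_object C Z" using ex_zero_object by blast
  \<comment> \<open>\<open>cp m\<close> has m + 1 layers, and the interval [-n, n] has to contain
    [a, b].\<close>
  define N where "N = Suc m + nat \<bar>a\<bar> + nat \<bar>b\<bar>"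
  have "E \<subseteq> gen_bar r C n G (- int n) (int n)" if n: "n \<ge> N" for n
  proof
    fix X assume "X \<in> E"
    then have X: "X \<in> cp m (shifts C G a b)" using 1 by blast
    obtain k where k: "n = Suc k" using n N_def by (cases n) auto
    have "X \<in> cp k (shifts C G (- int n) (int n))"
    proof -
      have "m \<le> k" "- int n \<le> a" "b \<le> int n" using n k unfolding N_def by linarith+
      from cp_shifts_le[OF this] show ?thesis using X by blast
    qed
    then have "X \<in> Coprod r C n G (- int n) (int n)" using Coprod_cp[of k G] k by simp
    moreover have "is_biproduct C X Z X" using is_biproduct_zero[OF cp_Obj[OF X] Z] .
    ultimately show "X \<in> gen_bar r C n G (- int n) (int n)" unfolding gen_bar_def smd_def by blast
  qed
  then show ?thesis using that[of N] N_def by simp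
qed

lemma cp_hom_zero_left:
  assumes X: "X \<in> cp m (shifts C G a b)" and G: "G \<in> Obj C" and Y: "Y \<in> Obj C"
    and z: "\<And>i. a \<le> i \<Longrightarrow> i \<le> b \<Longrightarrow> hom_zero C (shift C (n - i) G) Y"
  shows "hom_zero C (shift C n X) Y"
proof -
  have YO: "shift C (- n) Y \<in> Obj C" using Y by simp
  have "hom_zero C X (shift C (- n) Y)"
  proof (rule cp_closed[where Q = "\<lambda>X. hom_zero C X (shift C (- n) Y)", OF _ _ _ X])
    fix W assume "W \<in> shifts C G a b"
    then obtain i where i: "a \<le> i" "i \<le> b" "W = shift C (- i) G" unfolding shifts_def by blast
    then show "hom_zero C W (shift C (- n) Y)"
      using z[OF i(1,2)] hom_zero_shift[OF G Y, of "- i" "- n"] by (simp add: algebra_simps)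
  next
    fix I :: "'u set" and X P \<iota>
    assume "is_coproduct C I X P \<iota>" "\<forall>i \<in> I. hom_zero C (X i) (shift C (- n) Y)"
    then show "hom_zero C P (shift C (- n) Y)" using hom_zero_coproduct YO by blast
  qed (rule hom_zero_extension_left)
  then show ?thesis using hom_zero_shift[OF cp_Obj[OF X] Y, of 0 "- n"] by simp
qed

lemma cp_hom_zero_right:
  assumes X: "X \<in> cp m (shifts C G a b)" and G: "G \<in> Obj C" and K: "cpt r K"
    and z: "\<And>i. a \<le> i \<Longrightarrow> i \<le> b \<Longrightarrow> hom_zero C (shift C (n + i) K) G"
  shows "hom_zero C (shift C n K) X"
proof (rule cp_closed[where Q = "\<lambda>X. hom_zero C (shift C n K) X", OF _ _ _ X])
  fix W assume "W \<in> shifts C G a b"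
  then obtain i where i: "a \<le> i" "i \<le> b" "W = shift C (- i) G" unfolding shifts_def by blast
  then show "hom_zero C (shift C n K) W"
    using z[OF i(1,2)] hom_zero_shift[OF cpt_Obj[OF K] G, of n "- i"] by simp
next
  fix I :: "'u set" and X P \<iota>
  assume I: "small r I" and c: "is_coproduct C I X P \<iota>" and h: "\<forall>i \<in> I. hom_zero C (shift C n K) (X i)"
  show "hom_zero C (shift C n K) P" by (rule cpt_hom_zero[OF size cpt_shift[OF K] I c]) (use h in simp)
qed (rule hom_zero_extension_right)

text \<open>The members of \<open>E\<close> are built from \<Sigma>^(-i) G with a \<le> i \<le> b.
  In the first variable the smallest i is critical, whence the threshold N - a.\<close>

lemma bd_vanish_left:
  assumes E: "bd G E" and Y: "\<Y> \<subseteq> Obj C"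
    and z: "\<And>n Y. n \<ge> N \<Longrightarrow> Y \<in> \<Y> \<Longrightarrow> hom_zero C (shift C (- n) G) Y"
  obtains N' where "\<And>n X Y. n \<ge> N' \<Longrightarrow> X \<in> E \<Longrightarrow> Y \<in> \<Y> \<Longrightarrow> hom_zero C (shift C (- n) X) Y"
proof -
  obtain m a b where G: "G \<in> Obj C" and 1: "E \<subseteq> cp m (shifts C G a b)" using E unfolding bd_def by blast
  have "hom_zero C (shift C (- n) X) Y" if n: "n \<ge> N - a" and X: "X \<in> E" and "Y \<in> \<Y>" for n X Y
  proof (rule cp_hom_zero_left[OF _ G])
    show "hom_zero C (shift C (- n - i) G) Y" if "a \<le> i" for i
    proof -
      have e: "- n - i = - (n + i)" by simp
      show ?thesis unfolding e by (rule z) (use n \<open>Y \<in> \<Y>\<close> that in simp_all)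
    qed
  qed (use X 1 Y \<open>Y \<in> \<Y>\<close> in blast)+
  then show ?thesis using that by blast
qed

text \<open>In the second variable the largest i is critical, whence the threshold N + b;
  compactness of \<open>K\<close> carries the vanishing over coproducts.\<close>

lemma bd_vanish_right:
  assumes E: "bd G E" and K: "cpt r K" and z: "\<And>n. n \<ge> N \<Longrightarrow> hom_zero C (shift C (- n) K) G"
  obtains N' where "\<And>n X. n \<ge> N' \<Longrightarrow> X \<in> E \<Longrightarrow> hom_zero C (shift C (- n) K) X"
proof -
  obtain m a b where G: "G \<in> Obj C" and 1: "E \<subseteq> cp m (shifts C G a b)" using E unfolding bd_def by blast
  have "hom_zero C (shift C (- n) K) X" if n: "n \<ge> N + b" and X: "X \<in> E" for n X
  proof (rule cp_hom_zero_right[OF _ G K])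
    show "hom_zero C (shift C (- n + i) K) G" if "i \<le> b" for i
      using z[of "n - i"] n that by simp
  qed (use X 1 in blast)
  then show ?thesis using that by blast
qed

lemma generated_shifts:
  fixes S0 :: "'o set"
  assumes S0: "small r S0" "\<And>s. s \<in> S0 \<Longrightarrow> cpt r s" "generates C S0"
  shows "generated C r ((\<lambda>(s, n). shift C n s) ` (S0 \<times> UNIV))"
proof (unfold_locales)
  let ?S = "(\<lambda>(s, n). shift C n s) ` (S0 \<times> (UNIV :: int set))"
  show "cpt r s" if "s \<in> ?S" for s using that S0(2) cpt_shift by auto
  show "S s \<in> ?S" if s: "s \<in> ?S" for s
  proof -
    obtain t n where t: "t \<in> S0" "s = shift C n t" using s by auto
    then have "S s = shift C (n + 1) t" using shift_Suc[OF cpt_Obj[OF S0(2)[OF t(1)]]] by simp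
    then show ?thesis using t(1) by force
  qed
  show "\<exists>t \<in> ?S. S t = s" if s: "s \<in> ?S" for s
  proof -
    obtain t n where t: "t \<in> S0" "s = shift C n t" using s by auto
    then have "S (shift C (n - 1) t) = s" using shift_Suc[OF cpt_Obj[OF S0(2)[OF t(1)]], of "n - 1"] by simp
    then show ?thesis using t(1) by force
  qed
  show "zero_object C X" if "X \<in> Obj C" "\<And>s. s \<in> ?S \<Longrightarrow> hom_zero C s X" for X
    using S0(3) that unfolding generates_def by force
  show "small r ?S" using small_image[OF size small_Sigma[OF size S0(1) small_int[OF size]]] by blast
qed

text \<open>The compact objects built from \<open>G\<close> contain the shifts of \<open>G\<close>
  and are closed under extensions and fibres, so \<open>K\<close> is a retract of one of them; the
  swindle absorbs the retraction.\<close>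

lemma compact_bd:
  assumes G: "cpt r G" "generates C {G}" and K: "cpt r K" shows "bd G {K}"
proof -
  interpret G: generated C r "(\<lambda>(s, n). shift C n s) ` ({G} \<times> UNIV)"
    by (rule generated_shifts) (use G small_finite[OF size, of "{G}"] in simp_all)
  have GO: "G \<in> Obj C" using G cpt_Obj by blast
  let ?T = "{T. cpt r T \<and> bd G {T}}"
  have bG: "bd G {G}" using bd_self[OF GO] .
  have "extension_closed C ?T" unfolding extension_closed_def
  proof (intro allI impI)
    fix X Y Z assume t: "has_triangle C X Y Z" and XZ: "X \<in> ?T" "Z \<in> ?T"
    have "bd G (star C {X} {Z})" using bd_star XZ by blast
    then have "bd G {Y}" by (rule bd_subset) (use starI[OF t, of "{X}" "{Z}"] in simp)
    then show "Y \<in> ?T" using cpt_extension[OF t] XZ by blast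
  qed
  moreover have "fibre_closed C ?T" unfolding fibre_closed_def
  proof (intro allI impI)
    fix X Y Z assume t: "has_triangle C X Y Z" and YZ: "Y \<in> ?T" "Z \<in> ?T"
    have "bd G (star C (shift C (-1) ` {Z}) {Y})" using bd_star bd_shift YZ by blast
    then have "bd G {X}" 
      by (rule bd_subset) (use starI[OF shift_triangle_left[OF t], of "shift C (-1) ` {Z}" "{Y}"] in simp)
    then show "X \<in> ?T" using cpt_fibre[OF t] YZ by blast
  qed
  moreover have "(\<lambda>(s, n). shift C n s) ` ({G} \<times> UNIV) \<subseteq> ?T"
    using cpt_shift[OF G(1)] bd_shift[OF bG] by auto
  moreover have "G \<in> ?T" using G(1) bG by blast
  ultimately obtain T a b where T: "T \<in> ?T" "a \<in> Hom C K T" "b \<in> Hom C T K" "b \<cdot> a = Idn C K"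
    using G.compact_retract[of ?T G K] K by blast
  then have "bd G {T}" by blast
  from bd_retracts[OF this] show ?thesis by (rule bd_subset) (use T(2-4) in blast)
qed

end


section \<open>Exact functors and adjunctions\<close>

locale exact_fun = A: tri_coproducts C r + B: tri_coproducts D r
  for C :: "('o, 'm, 'y) tri_cat_scheme" and D :: "('p, 'n, 'z) tri_cat_scheme"
    and F :: "('o, 'm, 'p, 'n) functr" and r :: "'u rel" +
  assumes F_exact: "exact_functor C D F"

sublocale exact_fun \<subseteq> add_functor C D F
  by unfold_locales (use F_exact in \<open>simp add: exact_functor_def\<close>)

context exact_fun
begin

text \<open>The third morphism involves the comparison of \<open>F\<close> with suspension. Only the
  first two are compared with other triangles later, so it is merely asserted to exist.\<close>

lemma F_tri:
  assumes t: "tri C X Y Z f g h"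
  obtains h' where "tri D (on_obj F X) (on_obj F Y) (on_obj F Z) (on_arr F f) (on_arr F g) h'"
proof -
  obtain \<phi> where n: "natural_transformation C D (F \<circ>F Susp C) (Susp D \<circ>F F) \<phi>"
    and p: "\<And>f g h. (f, g, h) \<in> Tri C \<Longrightarrow> (on_arr F f, on_arr F g, \<phi> (Dom C f) \<cdot>\<^bsub>D\<^esub> on_arr F h) \<in> Tri D"
    using F_exact unfolding exact_functor_def by blast
  note tD = triD[OF t]
  have X: "X \<in> Obj C" using A.tri_Obj[OF t] by blast
  have fX: "\<phi> X \<in> Hom D (on_obj F (on_obj (Susp C) X)) (on_obj (Susp D) (on_obj F X))"
    using n X unfolding natural_transformation_def compF_def by simp
  have "Dom C f = X" using tD(2) by (simp add: Hom_iff)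
  then have "(on_arr F f, on_arr F g, \<phi> X \<cdot>\<^bsub>D\<^esub> on_arr F h) \<in> Tri D" using p[OF tD(1)] by simp
  then have "tri D (on_obj F X) (on_obj F Y) (on_obj F Z) (on_arr F f) (on_arr F g) (\<phi> X \<cdot>\<^bsub>D\<^esub> on_arr F h)"
    unfolding tri_def using F_Hom[OF tD(2)] F_Hom[OF tD(3)] B.Cmp_Hom[OF F_Hom[OF tD(4)] fX] by blast
  then show ?thesis using that by blast
qed

lemma F_triangle: "has_triangle C X Y Z \<Longrightarrow> has_triangle D (on_obj F X) (on_obj F Y) (on_obj F Z)"
  unfolding has_triangle_tri using F_tri by metis

lemma F_S: assumes "X \<in> Obj C" shows "isom D (on_obj F (on_obj (Susp C) X)) (on_obj (Susp D) (on_obj F X))"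
  using F_exact assms unfolding exact_functor_def isom_def by blast

lemma F_shift: assumes X: "X \<in> Obj C" shows "isom D (on_obj F (shift C n X)) (shift D n (on_obj F X))"
proof (induction n rule: int_induct[where k = 0])
  case base
  then show ?case using X B.isom_refl by simp
next
  case (step1 i)
  have "isom D (on_obj F (on_obj (Susp C) (shift C i X))) (on_obj (Susp D) (on_obj F (shift C i X)))"
    using F_S X by simp
  moreover have "isom D (on_obj (Susp D) (on_obj F (shift C i X))) (on_obj (Susp D) (shift D i (on_obj F X)))"
    using step1 by (intro B.Susp.F_isom)
  ultimately show ?case using A.shift_Suc[OF X] B.shift_Suc[OF F_Obj[OF X]] B.isom_trans by metis
next
  case (step2 i)
  have Y: "shift C (i - 1) X \<in> Obj C" using X by simp
  have e: "shift C i X = on_obj (Susp C) (shift C (i - 1) X)"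
    "shift D i (on_obj F X) = on_obj (Susp D) (shift D (i - 1) (on_obj F X))"
    using A.shift_Suc[OF X, of "i - 1"] B.shift_Suc[OF F_Obj[OF X], of "i - 1"] by simp_all
  have "isom D (on_obj (Susp D) (on_obj F (shift C (i - 1) X))) (on_obj F (shift C i X))"
    unfolding e(1) by (rule B.isom_sym[OF F_S[OF Y]])
  then have "isom D (on_obj (Susp D) (on_obj F (shift C (i - 1) X))) (on_obj (Susp D) (shift D (i - 1) (on_obj F X)))"
    using B.isom_trans step2 unfolding e(2)[symmetric] by blast
  then show ?case using B.isom_S F_Obj[OF Y] X by simp
qed

end

locale exact_coproduct_fun = exact_fun C D F r + coproduct_functor C D F r
  for C :: "('o, 'm, 'y) tri_cat_scheme" and D :: "('p, 'n, 'z) tri_cat_scheme"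
    and F :: "('o, 'm, 'p, 'n) functr" and r :: "'u rel"
begin

lemma F_Add: assumes "X \<in> Add r C E" shows "on_obj F X \<in> Add r D (on_obj F ` E)"
proof -
  obtain I :: "'u set" and Y \<iota> where I: "small r I" "\<forall>i \<in> I. Y i \<in> E" and c: "is_coproduct C I Y X \<iota>"
    using assms by (rule A.AddE)
  show ?thesis by (rule B.AddI[OF I(1) _ F_coproduct[OF I(1) c]]) (use I(2) in simp)
qed

lemma F_cp: "X \<in> A.cp n E \<Longrightarrow> on_obj F X \<in> B.cp n (on_obj F ` E)"
proof (induction n arbitrary: X)
  case 0
  then show ?case using F_Add by simp
next
  case (Suc n)
  then obtain a b where ab: "a \<in> Add r C E" "b \<in> A.cp n E" "has_triangle C a X b" by (auto simp: star_def)
  then show ?case using B.starI[OF F_triangle[OF ab(3)] F_Add[OF ab(1)] Suc.IH[OF ab(2)]] by simp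
qed

text \<open>\<open>F\<close> commutes with shifts only up to isomorphism, which \<open>bd\<close>
  tolerates because coproducts are determined up to isomorphism.\<close>

lemma F_bd: assumes E: "A.bd G E" shows "B.bd (on_obj F G) (on_obj F ` E)"
proof -
  obtain n a b where G: "G \<in> Obj C" and 1: "E \<subseteq> A.cp n (shifts C G a b)" using E unfolding A.bd_def by blast
  have "on_obj F ` shifts C G a b \<subseteq> {X. \<exists>Y \<in> shifts D (on_obj F G) a b. isom D Y X}"
  proof
    fix x assume "x \<in> on_obj F ` shifts C G a b"
    then obtain i where i: "a \<le> i" "i \<le> b" "x = on_obj F (shift C (- i) G)" unfolding shifts_def by blast
    have "shift D (- i) (on_obj F G) \<in> shifts D (on_obj F G) a b" unfolding shifts_def using i by blast
    moreover have "isom D (shift D (- i) (on_obj F G)) x" unfolding i(3) by (rule B.isom_sym[OF F_shift[OF G]])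
    ultimately show "x \<in> {X. \<exists>Y \<in> shifts D (on_obj F G) a b. isom D Y X}" by blast
  qed
  then have "B.bd (on_obj F G) (on_obj F ` shifts C G a b)"
    by (rule B.bd_subset[OF B.bd_isom[OF B.bd_shifts[OF F_Obj[OF G]]]])
  from B.bd_cp[OF this, of n] show ?thesis by (rule B.bd_subset) (use 1 F_cp in blast)
qed

end

section \<open>Adjunctions through transposed morphisms\<close>

locale adj = A: additive_category C + B: additive_category D
  for C :: "('o, 'm, 'y) add_cat_scheme" and D :: "('p, 'n, 'z) add_cat_scheme" +
  fixes L :: "('o, 'm, 'p, 'n) functr" and R :: "('p, 'n, 'o, 'm) functr" and \<eta> \<epsilon>
  assumes adj: "adjunction C D L R \<eta> \<epsilon>"
begin

lemma L_Obj [simp]: "X \<in> Obj C \<Longrightarrow> on_obj L X \<in> Obj D"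
  and R_Obj [simp]: "Y \<in> Obj D \<Longrightarrow> on_obj R Y \<in> Obj C"
  using adj by (simp_all add: adjunction_def is_functor_def)

lemma L_Idn: "X \<in> Obj C \<Longrightarrow> on_arr L (Idn C X) = Idn D (on_obj L X)"
  and R_Idn: "Y \<in> Obj D \<Longrightarrow> on_arr R (Idn D Y) = Idn C (on_obj R Y)"
  using adj by (simp_all add: adjunction_def is_functor_def)

lemma L_Hom: "f \<in> Hom C X Y \<Longrightarrow> on_arr L f \<in> Hom D (on_obj L X) (on_obj L Y)"
  and R_Hom: "g \<in> Hom D V W \<Longrightarrow> on_arr R g \<in> Hom C (on_obj R V) (on_obj R W)"
  using adj by (simp_all add: adjunction_def is_functor_def)

lemma L_Cmp: "f \<in> Hom C X Y \<Longrightarrow> g \<in> Hom C Y Z \<Longrightarrow> on_arr L (g \<cdot>\<^bsub>C\<^esub> f) = on_arr L g \<cdot>\<^bsub>D\<^esub> on_arr L f"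
  using adj unfolding adjunction_def is_functor_def by blast

lemma R_Cmp: "f \<in> Hom D X Y \<Longrightarrow> g \<in> Hom D Y Z \<Longrightarrow> on_arr R (g \<cdot>\<^bsub>D\<^esub> f) = on_arr R g \<cdot>\<^bsub>C\<^esub> on_arr R f"
  using adj unfolding adjunction_def is_functor_def by blast

lemma unit_Hom: "X \<in> Obj C \<Longrightarrow> \<eta> X \<in> Hom C X (on_obj R (on_obj L X))"
  and counit_Hom: "Y \<in> Obj D \<Longrightarrow> \<epsilon> Y \<in> Hom D (on_obj L (on_obj R Y)) Y"
  using adj by (simp_all add: adjunction_def natural_transformation_def idF_def compF_def)

lemma unit_nat: 
  assumes "f \<in> Hom C X Y" shows "\<eta> Y \<cdot>\<^bsub>C\<^esub> f = on_arr R (on_arr L f) \<cdot>\<^bsub>C\<^esub> \<eta> X"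
proof -
  have "natural_transformation C C idF (R \<circ>F L) \<eta>" using adj by (simp add: adjunction_def)
  then show ?thesis using assms unfolding natural_transformation_def by (simp add: idF_def compF_def)
qed

lemma counit_nat: 
  assumes "f \<in> Hom D X Y" shows "\<epsilon> Y \<cdot>\<^bsub>D\<^esub> on_arr L (on_arr R f) = f \<cdot>\<^bsub>D\<^esub> \<epsilon> X"
proof -
  have "natural_transformation D D (L \<circ>F R) idF \<epsilon>" using adj by (simp add: adjunction_def)
  then show ?thesis using assms unfolding natural_transformation_def by (simp add: idF_def compF_def)
qed

lemma zigzag_L: "X \<in> Obj C \<Longrightarrow> \<epsilon> (on_obj L X) \<cdot>\<^bsub>D\<^esub> on_arr L (\<eta> X) = Idn D (on_obj L X)"
  and zigzag_R: "Y \<in> Obj D \<Longrightarrow> on_arr R (\<epsilon> Y) \<cdot>\<^bsub>C\<^esub> \<eta> (on_obj R Y) = Idn C (on_obj R Y)"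
  using adj by (simp_all add: adjunction_def)

definition flat where "flat Y g = \<epsilon> Y \<cdot>\<^bsub>D\<^esub> on_arr L g"
definition sharp where "sharp X f = on_arr R f \<cdot>\<^bsub>C\<^esub> \<eta> X"

lemma flat_Hom: "g \<in> Hom C X (on_obj R Y) \<Longrightarrow> Y \<in> Obj D \<Longrightarrow> flat Y g \<in> Hom D (on_obj L X) Y"
  unfolding flat_def using B.Cmp_Hom L_Hom counit_Hom by blast

lemma sharp_Hom: "f \<in> Hom D (on_obj L X) Y \<Longrightarrow> X \<in> Obj C \<Longrightarrow> sharp X f \<in> Hom C X (on_obj R Y)"
  unfolding sharp_def using A.Cmp_Hom R_Hom unit_Hom by blast

lemma sharp_flat:
  assumes g: "g \<in> Hom C X (on_obj R Y)" and Y: "Y \<in> Obj D" shows "sharp X (flat Y g) = g"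
proof -
  have X: "X \<in> Obj C" using A.Obj_Hom[OF g] by blast
  have "sharp X (flat Y g) = (on_arr R (\<epsilon> Y) \<cdot>\<^bsub>C\<^esub> on_arr R (on_arr L g)) \<cdot>\<^bsub>C\<^esub> \<eta> X"
    unfolding sharp_def flat_def using R_Cmp[OF L_Hom[OF g] counit_Hom[OF Y]] by simp
  also have "\<dots> = on_arr R (\<epsilon> Y) \<cdot>\<^bsub>C\<^esub> (\<eta> (on_obj R Y) \<cdot>\<^bsub>C\<^esub> g)"
    unfolding unit_nat[OF g] by (rule A.Cmp_assoc[OF unit_Hom[OF X] R_Hom[OF L_Hom[OF g]] R_Hom[OF counit_Hom[OF Y]]])
  also have "\<dots> = Idn C (on_obj R Y) \<cdot>\<^bsub>C\<^esub> g"
    by (rule A.reassoc[OF zigzag_R[OF Y] R_Hom[OF counit_Hom[OF Y]] unit_Hom[OF R_Obj[OF Y]] g])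
  also have "\<dots> = g" by (rule A.Idn_left[OF g])
  finally show ?thesis .
qed

lemma flat_sharp:
  assumes f: "f \<in> Hom D (on_obj L X) Y" and X: "X \<in> Obj C" shows "flat Y (sharp X f) = f"
proof -
  have Y: "Y \<in> Obj D" using B.Obj_Hom[OF f] by blast
  have "flat Y (sharp X f) = \<epsilon> Y \<cdot>\<^bsub>D\<^esub> (on_arr L (on_arr R f) \<cdot>\<^bsub>D\<^esub> on_arr L (\<eta> X))"
    unfolding sharp_def flat_def using L_Cmp[OF unit_Hom[OF X] R_Hom[OF f]] by simp
  also have "\<dots> = (f \<cdot>\<^bsub>D\<^esub> \<epsilon> (on_obj L X)) \<cdot>\<^bsub>D\<^esub> on_arr L (\<eta> X)"
    by (rule B.reassoc[OF counit_nat[OF f] counit_Hom[OF Y] L_Hom[OF R_Hom[OF f]] L_Hom[OF unit_Hom[OF X]]])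
  also have "\<dots> = f \<cdot>\<^bsub>D\<^esub> Idn D (on_obj L X)"
    using B.Cmp_assoc[OF L_Hom[OF unit_Hom[OF X]] counit_Hom[OF L_Obj[OF X]] f] zigzag_L[OF X] by simp
  also have "\<dots> = f" by (rule B.Idn_right[OF f])
  finally show ?thesis .
qed

lemma sharp_comp:
  assumes "f \<in> Hom D (on_obj L X) Y" "g \<in> Hom D Y Z" "X \<in> Obj C"
  shows "sharp X (g \<cdot>\<^bsub>D\<^esub> f) = on_arr R g \<cdot>\<^bsub>C\<^esub> sharp X f"
  unfolding sharp_def R_Cmp[OF assms(1,2)]
  by (rule A.Cmp_assoc[OF unit_Hom[OF assms(3)] R_Hom[OF assms(1)] R_Hom[OF assms(2)]])

lemma sharp_precomp:
  assumes "f \<in> Hom D (on_obj L X) Y" "k \<in> Hom C W X"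
  shows "sharp W (f \<cdot>\<^bsub>D\<^esub> on_arr L k) = sharp X f \<cdot>\<^bsub>C\<^esub> k"
proof -
  have O: "W \<in> Obj C" "X \<in> Obj C" using A.Obj_Hom[OF assms(2)] by blast+
  have "sharp W (f \<cdot>\<^bsub>D\<^esub> on_arr L k) = (on_arr R f \<cdot>\<^bsub>C\<^esub> on_arr R (on_arr L k)) \<cdot>\<^bsub>C\<^esub> \<eta> W"
    unfolding sharp_def R_Cmp[OF L_Hom[OF assms(2)] assms(1)] ..
  also have "\<dots> = on_arr R f \<cdot>\<^bsub>C\<^esub> (\<eta> X \<cdot>\<^bsub>C\<^esub> k)"
    unfolding unit_nat[OF assms(2)]
    by (rule A.Cmp_assoc[OF unit_Hom[OF O(1)] R_Hom[OF L_Hom[OF assms(2)]] R_Hom[OF assms(1)]])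
  also have "\<dots> = sharp X f \<cdot>\<^bsub>C\<^esub> k"
    unfolding sharp_def using A.Cmp_assoc[OF assms(2) unit_Hom[OF O(2)] R_Hom[OF assms(1)]] by simp
  finally show ?thesis .
qed

lemma hom_zero_adj:
  assumes O: "X \<in> Obj C" "Y \<in> Obj D"
  shows "hom_zero D (on_obj L X) Y \<longleftrightarrow> hom_zero C X (on_obj R Y)"
proof
  assume z: "hom_zero D (on_obj L X) Y"
  show "hom_zero C X (on_obj R Y)"
  proof (rule A.hom_zeroI)
    fix g assume g: "g \<in> Hom C X (on_obj R Y)"
    have g0: "Zero C X (on_obj R Y) \<in> Hom C X (on_obj R Y)" using O by (simp add: Hom_iff)
    have "flat Y g = flat Y (Zero C X (on_obj R Y))"
      using B.hom_zeroD[OF z flat_Hom[OF g O(2)]] B.hom_zeroD[OF z flat_Hom[OF g0 O(2)]] by simp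
    then show "g = Zero C X (on_obj R Y)" by (metis sharp_flat[OF g O(2)] sharp_flat[OF g0 O(2)])
  qed (use O in simp_all)
next
  assume z: "hom_zero C X (on_obj R Y)"
  show "hom_zero D (on_obj L X) Y"
  proof (rule B.hom_zeroI)
    fix f assume f: "f \<in> Hom D (on_obj L X) Y"
    have f0: "Zero D (on_obj L X) Y \<in> Hom D (on_obj L X) Y" using O by (simp add: Hom_iff)
    have "sharp X f = sharp X (Zero D (on_obj L X) Y)"
      using A.hom_zeroD[OF z sharp_Hom[OF f O(1)]] A.hom_zeroD[OF z sharp_Hom[OF f0 O(1)]] by simp
    then show "f = Zero D (on_obj L X) Y" by (metis flat_sharp[OF f O(1)] flat_sharp[OF f0 O(1)])
  qed (use O in simp_all)
qed

lemma L_preserves_coproduct: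
  assumes c: "is_coproduct C I X P \<iota>"
  shows "is_coproduct D I (\<lambda>i. on_obj L (X i)) (on_obj L P) (\<lambda>i. on_arr L (\<iota> i))"
proof -
  note i = A.is_coproduct_arr[OF c]
  show ?thesis
  proof (rule B.is_coproductI)
    show "on_obj L P \<in> Obj D" using i(1) by simp
    show "on_obj L (X j) \<in> Obj D" "on_arr L (\<iota> j) \<in> Hom D (on_obj L (X j)) (on_obj L P)" if "j \<in> I" for j
      using i(2,3)[OF that] L_Hom by simp_all
    fix Y f assume Y: "Y \<in> Obj D" and f: "\<And>j. j \<in> I \<Longrightarrow> f j \<in> Hom D (on_obj L (X j)) Y"
    have "sharp (X j) (f j) \<in> Hom C (X j) (on_obj R Y)" if "j \<in> I" for j
      using sharp_Hom[OF f i(2)] that by blast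
    then obtain g where g: "g \<in> Hom C P (on_obj R Y)" "\<And>j. j \<in> I \<Longrightarrow> g \<cdot>\<^bsub>C\<^esub> \<iota> j = sharp (X j) (f j)"
      by (rule A.copr_map[OF c R_Obj[OF Y]]) auto
    have "flat Y g \<cdot>\<^bsub>D\<^esub> on_arr L (\<iota> j) = f j" if j: "j \<in> I" for j
    proof -
      have fh: "flat Y g \<cdot>\<^bsub>D\<^esub> on_arr L (\<iota> j) \<in> Hom D (on_obj L (X j)) Y"
        using B.Cmp_Hom[OF L_Hom[OF i(3)[OF j]] flat_Hom[OF g(1) Y]] .
      have "sharp (X j) (flat Y g \<cdot>\<^bsub>D\<^esub> on_arr L (\<iota> j)) = sharp (X j) (f j)"
        using sharp_precomp[OF flat_Hom[OF g(1) Y] i(3)[OF j]] sharp_flat[OF g(1) Y] g(2)[OF j] by simp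
      then have "flat Y (sharp (X j) (flat Y g \<cdot>\<^bsub>D\<^esub> on_arr L (\<iota> j))) = flat Y (sharp (X j) (f j))" by simp
      then show ?thesis using flat_sharp[OF fh i(2)[OF j]] flat_sharp[OF f[OF j] i(2)[OF j]] by simp
    qed
    then show "\<exists>h \<in> Hom D (on_obj L P) Y. \<forall>j \<in> I. h \<cdot>\<^bsub>D\<^esub> on_arr L (\<iota> j) = f j"
      using flat_Hom[OF g(1) Y] by blast
  next
    fix Y h h' assume h: "h \<in> Hom D (on_obj L P) Y" "h' \<in> Hom D (on_obj L P) Y"
      and eq: "\<And>j. j \<in> I \<Longrightarrow> h \<cdot>\<^bsub>D\<^esub> on_arr L (\<iota> j) = h' \<cdot>\<^bsub>D\<^esub> on_arr L (\<iota> j)"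
    have "sharp P h = sharp P h'"
    proof (rule A.copr_eq[OF c sharp_Hom[OF h(1) i(1)] sharp_Hom[OF h(2) i(1)]])
      fix j assume j: "j \<in> I"
      show "sharp P h \<cdot>\<^bsub>C\<^esub> \<iota> j = sharp P h' \<cdot>\<^bsub>C\<^esub> \<iota> j"
        using sharp_precomp[OF h(1) i(3)[OF j]] sharp_precomp[OF h(2) i(3)[OF j]] eq[OF j] by simp
    qed
    then have "flat Y (sharp P h) = flat Y (sharp P h')" by simp
    then show "h = h'" using flat_sharp[OF h(1) i(1)] flat_sharp[OF h(2) i(1)] by simp
  qed
qed

text \<open>By fullness the unit at the image of \<open>Y\<close> is the image of some
  \<open>t\<close>. The zigzag identities, read through faithfulness and through transposition, make
  \<open>t\<close> inverse to the counit.\<close>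

lemma counit_iso:
  assumes ff: "fully_faithful D C R" and Y: "Y \<in> Obj D"
  shows "iso_arr D (on_obj L (on_obj R Y)) Y (\<epsilon> Y)"
proof -
  let ?W = "on_obj L (on_obj R Y)"
  have W: "?W \<in> Obj D" "on_obj R Y \<in> Obj C" using Y by simp_all
  have "\<eta> (on_obj R Y) \<in> on_arr R ` Hom D Y ?W"
    using ff Y W unit_Hom[OF W(2)] unfolding fully_faithful_def bij_betw_def by blast
  then obtain t where "\<eta> (on_obj R Y) = on_arr R t" "t \<in> Hom D Y ?W" by (rule imageE)
  note t = this(2) this(1)[symmetric]
  note e = counit_Hom[OF Y]
  have inj: "inj_on (on_arr R) (Hom D Y Y)" using ff Y unfolding fully_faithful_def bij_betw_def by blast
  have "on_arr R (\<epsilon> Y \<cdot>\<^bsub>D\<^esub> t) = on_arr R (Idn D Y)"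
    using R_Cmp[OF t(1) e] t(2) zigzag_R[OF Y] R_Idn[OF Y] by simp
  then have 1: "\<epsilon> Y \<cdot>\<^bsub>D\<^esub> t = Idn D Y"
    using inj_onD[OF inj _ B.Cmp_Hom[OF t(1) e] B.Idn_Hom[OF Y]] by blast
  have te: "t \<cdot>\<^bsub>D\<^esub> \<epsilon> Y \<in> Hom D ?W ?W" using B.Cmp_Hom[OF e t(1)] .
  have "sharp (on_obj R Y) (t \<cdot>\<^bsub>D\<^esub> \<epsilon> Y) = on_arr R t \<cdot>\<^bsub>C\<^esub> sharp (on_obj R Y) (\<epsilon> Y)"
    by (rule sharp_comp[OF e t(1) W(2)])
  also have "\<dots> = \<eta> (on_obj R Y) \<cdot>\<^bsub>C\<^esub> Idn C (on_obj R Y)" unfolding sharp_def t(2) zigzag_R[OF Y] ..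
  also have "\<dots> = \<eta> (on_obj R Y)" by (rule A.Idn_right[OF unit_Hom[OF W(2)]])
  also have "\<dots> = sharp (on_obj R Y) (Idn D ?W)"
    unfolding sharp_def R_Idn[OF W(1)] using A.Idn_left[OF unit_Hom[OF W(2)]] by simp
  finally have "flat ?W (sharp (on_obj R Y) (t \<cdot>\<^bsub>D\<^esub> \<epsilon> Y)) = flat ?W (sharp (on_obj R Y) (Idn D ?W))" by simp
  then have 2: "t \<cdot>\<^bsub>D\<^esub> \<epsilon> Y = Idn D ?W"
    using flat_sharp[OF te W(2)] flat_sharp[OF B.Idn_Hom[OF W(1)] W(2)] by simp
  show ?thesis by (rule B.iso_arrI[OF e t(1) 2 1])
qed

lemma unit_iso:
  assumes ff: "fully_faithful C D L" and X: "X \<in> Obj C"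
  shows "iso_arr C X (on_obj R (on_obj L X)) (\<eta> X)"
proof -
  let ?W = "on_obj R (on_obj L X)"
  have W: "?W \<in> Obj C" "on_obj L X \<in> Obj D" using X by simp_all
  have "\<epsilon> (on_obj L X) \<in> on_arr L ` Hom C ?W X"
    using ff X W counit_Hom[OF W(2)] unfolding fully_faithful_def bij_betw_def by blast
  then obtain t where "\<epsilon> (on_obj L X) = on_arr L t" "t \<in> Hom C ?W X" by (rule imageE)
  note t = this(2) this(1)[symmetric]
  note e = unit_Hom[OF X]
  have inj: "inj_on (on_arr L) (Hom C X X)" using ff X unfolding fully_faithful_def bij_betw_def by blast
  have "on_arr L (t \<cdot>\<^bsub>C\<^esub> \<eta> X) = on_arr L (Idn C X)"
    using L_Cmp[OF e t(1)] t(2) zigzag_L[OF X] L_Idn[OF X] by simp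
  then have 1: "t \<cdot>\<^bsub>C\<^esub> \<eta> X = Idn C X"
    using inj_onD[OF inj _ A.Cmp_Hom[OF e t(1)] A.Idn_Hom[OF X]] by blast
  have te: "\<eta> X \<cdot>\<^bsub>C\<^esub> t \<in> Hom C ?W ?W" using A.Cmp_Hom[OF t(1) e] .
  have "flat (on_obj L X) (\<eta> X \<cdot>\<^bsub>C\<^esub> t) = \<epsilon> (on_obj L X) \<cdot>\<^bsub>D\<^esub> (on_arr L (\<eta> X) \<cdot>\<^bsub>D\<^esub> on_arr L t)"
    unfolding flat_def L_Cmp[OF t(1) e] ..
  also have "\<dots> = Idn D (on_obj L X) \<cdot>\<^bsub>D\<^esub> on_arr L t"
    by (rule B.reassoc[OF zigzag_L[OF X] counit_Hom[OF W(2)] L_Hom[OF e] L_Hom[OF t(1)]])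
  also have "\<dots> = on_arr L t" by (rule B.Idn_left[OF L_Hom[OF t(1)]])
  also have "\<dots> = flat (on_obj L X) (Idn C ?W)"
    unfolding flat_def L_Idn[OF W(1)] t(2) using B.Idn_right[OF counit_Hom[OF W(2)]] by simp
  finally have "sharp ?W (flat (on_obj L X) (\<eta> X \<cdot>\<^bsub>C\<^esub> t)) = sharp ?W (flat (on_obj L X) (Idn C ?W))" by simp
  then have 2: "\<eta> X \<cdot>\<^bsub>C\<^esub> t = Idn C ?W"
    using sharp_flat[OF te W(2)] sharp_flat[OF A.Idn_Hom[OF W(1)] W(2)] by simp
  show ?thesis by (rule A.iso_arrI[OF e t(1) 1 2])
qed

end

section \<open>Exact adjunctions: compact objects and transport of triangles\<close>

locale exact_adj = A: tri_coproducts C r + B: tri_coproducts D r + adj C D L R \<eta> \<epsilon>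
  for C :: "('o, 'm, 'y) tri_cat_scheme" and D :: "('p, 'n, 'z) tri_cat_scheme" and L R \<eta> \<epsilon>
    and r :: "'u rel" +
  assumes L_exact: "exact_functor C D L" and R_exact: "exact_functor D C R"

sublocale exact_adj \<subseteq> L: exact_coproduct_fun C D L r
proof unfold_locales
  show "exact_functor C D L" by (rule L_exact)
  then show "additive_functor C D L" by (simp add: exact_functor_def)
  show "preserves_coproducts r C D L"
    unfolding preserves_coproducts_def by (intro allI impI L_preserves_coproduct)
qed

sublocale exact_adj \<subseteq> R: exact_fun D C R r
  by unfold_locales (rule R_exact)

text \<open>The transpose of \<open>f\<close> goes from \<open>K\<close> to a coproduct of objects
  in the image of \<open>R\<close>, and \<open>R\<close> maps \<open>cut\<close> to
  \<open>cut\<close>; a finite support of the transpose is therefore one of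
  \<open>f\<close>.\<close>

lemma (in exact_adj) L_cpt:
  assumes R: "preserves_coproducts r D C R" and K: "A.cpt r K"
  shows "B.cpt r (on_obj L K)"
proof (rule B.cptI)
  have KO: "K \<in> Obj C" using K A.cpt_Obj by blast
  then show "on_obj L K \<in> Obj D" by simp
  fix I :: "'u set" and X P \<iota> f
  assume I: "small r I" and c: "is_coproduct D I X P \<iota>" and f: "f \<in> Hom D (on_obj L K) P"
  have c': "is_coproduct C I (\<lambda>i. on_obj R (X i)) (on_obj R P) (\<lambda>i. on_arr R (\<iota> i))"
    using R[unfolded preserves_coproducts_def, rule_format, OF c] .
  obtain J where J: "J \<subseteq> I" "finite J"
    "A.cut I (\<lambda>i. on_obj R (X i)) (on_obj R P) (\<lambda>i. on_arr R (\<iota> i)) J \<cdot>\<^bsub>C\<^esub> sharp K f = sharp K f"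
    by (rule A.cptD[OF K I c' sharp_Hom[OF f KO]])
  have cf: "B.cut I X P \<iota> J \<cdot>\<^bsub>D\<^esub> f \<in> Hom D (on_obj L K) P" using B.Cmp_Hom[OF f B.cut(1)[OF c]] .
  have "sharp K (B.cut I X P \<iota> J \<cdot>\<^bsub>D\<^esub> f) = sharp K f"
    using sharp_comp[OF f B.cut(1)[OF c] KO, of J] R.F_cut[OF c c', of J] J(3) by simp
  then have "flat P (sharp K (B.cut I X P \<iota> J \<cdot>\<^bsub>D\<^esub> f)) = flat P (sharp K f)" by simp
  then have "B.cut I X P \<iota> J \<cdot>\<^bsub>D\<^esub> f = f" using flat_sharp[OF cf KO] flat_sharp[OF f KO] by simp
  then show "\<exists>J\<subseteq>I. finite J \<and> B.cut I X P \<iota> J \<cdot>\<^bsub>D\<^esub> f = f" using J by blast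
qed


context exact_adj
begin

text \<open>Transposing the map to \<open>b\<close> replaces a triangle on the image of
  \<open>X\<close> by one on \<open>X\<close> itself. As the counit at \<open>b\<close> is
  invertible, \<open>L\<close> turns the new triangle into the old one, which identifies the image
  of the fibre. This is how truncations are glued.\<close>

lemma fibre_of_sharp:
  assumes ff: "fully_faithful D C R" and X: "X \<in> Obj C" and t: "has_triangle D a (on_obj L X) b"
  obtains Y where "has_triangle C Y X (on_obj R b)" "isom D (on_obj L Y) a"
proof -
  obtain p q h where T: "tri D a (on_obj L X) b p q h" using t unfolding has_triangle_tri by blast
  note qD = triD[OF T]
  have O: "a \<in> Obj D" "b \<in> Obj D" using B.tri_Obj[OF T] by blast+
  have s: "sharp X q \<in> Hom C X (on_obj R b)" using sharp_Hom[OF qD(3) X] .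
  obtain W g k where W: "tri C X (on_obj R b) W (sharp X q) g k" by (rule A.tri_ex[OF s])
  obtain Y where Y: "Y \<in> Obj C" "on_obj (Susp C) Y = W" by (rule A.S_surj[OF A.tri_Obj[OF W, THEN conjunct2, THEN conjunct2]])
  obtain y where y: "tri C Y X (on_obj R b) y (sharp X q) g"
    by (rule A.tri_rotinv[OF W[folded Y(2)] Y(1)])
  obtain h' where LY: "tri D (on_obj L Y) (on_obj L X) (on_obj L (on_obj R b)) (on_arr L y) (on_arr L (sharp X q)) h'"
    by (rule L.F_tri[OF y])
  have "\<epsilon> b \<cdot>\<^bsub>D\<^esub> on_arr L (sharp X q) = q" using flat_sharp[OF qD(3) X] unfolding flat_def .
  also have "\<dots> = q \<cdot>\<^bsub>D\<^esub> Idn D (on_obj L X)" using B.Idn_right[OF qD(3)] by simp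
  finally have "isom D (on_obj L Y) a"
    using B.fibre_isom[OF LY T B.iso_arr_Idn[OF L_Obj[OF X]] counit_iso[OF ff O(2)]] by blast
  moreover have "has_triangle C Y X (on_obj R b)" using y unfolding has_triangle_tri by blast
  ultimately show ?thesis using that by blast
qed

text \<open>The counterpart for fully faithful \<open>L\<close>: the map from \<open>e\<close> is
  transposed, and invertibility of the unit at \<open>e\<close> identifies the image of its cone
  with \<open>y\<close>.\<close>

lemma cone_of_flat:
  assumes ff: "fully_faithful C D L" and X: "X \<in> Obj D" and t: "has_triangle C e (on_obj R X) y"
  obtains X' where "has_triangle D (on_obj L e) X X'" "isom C (on_obj R X') y"
proof -
  obtain p q h where T: "tri C e (on_obj R X) y p q h" using t unfolding has_triangle_tri by blast
  note pD = triD[OF T]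
  have O: "e \<in> Obj C" "on_obj R X \<in> Obj C" using A.tri_Obj[OF T] by blast+
  have f: "flat X p \<in> Hom D (on_obj L e) X" using flat_Hom[OF pD(2) X] .
  obtain X' g k where X': "tri D (on_obj L e) X X' (flat X p) g k" by (rule B.tri_ex[OF f])
  obtain h' where RX: "tri C (on_obj R (on_obj L e)) (on_obj R X) (on_obj R X') (on_arr R (flat X p)) (on_arr R g) h'"
    by (rule R.F_tri[OF X'])
  have "Idn C (on_obj R X) \<cdot>\<^bsub>C\<^esub> p = p" using A.Idn_left[OF pD(2)] .
  also have "\<dots> = on_arr R (flat X p) \<cdot>\<^bsub>C\<^esub> \<eta> e" using sharp_flat[OF pD(2) X] unfolding sharp_def by simp
  finally have "isom C y (on_obj R X')"
    using A.cone_isom[OF T RX unit_iso[OF ff O(1)] A.iso_arr_Idn[OF O(2)]] by blast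
  then have "isom C (on_obj R X') y" by (rule A.isom_sym)
  moreover have "has_triangle D (on_obj L e) X X'" using X' unfolding has_triangle_tri by blast
  ultimately show ?thesis using that by blast
qed

lemma hom_zero_adj_shift:
  assumes "X \<in> Obj C" "Y \<in> Obj D"
  shows "hom_zero D (shift D n (on_obj L X)) Y \<longleftrightarrow> hom_zero C (shift C n X) (on_obj R Y)"
proof -
  have i: "isom D (on_obj L (shift C n X)) (shift D n (on_obj L X))" by (rule L.F_shift[OF assms(1)])
  have "hom_zero D (shift D n (on_obj L X)) Y \<longleftrightarrow> hom_zero D (on_obj L (shift C n X)) Y"
    using B.hom_zero_isom[OF i B.isom_refl[OF assms(2)]] B.hom_zero_isom[OF B.isom_sym[OF i] B.isom_refl[OF assms(2)]]
    by blast
  then show ?thesis using hom_zero_adj[of "shift C n X" Y] assms by simp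
qed

end


section \<open>t-structures and approximability\<close>

locale t_str = tri_coproducts C r for C :: "('o, 'm, 'z) tri_cat_scheme" (structure) and r :: "'u rel" +
  fixes L R :: "'o set"
  assumes t: "t_structure C L R"
begin

definition R1 where "R1 = shift_le C R 1"

lemma L_Obj: "X \<in> L \<Longrightarrow> X \<in> Obj C"
  using t unfolding t_structure_def by blast

lemma R1_Obj: "X \<in> R1 \<Longrightarrow> X \<in> Obj C"
  using t unfolding t_structure_def shift_le_def R1_def by auto

lemma L_R1: "X \<in> L \<Longrightarrow> Y \<in> R1 \<Longrightarrow> hom_zero C X Y"
  using t unfolding t_structure_def R1_def by blast

lemma L_truncation: "X \<in> Obj C \<Longrightarrow> \<exists>A \<in> L. \<exists>B \<in> R1. has_triangle C A X B"
  using t unfolding t_structure_def R1_def by blast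

lemma L_S: assumes "X \<in> L" shows "S X \<in> L"
proof -
  have "L \<subseteq> shift_le C L 1" using t unfolding t_structure_def by blast
  then obtain Y where Y: "Y \<in> L" "X = shift C (-1) Y" using assms unfolding shift_le_def by auto
  then have "S X = Y" using shift_Suc[OF L_Obj[OF Y(1)], of "-1"] by simp
  then show ?thesis using Y by simp
qed

text \<open>If X \<rightarrow> B is zero in the truncation triangle, the identity of B factors
  through \<Sigma>A, which lies in the aisle; so B vanishes. Written as an orthogonal, the aisle has
  its closure properties for formal reasons.\<close>

lemma L_iff: "X \<in> L \<longleftrightarrow> X \<in> Obj C \<and> (\<forall>Y \<in> R1. hom_zero C X Y)"
proof
  assume X: "X \<in> Obj C \<and> (\<forall>Y \<in> R1. hom_zero C X Y)"
  obtain A B where AB: "A \<in> L" "B \<in> R1" "has_triangle C A X B" using L_truncation X by blast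
  obtain f g h where T: "tri C A X B f g h" using AB(3) unfolding has_triangle_tri by blast
  note D = triD[OF T]
  have BO: "B \<in> Obj C" using R1_Obj AB(2) .
  have "g = Zero C X B" using hom_zeroD D(3) X AB(2) by blast
  then have "Idn C B \<cdot> g = Zero C X B" using D(3) BO by (simp add: Hom_iff)
  then obtain v where v: "v \<in> Hom C (S A) B" "v \<cdot> h = Idn C B" using tri_con2[OF T Idn_Hom[OF BO]] by blast
  have "v = Zero C (S A) B" using hom_zeroD[OF L_R1[OF L_S[OF AB(1)] AB(2)] v(1)] .
  then have "Idn C B = Zero C B B" using v(2) D(4) BO by (simp add: Hom_iff)
  then have "zero_object C B" using BO zero_object_iff by blast
  then have "iso_arr C A X f" using zero_cone_iso[OF T] by blast
  then show "X \<in> L" using t AB(1) unfolding t_structure_def by blast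
qed (use L_Obj L_R1 in blast)

lemma L_isom: "X \<in> L \<Longrightarrow> isom C X Y \<Longrightarrow> Y \<in> L"
  using t unfolding t_structure_def isom_def by blast

text \<open>\<open>lev n\<close> is membership in \<open>D\<^sup>\<le>\<^sup>n\<close>.\<close>

definition lev :: "int \<Rightarrow> 'o \<Rightarrow> bool" where
  "lev n X \<longleftrightarrow> X \<in> Obj C \<and> shift C n X \<in> L"

lemma lev_Obj: "lev n X \<Longrightarrow> X \<in> Obj C"
  by (simp add: lev_def)

lemma lev_0: "lev 0 X \<longleftrightarrow> X \<in> L"
  using L_Obj by (auto simp: lev_def)

lemma lev_mono: assumes "lev n X" "n \<le> m" shows "lev m X"
  using assms(2)
proof (induction m rule: int_ge_induct)
  case (step i)
  have X: "X \<in> Obj C" using assms(1) lev_Obj by blast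
  then show ?case using step L_S shift_Suc[OF X] unfolding lev_def by simp
qed (rule assms(1))

lemma lev_shift: "X \<in> Obj C \<Longrightarrow> lev n (shift C k X) \<longleftrightarrow> lev (n + k) X"
  using shift_add by (simp add: lev_def)

lemma lev_isom: "lev n X \<Longrightarrow> isom C X Y \<Longrightarrow> lev n Y"
  unfolding lev_def using L_isom isom_shift isom_Obj by blast

lemma lev_extension: assumes T: "has_triangle C X Y Z" and "lev n X" "lev n Z" shows "lev n Y"
proof -
  have O: "Y \<in> Obj C" using has_triangle_Obj[OF T] by blast
  have "hom_zero C (shift C n Y) W" if "W \<in> R1" for W
    using hom_zero_extension_left[OF has_triangle_shift[OF T, of n]] assms(2,3) L_R1 that unfolding lev_def by blast
  then show ?thesis using O unfolding lev_def L_iff by simp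
qed

lemma lev_cone: assumes T: "has_triangle C X Y Z" and "lev n X" "lev n Y" shows "lev n Z"
proof (rule lev_extension[OF has_triangle_rot[OF T]])
  have "X \<in> Obj C" using assms lev_Obj by blast
  then have "lev (n - 1) (S X)" using lev_shift[of X "n - 1" 1] shift_1 assms(2) by simp
  then show "lev n (S X)" using lev_mono by simp
qed (rule assms(3))

lemma lev_retract:
  assumes X: "lev n X" and ab: "a \<in> Hom C Y X" "b \<in> Hom C X Y" "b \<cdot> a = Idn C Y" shows "lev n Y"
proof -
  have O: "X \<in> Obj C" "Y \<in> Obj C" using Obj_Hom ab by blast+
  have "hom_zero C (shift C n Y) W" if W: "W \<in> R1" for W
  proof -
    have WO: "W \<in> Obj C" using R1_Obj W .
    have "hom_zero C X (shift C (- n) W)"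
      using X L_R1 W hom_zero_shift[OF O(1) WO, of 0 "- n"] unfolding lev_def by simp
    then have "hom_zero C Y (shift C (- n) W)" using hom_zero_retract ab by blast
    then show ?thesis using hom_zero_shift[OF O(2) WO, of 0 "- n"] by simp
  qed
  then show ?thesis using O unfolding lev_def L_iff by simp
qed

lemma lev_truncation:
  assumes X: "X \<in> Obj C"
  obtains T B where "has_triangle C T X B" "lev n T" "B \<in> Obj C" "\<And>W. lev n W \<Longrightarrow> hom_zero C W B"
proof -
  obtain A B where AB: "A \<in> L" "B \<in> R1" "has_triangle C A (shift C n X) B" using L_truncation X shift_Obj by blast
  have O: "A \<in> Obj C" "B \<in> Obj C" using L_Obj R1_Obj AB by blast+
  have "has_triangle C (shift C (- n) A) X (shift C (- n) B)"
    using has_triangle_shift[OF AB(3), of "- n"] shift_add[OF X] by simp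
  moreover have "lev n (shift C (- n) A)" using lev_shift[OF O(1), of n "- n"] AB(1) lev_0 by simp
  moreover have "hom_zero C W (shift C (- n) B)" if W: "lev n W" for W
    using W L_R1 AB(2) hom_zero_shift[OF lev_Obj[OF W] O(2), of 0 "- n"] unfolding lev_def by simp
  ultimately show ?thesis using that O by simp
qed

lemma shift_le_iff: "D \<in> shift_le C L (- 1) \<longleftrightarrow> lev (- 1) D"
proof
  assume "D \<in> shift_le C L (- 1)"
  then obtain X where X: "X \<in> L" "D = shift C 1 X" unfolding shift_le_def by auto
  then show "lev (- 1) D" using lev_shift[OF L_Obj[OF X(1)], of "-1" 1] lev_0 by simp
next
  assume l: "lev (- 1) D"
  then have "D = shift C 1 (shift C (- 1) D)" using shift_add[OF lev_Obj[OF l], of 1 "-1"] by simp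
  then show "D \<in> shift_le C L (- 1)" using l unfolding shift_le_def lev_def by auto
qed

lemma lev_coproduct:
  assumes c: "is_coproduct C I X P \<iota>" and X: "\<And>i. i \<in> I \<Longrightarrow> lev n (X i)" shows "lev n P"
proof -
  obtain \<iota>' where c': "is_coproduct C I (\<lambda>i. shift C n (X i)) (shift C n P) \<iota>'" using is_coproduct_shift[OF c] by blast
  have "hom_zero C (shift C n P) Y" if Y: "Y \<in> R1" for Y
    by (rule hom_zero_coproduct[OF c' _ R1_Obj[OF Y]]) (use X L_R1 Y in \<open>simp add: lev_def\<close>)
  then show ?thesis unfolding lev_def L_iff using is_coproduct_arr(1)[OF c] by simp
qed

lemma bd_lev:
  assumes H: "lev m H" and E: "bd H E" obtains m' where "\<And>X. X \<in> E \<Longrightarrow> lev m' X"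
proof -
  obtain n a b where 1: "E \<subseteq> cp n (shifts C H a b)" using E unfolding bd_def by blast
  have "lev (m + b) X" if X: "X \<in> E" for X
  proof (rule cp_closed[where Q = "lev (m + b)", OF _ _ lev_extension subsetD[OF 1 X]])
    fix W assume "W \<in> shifts C H a b"
    then obtain i where i: "i \<le> b" "W = shift C (- i) H" unfolding shifts_def by blast
    then show "lev (m + b) W" using lev_shift[OF lev_Obj[OF H], of "m + b" "- i"] lev_mono[OF H, of "m + b - i"] by simp
  next
    fix I :: "'b set" and X P \<iota> assume "is_coproduct C I X P \<iota>" "\<forall>i\<in>I. lev (m + b) (X i)"
    then show "lev (m + b) P" using lev_coproduct by blast
  qed
  then show ?thesis using that by blast
qed

end

text \<open>Approximability with its single constant taken apart: \<open>a\<close> locates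
  \<open>G\<close>, and \<E> is any class uniformly built from \<open>G\<close>. The constant is
  reassembled in \<open>approx_approximable\<close>.\<close>

locale approx = t_str C r L R
  for C :: "('o, 'm, 'z) tri_cat_scheme" (structure) and r :: "'u rel" and L R +
  fixes G :: 'o and a :: int and \<E> :: "'o set"
  assumes G_cpt: "cpt r G" and G_gen: "generates C {G}"
    and G_lev: "lev a G" and G_vanish: "X \<in> L \<Longrightarrow> hom_zero C (shift C (- a) G) X"
    and E_bd: "bd G \<E>"
    and G_approx: "X \<in> L \<Longrightarrow> \<exists>E \<in> \<E>. \<exists>D. lev (- 1) D \<and> has_triangle C E X D"
begin

lemma G_Obj: "G \<in> Obj C"
  using G_cpt cpt_Obj by blast

lemma vanish: assumes X: "lev m X" and n: "n \<ge> a + m" shows "hom_zero C (shift C (- n) G) X"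
proof -
  have XO: "X \<in> Obj C" using X lev_Obj by blast
  have "shift C (n - a) X \<in> L" using lev_mono[OF X, of "n - a"] n by (simp add: lev_def)
  then have "hom_zero C (shift C (- a) G) (shift C (n - a) X)" by (rule G_vanish)
  then show ?thesis using hom_zero_shift[OF G_Obj XO, of "- a" "n - a"] by simp
qed

lemma approx_step:
  assumes X: "lev m X"
  obtains E D where "has_triangle C E X D" "shift C m E \<in> \<E>" "lev (m - 1) D"
proof -
  have XO: "X \<in> Obj C" using X lev_Obj by blast
  obtain E D where ED: "E \<in> \<E>" "lev (- 1) D" "has_triangle C E (shift C m X) D"
    using G_approx X unfolding lev_def by blast
  have O: "E \<in> Obj C" "D \<in> Obj C" using has_triangle_Obj[OF ED(3)] by blast+
  have "has_triangle C (shift C (- m) E) X (shift C (- m) D)"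
    using has_triangle_shift[OF ED(3), of "- m"] shift_add[OF XO] by simp
  moreover have "shift C m (shift C (- m) E) \<in> \<E>" using shift_add[OF O(1)] ED(1) by simp
  moreover have "lev (m - 1) (shift C (- m) D)" using lev_shift[OF O(2), of "m - 1" "- m"] ED(2) by simp
  ultimately show ?thesis using that by blast
qed

text \<open>Each approximation lowers the level by one at the cost of an object from a shift of
  \<E>, and octahedra combine them. The resulting class depends only on \<open>c\<close> and
  \<open>k\<close>, which keeps it uniform.\<close>

lemma approx_many:
  shows "\<exists>\<F>. bd G \<F> \<and> (\<forall>X. lev c X \<longrightarrow> (\<exists>E \<in> \<F>. \<exists>D. has_triangle C E X D \<and> lev (c - int k) D))"
proof (induction k)
  case 0
  obtain Z where Z: "zero_object C Z" using ex_zero_object by blast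
  have "bd G {Z}" by (rule bd_subset[OF bd_Add[OF bd_self[OF G_Obj]]]) (use Add_zero[OF Z] in simp)
  moreover have "has_triangle C Z X X" if "lev c X" for X using has_triangle_left_zero[OF lev_Obj[OF that] Z] .
  ultimately show ?case by (intro exI[of _ "{Z}"]) auto
next
  case (Suc k)
  then obtain \<F> where F: "bd G \<F>" "\<And>X. lev c X \<Longrightarrow> \<exists>E \<in> \<F>. \<exists>D. has_triangle C E X D \<and> lev (c - int k) D" by blast
  let ?F = "star C \<F> (shift C (- (c - int k)) ` \<E>)"
  have "bd G ?F" using bd_star[OF F(1) bd_shift[OF E_bd]] .
  moreover have "\<exists>E \<in> ?F. \<exists>D. has_triangle C E X D \<and> lev (c - int (Suc k)) D" if X: "lev c X" for X
  proof -
    obtain E D where ED: "E \<in> \<F>" "has_triangle C E X D" "lev (c - int k) D" using F(2)[OF X] by blast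
    obtain E' D' where E': "has_triangle C E' D D'" "shift C (c - int k) E' \<in> \<E>" "lev (c - int k - 1) D'"
      by (rule approx_step[OF ED(3)])
    have E'O: "E' \<in> Obj C" using has_triangle_Obj[OF E'(1)] by blast
    have "E' = shift C (- (c - int k)) (shift C (c - int k) E')"
      using shift_add[OF E'O, of "- (c - int k)" "c - int k"] by simp
    then have E'F: "E' \<in> shift C (- (c - int k)) ` \<E>" using E'(2) by blast
    obtain v where v: "has_triangle C v X D'" "has_triangle C E v E'" by (rule octahedral2[OF ED(2) E'(1)])
    have "v \<in> ?F" by (rule starI[OF v(2) ED(1) E'F])
    moreover have "c - int (Suc k) = c - int k - 1" by simp
    ultimately show ?thesis using v(1) E'(3) by metis
  qed
  ultimately show ?case by blast
qed

text \<open>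
  Approximate the truncation \<open>T\<close> of \<open>X\<close> at level \<open>k\<close>: the approximating object has no morphisms to
  \<open>X\<close>, which makes \<open>T\<close> a retract of an object at level \<open>k - 1\<close>.
\<close>

lemma truncation_lower:
  assumes X: "\<And>n. n \<ge> N \<Longrightarrow> hom_zero C (shift C (- n) G) X"
  shows "\<exists>K. \<forall>k \<ge> K. \<forall>T B. has_triangle C T X B \<longrightarrow> lev k T \<longrightarrow> (\<forall>W. lev k W \<longrightarrow> hom_zero C W B) \<longrightarrow> lev (k - 1) T"
proof -
  have XO: "X \<in> Obj C" using X[OF order_refl] hom_zero_Obj by blast
  \<comment> \<open>Since \<E> is uniformly built from \<open>G\<close>, its members have no
    morphisms to \<open>X\<close> once shifted far enough; \<open>k\<close> is taken beyond that
    point.\<close>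
  obtain M where M: "\<And>n E. n \<ge> M \<Longrightarrow> E \<in> \<E> \<Longrightarrow> hom_zero C (shift C (- n) E) X"
    by (rule bd_vanish_left[OF E_bd, of "{X}" N]) (use X XO in auto)
  have "lev (k - 1) T" if k: "k \<ge> M" and T: "has_triangle C T X B" and lT: "lev k T"
    and B: "\<forall>W. lev k W \<longrightarrow> hom_zero C W B" for k T B
  proof -
    obtain E D where ED: "has_triangle C E T D" "shift C k E \<in> \<E>" "lev (k - 1) D" by (rule approx_step[OF lT])
    obtain e p q where e: "tri C E T D e p q" using ED(1) unfolding has_triangle_tri by blast
    obtain s u v where s: "tri C T X B s u v" using T unfolding has_triangle_tri by blast
    note eD = triD[OF e] and sD = triD[OF s]
    have O: "E \<in> Obj C" "T \<in> Obj C" "D \<in> Obj C" "B \<in> Obj C" using tri_Obj[OF e] tri_Obj[OF s] by blast+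
    have "hom_zero C (shift C (- k) (shift C k E)) X" by (rule M[OF k ED(2)])
    then have "hom_zero C E X" using shift_add[OF O(1), of "- k" k] by simp
    then have "s \<cdot> e = Zero C E X" using hom_zeroD Cmp_Hom[OF eD(2) sD(2)] by blast
    then obtain w where w: "w \<in> Hom C D X" "w \<cdot> p = s" using tri_con1[OF e sD(2)] by blast
    have "lev k D" using lev_mono[OF ED(3)] by simp
    then have "u \<cdot> w = Zero C D B" using B hom_zeroD Cmp_Hom[OF w(1) sD(3)] by blast
    then obtain z where z: "z \<in> Hom C D T" "s \<cdot> z = w" using tri_cov1[OF s w(1)] by blast
    have zp: "z \<cdot> p \<in> Hom C T T" using Cmp_Hom[OF eD(3) z(1)] .
    \<comment> \<open>\<open>s\<close> kills the difference, so the suspended difference factors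
      through a morphism \<Sigma>T \<rightarrow> B. As \<Sigma>T has level k, that morphism is zero,
      and \<open>z \<cdot> p\<close> is the identity.\<close>
    let ?d = "Plus C (z \<cdot> p) (Neg C (Idn C T))"
    have d: "?d \<in> Hom C T T" using zp O by (simp add: Hom_iff)
    have "s \<cdot> (z \<cdot> p) = s" using reassoc[OF z(2) sD(2) z(1) eD(3)] w(2) by simp
    then have sd: "s \<cdot> ?d = Zero C T X" using zp sD(2) O by (simp add: Hom_iff)
    have "Sa s \<cdot> Sa ?d = Sa (s \<cdot> ?d)" using d sD(2) by (intro Susp.F_Cmp[symmetric]) (simp_all add: Hom_iff)
    then have "Sa s \<cdot> Sa ?d = Zero C (S T) (S X)" using sd O XO by simp
    then obtain y where y: "y \<in> Hom C (S T) B" "v \<cdot> y = Sa ?d" using tri_cov3[OF s Susp.F_Hom[OF d]] by blast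
    have "lev (k - 1) (S T)" using lev_shift[OF O(2), of "k - 1" 1] shift_1[OF O(2)] lT by simp
    then have "lev k (S T)" using lev_mono by simp
    then have "y = Zero C (S T) B" using B hom_zeroD y(1) by blast
    then have "Sa ?d = Zero C (S T) (S T)" using y(2) sD(4) O by (simp add: Hom_iff)
    then have "?d = Zero C T T" by (rule Sa_zero[OF d])
    then have "z \<cdot> p = Idn C T" using diff_zero_iff[OF zp Idn_Hom[OF O(2)]] by blast
    then show ?thesis using lev_retract[OF ED(3) eD(3) z(1)] by blast
  qed
  then show ?thesis by blast
qed

text \<open>By \<open>truncation_lower\<close> the truncations of \<open>X\<close> stop growing at
  some level K. Every shift of \<open>G\<close> lies in some level, so it has no morphisms to the
  part of \<open>X\<close> above K, which therefore vanishes.\<close>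

lemma bounded_above:
  assumes X: "\<And>n. n \<ge> N \<Longrightarrow> hom_zero C (shift C (- n) G) X"
  shows "\<exists>m. lev m X"
proof -
  have XO: "X \<in> Obj C" using X[OF order_refl] hom_zero_Obj by blast
  obtain K where K: "\<And>k T B. k \<ge> K \<Longrightarrow> has_triangle C T X B \<Longrightarrow> lev k T \<Longrightarrow>
      (\<And>W. lev k W \<Longrightarrow> hom_zero C W B) \<Longrightarrow> lev (k - 1) T"
    using truncation_lower[OF X] by blast
  \<comment> \<open>Descends from k to K one level at a time: the truncation at any higher level
    already lies in level K.\<close>
  have low: "lev K T" if k: "k \<ge> K" and T: "has_triangle C T X B" "lev k T" "\<And>W. lev k W \<Longrightarrow> hom_zero C W B" for k T B
    using k T
  proof (induction k arbitrary: T B rule: int_ge_induct)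
    case (step i)
    have "lev (i + 1 - 1) T" by (rule K[OF _ step.prems]) (use step.hyps in simp)
    then have "lev i T" by simp
    then show ?case
      by (rule step.IH[OF step.prems(1)]) (rule step.prems(3), rule lev_mono, assumption, simp)
  qed
  obtain T B where T: "has_triangle C T X B" "lev K T" "B \<in> Obj C" and B: "\<And>W. lev K W \<Longrightarrow> hom_zero C W B"
    by (rule lev_truncation[OF XO, of K]) blast
  have "zero_object C B"
  proof -
    have "hom_zero C (shift C n G) B" for n
    proof -
      \<comment> \<open>A level that contains the n-th suspension of \<open>G\<close>: as
        \<open>G\<close> has level \<open>a\<close>, any k \<ge> a - n will do.\<close>
      define k where "k = max K (a - n)"
      have k: "k \<ge> K" "a \<le> n + k" by (simp_all add: k_def)
      have W: "lev k (shift C n G)" using lev_shift[OF G_Obj, of k n] lev_mono[OF G_lev, of "k + n"] k by simp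
      obtain T' B' where T': "has_triangle C T' B B'" "lev k T'" "B' \<in> Obj C" and B': "\<And>W. lev k W \<Longrightarrow> hom_zero C W B'"
        by (rule lev_truncation[OF T(3), of k]) blast
      \<comment> \<open>\<open>v\<close> is the truncation of \<open>X\<close> at level k, assembled
        from that of \<open>X\<close> at K and that of \<open>B\<close> at k. It lies in level K,
        hence so does T', which then has no morphisms to \<open>B\<close>.\<close>
      obtain v where v: "has_triangle C v X B'" "has_triangle C T v T'" by (rule octahedral2[OF T(1) T'(1)])
      have "lev k v" using lev_extension[OF v(2) lev_mono[OF T(2) k(1)] T'(2)] .
      then have "lev K v" using low[OF k(1) v(1) _ B'] by blast
      then have "lev K T'" using lev_cone[OF v(2) T(2)] by blast
      then have "hom_zero C T' B" by (rule B)
      obtain x y z where x: "tri C T' B B' x y z" using T'(1) unfolding has_triangle_tri by blast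
      note xD = triD[OF x]
      show ?thesis
      proof (rule hom_zeroI)
        fix f assume f: "f \<in> Hom C (shift C n G) B"
        have "y \<cdot> f = Zero C (shift C n G) B'" using hom_zeroD[OF B'[OF W] Cmp_Hom[OF f xD(3)]] .
        then obtain g where g: "g \<in> Hom C (shift C n G) T'" "x \<cdot> g = f" using tri_cov1[OF x f] by blast
        have "x = Zero C T' B" using hom_zeroD[OF \<open>hom_zero C T' B\<close> xD(2)] .
        then show "f = Zero C (shift C n G) B" using g T(3) by (auto simp: Hom_def)
      qed (use G_Obj T(3) in simp_all)
    qed
    then show ?thesis using G_gen T(3) unfolding generates_def by simp
  qed
  moreover obtain f g h where "tri C T X B f g h" using T(1) unfolding has_triangle_tri by blast
  ultimately have "isom C T X" using zero_cone_iso unfolding isom_def by blast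
  then show ?thesis using T(2) lev_isom by blast
qed

end

section \<open>Passing between one constant and separate bounds; vanishing on aisles\<close>

lemma (in t_str) approximable_approx:
  assumes "compact_generator r C G" "A > 0" "shift C (int A) G \<in> L"
    "\<forall>X \<in> L. hom_zero C (shift C (- int A) G) X"
    "\<forall>X \<in> L. \<exists>E \<in> gen_bar r C A G (- int A) (int A). \<exists>D \<in> shift_le C L (- 1). has_triangle C E X D"
  shows "approx C r L R G (int A) (gen_bar r C A G (- int A) (int A))"
proof unfold_locales
  show G: "cpt r G" using assms(1) unfolding compact_generator_def compact_iff by blast
  show "generates C {G}" using assms(1) unfolding compact_generator_def by blast
  have GO: "G \<in> Obj C" using G cpt_Obj by blast
  show "lev (int A) G" using assms(3) GO by (simp add: lev_def)
  show "bd G (gen_bar r C A G (- int A) (int A))" using bd_gen_bar[OF GO] .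
  show "hom_zero C (shift C (- int A) G) X" if "X \<in> L" for X using assms(4) that by blast
  show "\<exists>E \<in> gen_bar r C A G (- int A) (int A). \<exists>D. lev (- 1) D \<and> has_triangle C E X D" if X: "X \<in> L" for X
  proof -
    obtain E D where "E \<in> gen_bar r C A G (- int A) (int A)" "D \<in> shift_le C L (- 1)" "has_triangle C E X D"
      using assms(5) X by blast
    then show ?thesis using shift_le_iff[of D] by blast
  qed
qed

lemma (in t_str) approx_approximable:
  assumes "approx C r L R G a \<E>" shows "approximable r C"
proof -
  interpret approx C r L R G a \<E> by (rule assms)
  obtain N where N: "N > 0" "\<And>n. n \<ge> N \<Longrightarrow> \<E> \<subseteq> gen_bar r C n G (- int n) (int n)" by (rule gen_bar_bd[OF E_bd]) blast
  \<comment> \<open>One number for everything: N for the length and the interval of shifts,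
    \<open>a\<close> for the position of \<open>G\<close>.\<close>
  define A where "A = max N (nat a)"
  have A: "A > 0" "A \<ge> N" "int A \<ge> a" using N(1) by (auto simp: A_def)
  have "compact_generator r C G" using G_cpt G_gen unfolding compact_generator_def compact_iff by blast
  moreover have "shift C (int A) G \<in> L" using lev_mono[OF G_lev A(3)] by (simp add: lev_def)
  moreover have "\<forall>X \<in> L. hom_zero C (shift C (- int A) G) X"
    using vanish[of 0 _ "int A"] A(3) lev_0 by simp
  moreover have "\<forall>X \<in> L. \<exists>E \<in> gen_bar r C A G (- int A) (int A). \<exists>D \<in> shift_le C L (- 1). has_triangle C E X D"
    using G_approx N(2)[OF A(2)] shift_le_iff by blast
  moreover have "triangulated_with_coproducts r C"
    using triangulated_category_axioms coprods loc_small unfolding triangulated_with_coproducts_def by blast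
  ultimately show ?thesis unfolding approximable_def using t A(1) by blast
qed

text \<open>
  Vanishing extends from the approximating objects to the whole aisle: \<open>X\<close> has a sequence of
  quotients in \<open>D\<^sup>\<le>\<^sup>-\<^sup>k\<close> along which morphisms from \<open>K\<close> inject, yet die.
\<close>

lemma aisle_vanish:
  assumes F: "exact_coproduct_fun C D F r" and ap: "approx C r L R G a \<E>"
    and K: "compact_object r D K"
    and z: "\<And>n E. n \<ge> N \<Longrightarrow> E \<in> \<E> \<Longrightarrow> hom_zero D (shift D (- n) K) (on_obj F E)"
    and X: "X \<in> L" and n: "n \<ge> N"
  shows "hom_zero D (shift D (- n) K) (on_obj F X)"
proof -
  interpret F: exact_coproduct_fun C D F r by (rule F)
  interpret ap: approx C r L R G a \<E> by (rule ap)
  have K: "F.B.cpt r K" using K F.B.compact_iff by blast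
  have KO: "K \<in> Obj D" using K F.B.cpt_Obj by blast
  \<comment> \<open>Repeated approximation, by dependent choice: \<open>Y k\<close> has level -k,
    and the fibre of its map to \<open>Y (Suc k)\<close> is the k-th suspension of a member of
    \<E>.\<close>
  have "\<exists>Y. \<forall>k. (ap.lev (- int k) (Y k) \<and> (k = 0 \<longrightarrow> Y k = X)) \<and>
    (\<exists>E e p q. tri C E (Y k) (Y (Suc k)) e p q \<and> shift C (- int k) E \<in> \<E>)"
  proof (rule dependent_nat_choice)
    show "\<exists>x. ap.lev (- int 0) x \<and> (0 = (0::nat) \<longrightarrow> x = X)" using X ap.lev_0 by auto
    fix x k assume "ap.lev (- int k) x \<and> (k = 0 \<longrightarrow> x = X)"
    then have "ap.lev (- int k) x" by blast
    then obtain E D where ED: "has_triangle C E x D" "shift C (- int k) E \<in> \<E>" "ap.lev (- int k - 1) D"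
      by (rule ap.approx_step)
    have "- int (Suc k) = - int k - 1" by simp
    then have "ap.lev (- int (Suc k)) D" using ED(3) by metis
    then show "\<exists>y. (ap.lev (- int (Suc k)) y \<and> (Suc k = 0 \<longrightarrow> y = X)) \<and>
      (\<exists>E e p q. tri C E x y e p q \<and> shift C (- int k) E \<in> \<E>)"
      using ED(1,2) unfolding has_triangle_tri by blast
  qed
  then obtain Y where Y: "\<And>k. ap.lev (- int k) (Y k)" "Y 0 = X"
    and ex: "\<And>k. \<exists>E e p q. tri C E (Y k) (Y (Suc k)) e p q \<and> shift C (- int k) E \<in> \<E>" by blast
  obtain E e y q where T: "\<And>k. tri C (E k) (Y k) (Y (Suc k)) (e k) (y k) (q k)"
    and E: "\<And>k. shift C (- int k) (E k) \<in> \<E>" using ex by metis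
  have y: "y k \<in> Hom C (Y k) (Y (Suc k))" for k using triD(3)[OF T] .
  have YO: "Y k \<in> Obj C" and EO: "E k \<in> Obj C" for k using F.A.tri_Obj[OF T] by blast+
  let ?S = "(\<lambda>(s, n). shift C n s) ` ({G} \<times> (UNIV :: int set))"
  have gen: "generated C r ?S"
    by (rule F.A.generated_shifts) (use ap.G_cpt ap.G_gen small_finite[OF F.A.size, of "{G}"] in simp_all)
  have die: "\<exists>m. path C Y y k m \<cdot>\<^bsub>C\<^esub> f = Zero C s (Y (k + m))" if s: "s \<in> ?S" and f: "f \<in> Hom C s (Y k)" for s k f
  proof -
    obtain i where i: "s = shift C i G" using s by auto
    \<comment> \<open>The i-th suspension of \<open>G\<close> has no morphisms to objects of level
      -(k + m) as soon as m \<ge> a + i.\<close>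
    define m where "m = nat (a + i)"
    have "hom_zero C (shift C (- (- i)) G) (Y (k + m))" by (rule ap.vanish[OF Y(1)]) (simp add: m_def)
    then have "hom_zero C s (Y (k + m))" using i by simp
    then have "path C Y y k m \<cdot>\<^bsub>C\<^esub> f = Zero C s (Y (k + m))"
      using F.A.hom_zeroD F.A.Cmp_Hom[OF f F.A.path_Hom[where y = y and Y = Y, OF y]] by blast
    then show ?thesis by blast
  qed
  let ?K = "shift D (- n) K"
  have K': "F.B.cpt r ?K" using F.B.cpt_shift[OF K] .
  have KO': "?K \<in> Obj D" using KO by simp
  \<comment> \<open>\<open>E k\<close> is the k-th suspension of a member of \<E>. Moving this
    suspension to the side of \<open>K\<close> only increases \<open>n\<close>, so the hypothesis
    applies at every stage.\<close>
  have FE: "hom_zero D ?K (on_obj F (E k))" for k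
  proof -
    let ?E = "shift C (- int k) (E k)"
    have EO': "?E \<in> Obj C" using EO by simp
    have "hom_zero D (shift D (- (n + int k)) K) (on_obj F ?E)" by (rule z[OF _ E]) (use n in simp)
    moreover have "- (n + int k) = - n - int k" by simp
    ultimately have "hom_zero D ?K (shift D (int k) (on_obj F ?E))"
      using F.B.hom_zero_shift[OF KO F.F_Obj[OF EO'], of "- n" "int k"] by simp
    moreover have "isom D (shift D (int k) (on_obj F ?E)) (on_obj F (shift C (int k) ?E))"
      by (rule F.B.isom_sym[OF F.F_shift[OF EO']])
    moreover have "shift C (int k) ?E = E k" using F.A.shift_add[OF EO] by simp
    ultimately show ?thesis using F.B.hom_zero_isom[OF F.B.isom_refl[OF KO']] by metis
  qed
  have inj: "f = Zero D ?K (on_obj F (Y 0))" 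
    if f: "f \<in> Hom D ?K (on_obj F (Y 0))" and m: "on_arr F (path C Y y 0 m) \<cdot>\<^bsub>D\<^esub> f = Zero D ?K (on_obj F (Y m))" for f m
    using m
  proof (induction m)
    case 0
    then show ?case using f YO by (simp add: Hom_iff)
  next
    case (Suc m)
    have p: "path C Y y 0 m \<in> Hom C (Y 0) (Y m)" using F.A.path_Hom[where y = y and Y = Y, OF y, of 0 m] by simp
    let ?g = "on_arr F (path C Y y 0 m) \<cdot>\<^bsub>D\<^esub> f"
    have g: "?g \<in> Hom D ?K (on_obj F (Y m))" using F.B.Cmp_Hom[OF f F.F_Hom[OF p]] .
    have "on_arr F (y m) \<cdot>\<^bsub>D\<^esub> ?g = on_arr F (path C Y y 0 (Suc m)) \<cdot>\<^bsub>D\<^esub> f"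
      using f p y[of m] by (simp add: Hom_iff)
    then have yg: "on_arr F (y m) \<cdot>\<^bsub>D\<^esub> ?g = Zero D ?K (on_obj F (Y (Suc m)))" using Suc.prems by simp
    obtain h' where T': "tri D (on_obj F (E m)) (on_obj F (Y m)) (on_obj F (Y (Suc m))) (on_arr F (e m)) (on_arr F (y m)) h'"
      by (rule F.F_tri[OF T])
    obtain w where w: "w \<in> Hom D ?K (on_obj F (E m))" "on_arr F (e m) \<cdot>\<^bsub>D\<^esub> w = ?g"
      by (rule F.B.tri_cov1[OF T' g yg])
    have "w = Zero D ?K (on_obj F (E m))" using F.B.hom_zeroD[OF FE w(1)] .
    then have "?g = Zero D ?K (on_obj F (Y m))" using w(2) triD(2)[OF T'] KO' by (auto simp: Hom_def)
    then show ?case by (rule Suc.IH)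
  qed
  show ?thesis
  proof (rule F.B.hom_zeroI)
    fix f assume "f \<in> Hom D ?K (on_obj F X)"
    then have f: "f \<in> Hom D ?K (on_obj F (Y 0))" using Y(2) by simp
    obtain m where "on_arr F (path C Y y 0 m) \<cdot>\<^bsub>D\<^esub> f = Zero D ?K (on_obj F (Y m))"
      using F.compact_dies[OF gen y die K' f] by blast
    then show "f = Zero D ?K (on_obj F X)" using inj[OF f] Y(2) by simp
  qed (use KO' YO[of 0] Y(2) in simp_all)
qed


section \<open>Recollements\<close>

locale recoll = D: tri_coproducts D r + F: tri_coproducts DF r + U: tri_coproducts DU r +
  i1: exact_adj D DF i_ust i_lst \<eta>1 \<epsilon>1 r + i2: exact_adj DF D i_lst i_ush \<eta>2 \<epsilon>2 r +
  j1: exact_adj DU D j_lsh j_ust \<eta>3 \<epsilon>3 r + j2: exact_adj D DU j_ust j_lst \<eta>4 \<epsilon>4 r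
  for D :: "('o, 'm, 'x) tri_cat_scheme" and DF :: "('p, 'n, 'y) tri_cat_scheme"
    and DU :: "('q, 'k, 'z) tri_cat_scheme" and r :: "'u rel"
    and i_ust i_lst i_ush j_lsh j_ust j_lst \<eta>1 \<epsilon>1 \<eta>2 \<epsilon>2 \<eta>3 \<epsilon>3 \<eta>4 \<epsilon>4 +
  assumes ji: "\<And>X. X \<in> Obj DF \<Longrightarrow> zero_object DU (on_obj j_ust (on_obj i_lst X))"
    and ff_i: "fully_faithful DF D i_lst" and ff_j: "fully_faithful DU D j_lsh"
    and ff_j': "fully_faithful DU D j_lst"
    and ji_tri: "\<And>X. X \<in> Obj D \<Longrightarrow>
      \<exists>h. tri D (on_obj j_lsh (on_obj j_ust X)) X (on_obj i_lst (on_obj i_ust X)) (\<epsilon>3 X) (\<eta>1 X) h"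
begin

abbreviation iu where "iu \<equiv> on_obj i_ust"
abbreviation il where "il \<equiv> on_obj i_lst"
abbreviation js where "js \<equiv> on_obj j_lsh"
abbreviation ju where "ju \<equiv> on_obj j_ust"
abbreviation jl where "jl \<equiv> on_obj j_lst"

text \<open>\<open>i_lst\<close> is a left adjoint of \<open>i_ush\<close>, so it preserves
  coproducts, and its own left adjoint \<open>i_ust\<close> preserves compactness. For
  \<open>js_cpt\<close> the same role is played by \<open>j_ust\<close>, a left adjoint of
  \<open>j_lst\<close>.\<close>

lemma iu_cpt: "D.cpt r K \<Longrightarrow> F.cpt r (iu K)"
  by (rule i1.L_cpt[OF i2.L.pres])

lemma js_cpt: "U.cpt r K \<Longrightarrow> D.cpt r (js K)"
  by (rule j1.L_cpt[OF j2.L.pres])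

lemma glue_triangle: "X \<in> Obj D \<Longrightarrow> has_triangle D (js (ju X)) X (il (iu X))"
  unfolding has_triangle_tri using ji_tri by blast

text \<open>By two adjunctions the morphisms from \<open>iu (js Y)\<close> to W are those from
  \<open>Y\<close> to the zero object \<open>ju (il W)\<close>; taking W to be
  \<open>iu (js Y)\<close> shows that it is zero.\<close>

lemma ij_zero: assumes Y: "Y \<in> Obj DU" shows "zero_object DF (iu (js Y))"
proof -
  have O: "js Y \<in> Obj D" "iu (js Y) \<in> Obj DF" using Y by simp_all
  have "hom_zero DU Y (ju (il (iu (js Y))))" using U.zero_object_hom_zero(1)[OF ji[OF O(2)] Y] .
  then have "hom_zero D (js Y) (il (iu (js Y)))" using j1.hom_zero_adj[OF Y, of "il (iu (js Y))"] O by simp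
  then have "hom_zero DF (iu (js Y)) (iu (js Y))" using i1.hom_zero_adj[OF O] by simp
  then show ?thesis by (rule F.hom_zero_self)
qed

lemma zero_glue:
  assumes X: "X \<in> Obj D" and z: "zero_object DU (ju X)" "zero_object DF (iu X)" shows "zero_object D X"
proof -
  have "zero_object D (js (ju X))" "zero_object D (il (iu X))"
    using j1.L.F_zero_object[OF z(1)] i1.R.F_zero_object[OF z(2)] .
  then have "hom_zero D (js (ju X)) X" "hom_zero D (il (iu X)) X" using D.zero_object_hom_zero X by blast+
  then have "hom_zero D X X" using D.hom_zero_extension_left[OF glue_triangle[OF X]] by blast
  then show ?thesis by (rule D.hom_zero_self)
qed

lemma il_zero: assumes Y: "Y \<in> Obj DF" and z: "zero_object D (il Y)" shows "zero_object DF Y"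
proof -
  have "zero_object DF (iu (il Y))" using i1.L.F_zero_object[OF z] .
  moreover have "isom DF (iu (il Y)) Y" using i1.counit_iso[OF ff_i Y] unfolding isom_def by blast
  ultimately show ?thesis by (rule F.zero_object_isom)
qed

text \<open>Adjunction turns orthogonality of \<open>Y\<close> to the \<open>iu s\<close> into
  orthogonality of \<open>il Y\<close> to the \<open>s\<close>, and a zero \<open>il Y\<close>
  forces a zero \<open>Y\<close>.\<close>

lemma iu_generates:
  assumes S: "\<And>s. s \<in> S \<Longrightarrow> s \<in> Obj D" and gen: "generates D S" shows "generates DF (iu ` S)"
  unfolding generates_def
proof (intro ballI impI)
  fix Y assume Y: "Y \<in> Obj DF" and z: "\<forall>s \<in> iu ` S. \<forall>n. hom_zero DF (shift DF n s) Y"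
  have "hom_zero D (shift D n s) (il Y)" if "s \<in> S" for s n
    using z that i1.hom_zero_adj_shift[OF S[OF that] Y] by blast
  then have "zero_object D (il Y)" using gen Y unfolding generates_def by simp
  then show "zero_object DF Y" by (rule il_zero[OF Y])
qed

theorem ex_compact_generator:
  assumes GF: "F.cpt r GF" "generates DF {GF}" and GU: "U.cpt r GU" "generates DU {GU}"
    and cg: "compactly_generated r D"
  shows "\<exists>G. compact_generator r D G"
proof -
  obtain S where S: "small r S" "\<And>s. s \<in> S \<Longrightarrow> D.cpt r s" "generates D S"
    using cg unfolding compactly_generated_def D.compact_iff by blast
  have SO: "s \<in> Obj D" if "s \<in> S" for s using S(2)[OF that] D.cpt_Obj by blast
  let ?SS = "(\<lambda>(s, n). shift DF n s) ` (iu ` S \<times> UNIV)"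
  interpret g: generated DF r ?SS
    by (rule F.generated_shifts[OF small_image[OF F.size S(1)] _ iu_generates[OF SO S(3)]]) (use S(2) iu_cpt in blast)
  \<comment> \<open>That \<open>S0\<close> controls \<open>T\<close>. In terms of orthogonality this
    passes to extensions and fibres, with finite sets being united, and later to the retract
    \<open>GF\<close>.\<close>
  define perp where "perp S0 T \<longleftrightarrow> (\<forall>X \<in> Obj DF. (\<forall>s \<in> S0. \<forall>n. hom_zero DF (shift DF n (iu s)) X) \<longrightarrow>
    (\<forall>n. hom_zero DF (shift DF n T) X))" for S0 T
  let ?T = "{T. F.cpt r T \<and> (\<exists>S0 \<subseteq> S. finite S0 \<and> perp S0 T)}"
  have ext_perp: "perp (S0 \<union> S1) Y" if "has_triangle DF X Y Z" "perp S0 X" "perp S1 Z" for X Y Z S0 S1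
    using F.hom_zero_extension_left[OF F.has_triangle_shift[OF that(1)]] that(2,3) unfolding perp_def by blast
  have ext: "extension_closed DF ?T" unfolding extension_closed_def
  proof (intro allI impI)
    fix X Y Z assume t: "has_triangle DF X Y Z" and XZ: "X \<in> ?T" "Z \<in> ?T"
    obtain S0 S1 where "S0 \<subseteq> S" "finite S0" "perp S0 X" "S1 \<subseteq> S" "finite S1" "perp S1 Z" using XZ by blast
    then have "S0 \<union> S1 \<subseteq> S \<and> finite (S0 \<union> S1) \<and> perp (S0 \<union> S1) Y" using ext_perp[OF t] by simp
    then show "Y \<in> ?T" using F.cpt_extension[OF t] XZ by blast
  qed
  have perp_shift: "perp S0 (shift DF k T)" if T: "perp S0 T" "T \<in> Obj DF" for S0 T k
    using T(1) F.shift_add[OF T(2)] unfolding perp_def by simp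
  have fib: "fibre_closed DF ?T" unfolding fibre_closed_def
  proof (intro allI impI)
    fix X Y Z assume t: "has_triangle DF X Y Z" and YZ: "Y \<in> ?T" "Z \<in> ?T"
    have Z: "Z \<in> Obj DF" using F.has_triangle_Obj[OF t] by blast
    obtain S0 S1 where S01: "S0 \<subseteq> S" "finite S0" "perp S0 Y" "S1 \<subseteq> S" "finite S1" "perp S1 Z" using YZ by blast
    have "perp (S1 \<union> S0) X" by (rule ext_perp[OF F.shift_triangle_left[OF t] perp_shift[OF S01(6) Z] S01(3)])
    then have "S1 \<union> S0 \<subseteq> S \<and> finite (S1 \<union> S0) \<and> perp (S1 \<union> S0) X" using S01 by simp
    then show "X \<in> ?T" using F.cpt_fibre[OF t] YZ by blast
  qed
  have ST: "?SS \<subseteq> ?T"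
  proof
    fix x assume "x \<in> ?SS"
    then obtain s n where s: "s \<in> S" "x = shift DF n (iu s)" by auto
    have "perp {s} (iu s)" unfolding perp_def by blast
    then have "perp {s} x" unfolding s(2) using perp_shift SO[OF s(1)] by simp
    moreover have "F.cpt r x" unfolding s(2) using F.cpt_shift[OF iu_cpt[OF S(2)[OF s(1)]]] .
    ultimately show "x \<in> ?T" using s(1) by blast
  qed
  obtain Z where Z: "zero_object DF Z" using F.ex_zero_object by blast
  have "hom_zero DF (shift DF n Z) X" if "X \<in> Obj DF" for n X
    using F.zero_object_hom_zero(2)[OF F.zero_object_shift[OF Z] that] .
  then have "perp {} Z" unfolding perp_def by blast
  then have ZT: "Z \<in> ?T" using F.cpt_zero[OF Z] by blast
  have Tc: "\<forall>T \<in> ?T. F.cpt r T" by blast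
  obtain T a b where T: "T \<in> ?T" "a \<in> Hom DF GF T" "b \<in> Hom DF T GF" "b \<cdot>\<^bsub>DF\<^esub> a = Idn DF GF"
    using g.compact_retract[OF ext fib Tc ST ZT GF(1)] by blast
  obtain S0 where S0: "S0 \<subseteq> S" "finite S0" "perp S0 T" using T(1) by blast
  obtain H where H: "D.cpt r H" "\<And>X. X \<in> Obj D \<Longrightarrow> (\<And>n. hom_zero D (shift D n H) X) \<Longrightarrow>
      \<forall>s \<in> insert (js GU) S0. \<forall>n. hom_zero D (shift D n s) X"
    using D.finite_compact_sum[of "insert (js GU) S0" r] S0(1,2) S(2) js_cpt[OF GU(1)] by blast
  have "zero_object D X" if X: "X \<in> Obj D" and z: "\<And>n. hom_zero D (shift D n H) X" for X
  proof -
    \<comment> \<open>Orthogonality to \<open>js GU\<close> makes \<open>ju X\<close> zero, so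
      \<open>X\<close> comes from \<open>DF\<close>; orthogonality to \<open>S0\<close> can then be
      read off there.\<close>
    note h = H(2)[OF X z]
    have GUO: "GU \<in> Obj DU" using GU(1) U.cpt_Obj by blast
    have "hom_zero DU (shift DU n GU) (ju X)" for n using h j1.hom_zero_adj_shift[OF GUO X] by blast
    then have zU: "zero_object DU (ju X)" using GU(2) X unfolding generates_def by simp
    have iX: "iu X \<in> Obj DF" using X by simp
    have iso: "isom D X (il (iu X))" by (rule D.isom_zero_fibre[OF glue_triangle[OF X] j1.L.F_zero_object[OF zU]])
    have "hom_zero DF (shift DF n (iu s)) (iu X)" if s: "s \<in> S0" for s n
    proof -
      have sO: "s \<in> Obj D" using s S0(1) SO by blast
      have "hom_zero D (shift D n s) X" using h s by blast
      then have "hom_zero D (shift D n s) (il (iu X))"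
        using D.hom_zero_isom[OF D.isom_refl iso] sO by simp
      then show ?thesis using i1.hom_zero_adj_shift[OF sO iX] by blast
    qed
    then have "hom_zero DF (shift DF n T) (iu X)" for n using S0(3) iX unfolding perp_def by blast
    then have "hom_zero DF (shift DF n GF) (iu X)" for n using F.hom_zero_shift_retract[OF T(2-4) _ iX] by blast
    then have "zero_object DF (iu X)" using GF(2) iX unfolding generates_def by simp
    then show ?thesis by (rule zero_glue[OF X zU])
  qed
  then have "generates D {H}" unfolding generates_def by blast
  then show ?thesis using H(1) unfolding compact_generator_def D.compact_iff by blast
qed

end

section \<open>The glued t-structure\<close>

locale recoll_approx = recoll D DF DU r i_ust i_lst i_ush j_lsh j_ust j_lst \<eta>1 \<epsilon>1 \<eta>2 \<epsilon>2 \<eta>3 \<epsilon>3 \<eta>4 \<epsilon>4 +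
  FA: approx DF r LF RF GF aF \<E>F + UA: approx DU r LU RU GU aU \<E>U
  for D :: "('o, 'm, 'x) tri_cat_scheme" and DF :: "('p, 'n, 'y) tri_cat_scheme"
    and DU :: "('q, 'k, 'z) tri_cat_scheme" and r :: "'u rel"
    and i_ust i_lst i_ush j_lsh j_ust j_lst \<eta>1 \<epsilon>1 \<eta>2 \<epsilon>2 \<eta>3 \<epsilon>3 \<eta>4 \<epsilon>4 LF RF GF aF \<E>F LU RU GU aU \<E>U +
  fixes G :: 'o and N :: int
  assumes G_cpt: "D.cpt r G" and G_gen: "generates D {G}"
    and G_self: "n \<ge> N \<Longrightarrow> hom_zero D (shift D (- n) G) G"
begin

lemma G_Obj: "G \<in> Obj D"
  using G_cpt D.cpt_Obj by blast

definition Lg where "Lg = {X \<in> Obj D. ju X \<in> LU \<and> iu X \<in> LF}"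
text \<open>Taken as an orthogonal of the aisle instead of by conditions on \<open>ju\<close> and
  \<open>i_ush\<close>, so that the content lies in the truncation triangles. The desuspension is
  there because \<open>t_structure\<close> asks for vanishing on
  \<open>shift_le D Rg 1\<close>.\<close>

definition Rg where "Rg = {Y \<in> Obj D. \<forall>X \<in> Lg. hom_zero D X (shift D (- 1) Y)}"

lemma Lg_isom: assumes "X \<in> Lg" "isom D X Y" shows "Y \<in> Lg"
  using assms D.isom_Obj UA.L_isom[OF _ j1.R.F_isom] FA.L_isom[OF _ i1.L.F_isom] unfolding Lg_def by blast

lemma Lg_shift_iff:
  assumes X: "X \<in> Obj D" shows "shift D n X \<in> Lg \<longleftrightarrow> UA.lev n (ju X) \<and> FA.lev n (iu X)"
proof -
  note a = j1.R.F_shift[OF X, of n] and b = i1.L.F_shift[OF X, of n]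
  have "ju (shift D n X) \<in> LU \<longleftrightarrow> shift DU n (ju X) \<in> LU" 
    using UA.L_isom[OF _ a] UA.L_isom[OF _ U.isom_sym[OF a]] by blast
  moreover have "iu (shift D n X) \<in> LF \<longleftrightarrow> shift DF n (iu X) \<in> LF" 
    using FA.L_isom[OF _ b] FA.L_isom[OF _ F.isom_sym[OF b]] by blast
  ultimately show ?thesis using X unfolding Lg_def UA.lev_def FA.lev_def by simp
qed

lemma Lg_up: assumes X: "X \<in> Lg" shows "shift D 1 X \<in> Lg"
proof -
  have "X \<in> Obj D" using X unfolding Lg_def by blast
  moreover have "UA.lev 1 (ju X)" "FA.lev 1 (iu X)"
    using X UA.lev_mono[of 0 _ 1] FA.lev_mono[of 0 _ 1] UA.lev_0 FA.lev_0 unfolding Lg_def by simp_all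
  ultimately show ?thesis using Lg_shift_iff by blast
qed

text \<open>Truncation along \<open>ju\<close> splits off \<open>jl b\<close>, then truncation along
  \<open>iu\<close> splits off \<open>il d\<close>. The second does not disturb the first, since
  \<open>ju (il d)\<close> is zero; and the part split off is an extension of two objects that are
  orthogonal to the aisle by adjunction.\<close>

lemma Lg_truncation:
  assumes X: "X \<in> Obj D"
  shows "\<exists>A \<in> Lg. \<exists>B \<in> shift_le D Rg 1. has_triangle D A X B"
proof -
  obtain a b where ab: "a \<in> LU" "b \<in> UA.R1" "has_triangle DU a (ju X) b" using UA.L_truncation[of "ju X"] X by auto
  obtain Y where Y: "has_triangle D Y X (jl b)" "isom DU (ju Y) a"
    by (rule j2.fibre_of_sharp[OF ff_j' X ab(3)])
  have YO: "Y \<in> Obj D" using D.has_triangle_Obj[OF Y(1)] by blast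
  obtain c d where cd: "c \<in> LF" "d \<in> FA.R1" "has_triangle DF c (iu Y) d" using FA.L_truncation[of "iu Y"] YO by auto
  obtain A where A: "has_triangle D A Y (il d)" "isom DF (iu A) c"
    by (rule i1.fibre_of_sharp[OF ff_i YO cd(3)])
  have AO: "A \<in> Obj D" using D.has_triangle_Obj[OF A(1)] by blast
  have O: "b \<in> Obj DU" "d \<in> Obj DF" using UA.R1_Obj ab FA.R1_Obj cd by blast+
  have "isom DU (ju A) (ju Y)" by (rule U.isom_zero_cone[OF j1.R.F_triangle[OF A(1)] ji[OF O(2)]])
  then have "ju A \<in> LU" using ab(1) UA.L_isom U.isom_sym Y(2) U.isom_trans by blast
  moreover have "iu A \<in> LF" using cd(1) FA.L_isom F.isom_sym A(2) by blast
  ultimately have AL: "A \<in> Lg" using AO unfolding Lg_def by blast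
  obtain B where B: "has_triangle D A X B" "has_triangle D (il d) B (jl b)" by (rule D.octahedral1[OF Y(1) A(1)])
  have BO: "B \<in> Obj D" using D.has_triangle_Obj[OF B(1)] by blast
  have "hom_zero D W B" if W: "W \<in> Lg" for W
  proof (rule D.hom_zero_extension_right[OF B(2)])
    have WO: "W \<in> Obj D" "iu W \<in> LF" "ju W \<in> LU" using W unfolding Lg_def by blast+
    show "hom_zero D W (il d)" using i1.hom_zero_adj[OF WO(1) O(2)] FA.L_R1[OF WO(2) cd(2)] by blast
    show "hom_zero D W (jl b)" using j2.hom_zero_adj[OF WO(1) O(1)] UA.L_R1[OF WO(3) ab(2)] by blast
  qed
  then have "shift D 1 B \<in> Rg" using BO D.shift_add[OF BO, of "-1" 1] unfolding Rg_def by simp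
  moreover have "B = shift D (- 1) (shift D 1 B)" using D.shift_add[OF BO, of "-1" 1] by simp
  ultimately have "B \<in> shift_le D Rg 1" unfolding shift_le_def by blast
  then show ?thesis using AL B(1) by blast
qed

lemma glued_t_structure: "t_structure D Lg Rg"
  unfolding t_structure_def
proof (intro conjI allI impI ballI)
  show "Lg \<subseteq> Obj D" "Rg \<subseteq> Obj D" unfolding Lg_def Rg_def by blast+
  show "Y \<in> Lg" if "iso_arr D X Y f" "X \<in> Lg" for X Y f using Lg_isom that unfolding isom_def by blast
  show "Y \<in> Rg" if f: "iso_arr D X Y f" and X: "X \<in> Rg" for X Y f
  proof -
    have i: "isom D X Y" using f unfolding isom_def by blast
    have "hom_zero D W (shift D (- 1) Y)" if W: "W \<in> Lg" for W
    proof -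
      have WO: "W \<in> Obj D" and z: "hom_zero D W (shift D (- 1) X)" using W X unfolding Lg_def Rg_def by blast+
      show ?thesis by (rule D.hom_zero_isom[OF D.isom_refl[OF WO] D.isom_shift[OF i] z])
    qed
    then show ?thesis using D.isom_Obj[OF i] unfolding Rg_def by blast
  qed
  show "Lg \<subseteq> shift_le D Lg 1"
  proof
    fix X assume X: "X \<in> Lg"
    then have "X \<in> Obj D" unfolding Lg_def by blast
    then have "X = shift D (- 1) (shift D 1 X)" using D.shift_add[of X "-1" 1] by simp
    then show "X \<in> shift_le D Lg 1" using Lg_up[OF X] unfolding shift_le_def by blast
  qed
  show "shift_le D Rg 1 \<subseteq> Rg"
  proof
    fix Y assume "Y \<in> shift_le D Rg 1"
    then obtain Z where Z: "Z \<in> Rg" "Y = shift D (- 1) Z" unfolding shift_le_def by blast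
    have ZO: "Z \<in> Obj D" using Z unfolding Rg_def by blast
    have "hom_zero D X (shift D (- 1) Y)" if X: "X \<in> Lg" for X
    proof -
      have XO: "X \<in> Obj D" using X unfolding Lg_def by blast
      have "hom_zero D (shift D 1 X) (shift D (- 1) Z)" using Lg_up[OF X] Z(1) unfolding Rg_def by blast
      then show ?thesis unfolding Z(2)
        using D.hom_zero_shift_left[OF XO, of "shift D (- 1) Z" 1] ZO by simp
    qed
    then show "Y \<in> Rg" unfolding Rg_def Z(2) using ZO Z(2) by simp
  qed
  show "hom_zero D X Y" if "X \<in> Lg" "Y \<in> shift_le D Rg 1" for X Y
    using that unfolding shift_le_def Rg_def by auto
  show "\<exists>A \<in> Lg. \<exists>B \<in> shift_le D Rg 1. has_triangle D A X B" if "X \<in> Obj D" for X by (rule Lg_truncation[OF that])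
qed

section \<open>The position of G in the glued t-structure\<close>

lemma bd_js: "D.bd G {js GU}"
  by (rule D.compact_bd[OF G_cpt G_gen js_cpt[OF UA.G_cpt]])

text \<open>\<open>iu G\<close> generates \<open>DF\<close> as well. That \<open>GF\<close> is built
  from it allows approximations in \<open>DF\<close> to be made of sums of shifts of
  \<open>iu G\<close>, which are the objects that can be lifted to \<open>D\<close>.\<close>

lemma bd_GF: "F.bd (iu G) {GF}"
proof (rule F.compact_bd[OF iu_cpt[OF G_cpt] _ FA.G_cpt])
  show "generates DF {iu G}" using iu_generates[of "{G}"] G_Obj G_gen by simp
qed

lemma bd_iuG: "F.bd GF {iu G}"
  by (rule F.compact_bd[OF FA.G_cpt FA.G_gen iu_cpt[OF G_cpt]])

lemma js_bd: assumes "U.bd GU E" shows "D.bd G (js ` E)"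
  by (rule D.bd_trans[OF bd_js j1.L.F_bd[OF assms]])

text \<open>\<open>js GU\<close> is compact, hence built from \<open>G\<close>, so the assumption on
  \<open>G\<close> excludes morphisms from \<Sigma>^(-n) of it to \<open>G\<close> for large n. By
  adjunction nothing comes to \<open>ju G\<close> from \<Sigma>^(-n) GU, and
  \<open>bounded_above\<close> applies.\<close>

lemma juG_lev: "\<exists>m. UA.lev m (ju G)"
proof -
  obtain N' where N': "\<And>n X Y. n \<ge> N' \<Longrightarrow> X \<in> {js GU} \<Longrightarrow> Y \<in> {G} \<Longrightarrow> hom_zero D (shift D (- n) X) Y"
    by (rule D.bd_vanish_left[OF bd_js, of "{G}" N]) (use G_self G_Obj in auto)
  have "hom_zero DU (shift DU (- n) GU) (ju G)" if n: "n \<ge> N'" for n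
    using N'[OF n, of "js GU" G] j1.hom_zero_adj_shift[OF UA.G_Obj G_Obj] by blast
  then show ?thesis using UA.bounded_above by blast
qed

lemma iuG_lev: "\<exists>m. FA.lev m (iu G)"
  by (rule FA.bd_lev[OF FA.G_lev bd_iuG]) blast

lemma G_lev: "\<exists>m. \<forall>n \<ge> m. shift D n G \<in> Lg"
proof -
  obtain m m' where m: "UA.lev m (ju G)" "FA.lev m' (iu G)" using juG_lev iuG_lev by blast
  have "shift D n G \<in> Lg" if "n \<ge> max m m'" for n
    using Lg_shift_iff[OF G_Obj, of n] UA.lev_mono[OF m(1), of n] FA.lev_mono[OF m(2), of n] that by simp
  then show ?thesis by blast
qed

text \<open>\<open>js\<close> carries the approximating objects of \<open>DU\<close> to objects
  built from \<open>G\<close>, where the assumption on \<open>G\<close> gives the vanishing;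
  \<open>aisle_vanish\<close> spreads it over the aisle.\<close>

lemma G_vanish_U: "\<exists>M. \<forall>n \<ge> M. \<forall>Y \<in> LU. hom_zero D (shift D (- n) G) (js Y)"
proof -
  obtain M where M: "\<And>n X. n \<ge> M \<Longrightarrow> X \<in> js ` \<E>U \<Longrightarrow> hom_zero D (shift D (- n) G) X"
    by (rule D.bd_vanish_right[OF js_bd[OF UA.E_bd] G_cpt, of N]) (use G_self in auto)
  have "hom_zero D (shift D (- n) G) (js Y)" if "n \<ge> M" "Y \<in> LU" for n Y
    by (rule aisle_vanish[OF j1.L.exact_coproduct_fun_axioms UA.approx_axioms _ _ that(2,1)])
      (use M G_cpt D.compact_iff in blast)+
  then show ?thesis by blast
qed

text \<open>Adjunction replaces \<open>G\<close> by \<open>iu G\<close>, which is compact and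
  therefore built from \<open>GF\<close>.\<close>

lemma G_vanish_F: "\<exists>M. \<forall>n \<ge> M. \<forall>Y \<in> LF. hom_zero D (shift D (- n) G) (il Y)"
proof -
  have LFO: "LF \<subseteq> Obj DF" using FA.L_Obj by blast
  obtain M where M: "\<And>n X Y. n \<ge> M \<Longrightarrow> X \<in> {iu G} \<Longrightarrow> Y \<in> LF \<Longrightarrow> hom_zero DF (shift DF (- n) X) Y"
    by (rule F.bd_vanish_left[OF bd_iuG LFO, of aF]) (use FA.vanish[of 0] FA.lev_0 in auto)
  have "hom_zero D (shift D (- n) G) (il Y)" if n: "n \<ge> M" and Y: "Y \<in> LF" for n Y
    using M[OF n, of "iu G" Y] i1.hom_zero_adj_shift[OF G_Obj FA.L_Obj[OF Y]] Y by blast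
  then show ?thesis by blast
qed

lemma G_vanish: "\<exists>M. \<forall>n \<ge> M. \<forall>X \<in> Lg. hom_zero D (shift D (- n) G) X"
proof -
  obtain M where M: "\<And>n Y. n \<ge> M \<Longrightarrow> Y \<in> LU \<Longrightarrow> hom_zero D (shift D (- n) G) (js Y)" using G_vanish_U by blast
  obtain M' where M': "\<And>n Y. n \<ge> M' \<Longrightarrow> Y \<in> LF \<Longrightarrow> hom_zero D (shift D (- n) G) (il Y)" using G_vanish_F by blast
  have "hom_zero D (shift D (- n) G) X" if n: "n \<ge> max M M'" and X: "X \<in> Lg" for n X
  proof -
    have "X \<in> Obj D" "ju X \<in> LU" "iu X \<in> LF" using X unfolding Lg_def by blast+
    then show ?thesis using D.hom_zero_extension_right[OF glue_triangle M M'] n by simp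
  qed
  then show ?thesis by blast
qed

section \<open>Lifting approximations from DF to D\<close>

lemma push_down:
  "\<exists>\<F>. D.bd G \<F> \<and> (\<forall>X \<in> Obj D. UA.lev c (ju X) \<longrightarrow> (\<exists>E \<in> \<F>. \<exists>X'. has_triangle D E X X' \<and>
     UA.lev m (ju X') \<and> isom DF (iu X') (iu X)))"
proof -
  \<comment> \<open>From level c to level m it takes \<open>nat (c - m)\<close> approximations in
    \<open>DU\<close>, none if c \<le> m. They are attached to \<open>X\<close> through
    \<open>js\<close>, so that \<open>iu X\<close> does not change.\<close>
  obtain \<F> where F: "U.bd GU \<F>"
    "\<And>Y. UA.lev c Y \<Longrightarrow> \<exists>E \<in> \<F>. \<exists>Z. has_triangle DU E Y Z \<and> UA.lev (c - int (nat (c - m))) Z"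
    using UA.approx_many[of c "nat (c - m)"] by blast
  have "\<exists>E \<in> js ` \<F>. \<exists>X'. has_triangle D E X X' \<and> UA.lev m (ju X') \<and> isom DF (iu X') (iu X)"
    if X: "X \<in> Obj D" and l: "UA.lev c (ju X)" for X
  proof -
    obtain e y where e: "e \<in> \<F>" "has_triangle DU e (ju X) y" "UA.lev (c - int (nat (c - m))) y" using F(2)[OF l] by blast
    have eO: "e \<in> Obj DU" using U.has_triangle_Obj[OF e(2)] by blast
    have y: "UA.lev m y" by (rule UA.lev_mono[OF e(3)]) simp
    obtain X' where X': "has_triangle D (js e) X X'" "isom DU (ju X') y" by (rule j1.cone_of_flat[OF ff_j X e(2)])
    have "UA.lev m (ju X')" using UA.lev_isom[OF y U.isom_sym[OF X'(2)]] .
    moreover have "isom DF (iu X) (iu X')" by (rule F.isom_zero_fibre[OF i1.L.F_triangle[OF X'(1)] ij_zero[OF eO]])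
    ultimately show ?thesis using X'(1) e(1) F.isom_sym by blast
  qed
  then show ?thesis using js_bd[OF F(1)] by blast
qed

lemma compose_cones:
  assumes "has_triangle D E X Y" "has_triangle D E' Y Z" "E \<in> \<A>" "E' \<in> \<B>"
  obtains E'' where "E'' \<in> star D \<A> \<B>" "has_triangle D E'' X Z"
  by (rule D.octahedral2[OF assms(1,2)]) (use D.starI[OF _ assms(3,4)] in blast)

text \<open>\<open>iu\<close> commutes with coproducts and, up to isomorphism, with shifts; the same
  coproduct of shifts of \<open>G\<close>, formed in \<open>D\<close>, is a lift.\<close>

lemma lift_Add:
  assumes P: "P \<in> Add r DF (shifts DF (iu G) a b)"
  obtains Q where "Q \<in> Add r D (shifts D G a b)" "isom DF P (iu Q)"
proof -
  obtain I :: "'u set" and X \<iota> where I: "small r I" "\<forall>i \<in> I. X i \<in> shifts DF (iu G) a b" and c: "is_coproduct DF I X P \<iota>"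
    using P by (rule F.AddE)
  have "\<forall>i \<in> I. \<exists>k. a \<le> k \<and> k \<le> b \<and> X i = shift DF (- k) (iu G)" using I(2) unfolding shifts_def by blast
  then obtain k where k: "\<And>i. i \<in> I \<Longrightarrow> a \<le> k i \<and> k i \<le> b \<and> X i = shift DF (- k i) (iu G)" by metis
  have "shift D (- k i) G \<in> Obj D" for i using G_Obj by simp
  then obtain Q \<kappa> where Q: "is_coproduct D I (\<lambda>i. shift D (- k i) G) Q \<kappa>"
    by (rule D.ex_coproduct[OF I(1), of "\<lambda>i. shift D (- k i) G"])
  have "Q \<in> Add r D (shifts D G a b)"
    by (rule D.AddI[OF I(1) _ Q]) (use k in \<open>auto simp: shifts_def\<close>)
  moreover have "isom DF (X i) (iu (shift D (- k i) G))" if "i \<in> I" for i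
    using F.isom_sym[OF i1.L.F_shift[OF G_Obj]] k[OF that] by simp
  then obtain \<kappa>' where "is_coproduct DF I X (iu Q) \<kappa>'"
    by (rule F.is_coproduct_transfer_family[OF i1.L_preserves_coproduct[OF Q]])
  then have "isom DF P (iu Q)" using F.is_coproduct_isom[OF c] by blast
  ultimately show ?thesis using that by blast
qed

text \<open>
  A morphism \<open>i\<^sup>*Q \<rightarrow> i\<^sup>*X\<close> is a morphism \<open>Q \<rightarrow> i\<^sub>*i\<^sup>*X\<close>, and the obstruction to lifting it to \<open>X\<close> is its
  image in \<open>Hom(Q, \<Sigma>j\<^sub>!j\<^sup>*X)\<close>.
\<close>

lemma lift_cone:
  assumes O: "X \<in> Obj D" "Q \<in> Obj D" and t: "has_triangle DF (iu Q) (iu X) Z"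
    and z: "hom_zero D Q (on_obj (Susp D) (js (ju X)))"
  obtains X' where "has_triangle D Q X X'" "isom DF (iu X') Z"
proof -
  obtain g p q where T: "tri DF (iu Q) (iu X) Z g p q" using t unfolding has_triangle_tri by blast
  note gD = triD[OF T]
  obtain h where h: "tri D (js (ju X)) X (il (iu X)) (\<epsilon>3 X) (\<eta>1 X) h" using ji_tri[OF O(1)] by blast
  note hD = triD[OF h]
  have s: "i1.sharp Q g \<in> Hom D Q (il (iu X))" using i1.sharp_Hom[OF gD(2) O(2)] .
  have "h \<cdot>\<^bsub>D\<^esub> i1.sharp Q g = Zero D Q (on_obj (Susp D) (js (ju X)))" using D.hom_zeroD[OF z D.Cmp_Hom[OF s hD(4)]] .
  then obtain f where f: "f \<in> Hom D Q X" "\<eta>1 X \<cdot>\<^bsub>D\<^esub> f = i1.sharp Q g" by (rule D.tri_cov2[OF h s])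
  have iX: "iu X \<in> Obj DF" "iu Q \<in> Obj DF" using O by simp_all
  \<comment> \<open>By the zigzag identity a lift of the transpose of \<open>g\<close> along the
    unit is sent by \<open>i_ust\<close> to \<open>g\<close> itself; hence \<open>i_ust\<close>
    sends its cone to the cone of \<open>g\<close>.\<close>
  have "g = \<epsilon>1 (iu X) \<cdot>\<^bsub>DF\<^esub> on_arr i_ust (\<eta>1 X \<cdot>\<^bsub>D\<^esub> f)"
    using i1.flat_sharp[OF gD(2) O(2)] f(2) unfolding i1.flat_def by simp
  also have "\<dots> = \<epsilon>1 (iu X) \<cdot>\<^bsub>DF\<^esub> (on_arr i_ust (\<eta>1 X) \<cdot>\<^bsub>DF\<^esub> on_arr i_ust f)"
    using i1.L_Cmp[OF f(1) hD(3)] by simp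
  also have "\<dots> = Idn DF (iu X) \<cdot>\<^bsub>DF\<^esub> on_arr i_ust f"
    by (rule F.reassoc[OF i1.zigzag_L[OF O(1)] i1.counit_Hom[OF iX(1)] i1.L_Hom[OF hD(3)] i1.L_Hom[OF f(1)]])
  also have "\<dots> = on_arr i_ust f" by (rule F.Idn_left[OF i1.L_Hom[OF f(1)]])
  finally have gf: "g = on_arr i_ust f" .
  obtain X' u v where X': "tri D Q X X' f u v" by (rule D.tri_ex[OF f(1)])
  obtain v' where iX': "tri DF (iu Q) (iu X) (iu X') (on_arr i_ust f) (on_arr i_ust u) v'" by (rule i1.L.F_tri[OF X'])
  have "Idn DF (iu X) \<cdot>\<^bsub>DF\<^esub> on_arr i_ust f = g \<cdot>\<^bsub>DF\<^esub> Idn DF (iu Q)"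
    unfolding gf using F.Idn_left[OF i1.L_Hom[OF f(1)]] F.Idn_right[OF i1.L_Hom[OF f(1)]] by simp
  from F.cone_isom[OF iX' T F.iso_arr_Idn[OF iX(2)] F.iso_arr_Idn[OF iX(1)] this]
  have "isom DF (iu X') Z" .
  moreover have "has_triangle D Q X X'" using X' unfolding has_triangle_tri by blast
  ultimately show ?thesis using that by blast
qed

text \<open>Three cones: lowering \<open>ju X\<close> to level -m removes the obstruction to
  lifting, the lifted sum is split off, and since its image under \<open>ju\<close> is merely
  bounded above, the level is lowered again, to -1.\<close>

lemma lift_base:
  "\<exists>\<F>. D.bd G \<F> \<and> (\<forall>X \<in> Obj D. \<forall>P Z. UA.lev c (ju X) \<longrightarrow> P \<in> Add r DF (shifts DF (iu G) a b) \<longrightarrow>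
     has_triangle DF P (iu X) Z \<longrightarrow>
     (\<exists>E \<in> \<F>. \<exists>X'. has_triangle D E X X' \<and> isom DF (iu X') Z \<and> UA.lev (- 1) (ju X')))"
proof -
  obtain M where M: "\<And>n Y. n \<ge> M \<Longrightarrow> Y \<in> LU \<Longrightarrow> hom_zero D (shift D (- n) G) (js Y)" using G_vanish_U by blast
  \<comment> \<open>For Y of level -m, morphisms from \<Sigma>^(-i) G to \<Sigma>(js Y) correspond
    to morphisms from \<Sigma>^(-(i + m + 1)) G to \<open>js\<close> of an object of the aisle; i =
    a is the critical case.\<close>
  define m where "m = M - a"
  let ?Q = "Add r D (shifts D G a b)"
  have Qb: "D.bd G ?Q" by (rule D.bd_Add[OF D.bd_shifts[OF G_Obj]])
  have van: "hom_zero D Q (on_obj (Susp D) (js Y))" if Q: "Q \<in> ?Q" and Y: "UA.lev (- m) Y" for Q Y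
  proof -
    have YO: "Y \<in> Obj DU" using Y UA.lev_Obj by blast
    let ?Y = "shift DU (- m) Y"
    have YL: "?Y \<in> LU" using Y by (simp add: UA.lev_def)
    have jO: "js ?Y \<in> Obj D" using YO by simp
    have "isom D (shift D (- m) (js Y)) (js ?Y)" by (rule D.isom_sym[OF j1.L.F_shift[OF YO]])
    from D.isom_shift[OF this, of "m + 1"]
    have "isom D (shift D 1 (js Y)) (shift D (m + 1) (js ?Y))" using D.shift_add[of "js Y" "m + 1" "- m"] YO by simp
    then have iso: "isom D (shift D (m + 1) (js ?Y)) (on_obj (Susp D) (js Y))"
      using D.shift_1[of "js Y"] YO D.isom_sym by simp
    have "hom_zero D (shift D 0 Q) (shift D (m + 1) (js ?Y))"
    proof (rule D.cp_hom_zero_left[of Q 0 G a b])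
      show "Q \<in> D.cp 0 (shifts D G a b)" using Q by simp
      fix i assume i: "a \<le> i" "i \<le> b"
      have "hom_zero D (shift D (- (i + m + 1)) G) (js ?Y)" by (rule M[OF _ YL]) (use i in \<open>simp add: m_def\<close>)
      moreover have "0 - i - (m + 1) = - (i + m + 1)" by simp
      ultimately show "hom_zero D (shift D (0 - i) G) (shift D (m + 1) (js ?Y))"
        unfolding D.hom_zero_shift[OF G_Obj jO] by metis
    qed (use G_Obj YO in simp_all)
    then show ?thesis using D.hom_zero_isom[OF D.isom_refl[OF D.Add_Obj[OF Q]] iso] by simp
  qed
  obtain \<F>1 where F1: "D.bd G \<F>1" "\<And>X. X \<in> Obj D \<Longrightarrow> UA.lev c (ju X) \<Longrightarrow> \<exists>E \<in> \<F>1. \<exists>X'. has_triangle D E X X' \<and>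
     UA.lev (- m) (ju X') \<and> isom DF (iu X') (iu X)" using push_down[of c "- m"] by blast
  obtain g where g: "UA.lev g (ju G)" using juG_lev by blast
  obtain q where q: "\<And>X. X \<in> ju ` ?Q \<Longrightarrow> UA.lev q X" by (rule UA.bd_lev[OF g j2.L.F_bd[OF Qb]]) blast
  \<comment> \<open>Bounds the level after splitting off the lifted sum Q: \<open>ju Q\<close> has
    level q because \<open>ju G\<close> is bounded above, and the object treated has level
    -m.\<close>
  define c' where "c' = max q (- m)"
  obtain \<F>2 where F2: "D.bd G \<F>2" "\<And>X. X \<in> Obj D \<Longrightarrow> UA.lev c' (ju X) \<Longrightarrow> \<exists>E \<in> \<F>2. \<exists>X'. has_triangle D E X X' \<and>
     UA.lev (- 1) (ju X') \<and> isom DF (iu X') (iu X)" using push_down[of c' "- 1"] by blast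
  let ?F = "star D (star D \<F>1 ?Q) \<F>2"
  have "\<exists>E \<in> ?F. \<exists>X'. has_triangle D E X X' \<and> isom DF (iu X') Z \<and> UA.lev (- 1) (ju X')"
    if X: "X \<in> Obj D" "UA.lev c (ju X)" and P: "P \<in> Add r DF (shifts DF (iu G) a b)" and t: "has_triangle DF P (iu X) Z"
    for X P Z
  proof -
    have ZO: "Z \<in> Obj DF" using F.has_triangle_Obj[OF t] by blast
    obtain E1 X1 where X1: "E1 \<in> \<F>1" "has_triangle D E1 X X1" "UA.lev (- m) (ju X1)" "isom DF (iu X1) (iu X)"
      using F1(2)[OF X] by blast
    have X1O: "X1 \<in> Obj D" using D.has_triangle_Obj[OF X1(2)] by blast
    obtain Q where Q: "Q \<in> ?Q" "isom DF P (iu Q)" by (rule lift_Add[OF P])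
    have QO: "Q \<in> Obj D" using D.Add_Obj[OF Q(1)] .
    have "has_triangle DF (iu Q) (iu X1) Z"
      by (rule F.has_triangle_isom[OF t Q(2) F.isom_sym[OF X1(4)] F.isom_refl[OF ZO]])
    then obtain X2 where X2: "has_triangle D Q X1 X2" "isom DF (iu X2) Z"
      by (rule lift_cone[OF X1O QO _ van[OF Q(1) X1(3)]])
    have X2O: "X2 \<in> Obj D" using D.has_triangle_Obj[OF X2(1)] by blast
    have "UA.lev c' (ju Q)" "UA.lev c' (ju X1)"
      using UA.lev_mono[OF q, of "ju Q" c'] UA.lev_mono[OF X1(3), of c'] Q(1) by (simp_all add: c'_def)
    then have "UA.lev c' (ju X2)" by (rule UA.lev_cone[OF j1.R.F_triangle[OF X2(1)]])
    then obtain E3 X3 where X3: "E3 \<in> \<F>2" "has_triangle D E3 X2 X3" "UA.lev (- 1) (ju X3)" "isom DF (iu X3) (iu X2)"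
      using F2(2)[OF X2O] by blast
    obtain E' where E': "E' \<in> star D \<F>1 ?Q" "has_triangle D E' X X2" by (rule compose_cones[OF X1(2) X2(1) X1(1) Q(1)])
    obtain E where E: "E \<in> ?F" "has_triangle D E X X3" by (rule compose_cones[OF E'(2) X3(2) E'(1) X3(1)])
    have "isom DF (iu X3) Z" using F.isom_trans[OF X3(4) X2(2)] .
    then show ?thesis using E X3(3) by blast
  qed
  moreover have "D.bd G ?F" by (rule D.bd_star[OF D.bd_star[OF F1(1) Qb] F2(1)])
  ultimately show ?thesis by blast
qed

text \<open>One layer at a time by \<open>lift_base\<close>. Each lift ends with \<open>ju\<close>
  in level -1, which is why the induction leaves \<open>c\<close> open and is used at -1.\<close>

lemma lift_cp:
  "\<exists>\<F>. D.bd G \<F> \<and> (\<forall>X \<in> Obj D. \<forall>P Z. UA.lev c (ju X) \<longrightarrow> P \<in> F.cp n (shifts DF (iu G) a b) \<longrightarrow>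
     has_triangle DF P (iu X) Z \<longrightarrow>
     (\<exists>E \<in> \<F>. \<exists>X'. has_triangle D E X X' \<and> isom DF (iu X') Z \<and> UA.lev (- 1) (ju X')))"
proof (induction n arbitrary: c)
  case 0
  then show ?case using lift_base by simp
next
  case (Suc n)
  obtain \<F>1 where F1: "D.bd G \<F>1" "\<And>X P Z. X \<in> Obj D \<Longrightarrow> UA.lev c (ju X) \<Longrightarrow> P \<in> Add r DF (shifts DF (iu G) a b) \<Longrightarrow>
     has_triangle DF P (iu X) Z \<Longrightarrow> \<exists>E \<in> \<F>1. \<exists>X'. has_triangle D E X X' \<and> isom DF (iu X') Z \<and> UA.lev (- 1) (ju X')"
    using lift_base[of c a b] by blast
  obtain \<F>2 where F2: "D.bd G \<F>2" "\<And>X P Z. X \<in> Obj D \<Longrightarrow> UA.lev (- 1) (ju X) \<Longrightarrow> P \<in> F.cp n (shifts DF (iu G) a b) \<Longrightarrow>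
     has_triangle DF P (iu X) Z \<Longrightarrow> \<exists>E \<in> \<F>2. \<exists>X'. has_triangle D E X X' \<and> isom DF (iu X') Z \<and> UA.lev (- 1) (ju X')"
    using Suc.IH[of "- 1"] by blast
  have "\<exists>E \<in> star D \<F>1 \<F>2. \<exists>X'. has_triangle D E X X' \<and> isom DF (iu X') Z \<and> UA.lev (- 1) (ju X')"
    if X: "X \<in> Obj D" "UA.lev c (ju X)" and P: "P \<in> F.cp (Suc n) (shifts DF (iu G) a b)" and t: "has_triangle DF P (iu X) Z"
    for X P Z
  proof -
    have "P \<in> star DF (Add r DF (shifts DF (iu G) a b)) (F.cp n (shifts DF (iu G) a b))" using P by simp
    then obtain p q where pq: "p \<in> Add r DF (shifts DF (iu G) a b)" "q \<in> F.cp n (shifts DF (iu G) a b)" "has_triangle DF p P q"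
      by (rule F.starE)
    \<comment> \<open>The octahedron separates the first layer \<open>p\<close>, lifted now, from
      the remaining layers \<open>q\<close>, which are left to the induction hypothesis.\<close>
    obtain Y where Y: "has_triangle DF p (iu X) Y" "has_triangle DF q Y Z" by (rule F.octahedral1[OF t pq(3)])
    have O: "q \<in> Obj DF" "Z \<in> Obj DF" using F.has_triangle_Obj[OF Y(2)] by blast+
    obtain E1 X1 where X1: "E1 \<in> \<F>1" "has_triangle D E1 X X1" "isom DF (iu X1) Y" "UA.lev (- 1) (ju X1)"
      using F1(2)[OF X pq(1) Y(1)] by blast
    have X1O: "X1 \<in> Obj D" using D.has_triangle_Obj[OF X1(2)] by blast
    have "has_triangle DF q (iu X1) Z"
      by (rule F.has_triangle_isom[OF Y(2) F.isom_refl[OF O(1)] F.isom_sym[OF X1(3)] F.isom_refl[OF O(2)]])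
    from F2(2)[OF X1O X1(4) pq(2) this]
    obtain E2 X2 where X2: "E2 \<in> \<F>2" "has_triangle D E2 X1 X2" "isom DF (iu X2) Z" "UA.lev (- 1) (ju X2)" by blast
    obtain E where "E \<in> star D \<F>1 \<F>2" "has_triangle D E X X2" by (rule compose_cones[OF X1(2) X2(2) X1(1) X2(1)])
    then show ?thesis using X2(3,4) by blast
  qed
  then show ?case using D.bd_star[OF F1(1) F2(1)] by blast
qed

text \<open>The approximating objects of \<open>DF\<close> are uniformly built from
  \<open>iu G\<close>, direct summands having been absorbed by \<open>bd\<close>. Lifting one of
  them gives \<open>iu X'\<close> its level, and \<open>ju X'\<close> has level -1 by
  construction.\<close>

lemma glued_approximation:
  "\<exists>\<F>. D.bd G \<F> \<and> (\<forall>X \<in> Lg. \<exists>E \<in> \<F>. \<exists>X'. shift D (- 1) X' \<in> Lg \<and> X' \<in> Obj D \<and> has_triangle D E X X')"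
proof -
  have "F.bd (iu G) \<E>F" by (rule F.bd_trans[OF bd_GF FA.E_bd])
  then obtain n a b where n: "\<E>F \<subseteq> F.cp n (shifts DF (iu G) a b)" unfolding F.bd_def by blast
  obtain \<F> where F: "D.bd G \<F>" "\<And>X P Z. X \<in> Obj D \<Longrightarrow> UA.lev 0 (ju X) \<Longrightarrow> P \<in> F.cp n (shifts DF (iu G) a b) \<Longrightarrow>
     has_triangle DF P (iu X) Z \<Longrightarrow> \<exists>E \<in> \<F>. \<exists>X'. has_triangle D E X X' \<and> isom DF (iu X') Z \<and> UA.lev (- 1) (ju X')"
    using lift_cp[of 0 n a b] by blast
  have "\<exists>E \<in> \<F>. \<exists>X'. shift D (- 1) X' \<in> Lg \<and> X' \<in> Obj D \<and> has_triangle D E X X'" if X: "X \<in> Lg" for X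
  proof -
    have XO: "X \<in> Obj D" "UA.lev 0 (ju X)" "iu X \<in> LF" using X UA.lev_0 unfolding Lg_def by blast+
    obtain P Z where PZ: "P \<in> \<E>F" "FA.lev (- 1) Z" "has_triangle DF P (iu X) Z" using FA.G_approx[OF XO(3)] by blast
    obtain E X' where E: "E \<in> \<F>" "has_triangle D E X X'" "isom DF (iu X') Z" "UA.lev (- 1) (ju X')"
      using F(2)[OF XO(1,2) subsetD[OF n PZ(1)] PZ(3)] by blast
    have X'O: "X' \<in> Obj D" using D.has_triangle_Obj[OF E(2)] by blast
    have "FA.lev (- 1) (iu X')" by (rule FA.lev_isom[OF PZ(2) F.isom_sym[OF E(3)]])
    then have "shift D (- 1) X' \<in> Lg" using Lg_shift_iff[OF X'O] E(4) by blast
    then show ?thesis using E(1,2) X'O by blast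
  qed
  then show ?thesis using F(1) by blast
qed

theorem glued_approximable: "approximable r D"
proof -
  interpret t: t_str D r Lg Rg by unfold_locales (rule glued_t_structure)
  obtain m where m: "\<And>n. n \<ge> m \<Longrightarrow> shift D n G \<in> Lg" using G_lev by blast
  obtain M where M: "\<And>n X. n \<ge> M \<Longrightarrow> X \<in> Lg \<Longrightarrow> hom_zero D (shift D (- n) G) X" using G_vanish by blast
  obtain \<F> where F: "D.bd G \<F>"
    "\<And>X. X \<in> Lg \<Longrightarrow> \<exists>E \<in> \<F>. \<exists>X'. shift D (- 1) X' \<in> Lg \<and> X' \<in> Obj D \<and> has_triangle D E X X'"
    using glued_approximation by blast
  \<comment> \<open>One bound must bring \<open>G\<close> into the aisle by suspension and make it
    orthogonal to the aisle by desuspension.\<close>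
  have "approx D r Lg Rg G (max m M) \<F>"
  proof unfold_locales
    show "D.cpt r G" "generates D {G}" "D.bd G \<F>" using G_cpt G_gen F(1) .
    show "t.lev (max m M) G" using m[of "max m M"] G_Obj by (simp add: t.lev_def)
    show "hom_zero D (shift D (- max m M) G) X" if "X \<in> Lg" for X using M[OF _ that] by simp
    show "\<exists>E \<in> \<F>. \<exists>X'. t.lev (- 1) X' \<and> has_triangle D E X X'" if "X \<in> Lg" for X
      using F(2)[OF that] unfolding t.lev_def by blast
  qed
  then show ?thesis by (rule t.approx_approximable)
qed

end

section \<open>Unpacking the hypotheses and conclusion\<close>

lemma triangulated_with_coproducts_locale:
  assumes "size_cardinal r" "triangulated_with_coproducts r C" shows "tri_coproducts C r"
  using assms unfolding triangulated_with_coproducts_def tri_coproducts_def tri_coproducts_axioms_def by blast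

lemma approximable_data:
  assumes r: "size_cardinal r" and a: "approximable r C"
  obtains L R G k \<E> where "approx C r L R G k \<E>"
proof -
  obtain G L R and A :: nat where *: "compact_generator r C G" "t_structure C L R" "A > 0" "shift C (int A) G \<in> L"
    "\<forall>X \<in> L. hom_zero C (shift C (- int A) G) X"
    "\<forall>X \<in> L. \<exists>E \<in> gen_bar r C A G (- int A) (int A). \<exists>D \<in> shift_le C L (- 1). has_triangle C E X D"
    and t: "triangulated_with_coproducts r C"
    using a unfolding approximable_def by blast
  interpret tri_coproducts C r by (rule triangulated_with_coproducts_locale[OF r t])
  interpret t_str C r L R by unfold_locales (rule *(2))
  show ?thesis by (rule that[OF approximable_approx[OF *(1,3-6)]])
qed

lemma recollement_data:
  assumes "tri_coproducts D r" "tri_coproducts DF r" "tri_coproducts DU r"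
    and rec: "recollement D DF DU i_ust i_lst i_ush j_lsh j_ust j_lst"
  obtains \<eta>1 \<epsilon>1 \<eta>2 \<epsilon>2 \<eta>3 \<epsilon>3 \<eta>4 \<epsilon>4 where
    "recoll D DF DU r i_ust i_lst i_ush j_lsh j_ust j_lst \<eta>1 \<epsilon>1 \<eta>2 \<epsilon>2 \<eta>3 \<epsilon>3 \<eta>4 \<epsilon>4"
proof -
  interpret D: tri_coproducts D r by fact
  interpret F: tri_coproducts DF r by fact
  interpret U: tri_coproducts DU r by fact
  have ex: "exact_functor D DF i_ust" "exact_functor DF D i_lst" "exact_functor D DF i_ush"
    "exact_functor DU D j_lsh" "exact_functor D DU j_ust" "exact_functor DU D j_lst"
    and ji: "\<forall>X \<in> Obj DF. zero_object DU (on_obj j_ust (on_obj i_lst X))"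
    and ff: "fully_faithful DF D i_lst" "fully_faithful DU D j_lsh" "fully_faithful DU D j_lst"
    using rec unfolding recollement_def by blast+
  obtain \<eta>1 \<epsilon>1 \<eta>2 \<epsilon>2 \<eta>3 \<epsilon>3 \<eta>4 \<epsilon>4 \<delta> where
    adj: "adjunction D DF i_ust i_lst \<eta>1 \<epsilon>1" "adjunction DF D i_lst i_ush \<eta>2 \<epsilon>2"
    "adjunction DU D j_lsh j_ust \<eta>3 \<epsilon>3" "adjunction D DU j_ust j_lst \<eta>4 \<epsilon>4"
    and d: "natural_transformation D D (i_lst \<circ>F i_ust) (Susp D \<circ>F (j_lsh \<circ>F j_ust)) \<delta>"
    and T: "\<forall>X \<in> Obj D. (\<epsilon>3 X, \<eta>1 X, \<delta> X) \<in> Tri D"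
    using rec unfolding recollement_def by blast
  interpret i1: exact_adj D DF i_ust i_lst \<eta>1 \<epsilon>1 r by unfold_locales (rule adj ex)+
  interpret i2: exact_adj DF D i_lst i_ush \<eta>2 \<epsilon>2 r by unfold_locales (rule adj ex)+
  interpret j1: exact_adj DU D j_lsh j_ust \<eta>3 \<epsilon>3 r by unfold_locales (rule adj ex)+
  interpret j2: exact_adj D DU j_ust j_lst \<eta>4 \<epsilon>4 r by unfold_locales (rule adj ex)+
  have "recoll D DF DU r i_ust i_lst i_ush j_lsh j_ust j_lst \<eta>1 \<epsilon>1 \<eta>2 \<epsilon>2 \<eta>3 \<epsilon>3 \<eta>4 \<epsilon>4"
  proof unfold_locales
    show "zero_object DU (on_obj j_ust (on_obj i_lst X))" if "X \<in> Obj DF" for X using ji that by blast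
    show "fully_faithful DF D i_lst" "fully_faithful DU D j_lsh" "fully_faithful DU D j_lst" by (rule ff)+
    show "\<exists>h. tri D (on_obj j_lsh (on_obj j_ust X)) X (on_obj i_lst (on_obj i_ust X)) (\<epsilon>3 X) (\<eta>1 X) h"
      if X: "X \<in> Obj D" for X
    proof -
      have "\<delta> X \<in> Hom D (on_obj i_lst (on_obj i_ust X)) (on_obj (Susp D) (on_obj j_lsh (on_obj j_ust X)))"
        using d X unfolding natural_transformation_def compF_def by simp
      then show ?thesis using j1.counit_Hom[OF X] i1.unit_Hom[OF X] T X unfolding tri_def by blast
    qed
  qed
  then show ?thesis by (rule that)
qed

theorem theorem4p1:
  fixes r :: "'u rel"
    and D :: "('o, 'm) tri_cat"
    and DF :: "('p, 'n) tri_cat"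
    and DU :: "('q, 'k) tri_cat"
  assumes "size_cardinal r"
    and "approximable r DF" and "approximable r DU"
    and "triangulated_with_coproducts r D" and "compactly_generated r D"
    and "recollement D DF DU i_ust i_lst i_ush j_lsh j_ust j_lst"
  shows "(\<exists>G. compact_generator r D G) \<and>
    (\<forall>G. compact_generator r D G \<longrightarrow>
       (\<exists>N. \<forall>n \<ge> N. hom_zero D (shift D (- n) G) G) \<longrightarrow> approximable r D)"
proof -
  obtain LF RF GF aF \<E>F where FA: "approx DF r LF RF GF aF \<E>F" by (rule approximable_data[OF assms(1,2)])
  obtain LU RU GU aU \<E>U where UA: "approx DU r LU RU GU aU \<E>U" by (rule approximable_data[OF assms(1,3)])
  interpret FA: approx DF r LF RF GF aF \<E>F by (rule FA)
  interpret UA: approx DU r LU RU GU aU \<E>U by (rule UA)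
  obtain \<eta>1 \<epsilon>1 \<eta>2 \<epsilon>2 \<eta>3 \<epsilon>3 \<eta>4 \<epsilon>4 where
    rec: "recoll D DF DU r i_ust i_lst i_ush j_lsh j_ust j_lst \<eta>1 \<epsilon>1 \<eta>2 \<epsilon>2 \<eta>3 \<epsilon>3 \<eta>4 \<epsilon>4"
    by (rule recollement_data[OF triangulated_with_coproducts_locale[OF assms(1,4)]
          FA.tri_coproducts_axioms UA.tri_coproducts_axioms assms(6)])
  interpret rec: recoll D DF DU r i_ust i_lst i_ush j_lsh j_ust j_lst \<eta>1 \<epsilon>1 \<eta>2 \<epsilon>2 \<eta>3 \<epsilon>3 \<eta>4 \<epsilon>4 by (rule rec)
  show ?thesis
  proof (intro conjI allI impI)
    show "\<exists>G. compact_generator r D G"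
      by (rule rec.ex_compact_generator[OF FA.G_cpt FA.G_gen UA.G_cpt UA.G_gen assms(5)])
    fix G assume G: "compact_generator r D G" and "\<exists>N. \<forall>n \<ge> N. hom_zero D (shift D (- n) G) G"
    then obtain N where N: "\<And>n. n \<ge> N \<Longrightarrow> hom_zero D (shift D (- n) G) G" by blast
    interpret recoll_approx D DF DU r i_ust i_lst i_ush j_lsh j_ust j_lst \<eta>1 \<epsilon>1 \<eta>2 \<epsilon>2 \<eta>3 \<epsilon>3 \<eta>4 \<epsilon>4
      LF RF GF aF \<E>F LU RU GU aU \<E>U G N
      by unfold_locales (use G N in \<open>simp_all add: compact_generator_def rec.D.compact_iff\<close>)
    show "approximable r D" by (rule glued_approximable)
  qed
qed

end
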